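(* Let $k$ be a non-negative integer. Then $m\in MW_H^{k,2}(\mathbb{R}^n)$ if and only if the operators $(\partial^\alpha m)H^{-|\alpha|/2}$ are bounded on $L^2(\mathbb{R}^n)$ for all $|\alpha|\le k$.
   Context: $H=-\Delta+|x|^2$ is the Hermite operator on $\mathbb{R}^n$; its real powers are defined spectrally using the orthonormal basis of Hermite functions. The Hermite-Sobolev space is $W_H^{k,2}(\mathbb{R}^n)=\{f\in L^2(\mathbb{R}^n):H^{k/2}f\in L^2(\mathbb{R}^n)\}$ with norm $\|H^{k/2}f\|_2$. For a measurable function $m$ on $\mathbb{R}^n$ let $T_mf(x)=(2\pi)^{-n/2}\int_{\mathbb{R}^n}e^{ix\cdot\xi}m(\xi)\widehat f(\xi)\,d\xi$; $MW_H^{k,2}(\mathbb{R}^n)$ is the set of all $m$ such that $T_m$ is bounded on $W_H^{k,2}(\mathbb{R}^n)$ (as $W_H^{k,2}$ is Fourier invariant, this is the same as $f\mapsto mf$ being bounded on $W_H^{k,2}(\mathbb{R}^n)$). In $(\partial^\alpha m)H^{-|\alpha|/2}$, $\partial^\alpha m$ is the distributional derivative of $m$ and denotes the operator of multiplication by it; boundedness on $L^2$ means that $\|(\partial^\alpha m)f\|_2\le C\|H^{|\alpha|/2}f\|_2$ for all Schwartz functions $f$ (in particular, for $\alpha=0$, that $m\in L^\infty(\mathbb{R}^n)$). *)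

theory Defs
  imports "HOL-Analysis.Analysis"
begin

text \<open>Functions on \<open>\<real>\<^sup>n\<close> have type \<open>real ^ 'n \<Rightarrow> complex\<close> and \<open>n = CARD('n)\<close>. Elements of
  \<open>L\<^sup>2\<close> are represented by functions. The operators on \<open>L\<^sup>2\<close> defined by \<open>SOME\<close> are
  determined up to Lebesgue null sets, which their \<open>L\<^sup>2\<close> norms do not see.\<close>

definition L2 :: "('a::euclidean_space \<Rightarrow> complex) set" where
  "L2 = {f \<in> borel_measurable lebesgue. integrable lebesgue (\<lambda>x. (cmod (f x))\<^sup>2)}"

definition l2norm :: "('a::euclidean_space \<Rightarrow> complex) \<Rightarrow> real" where
  "l2norm f = sqrt (\<integral>x. (cmod (f x))\<^sup>2 \<partial>lebesgue)"

text \<open>Membership in \<open>L\<^sup>2\<close> is part of the definition because \<^const>\<open>l2norm\<close> is \<open>0\<close> where the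
  integral diverges.\<close>

definition L2_tendsto ::
    "('i \<Rightarrow> 'a::euclidean_space \<Rightarrow> complex) \<Rightarrow> ('a \<Rightarrow> complex) \<Rightarrow> 'i filter \<Rightarrow> bool" where
  "L2_tendsto f g F \<longleftrightarrow> (\<forall>i. f i \<in> L2) \<and> g \<in> L2 \<and> ((\<lambda>i. l2norm (\<lambda>x. f i x - g x)) \<longlongrightarrow> 0) F"


section \<open>Derivatives, Schwartz functions, test functions\<close>

definition partial :: "'n \<Rightarrow> (real ^ 'n \<Rightarrow> complex) \<Rightarrow> (real ^ 'n \<Rightarrow> complex)" where
  "partial i f x = vector_derivative (\<lambda>t. f (x + t *\<^sub>R axis i 1)) (at 0)"

definition smooth :: "(real ^ 'n \<Rightarrow> complex) \<Rightarrow> bool" where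
  "smooth f \<longleftrightarrow> (\<forall>is x. foldr partial is f differentiable (at x))"

definition msize :: "('n::finite \<Rightarrow> nat) \<Rightarrow> nat" where
  "msize \<alpha> = (\<Sum>i\<in>UNIV. \<alpha> i)"

definition coord_order :: "'n::finite list" where
  "coord_order = (SOME is. distinct is \<and> set is = UNIV)"

text \<open>\<open>\<partial>\<^sup>\<alpha> = \<Prod>\<^sub>i \<partial>\<^sub>i ^ \<alpha>\<^sub>i\<close>, with the factors in some fixed order. It is only used for smooth functions,
  whose partial derivatives commute.\<close>

definition mderiv :: "('n::finite \<Rightarrow> nat) \<Rightarrow> (real ^ 'n \<Rightarrow> complex) \<Rightarrow> (real ^ 'n \<Rightarrow> complex)" where
  "mderiv \<alpha> f = foldr (\<lambda>i. partial i ^^ \<alpha> i) coord_order f"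

definition mpower :: "real ^ 'n \<Rightarrow> ('n::finite \<Rightarrow> nat) \<Rightarrow> real" where
  "mpower x \<beta> = (\<Prod>i\<in>UNIV. (x $ i) ^ \<beta> i)"

definition schwartz :: "(real ^ 'n \<Rightarrow> complex) set" where
  "schwartz = {f. smooth f \<and> (\<forall>\<alpha> \<beta>. bounded (range (\<lambda>x. mpower x \<beta> *\<^sub>R mderiv \<alpha> f x)))}"

definition test_functions :: "(real ^ 'n \<Rightarrow> complex) set" where
  "test_functions = {\<phi>. smooth \<phi> \<and> compact (closure {x. \<phi> x \<noteq> 0})}"


section \<open>Hermite functions and powers of the Hermite operator\<close>

definition hermite_poly :: "nat \<Rightarrow> real \<Rightarrow> real" where
  "hermite_poly k t = (-1) ^ k * exp (t\<^sup>2) * (deriv ^^ k) (\<lambda>s. exp (- s\<^sup>2)) t"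

definition hermite_fun1 :: "nat \<Rightarrow> real \<Rightarrow> real" where
  "hermite_fun1 k t = hermite_poly k t * exp (- t\<^sup>2 / 2) / sqrt (2 ^ k * fact k * sqrt pi)"

definition hermite_fun :: "('n::finite \<Rightarrow> nat) \<Rightarrow> real ^ 'n \<Rightarrow> complex" where
  "hermite_fun \<alpha> x = of_real (\<Prod>i\<in>UNIV. hermite_fun1 (\<alpha> i) (x $ i))"

definition hermite_op :: "(real ^ 'n \<Rightarrow> complex) \<Rightarrow> (real ^ 'n \<Rightarrow> complex)" where
  "hermite_op f x = - (\<Sum>i\<in>UNIV. partial i (partial i f) x) + of_real ((norm x)\<^sup>2) * f x"

definition hermite_eigenvalue :: "('n::finite \<Rightarrow> nat) \<Rightarrow> real" where
  "hermite_eigenvalue \<alpha> = 2 * real (msize \<alpha>) + real CARD('n)"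

definition hermite_coeff :: "('n::finite \<Rightarrow> nat) \<Rightarrow> (real ^ 'n \<Rightarrow> complex) \<Rightarrow> complex" where
  "hermite_coeff \<alpha> f = (\<integral>x. f x * cnj (hermite_fun \<alpha> x) \<partial>lebesgue)"

text \<open>\<open>is_hermite_power s f g\<close>: \<open>f\<close> lies in the domain of \<open>H\<^sup>s\<close> and \<open>H\<^sup>s f = g\<close>, where \<open>H\<^sup>s f\<close> is
  the (unconditionally) \<open>L\<^sup>2\<close>-convergent series
  \<open>\<Sum>\<^sub>\<alpha> (2 |\<alpha>| + n) powr s * \<langle>f, h\<^sub>\<alpha>\<rangle> h\<^sub>\<alpha>\<close>. The eigenvalues are justified by
  \<open>hermite_op_hermite_fun\<close> below.\<close>

definition is_hermite_power ::
    "real \<Rightarrow> (real ^ 'n \<Rightarrow> complex) \<Rightarrow> (real ^ 'n \<Rightarrow> complex) \<Rightarrow> bool" where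
  "is_hermite_power s f g \<longleftrightarrow> f \<in> L2 \<and>
     L2_tendsto
       (\<lambda>A x. \<Sum>\<alpha>\<in>A. of_real (hermite_eigenvalue \<alpha> powr s) * hermite_coeff \<alpha> f * hermite_fun \<alpha> x)
       g (finite_subsets_at_top UNIV)"

text \<open>Outside the domain of \<open>H\<^sup>s\<close> the value is arbitrary; inside, it is unique up to null sets.\<close>

definition hermite_power :: "real \<Rightarrow> (real ^ 'n \<Rightarrow> complex) \<Rightarrow> (real ^ 'n \<Rightarrow> complex)" where
  "hermite_power s f = (SOME g. is_hermite_power s f g)"

definition hermite_sobolev :: "nat \<Rightarrow> (real ^ 'n \<Rightarrow> complex) set" where
  "hermite_sobolev k = {f \<in> L2. \<exists>g. is_hermite_power (real k / 2) f g}"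

definition hermite_sobolev_norm :: "nat \<Rightarrow> (real ^ 'n \<Rightarrow> complex) \<Rightarrow> real" where
  "hermite_sobolev_norm k f = l2norm (hermite_power (real k / 2) f)"

context
begin

text \<open>\<open>E k = (d/dt)^k exp (-t\<^sup>2)\<close>\<close>

private fun E :: "nat \<Rightarrow> real \<Rightarrow> real" where
  "E 0 t = exp (- t\<^sup>2)"
| "E (Suc 0) t = - 2 * t * exp (- t\<^sup>2)"
| "E (Suc (Suc k)) t = - 2 * t * E (Suc k) t - 2 * (real k + 1) * E k t"

private lemma E_deriv: "(E k has_real_derivative E (Suc k) t) (at t)"
proof (induction k t rule: E.induct)
  case (1 u)
  show ?case
    by (auto intro!: derivative_eq_intros simp: E.simps(1)[abs_def])
next
  case (2 u)
  have "E (Suc 0) = (\<lambda>t. - 2 * t * exp (- t\<^sup>2))" by (simp add: fun_eq_iff)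
  then show ?case
    by (auto intro!: derivative_eq_intros simp: algebra_simps)
next
  case (3 k u)
  have "E (Suc (Suc k)) = (\<lambda>t. - 2 * t * E (Suc k) t - 2 * (real k + 1) * E k t)"
    by (simp add: fun_eq_iff)
  then show ?case
    by (auto intro!: derivative_eq_intros 3 simp: algebra_simps)
qed

private lemma deriv_E: "(deriv ^^ k) (\<lambda>s. exp (- s\<^sup>2)) = E k"
proof (induction k)
  case 0
  show ?case by (simp add: fun_eq_iff)
next
  case (Suc k)
  have "deriv (E k) = E (Suc k)" using DERIV_imp_deriv[OF E_deriv] by (rule ext)
  with Suc show ?case by simp
qed

private lemma hermite_fun1_E:
  "hermite_fun1 k t = (-1) ^ k / sqrt (2 ^ k * fact k * sqrt pi) * (exp (t\<^sup>2 / 2) * E k t)"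
proof -
  have "exp (t\<^sup>2) * exp (- t\<^sup>2 / 2) = exp (t\<^sup>2 / 2)" by (simp add: exp_add[symmetric])
  then show ?thesis
    by (simp add: hermite_fun1_def hermite_poly_def deriv_E mult_ac)
qed

private definition h' :: "nat \<Rightarrow> real \<Rightarrow> real" where
  "h' k t = (-1) ^ k / sqrt (2 ^ k * fact k * sqrt pi)
     * (exp (t\<^sup>2 / 2) * (t * E k t + E (Suc k) t))"

private lemma deriv_h: "(hermite_fun1 k has_real_derivative h' k t) (at t)"
  unfolding hermite_fun1_E[abs_def] h'_def
  by (rule DERIV_cmult) (auto intro!: derivative_eq_intros E_deriv simp: algebra_simps)

private lemma deriv_h':
  "(h' k has_real_derivative (t\<^sup>2 - (2 * real k + 1)) * hermite_fun1 k t) (at t)"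
proof -
  have "((\<lambda>t. (-1) ^ k / sqrt (2 ^ k * fact k * sqrt pi)
           * (exp (t\<^sup>2 / 2) * (t * E k t + E (Suc k) t))) has_real_derivative
         (-1) ^ k / sqrt (2 ^ k * fact k * sqrt pi)
           * (exp (t\<^sup>2 / 2) * ((t\<^sup>2 - (2 * real k + 1)) * E k t))) (at t)"
    by (rule DERIV_cmult)
       (auto intro!: derivative_eq_intros E_deriv simp: algebra_simps power2_eq_square)
  then show ?thesis
    by (simp add: h'_def[abs_def] hermite_fun1_E mult_ac)
qed

private lemma partial_prod:
  fixes g :: "'n::finite \<Rightarrow> real \<Rightarrow> real" and x :: "real ^ 'n"
  assumes "(g i has_real_derivative d) (at (x $ i))"
  shows "partial i (\<lambda>x. of_real (\<Prod>j\<in>UNIV. g j (x $ j))) x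
         = of_real (d * (\<Prod>j\<in>UNIV - {i}. g j (x $ j)))"
proof -
  have *: "(\<Prod>j\<in>UNIV. g j ((x + t *\<^sub>R axis i 1) $ j))
           = g i (x $ i + t) * (\<Prod>j\<in>UNIV - {i}. g j (x $ j))" for t
    by (subst prod.remove[of _ i]) (auto simp: axis_def intro!: prod.cong)
  have "((\<lambda>t. g i (x $ i + t)) has_real_derivative d) (at 0)"
    using assms DERIV_at_within_shift[of "g i" d "x $ i" 0 UNIV] by (simp add: add_ac)
  then have "((\<lambda>t. g i (x $ i + t) * (\<Prod>j\<in>UNIV - {i}. g j (x $ j))) has_real_derivative
       d * (\<Prod>j\<in>UNIV - {i}. g j (x $ j))) (at 0)"
    by (rule DERIV_cmult_right)
  then have "((\<lambda>t. complex_of_real (g i (x $ i + t) * (\<Prod>j\<in>UNIV - {i}. g j (x $ j))))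
       has_vector_derivative of_real (d * (\<Prod>j\<in>UNIV - {i}. g j (x $ j)))) (at 0)"
    by (rule has_vector_derivative_of_real)
  then show ?thesis
    unfolding partial_def * by (rule vector_derivative_at)
qed

theorem hermite_op_hermite_fun:
  "hermite_op (hermite_fun \<alpha>) x = of_real (hermite_eigenvalue \<alpha>) * hermite_fun \<alpha> x"
  for \<alpha> :: "'n::finite \<Rightarrow> nat"
proof -
  have 1: "partial i (hermite_fun \<alpha>) =
      (\<lambda>x. of_real (\<Prod>j\<in>UNIV. (if j = i then h' (\<alpha> j) else hermite_fun1 (\<alpha> j)) (x $ j)))" for i
  proof
    fix x :: "real ^ 'n"
    have "partial i (hermite_fun \<alpha>) x =
      of_real (h' (\<alpha> i) (x $ i) * (\<Prod>j\<in>UNIV - {i}. hermite_fun1 (\<alpha> j) (x $ j)))"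
      unfolding hermite_fun_def[abs_def] by (rule partial_prod) (rule deriv_h)
    also have "\<dots> = of_real (\<Prod>j\<in>UNIV. (if j = i then h' (\<alpha> j) else hermite_fun1 (\<alpha> j)) (x $ j))"
      by (subst (2) prod.remove[of _ i]) (auto intro!: prod.cong)
    finally show "partial i (hermite_fun \<alpha>) x = \<dots>" .
  qed
  have 2: "partial i (partial i (hermite_fun \<alpha>)) x
      = of_real ((x $ i)\<^sup>2 - (2 * real (\<alpha> i) + 1)) * hermite_fun \<alpha> x" for i
  proof -
    have "partial i (partial i (hermite_fun \<alpha>)) x =
      of_real (((x $ i)\<^sup>2 - (2 * real (\<alpha> i) + 1)) * hermite_fun1 (\<alpha> i) (x $ i)
        * (\<Prod>j\<in>UNIV - {i}. (if j = i then h' (\<alpha> j) else hermite_fun1 (\<alpha> j)) (x $ j)))"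
      unfolding 1 by (rule partial_prod) (simp add: deriv_h')
    also have "(\<Prod>j\<in>UNIV - {i}. (if j = i then h' (\<alpha> j) else hermite_fun1 (\<alpha> j)) (x $ j))
      = (\<Prod>j\<in>UNIV - {i}. hermite_fun1 (\<alpha> j) (x $ j))"
      by (rule prod.cong) auto
    also have "of_real (((x $ i)\<^sup>2 - (2 * real (\<alpha> i) + 1)) * hermite_fun1 (\<alpha> i) (x $ i) * \<dots>)
      = of_real ((x $ i)\<^sup>2 - (2 * real (\<alpha> i) + 1)) * hermite_fun \<alpha> x"
      unfolding hermite_fun_def of_real_mult[symmetric]
      by (subst (2) prod.remove[of _ i]) (simp_all add: mult_ac)
    finally show ?thesis .
  qed
  have 3: "(\<Sum>i\<in>UNIV. (x $ i)\<^sup>2 - (2 * real (\<alpha> i) + 1)) = (norm x)\<^sup>2 - hermite_eigenvalue \<alpha>"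
    unfolding power2_norm_eq_inner
    by (simp add: inner_vec_def sum_subtractf sum.distrib hermite_eigenvalue_def msize_def
        sum_distrib_left power2_eq_square)
  show ?thesis
    unfolding hermite_op_def 2 sum_distrib_right[symmetric] of_real_sum[symmetric] 3
    by (simp add: algebra_simps)
qed

end


section \<open>Fourier multipliers on the Hermite-Sobolev space\<close>

text \<open>The Fourier transform on \<open>L\<^sup>2\<close> (Plancherel): the \<open>L\<^sup>2\<close>-limit, as \<open>R \<rightarrow> \<infinity>\<close>, of the Fourier
  integrals over the balls of radius \<open>R\<close>. The parameter \<open>\<sigma>\<close> is the sign in the
  exponent: \<open>-1\<close> for the Fourier transform, \<open>1\<close> for its inverse.\<close>

definition truncated_fourier ::
    "real \<Rightarrow> (real ^ 'n \<Rightarrow> complex) \<Rightarrow> real \<Rightarrow> real ^ 'n \<Rightarrow> complex" where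
  "truncated_fourier \<sigma> f R \<xi> =
     of_real ((2 * pi) powr (- real CARD('n) / 2)) *
     (\<integral>x\<in>cball 0 R. exp (\<i> * of_real (\<sigma> * (x \<bullet> \<xi>))) * f x \<partial>lebesgue)"

definition fourier :: "(real ^ 'n \<Rightarrow> complex) \<Rightarrow> (real ^ 'n \<Rightarrow> complex)" where
  "fourier f = (SOME g. L2_tendsto (truncated_fourier (-1) f) g at_top)"

definition inverse_fourier :: "(real ^ 'n \<Rightarrow> complex) \<Rightarrow> (real ^ 'n \<Rightarrow> complex)" where
  "inverse_fourier g = (SOME f. L2_tendsto (truncated_fourier 1 g) f at_top)"

definition fourier_multiplier ::
    "(real ^ 'n \<Rightarrow> complex) \<Rightarrow> (real ^ 'n \<Rightarrow> complex) \<Rightarrow> (real ^ 'n \<Rightarrow> complex)" where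
  "fourier_multiplier m f = inverse_fourier (\<lambda>\<xi>. m \<xi> * fourier f \<xi>)"

text \<open>That \<open>m\<close> times the Fourier transform of \<open>f\<close> is in \<open>L\<^sup>2\<close> says that \<open>T\<^sub>m f\<close> is defined.\<close>

definition hermite_multipliers :: "nat \<Rightarrow> (real ^ 'n \<Rightarrow> complex) set" where
  "hermite_multipliers k = {m \<in> borel_measurable lebesgue.
     \<exists>C. \<forall>f\<in>hermite_sobolev k.
       (\<lambda>\<xi>. m \<xi> * fourier f \<xi>) \<in> L2 \<and>
       fourier_multiplier m f \<in> hermite_sobolev k \<and>
       hermite_sobolev_norm k (fourier_multiplier m f) \<le> C * hermite_sobolev_norm k f}"


section \<open>The operators \<open>(\<partial>\<^sup>\<alpha> m) H\<^bsup>-|\<alpha>|/2\<^esup>\<close>\<close>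

text \<open>Distributions are represented by their action on \<^const>\<open>test_functions\<close>.\<close>

type_synonym 'n distribution = "(real ^ 'n \<Rightarrow> complex) \<Rightarrow> complex"

definition locally_integrable :: "(real ^ 'n \<Rightarrow> complex) \<Rightarrow> bool" where
  "locally_integrable m \<longleftrightarrow> (\<forall>K. compact K \<longrightarrow> set_integrable lebesgue K m)"

definition dist_of_fun :: "(real ^ 'n \<Rightarrow> complex) \<Rightarrow> 'n distribution" where
  "dist_of_fun m \<phi> = (\<integral>x. m x * \<phi> x \<partial>lebesgue)"

definition dist_deriv :: "('n::finite \<Rightarrow> nat) \<Rightarrow> 'n distribution \<Rightarrow> 'n distribution" where
  "dist_deriv \<alpha> u \<phi> = (-1) ^ msize \<alpha> * u (mderiv \<alpha> \<phi>)"

definition dist_mult :: "'n distribution \<Rightarrow> (real ^ 'n \<Rightarrow> complex) \<Rightarrow> 'n distribution" where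
  "dist_mult u f \<phi> = u (\<lambda>x. f x * \<phi> x)"

text \<open>Boundedness of \<open>(\<partial>\<^sup>\<alpha> m) H\<^bsup>-|\<alpha>|/2\<^esup>\<close> on \<open>L\<^sup>2\<close>: for every Schwartz function \<open>f\<close>, the
  distribution \<open>(\<partial>\<^sup>\<alpha> m) f\<close> is given by an \<open>L\<^sup>2\<close> function \<open>g\<close> with
  \<open>\<parallel>g\<parallel>\<^sub>2 \<le> C \<parallel>H\<^bsup>|\<alpha>|/2\<^esup> f\<parallel>\<^sub>2\<close>. Local integrability of \<open>m\<close> makes \<open>\<partial>\<^sup>\<alpha> m\<close> meaningful.\<close>

definition deriv_mult_L2_bounded :: "(real ^ 'n \<Rightarrow> complex) \<Rightarrow> ('n::finite \<Rightarrow> nat) \<Rightarrow> bool" where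
  "deriv_mult_L2_bounded m \<alpha> \<longleftrightarrow> locally_integrable m \<and>
     (\<exists>C. \<forall>f\<in>schwartz. \<exists>g\<in>L2.
        (\<forall>\<phi>\<in>test_functions.
           dist_mult (dist_deriv \<alpha> (dist_of_fun m)) f \<phi> = dist_of_fun g \<phi>) \<and>
        l2norm g \<le> C * l2norm (hermite_power (real (msize \<alpha>) / 2) f))"

end

theory Submission
  imports Defs "HOL-Probability.Probability"
begin

text \<open>The Fourier transform multiplies the coefficient of a function at the Hermite function \<open>h\<^sub>\<alpha>\<close> by
  \<open>(-\<i>)\<^bsup>|\<alpha>|\<^esup>\<close>, so it is an isometry of every \<open>W\<^sub>H\<^sup>k\<^sup>,\<^sup>2\<close>, and \<open>m\<close> is a Fourier multiplier if and only if
  multiplication by \<open>m\<close> is bounded on \<open>W\<^sub>H\<^sup>k\<^sup>,\<^sup>2\<close> (\<open>hermite_multipliers_iff\<close>). Multiplication need only be tested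
  on finite Hermite sums (\<open>hermite_multipliers_mult_bounded\<close>). This uses that the Hermite functions are
  an orthonormal basis of eigenfunctions of the Fourier transform. Everything else is governed by the
  ladder operators \<open>x\<^sub>i + \<partial>\<^sub>i\<close> and \<open>x\<^sub>i - \<partial>\<^sub>i\<close>, which move \<open>h\<^sub>\<alpha>\<close> to a multiple of a neighbour, the square of the
  factor being comparable to \<open>\<alpha>\<^sub>i + 1\<close> or to \<open>\<alpha>\<^sub>i\<close> and so dominated by the eigenvalue \<open>2|\<alpha>| + n\<close>.

  Suppose that multiplication by \<open>m\<close> is bounded on \<open>W\<^sub>H\<^sup>k\<^sup>,\<^sup>2\<close> with constant \<open>C\<close>. Then \<open>|m| \<le> C\<close> almost everywhere,
  because the powers \<open>m\<^sup>N\<close> are multipliers with constants \<open>C\<^sup>N\<close> and can be applied to a Gaussian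
  (\<open>mult_bounded_AE_le\<close>). Interpolation with \<open>L\<^sup>2\<close>, carried out through a dyadic decomposition of the
  eigenvalues, shows that \<open>m\<close> is a multiplier of every order \<open>j \<le> k\<close> (\<open>mult_bounded_mono\<close>). By the Leibniz rule
  \<open>(\<partial>\<^sup>\<alpha> m) f\<close> is a sum of terms \<open>\<plusminus>\<partial>\<^sup>v (m \<cdot> \<partial>\<^sup>u f)\<close>. A derivative costs one order of regularity, so \<open>\<partial>\<^sup>u f\<close> has
  the remaining order \<open>|v|\<close>, multiplication by \<open>m\<close> keeps it, and \<open>\<partial>\<^sup>v\<close> leads to \<open>L\<^sup>2\<close>
  (\<open>deriv_mult_bounded_if_mult_bounded\<close>).

  Conversely, suppose that the operators \<open>(\<partial>\<^sup>\<alpha> m) H\<^bsup>-|\<alpha>|/2\<^esup>\<close> are bounded. For \<open>\<alpha> = 0\<close> this says that \<open>m\<close> is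
  bounded. To bound \<open>m f\<close> in \<open>W\<^sub>H\<^sup>k\<^sup>,\<^sup>2\<close> it suffices to bound the functions \<open>(x\<^sub>i + \<partial>\<^sub>i)\<^sup>k (m f)\<close> in \<open>L\<^sup>2\<close>, because the size
  of an eigenvalue is governed by a single coordinate (\<open>hermite_sobolev_criterion\<close>). Their coefficients
  are the integrals of \<open>m f\<close> against \<open>(x\<^sub>i - \<partial>\<^sub>i)\<^sup>k h\<^sub>\<beta>\<close>. Moving \<open>f\<close> past \<open>(x\<^sub>i - \<partial>\<^sub>i)\<^sup>k\<close> turns \<open>f \<cdot> (x\<^sub>i - \<partial>\<^sub>i)\<^sup>k h\<^sub>\<beta>\<close> into a sum of
  derivatives \<open>\<plusminus>\<partial>\<^sub>i\<^sup>j (F h\<^sub>\<beta>)\<close> with \<open>F = (x\<^sub>i + \<partial>\<^sub>i)\<^bsup>k-j\<^esup> f\<close> (\<open>mult_raise_power\<close>), and integrals of \<open>m\<close> against these are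
  what the hypothesis on \<open>\<partial>\<^sub>i\<^sup>j m\<close> controls, with \<open>F\<close> in place of \<open>f\<close> (\<open>mult_bounded_if_deriv_mult_bounded\<close>).

  Completeness of the Hermite functions is proved with the Stone-Weierstrass theorem
  (\<open>hermite_orthogonal\<close>): a function orthogonal to all of them is orthogonal to all polynomials times
  \<open>e\<^bsup>-a |x|\<^sup>2\<^esup>\<close> for \<open>a\<close> in an arithmetic progression, and these are dense enough. That they are eigenfunctions
  of the Fourier transform follows from the three-term recursion (\<open>fourier_hermite_fun\<close>).\<close>

section \<open>The space \<open>L\<^sup>2\<close>\<close>

lemma L2_measurable: "f \<in> L2 \<Longrightarrow> f \<in> borel_measurable lebesgue"
  by (simp add: L2_def)

lemma L2_integrable_square: "f \<in> L2 \<Longrightarrow> integrable lebesgue (\<lambda>x. (cmod (f x))\<^sup>2)"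
  by (simp add: L2_def)

lemma L2I:
  assumes "f \<in> borel_measurable lebesgue" "integrable lebesgue g"
    "\<And>x. (cmod (f x))\<^sup>2 \<le> g x"
  shows "f \<in> L2"
proof -
  have [measurable]: "f \<in> borel_measurable lebesgue" by fact
  have "integrable lebesgue (\<lambda>x. (cmod (f x))\<^sup>2)"
    by (rule Bochner_Integration.integrable_bound[OF assms(2)])
      (auto intro!: AE_I2 order_trans[OF assms(3) abs_ge_self])
  then show ?thesis by (simp add: L2_def)
qed

lemma L2_cong_AE:
  assumes "f \<in> L2" "g \<in> borel_measurable lebesgue" "AE x in lebesgue. f x = g x"
  shows "g \<in> L2"
proof -
  have [measurable]: "g \<in> borel_measurable lebesgue" "f \<in> borel_measurable lebesgue"
    using assms L2_measurable by auto
  have "integrable lebesgue (\<lambda>x. (cmod (g x))\<^sup>2)"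
    using L2_integrable_square[OF assms(1)]
    by (rule Bochner_Integration.integrable_cong_AE_imp) (use assms(3) in auto)
  then show ?thesis by (simp add: L2_def)
qed

lemma l2norm_cong_AE:
  assumes "f \<in> borel_measurable lebesgue" "g \<in> borel_measurable lebesgue"
    "AE x in lebesgue. f x = g x"
  shows "l2norm f = l2norm g"
proof -
  have [measurable]: "g \<in> borel_measurable lebesgue" "f \<in> borel_measurable lebesgue"
    using assms by auto
  have "(\<integral>x. (cmod (f x))\<^sup>2 \<partial>lebesgue) = (\<integral>x. (cmod (g x))\<^sup>2 \<partial>lebesgue)"
    by (rule integral_cong_AE) (use assms(3) in auto)
  then show ?thesis by (simp add: l2norm_def)
qed

lemma L2_scale [intro]: "f \<in> L2 \<Longrightarrow> (\<lambda>x. c * f x) \<in> L2"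
  by (auto simp: L2_def norm_mult power_mult_distrib)

lemma L2_add [intro]:
  assumes "f \<in> L2" "g \<in> L2"
  shows "(\<lambda>x. f x + g x) \<in> L2"
proof (rule L2I)
  show "(\<lambda>x. f x + g x) \<in> borel_measurable lebesgue"
    using assms by (auto dest!: L2_measurable)
  show "integrable lebesgue (\<lambda>x. 2 * (cmod (f x))\<^sup>2 + 2 * (cmod (g x))\<^sup>2)"
    using assms by (auto dest!: L2_integrable_square)
  show "(cmod (f x + g x))\<^sup>2 \<le> 2 * (cmod (f x))\<^sup>2 + 2 * (cmod (g x))\<^sup>2" for x
  proof -
    have "(cmod (f x + g x))\<^sup>2 \<le> (cmod (f x) + cmod (g x))\<^sup>2"
      by (intro power_mono norm_triangle_ineq) auto
    also have "\<dots> \<le> 2 * (cmod (f x))\<^sup>2 + 2 * (cmod (g x))\<^sup>2"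
      using sum_squares_bound[of "cmod (f x)" "cmod (g x)"] by (simp add: power2_sum)
    finally show ?thesis .
  qed
qed

lemma L2_minus [intro]: "f \<in> L2 \<Longrightarrow> (\<lambda>x. - f x) \<in> L2"
  using L2_scale[of f "-1"] by simp

lemma L2_diff [intro]: "f \<in> L2 \<Longrightarrow> g \<in> L2 \<Longrightarrow> (\<lambda>x. f x - g x) \<in> L2"
  using L2_add[of f "\<lambda>x. - g x"] by auto

lemma L2_zero [simp]: "(\<lambda>x. 0) \<in> L2"
  by (simp add: L2_def)

lemma L2_sum [intro]: "(\<And>i. i \<in> A \<Longrightarrow> f i \<in> L2) \<Longrightarrow> (\<lambda>x. \<Sum>i\<in>A. f i x) \<in> L2"
  by (induction A rule: infinite_finite_induct) auto

lemma borel_measurable_cnj [measurable]: "cnj \<in> borel_measurable borel"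
  by (intro borel_measurable_continuous_onI continuous_intros)

lemma L2_cnj [intro]: "f \<in> L2 \<Longrightarrow> (\<lambda>x. cnj (f x)) \<in> L2"
  by (auto simp: L2_def intro!: measurable_compose[OF _ borel_measurable_cnj])

lemma L2_mult_bounded:
  assumes "f \<in> L2" "m \<in> borel_measurable lebesgue" "AE x in lebesgue. cmod (m x) \<le> C"
  shows "(\<lambda>x. m x * f x) \<in> L2" "l2norm (\<lambda>x. m x * f x) \<le> C * l2norm f"
proof -
  have [measurable]: "m \<in> borel_measurable lebesgue" "f \<in> borel_measurable lebesgue"
    using assms L2_measurable by auto
  have C: "0 \<le> C"
  proof -
    have "\<exists>x. cmod (m x) \<le> C"
    proof (rule ccontr)
      assume "\<not> ?thesis"
      then have "AE x in (lebesgue :: 'a measure). x \<notin> UNIV"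
        using assms(3) by simp
      then have "(UNIV :: 'a set) \<in> null_sets lebesgue"
        using AE_iff_null_sets[of "UNIV :: 'a set" lebesgue] by simp
      then show False
        by (auto simp: null_sets_def)
    qed
    then show ?thesis
      using order_trans[OF norm_ge_zero] by blast
  qed
  have int: "integrable lebesgue (\<lambda>x. C\<^sup>2 * (cmod (f x))\<^sup>2)"
    using L2_integrable_square[OF assms(1)] by simp
  have le: "AE x in lebesgue. (cmod (m x * f x))\<^sup>2 \<le> C\<^sup>2 * (cmod (f x))\<^sup>2"
    using assms(3)
    by eventually_elim (auto simp: norm_mult power_mult_distrib intro!: mult_right_mono power_mono)
  have int2: "integrable lebesgue (\<lambda>x. (cmod (m x * f x))\<^sup>2)"
    by (rule Bochner_Integration.integrable_bound[OF int]) (use le in auto)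
  then show "(\<lambda>x. m x * f x) \<in> L2" by (simp add: L2_def)
  have "(\<integral>x. (cmod (m x * f x))\<^sup>2 \<partial>lebesgue) \<le> (\<integral>x. C\<^sup>2 * (cmod (f x))\<^sup>2 \<partial>lebesgue)"
    by (rule integral_mono_AE[OF int2 int le])
  then have "l2norm (\<lambda>x. m x * f x) \<le> sqrt (C\<^sup>2 * (\<integral>x. (cmod (f x))\<^sup>2 \<partial>lebesgue))"
    unfolding l2norm_def by (intro real_sqrt_le_mono) simp
  also have "\<dots> = C * l2norm f"
    using C by (simp add: l2norm_def real_sqrt_mult)
  finally show "l2norm (\<lambda>x. m x * f x) \<le> C * l2norm f" .
qed

lemma L2_mult_integrable:
  assumes "f \<in> L2" "g \<in> L2"
  shows "integrable lebesgue (\<lambda>x. f x * g x)"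
proof -
  have [measurable]: "f \<in> borel_measurable lebesgue" "g \<in> borel_measurable lebesgue"
    using assms L2_measurable by auto
  have "integrable lebesgue (\<lambda>x. (cmod (f x))\<^sup>2 + (cmod (g x))\<^sup>2)"
    using assms by (auto dest!: L2_integrable_square)
  then show ?thesis
  proof (rule Bochner_Integration.integrable_bound)
    show "AE x in lebesgue. norm (f x * g x) \<le> norm ((cmod (f x))\<^sup>2 + (cmod (g x))\<^sup>2)"
    proof (rule AE_I2)
      fix x
      show "norm (f x * g x) \<le> norm ((cmod (f x))\<^sup>2 + (cmod (g x))\<^sup>2)"
        using sum_squares_bound[of "cmod (f x)" "cmod (g x)"]
          mult_nonneg_nonneg[of "cmod (f x)" "cmod (g x)"]
        unfolding norm_mult real_norm_def by linarith
    qed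
  qed auto
qed

lemma l2norm_nonneg [simp]: "0 \<le> l2norm f"
  by (simp add: l2norm_def)

lemma l2norm_square: "(l2norm f)\<^sup>2 = (\<integral>x. (cmod (f x))\<^sup>2 \<partial>lebesgue)"
  by (simp add: l2norm_def)

lemma l2norm_zero [simp]: "l2norm (\<lambda>x. 0) = 0"
  by (simp add: l2norm_def)

lemma l2norm_scale: "l2norm (\<lambda>x. c * f x) = cmod c * l2norm f"
  by (simp add: l2norm_def norm_mult power_mult_distrib real_sqrt_mult)

lemma l2norm_minus_commute: "l2norm (\<lambda>x. f x - g x) = l2norm (\<lambda>x. g x - f x)"
  by (simp add: l2norm_def norm_minus_commute)

lemma l2norm_eq_0:
  assumes "f \<in> L2"
  shows "l2norm f = 0 \<longleftrightarrow> (AE x in lebesgue. f x = 0)"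
  using integral_nonneg_eq_0_iff_AE[OF L2_integrable_square[OF assms]]
  by (simp add: l2norm_def)

lemma Cauchy_Schwarz_norm:
  assumes "f \<in> L2" "g \<in> L2"
  shows "(\<integral>x. cmod (f x) * cmod (g x) \<partial>lebesgue) \<le> l2norm f * l2norm g"
proof -
  let ?a = "l2norm f" and ?b = "l2norm g"
  have int: "integrable lebesgue (\<lambda>x. cmod (f x) * cmod (g x))"
    using integrable_norm[OF L2_mult_integrable[OF assms]] by (simp add: norm_mult)
  consider "?a = 0" | "?b = 0" | "?a > 0" "?b > 0"
    using l2norm_nonneg[of f] l2norm_nonneg[of g] by linarith
  then show ?thesis
  proof cases
    case 1
    then have "AE x in lebesgue. cmod (f x) * cmod (g x) = 0"
      using l2norm_eq_0[OF assms(1)] by auto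
    then show ?thesis by (simp add: integral_eq_zero_AE)
  next
    case 2
    then have "AE x in lebesgue. cmod (f x) * cmod (g x) = 0"
      using l2norm_eq_0[OF assms(2)] by auto
    then show ?thesis by (simp add: integral_eq_zero_AE)
  next
    case 3
    have pt: "cmod (f x) * cmod (g x) \<le> (?b / ?a * (cmod (f x))\<^sup>2 + ?a / ?b * (cmod (g x))\<^sup>2) / 2"
      for x
    proof -
      have "0 \<le> (?b * cmod (f x) - ?a * cmod (g x))\<^sup>2 / (?a * ?b)"
        using 3 by simp
      then show ?thesis
        using 3 by (simp add: power2_diff field_simps power2_eq_square)
    qed
    have "(\<integral>x. cmod (f x) * cmod (g x) \<partial>lebesgue) \<le>
      (\<integral>x. (?b / ?a * (cmod (f x))\<^sup>2 + ?a / ?b * (cmod (g x))\<^sup>2) / 2 \<partial>lebesgue)"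
      by (rule integral_mono[OF int _ pt])
        (intro integrable_divide Bochner_Integration.integrable_add integrable_mult_right
          L2_integrable_square assms)
    also have "\<dots> = (?b / ?a * ?a\<^sup>2 + ?a / ?b * ?b\<^sup>2) / 2"
      unfolding l2norm_square
      using L2_integrable_square[OF assms(1)] L2_integrable_square[OF assms(2)]
      by (simp add: integrable_divide)
    also have "\<dots> = ?a * ?b"
      using 3 by (simp add: power2_eq_square)
    finally show ?thesis .
  qed
qed

lemma Cauchy_Schwarz:
  assumes "f \<in> L2" "g \<in> L2"
  shows "cmod (\<integral>x. f x * g x \<partial>lebesgue) \<le> l2norm f * l2norm g"
  using Cauchy_Schwarz_norm[OF assms] integral_norm_bound[of lebesgue "\<lambda>x. f x * g x"]
  by (simp add: norm_mult)

lemma l2norm_triangle: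
  assumes "f \<in> L2" "g \<in> L2"
  shows "l2norm (\<lambda>x. f x + g x) \<le> l2norm f + l2norm g"
proof (rule power2_le_imp_le)
  have int: "integrable lebesgue (\<lambda>x. cmod (f x) * cmod (g x))"
    using integrable_norm[OF L2_mult_integrable[OF assms]] by (simp add: norm_mult)
  note ints = int L2_integrable_square[OF assms(1)] L2_integrable_square[OF assms(2)]
  have "(l2norm (\<lambda>x. f x + g x))\<^sup>2 = (\<integral>x. (cmod (f x + g x))\<^sup>2 \<partial>lebesgue)"
    by (rule l2norm_square)
  also have "\<dots> \<le> (\<integral>x. (cmod (f x))\<^sup>2 + (cmod (g x))\<^sup>2 + 2 * (cmod (f x) * cmod (g x)) \<partial>lebesgue)"
  proof (rule integral_mono)
    show "integrable lebesgue (\<lambda>x. (cmod (f x + g x))\<^sup>2)"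
      by (rule L2_integrable_square) (use assms in auto)
    show "integrable lebesgue
      (\<lambda>x. (cmod (f x))\<^sup>2 + (cmod (g x))\<^sup>2 + 2 * (cmod (f x) * cmod (g x)))"
      using ints by simp
    fix x
    have "(cmod (f x + g x))\<^sup>2 \<le> (cmod (f x) + cmod (g x))\<^sup>2"
      by (intro power_mono norm_triangle_ineq) auto
    then show "(cmod (f x + g x))\<^sup>2 \<le>
        (cmod (f x))\<^sup>2 + (cmod (g x))\<^sup>2 + 2 * (cmod (f x) * cmod (g x))"
      by (simp add: power2_sum)
  qed
  also have "\<dots> = (l2norm f)\<^sup>2 + (l2norm g)\<^sup>2 + 2 * (\<integral>x. cmod (f x) * cmod (g x) \<partial>lebesgue)"
    using ints by (simp add: l2norm_square)
  also have "\<dots> \<le> (l2norm f + l2norm g)\<^sup>2"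
    using Cauchy_Schwarz_norm[OF assms] by (simp add: power2_sum)
  finally show "(l2norm (\<lambda>x. f x + g x))\<^sup>2 \<le> (l2norm f + l2norm g)\<^sup>2" .
qed simp

lemma L2_tendsto_integral_mult:
  assumes "\<And>n. u n \<in> L2" "f \<in> L2" "g \<in> L2" "((\<lambda>n. l2norm (\<lambda>x. u n x - f x)) \<longlongrightarrow> 0) F"
  shows "((\<lambda>n. \<integral>x. u n x * g x \<partial>lebesgue) \<longlongrightarrow> (\<integral>x. f x * g x \<partial>lebesgue)) F"
proof (rule LIM_zero_cancel, rule Lim_null_comparison)
  have *: "cmod ((\<integral>x. u n x * g x \<partial>lebesgue) - (\<integral>x. f x * g x \<partial>lebesgue))
      \<le> l2norm (\<lambda>x. u n x - f x) * l2norm g" for n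
  proof -
    have "(\<integral>x. u n x * g x \<partial>lebesgue) - (\<integral>x. f x * g x \<partial>lebesgue)
      = (\<integral>x. (u n x - f x) * g x \<partial>lebesgue)"
      using L2_mult_integrable[OF assms(1,3)] L2_mult_integrable[OF assms(2,3)]
      by (simp add: algebra_simps)
    then show ?thesis
      using Cauchy_Schwarz[of "\<lambda>x. u n x - f x" g] assms by auto
  qed
  show "\<forall>\<^sub>F n in F. norm ((\<integral>x. u n x * g x \<partial>lebesgue) - (\<integral>x. f x * g x \<partial>lebesgue))
      \<le> l2norm (\<lambda>x. u n x - f x) * l2norm g"
    using * by simp
  show "((\<lambda>n. l2norm (\<lambda>x. u n x - f x) * l2norm g) \<longlongrightarrow> 0) F"
    using tendsto_mult_left_zero[OF assms(4)] by simp
qed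

lemma L2_tendsto_AE_subseq:
  assumes "\<And>n. u n \<in> L2" "f \<in> L2" "(\<lambda>n. l2norm (\<lambda>x. u n x - f x)) \<longlonglongrightarrow> 0"
  obtains r :: "nat \<Rightarrow> nat" where "strict_mono r" "AE x in lebesgue. (\<lambda>n. u (r n) x) \<longlonglongrightarrow> f x"
proof -
  have "(\<lambda>n. (l2norm (\<lambda>x. u n x - f x))\<^sup>2) \<longlonglongrightarrow> 0\<^sup>2"
    by (intro tendsto_power assms)
  then have "(\<lambda>n. \<integral>x. norm ((cmod (u n x - f x))\<^sup>2) \<partial>lebesgue) \<longlonglongrightarrow> 0"
    by (simp add: l2norm_square)
  moreover have "integrable lebesgue (\<lambda>x. (cmod (u n x - f x))\<^sup>2)" for n
    using assms by (intro L2_integrable_square) auto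
  ultimately obtain r where r: "strict_mono r"
      "AE x in lebesgue. (\<lambda>n. (cmod (u (r n) x - f x))\<^sup>2) \<longlonglongrightarrow> 0"
    using tendsto_L1_AE_subseq[of lebesgue "\<lambda>n x. (cmod (u n x - f x))\<^sup>2"] by blast
  have "AE x in lebesgue. (\<lambda>n. u (r n) x) \<longlonglongrightarrow> f x"
    using r(2)
  proof eventually_elim
    case (elim x)
    then have "(\<lambda>n. sqrt ((cmod (u (r n) x - f x))\<^sup>2)) \<longlonglongrightarrow> sqrt 0"
      by (rule tendsto_real_sqrt)
    then show ?case
      by (simp add: tendsto_norm_zero_iff LIM_zero_iff)
  qed
  with r(1) show ?thesis by (rule that)
qed

lemma L2_Fatou:
  assumes u: "\<And>n. u n \<in> L2" "\<And>n. l2norm (u n) \<le> B"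
    and f: "f \<in> borel_measurable lebesgue" "AE x in lebesgue. (\<lambda>n. u n x) \<longlonglongrightarrow> f x"
  shows "f \<in> L2" "l2norm f \<le> B"
proof -
  have [measurable]: "f \<in> borel_measurable lebesgue" "\<And>n. u n \<in> borel_measurable lebesgue"
    using assms L2_measurable by auto
  have B: "0 \<le> B" using u(2)[of 0] l2norm_nonneg[of "u 0"] by linarith
  have nn: "(\<integral>\<^sup>+x. ennreal ((cmod (u n x))\<^sup>2) \<partial>lebesgue) \<le> ennreal (B\<^sup>2)" for n
    using nn_integral_eq_integral[OF L2_integrable_square[OF u(1)[of n]]] u(2)[of n]
    by (auto simp: l2norm_square[symmetric] intro!: ennreal_leI power_mono)
  have "(\<integral>\<^sup>+x. ennreal ((cmod (f x))\<^sup>2) \<partial>lebesgue) =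
      (\<integral>\<^sup>+x. liminf (\<lambda>n. ennreal ((cmod (u n x))\<^sup>2)) \<partial>lebesgue)"
  proof (rule nn_integral_cong_AE)
    show "AE x in lebesgue. ennreal ((cmod (f x))\<^sup>2) = liminf (\<lambda>n. ennreal ((cmod (u n x))\<^sup>2))"
      using f(2)
    proof eventually_elim
      case (elim x)
      then have "(\<lambda>n. ennreal ((cmod (u n x))\<^sup>2)) \<longlonglongrightarrow> ennreal ((cmod (f x))\<^sup>2)"
        by (intro tendsto_intros)
      then show ?case
        by (intro lim_imp_Liminf[symmetric]) auto
    qed
  qed
  also have "\<dots> \<le> liminf (\<lambda>n. \<integral>\<^sup>+x. ennreal ((cmod (u n x))\<^sup>2) \<partial>lebesgue)"
    by (rule nn_integral_liminf) auto
  also have "\<dots> \<le> liminf (\<lambda>n. ennreal (B\<^sup>2))"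
    by (rule Liminf_mono) (use nn in auto)
  also have "\<dots> = ennreal (B\<^sup>2)"
    by (simp add: Liminf_const)
  finally have le: "(\<integral>\<^sup>+x. ennreal ((cmod (f x))\<^sup>2) \<partial>lebesgue) \<le> ennreal (B\<^sup>2)" .
  have int: "integrable lebesgue (\<lambda>x. (cmod (f x))\<^sup>2)"
    by (rule integrableI_bounded) (use le_less_trans[OF le ennreal_less_top] in auto)
  then show "f \<in> L2" by (simp add: L2_def)
  have "(l2norm f)\<^sup>2 \<le> B\<^sup>2"
    using le nn_integral_eq_integral[OF int] B by (simp add: l2norm_square)
  then show "l2norm f \<le> B"
    using B by (rule power2_le_imp_le)
qed

text \<open>Completeness. Along a subsequence \<open>v\<close> with \<open>\<parallel>v\<^sub>k\<^sub>+\<^sub>1 - v\<^sub>k\<parallel> \<le> 2\<^sup>-\<^sup>k\<close> the series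
  \<open>\<Sum>\<^sub>k 2\<^sup>k |v\<^sub>k\<^sub>+\<^sub>1 - v\<^sub>k|\<^sup>2\<close> has a finite integral, so its terms are bounded at almost every point and
  the telescoping series of \<open>v\<close> converges there. Fatou's lemma turns this into \<open>L\<^sup>2\<close> convergence.\<close>

lemma L2_complete:
  assumes u: "\<And>n. u n \<in> L2"
    and cauchy: "\<And>e. e > 0 \<Longrightarrow> \<exists>N. \<forall>m\<ge>N. \<forall>n\<ge>N. l2norm (\<lambda>x. u m x - u n x) < e"
  obtains f where "f \<in> L2" "(\<lambda>n. l2norm (\<lambda>x. u n x - f x)) \<longlonglongrightarrow> 0"
proof -
  have [measurable]: "\<And>n. u n \<in> borel_measurable lebesgue"
    using u L2_measurable by auto
  have "\<exists>N. \<forall>k. \<forall>m\<ge>N k. \<forall>n\<ge>N k. l2norm (\<lambda>x. u m x - u n x) < (1/2)^k"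
    by (rule choice) (use cauchy in auto)
  then obtain N where N: "\<And>k m n. m \<ge> N k \<Longrightarrow> n \<ge> N k \<Longrightarrow> l2norm (\<lambda>x. u m x - u n x) < (1/2)^k"
    by blast
  define M where "M k = (\<Sum>i\<le>k. N i) + k" for k
  have MN: "N k \<le> M k" for k
  proof -
    have "N k \<le> (\<Sum>i\<le>k. N i)" by (rule member_le_sum) auto
    then show ?thesis by (simp add: M_def)
  qed
  have Mk: "k \<le> M k" for k by (simp add: M_def)
  have MS: "M k \<le> M (Suc k)" for k by (simp add: M_def)
  define d where "d k x = (cmod (u (M (Suc k)) x - u (M k) x))\<^sup>2" for k x
  have [measurable]: "d k \<in> borel_measurable lebesgue" for k
    unfolding d_def by measurable
  have dint: "(\<integral>\<^sup>+x. ennreal (2 ^ k * d k x) \<partial>lebesgue) \<le> ennreal ((1/2)^k)" for k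
  proof -
    have L: "(\<lambda>x. u (M (Suc k)) x - u (M k) x) \<in> L2"
      using u by auto
    have int: "integrable lebesgue (\<lambda>x. 2 ^ k * d k x)"
      using L2_integrable_square[OF L] by (simp add: d_def)
    have "(\<integral>\<^sup>+x. ennreal (2 ^ k * d k x) \<partial>lebesgue) = ennreal (\<integral>x. 2 ^ k * d k x \<partial>lebesgue)"
      by (rule nn_integral_eq_integral[OF int]) (auto simp: d_def)
    also have "(\<integral>x. 2 ^ k * d k x \<partial>lebesgue)
        = 2 ^ k * (l2norm (\<lambda>x. u (M (Suc k)) x - u (M k) x))\<^sup>2"
      by (simp add: d_def l2norm_square)
    also have "ennreal \<dots> \<le> ennreal (2 ^ k * ((1/2)^k)\<^sup>2)"
      using N[of k "M (Suc k)" "M k"] MN[of k] MS[of k]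
      by (intro ennreal_leI mult_left_mono power_mono) auto
    also have "2 ^ k * ((1/2)^k)\<^sup>2 = (1/2::real)^k"
      by (simp add: power2_eq_square power_mult_distrib[symmetric])
    finally show ?thesis .
  qed
  have "(\<integral>\<^sup>+x. (\<Sum>k. ennreal (2 ^ k * d k x)) \<partial>lebesgue) =
      (\<Sum>k. \<integral>\<^sup>+x. ennreal (2 ^ k * d k x) \<partial>lebesgue)"
    by (rule nn_integral_suminf) measurable
  also have "\<dots> \<le> (\<Sum>k. ennreal ((1/2)^k))"
    by (intro suminf_le dint) auto
  also have "\<dots> = ennreal (\<Sum>k. (1/2)^k)"
    by (rule suminf_ennreal2) auto
  finally have "(\<integral>\<^sup>+x. (\<Sum>k. ennreal (2 ^ k * d k x)) \<partial>lebesgue) \<noteq> \<infinity>"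
    using order_le_less_trans[of _ "ennreal (\<Sum>k. (1/2)^k)" \<top>]
    by (auto simp: less_top)
  then have fin: "AE x in lebesgue. (\<Sum>k. ennreal (2 ^ k * d k x)) \<noteq> \<infinity>"
    by (intro nn_integral_PInf_AE) simp_all
  define v where "v k = u (M k)" for k
  define f where "f x = lim (\<lambda>k. v k x)" for x
  have [measurable]: "v k \<in> borel_measurable lebesgue" for k
    by (simp add: v_def)
  have fmeas: "f \<in> borel_measurable lebesgue"
    unfolding f_def by measurable
  have conv: "AE x in lebesgue. (\<lambda>k. v k x) \<longlonglongrightarrow> f x"
    using fin
  proof eventually_elim
    case (elim x)
    then have summ: "summable (\<lambda>k. 2 ^ k * d k x)"
      by (intro summable_suminf_not_top) (auto simp: d_def)
    then obtain K where K: "\<And>k. norm (2 ^ k * d k x) \<le> K"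
      using summable_imp_Bseq[OF summ] unfolding Bseq_def by blast
    have bound: "cmod (v (Suc k) x - v k x) \<le> sqrt K * sqrt (1/2) ^ k" for k
    proof -
      have "(cmod (v (Suc k) x - v k x))\<^sup>2 \<le> K * (1/2) ^ k"
        using K[of k] by (simp add: v_def d_def field_simps)
      then have "cmod (v (Suc k) x - v k x) \<le> sqrt (K * (1/2) ^ k)"
        by (rule real_le_rsqrt)
      then show ?thesis by (simp add: real_sqrt_mult real_sqrt_power real_sqrt_divide)
    qed
    have "summable (\<lambda>k. v (Suc k) x - v k x)"
    proof (rule summable_comparison_test'[where N = 0])
      show "summable (\<lambda>k. sqrt K * sqrt (1/2) ^ k)"
        by (intro summable_mult summable_geometric) simp
    qed (use bound in auto)
    then have "convergent (\<lambda>n. v n x - v 0 x)"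
      by (simp only: summable_iff_convergent sum_lessThan_telescope[of "\<lambda>n. v n x"])
    then have "convergent (\<lambda>n. (v n x - v 0 x) + v 0 x)"
      by (intro convergent_add convergent_const)
    then show ?case
      unfolding f_def by (simp add: convergent_LIMSEQ_iff)
  qed
  have fin2: "(\<lambda>x. u n x - f x) \<in> L2 \<and> l2norm (\<lambda>x. u n x - f x) \<le> (1/2)^k" if "n \<ge> N k" for n k
  proof -
    have 1: "(\<lambda>x. u n x - v (j + k) x) \<in> L2" for j
      unfolding v_def using u by auto
    have 2: "l2norm (\<lambda>x. u n x - v (j + k) x) \<le> (1/2)^k" for j
    proof -
      have "M (j + k) \<ge> N k"
        using MN[of k] lift_Suc_mono_le[of M, OF MS, of k "j + k"] by linarith
      then show ?thesis unfolding v_def using N[of k n "M (j + k)"] that by simp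
    qed
    have 3: "AE x in lebesgue. (\<lambda>j. u n x - v (j + k) x) \<longlonglongrightarrow> u n x - f x"
      using conv
    proof eventually_elim
      case (elim x)
      show ?case
        by (intro tendsto_diff tendsto_const LIMSEQ_ignore_initial_segment elim)
    qed
    show ?thesis
      using L2_Fatou[OF 1 2 _ 3] fmeas by auto
  qed
  have "f \<in> L2"
    using L2_diff[OF u[of "N 0"] conjunct1[OF fin2[of 0 "N 0"]]] by simp
  moreover have "(\<lambda>n. l2norm (\<lambda>x. u n x - f x)) \<longlonglongrightarrow> 0"
  proof (rule LIMSEQ_I)
    fix r :: real assume "r > 0"
    then obtain k where k: "(1/2::real)^k < r"
      using real_arch_pow_inv[of r "1/2"] by auto
    have "norm (l2norm (\<lambda>x. u n x - f x) - 0) < r" if "n \<ge> N k" for n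
      using conjunct2[OF fin2[OF that]] k by simp
    then show "\<exists>no. \<forall>n\<ge>no. norm (l2norm (\<lambda>x. u n x - f x) - 0) < r" by blast
  qed
  ultimately show ?thesis by (rule that)
qed

section \<open>Partial derivatives and Schwartz functions\<close>

lemma has_vector_derivative_partial:
  fixes f :: "real ^ 'n \<Rightarrow> complex"
  assumes "f differentiable (at (x + s *\<^sub>R axis i 1))"
  shows "((\<lambda>t. f (x + t *\<^sub>R axis i 1)) has_vector_derivative partial i f (x + s *\<^sub>R axis i 1)) (at s)"
proof -
  let ?e = "axis i 1 :: real ^ 'n"
  from assms obtain D where D: "(f has_derivative D) (at (x + s *\<^sub>R ?e))"
    by (auto simp: differentiable_def)
  have gen: "((\<lambda>t. f (z + t *\<^sub>R ?e)) has_vector_derivative D ?e) (at r)"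
    if "z + r *\<^sub>R ?e = x + s *\<^sub>R ?e" for z r
  proof -
    have "((\<lambda>t. z + t *\<^sub>R ?e) has_derivative (\<lambda>t. t *\<^sub>R ?e)) (at r)"
      by (auto intro!: derivative_eq_intros)
    from has_derivative_compose[OF this, of f D] D that
    have "((\<lambda>t. f (z + t *\<^sub>R ?e)) has_derivative (\<lambda>t. D (t *\<^sub>R ?e))) (at r)"
      by simp
    moreover have "D (t *\<^sub>R ?e) = t *\<^sub>R D ?e" for t
      using D by (simp add: has_derivative_def bounded_linear.linear linear_scale)
    ultimately show ?thesis by (simp add: has_vector_derivative_def)
  qed
  have "partial i f (x + s *\<^sub>R ?e) = D ?e"
    unfolding partial_def by (rule vector_derivative_at) (rule gen, simp)
  with gen[of x s] show ?thesis by simp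
qed

lemma partialI:
  assumes "(f has_derivative D) (at x)"
  shows "partial i f x = D (axis i 1)"
proof -
  have "((\<lambda>t. x + t *\<^sub>R axis i 1) has_derivative (\<lambda>t. t *\<^sub>R axis i 1)) (at 0)"
    by (auto intro!: derivative_eq_intros)
  from has_derivative_compose[OF this, of f D] assms
  have "((\<lambda>t. f (x + t *\<^sub>R axis i 1)) has_derivative (\<lambda>t. D (t *\<^sub>R axis i 1))) (at 0)"
    by simp
  moreover have "D (t *\<^sub>R axis i 1) = t *\<^sub>R D (axis i 1)" for t
    using assms by (simp add: has_derivative_def bounded_linear.linear linear_scale)
  ultimately show ?thesis
    unfolding partial_def by (intro vector_derivative_at) (simp add: has_vector_derivative_def)
qed

lemma partial_const [simp]: "partial i (\<lambda>x. c) = (\<lambda>x. 0)"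
  by (rule ext) (simp add: partialI[OF has_derivative_const])

lemma partial_add:
  assumes "f differentiable (at x)" "g differentiable (at x)"
  shows "partial i (\<lambda>x. f x + g x) x = partial i f x + partial i g x"
  using assms by (auto simp: differentiable_def partialI[OF has_derivative_add] partialI)

lemma partial_mult:
  assumes "f differentiable (at x)" "g differentiable (at x)"
  shows "partial i (\<lambda>x. f x * g x) x = f x * partial i g x + partial i f x * g x"
  using assms by (auto simp: differentiable_def partialI[OF has_derivative_mult] partialI)

lemma partial_scale:
  assumes "f differentiable (at x)"
  shows "partial i (\<lambda>x. c * f x) x = c * partial i f x"
  using partial_mult[of "\<lambda>x. c" x f i] assms by simp

lemma partial_sum_list:
  assumes "\<And>p. p \<in> set ps \<Longrightarrow> f p differentiable (at x)"
  shows "(\<lambda>x. \<Sum>p\<leftarrow>ps. f p x) differentiable (at x)"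
    "partial i (\<lambda>x. \<Sum>p\<leftarrow>ps. f p x) x = (\<Sum>p\<leftarrow>ps. partial i (f p) x)"
  using assms by (induction ps) (auto simp: partial_add)

lemma smoothD: "smooth f \<Longrightarrow> foldr partial is f differentiable (at x)"
  by (simp add: smooth_def)

lemma smooth_differentiable: "smooth f \<Longrightarrow> f differentiable (at x)"
  using smoothD[of f "[]"] by simp

lemma smooth_foldr_partial: "smooth f \<Longrightarrow> smooth (foldr partial is f)"
  unfolding smooth_def using foldr_append[of partial _ "is" f] by metis

lemma smooth_partial: "smooth f \<Longrightarrow> smooth (partial i f)"
  using smooth_foldr_partial[of f "[i]"] by simp

lemma smooth_continuous: "smooth f \<Longrightarrow> continuous_on A f"
  by (intro continuous_at_imp_continuous_on ballI differentiable_imp_continuous_within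
      smooth_differentiable)

lemma smooth_coinduct:
  assumes "P f" "\<And>f x. P f \<Longrightarrow> f differentiable (at x)" "\<And>f i. P f \<Longrightarrow> P (partial i f)"
  shows "smooth f"
proof -
  have "P (foldr partial is f)" for "is"
    by (induction "is") (auto intro: assms)
  then show ?thesis by (auto simp: smooth_def intro: assms(2))
qed

lemma foldr_partial_add:
  assumes "smooth f" "smooth g"
  shows "foldr partial is (\<lambda>x. f x + g x) = (\<lambda>x. foldr partial is f x + foldr partial is g x)"
  by (induction "is") (auto simp: partial_add[OF smoothD[OF assms(1)] smoothD[OF assms(2)]])

lemma foldr_partial_scale:
  assumes "smooth f"
  shows "foldr partial is (\<lambda>x. c * f x) = (\<lambda>x. c * foldr partial is f x)"
  by (induction "is") (auto simp: partial_scale[OF smoothD[OF assms]])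

lemma smooth_add: "smooth f \<Longrightarrow> smooth g \<Longrightarrow> smooth (\<lambda>x. f x + g x)"
  by (auto simp: smooth_def[of "\<lambda>x. f x + g x"] foldr_partial_add smoothD)

lemma smooth_const: "smooth (\<lambda>x. c)"
  by (rule smooth_coinduct[where P = "\<lambda>f. \<exists>c. f = (\<lambda>x. c)"]) (auto simp: exI[of _ "0::complex"])

fun splits :: "'a list \<Rightarrow> ('a list \<times> 'a list) list" where
  "splits [] = [([], [])]"
| "splits (i # w) = map (\<lambda>(u, v). (i # u, v)) (splits w) @ map (\<lambda>(u, v). (u, i # v)) (splits w)"

lemma splits_length: "(u, v) \<in> set (splits w) \<Longrightarrow> length u + length v = length w"
  by (induction w arbitrary: u v) auto

lemma sum_list_splits_Cons:
  "(\<Sum>(u, v)\<leftarrow>splits (i # w). h u v) =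
    (\<Sum>(u, v)\<leftarrow>splits w. h (i # u) v) + (\<Sum>(u, v)\<leftarrow>splits w. h u (i # v))"
  by (simp add: o_def split_def)

text \<open>The Leibniz rule for iterated derivatives. Words of coordinates instead of multi-indices make
  the binomial coefficients disappear: each letter of the word goes to one of the two factors.\<close>

lemma foldr_partial_mult:
  assumes f: "smooth f" and g: "smooth g"
  shows "foldr partial w (\<lambda>x. f x * g x) =
    (\<lambda>x. \<Sum>(u, v)\<leftarrow>splits w. foldr partial u f x * foldr partial v g x)"
proof (induction w)
  case (Cons i w)
  show ?case
  proof
    fix x
    have d: "(\<lambda>x. foldr partial u f x * foldr partial v g x) differentiable (at x)" for u v
      by (intro differentiable_mult smoothD f g)
    have "foldr partial (i # w) (\<lambda>x. f x * g x) x
      = partial i (\<lambda>x. \<Sum>(u, v)\<leftarrow>splits w. foldr partial u f x * foldr partial v g x) x"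
      by (simp add: Cons)
    also have "\<dots> = (\<Sum>(u, v)\<leftarrow>splits w. partial i (\<lambda>x. foldr partial u f x * foldr partial v g x) x)"
      unfolding split_def by (rule partial_sum_list) (rule d)
    also have "\<dots> = (\<Sum>(u, v)\<leftarrow>splits w. foldr partial (i # u) f x * foldr partial v g x)
        + (\<Sum>(u, v)\<leftarrow>splits w. foldr partial u f x * foldr partial (i # v) g x)"
      by (simp add: partial_mult[OF smoothD[OF f] smoothD[OF g]] split_def sum_list_addf add.commute)
    also have "\<dots> = (\<Sum>(u, v)\<leftarrow>splits (i # w). foldr partial u f x * foldr partial v g x)"
      by (rule sum_list_splits_Cons[symmetric])
    finally show "foldr partial (i # w) (\<lambda>x. f x * g x) x =
      (\<Sum>(u, v)\<leftarrow>splits (i # w). foldr partial u f x * foldr partial v g x)" .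
  qed
qed simp

lemma smooth_mult:
  assumes "smooth f" "smooth g"
  shows "smooth (\<lambda>x. f x * g x)"
  unfolding smooth_def foldr_partial_mult[OF assms] split_beta
  by (intro allI partial_sum_list differentiable_mult smoothD assms)

lemma smooth_prod: "(\<And>a. a \<in> A \<Longrightarrow> smooth (f a)) \<Longrightarrow> smooth (\<lambda>x. \<Prod>a\<in>A. f a x)"
  by (induction A rule: infinite_finite_induct) (auto intro: smooth_const smooth_mult)

lemma has_derivative_component: "((\<lambda>x. complex_of_real (x $ i)) has_derivative (\<lambda>x. of_real (x $ i))) F"
  by (intro bounded_linear_imp_has_derivative bounded_linear_compose[OF bounded_linear_of_real]
      bounded_linear_vec_nth)

lemma partial_component:
  "partial j (\<lambda>x. complex_of_real (x $ i)) = (\<lambda>x. if i = j then 1 else 0)"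
  by (rule ext) (auto simp: partialI[OF has_derivative_component] axis_def)

lemma smooth_component: "smooth (\<lambda>x. complex_of_real (x $ i))"
proof (rule smooth_coinduct[where P = "\<lambda>f. f = (\<lambda>x. complex_of_real (x $ i)) \<or> (\<exists>c. f = (\<lambda>x. c))"])
  show "f differentiable (at x)"
    if "f = (\<lambda>x. complex_of_real (x $ i)) \<or> (\<exists>c. f = (\<lambda>x. c))" for f x
    using that has_derivative_component unfolding differentiable_def
    by (metis has_derivative_const)
qed (auto simp: partial_component)

subsection \<open>Symmetry of second derivatives\<close>

lemma vector_derivative_bound:
  fixes q :: "real \<Rightarrow> 'a::real_normed_vector"
  assumes "0 \<le> h"
    "\<And>s. s \<in> {0..h} \<Longrightarrow> (q has_vector_derivative q' s) (at s within {0..h})"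
    "\<And>s. s \<in> {0..h} \<Longrightarrow> norm (q' s) \<le> B"
  shows "norm (q h - q 0) \<le> B * h"
proof -
  have "norm (q h - q 0) \<le> B * norm (h - 0)"
  proof (rule differentiable_bound[where S = "{0..h}" and f' = "\<lambda>s r. r *\<^sub>R q' s"])
    show "(q has_derivative (\<lambda>r. r *\<^sub>R q' s)) (at s within {0..h})" if "s \<in> {0..h}" for s
      using assms(2)[OF that] by (simp add: has_vector_derivative_def)
    show "onorm (\<lambda>r. r *\<^sub>R q' s) \<le> B" if "s \<in> {0..h}" for s
      using assms(3)[OF that] by (intro onorm_le) (simp add: mult.commute[of B] mult_left_mono)
  qed (use assms(1) in auto)
  then show ?thesis using assms(1) by simp
qed

text \<open>The second difference of \<open>f\<close> over a square of side \<open>h\<close> is \<open>h\<^sup>2 \<partial>\<^sub>i \<partial>\<^sub>j f\<close> up to \<open>o(h\<^sup>2)\<close>, and it is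
  symmetric in \<open>i\<close> and \<open>j\<close>.\<close>

lemma second_difference:
  fixes f :: "real ^ 'n \<Rightarrow> complex"
  assumes f: "smooth f" and e: "e > 0"
  obtains d where "d > 0" "\<And>h. 0 < h \<Longrightarrow> h < d \<Longrightarrow>
    cmod (f (x + h *\<^sub>R axis i 1 + h *\<^sub>R axis j 1) - f (x + h *\<^sub>R axis i 1) - f (x + h *\<^sub>R axis j 1) + f x
      - (h * h) *\<^sub>R partial i (partial j f) x) \<le> e * h * h"
proof -
  let ?a = "axis i 1 :: real ^ 'n" and ?b = "axis j 1 :: real ^ 'n"
  let ?c = "partial i (partial j f) x"
  have "isCont (partial i (partial j f)) x"
    using smooth_differentiable[OF smooth_partial[OF smooth_partial[OF f]]]
    by (rule differentiable_imp_continuous_within)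
  then obtain d where d: "d > 0" "\<And>y. dist y x < d \<Longrightarrow> cmod (partial i (partial j f) y - ?c) \<le> e"
    using e unfolding continuous_at dist_norm by (metis (no_types, lifting) LIM_eq diff_self dist_norm
        less_eq_real_def norm_zero tendsto_ident_at)
  show ?thesis
  proof (rule that)
    show "d / 2 > 0" using d by simp
    fix h :: real assume h: "0 < h" "h < d / 2"
    have near: "cmod (partial i (partial j f) (x + s *\<^sub>R ?a + t *\<^sub>R ?b) - ?c) \<le> e"
      if "s \<in> {0..h}" "t \<in> {0..h}" for s t
    proof (rule d(2))
      have "dist (x + s *\<^sub>R ?a + t *\<^sub>R ?b) x \<le> norm (s *\<^sub>R ?a) + norm (t *\<^sub>R ?b)"
        by (simp add: dist_norm add.assoc) (rule order_trans[OF norm_triangle_ineq], simp)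
      also have "\<dots> < d" using that h by simp
      finally show "dist (x + s *\<^sub>R ?a + t *\<^sub>R ?b) x < d" .
    qed
    have inner: "cmod (partial j f (x + h *\<^sub>R ?a + t *\<^sub>R ?b) - partial j f (x + t *\<^sub>R ?b) - h *\<^sub>R ?c) \<le> e * h"
      if t: "t \<in> {0..h}" for t
    proof -
      let ?q = "\<lambda>s. partial j f (x + t *\<^sub>R ?b + s *\<^sub>R ?a) - s *\<^sub>R ?c"
      have "norm (?q h - ?q 0) \<le> e * h"
      proof (rule vector_derivative_bound)
        fix s assume s: "s \<in> {0..h}"
        have "((\<lambda>s. s *\<^sub>R ?c) has_vector_derivative ?c) (at s within {0..h})"
          by (auto simp: has_vector_derivative_def intro!: derivative_eq_intros)
        then have "(?q has_vector_derivative
            partial i (partial j f) (x + t *\<^sub>R ?b + s *\<^sub>R ?a) - ?c) (at s within {0..h})"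
          by (intro has_vector_derivative_diff has_vector_derivative_at_within
              [OF has_vector_derivative_partial] smooth_differentiable smooth_partial f)
        then show "(?q has_vector_derivative
            partial i (partial j f) (x + s *\<^sub>R ?a + t *\<^sub>R ?b) - ?c) (at s within {0..h})"
          by (simp add: add_ac)
        show "norm (partial i (partial j f) (x + s *\<^sub>R ?a + t *\<^sub>R ?b) - ?c) \<le> e"
          by (rule near[OF s t])
      qed (use h in auto)
      then show ?thesis using h by (simp add: add_ac algebra_simps)
    qed
    let ?r = "\<lambda>t. f (x + h *\<^sub>R ?a + t *\<^sub>R ?b) - f (x + t *\<^sub>R ?b) - (t * h) *\<^sub>R ?c"
    have "norm (?r h - ?r 0) \<le> (e * h) * h"
    proof (rule vector_derivative_bound)
      fix t assume t: "t \<in> {0..h}"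
      have "((\<lambda>t. (t * h) *\<^sub>R ?c) has_vector_derivative h *\<^sub>R ?c) (at t within {0..h})"
        by (auto simp: has_vector_derivative_def intro!: derivative_eq_intros)
      then show "(?r has_vector_derivative
          partial j f (x + h *\<^sub>R ?a + t *\<^sub>R ?b) - partial j f (x + t *\<^sub>R ?b) - h *\<^sub>R ?c) (at t within {0..h})"
        by (intro has_vector_derivative_diff has_vector_derivative_at_within
              [OF has_vector_derivative_partial] smooth_differentiable smooth_partial f)
    qed (use h inner in auto)
    then show "cmod (f (x + h *\<^sub>R ?a + h *\<^sub>R ?b) - f (x + h *\<^sub>R ?a) - f (x + h *\<^sub>R ?b) + f x
        - (h * h) *\<^sub>R ?c) \<le> e * h * h"
      using h by (simp add: algebra_simps)
  qed
qed

lemma partial_commute: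
  fixes f :: "real ^ 'n \<Rightarrow> complex"
  assumes f: "smooth f"
  shows "partial i (partial j f) = partial j (partial i f)"
proof
  fix x
  let ?c = "partial i (partial j f) x" and ?c' = "partial j (partial i f) x"
  have "cmod (?c - ?c') \<le> 0 + e" if e: "e > 0" for e
  proof -
    have e2: "e / 2 > 0" using e by simp
    obtain d where d: "d > 0" "\<And>h. 0 < h \<Longrightarrow> h < d \<Longrightarrow>
      cmod (f (x + h *\<^sub>R axis i 1 + h *\<^sub>R axis j 1) - f (x + h *\<^sub>R axis i 1) - f (x + h *\<^sub>R axis j 1) + f x
        - (h * h) *\<^sub>R ?c) \<le> e / 2 * h * h"
      using second_difference[OF f e2, of x i j] by blast
    obtain d' where d': "d' > 0" "\<And>h. 0 < h \<Longrightarrow> h < d' \<Longrightarrow>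
      cmod (f (x + h *\<^sub>R axis j 1 + h *\<^sub>R axis i 1) - f (x + h *\<^sub>R axis j 1) - f (x + h *\<^sub>R axis i 1) + f x
        - (h * h) *\<^sub>R ?c') \<le> e / 2 * h * h"
      using second_difference[OF f e2, of x j i] by blast
    define h where "h = min d d' / 2"
    have h: "0 < h" "h < d" "h < d'" using d(1) d'(1) by (auto simp: h_def)
    let ?D = "f (x + h *\<^sub>R axis i 1 + h *\<^sub>R axis j 1) - f (x + h *\<^sub>R axis i 1) - f (x + h *\<^sub>R axis j 1) + f x"
    have 1: "cmod (?D - (h * h) *\<^sub>R ?c) \<le> e / 2 * h * h"
      by (rule d(2)) (use h in auto)
    have 2: "cmod (?D - (h * h) *\<^sub>R ?c') \<le> e / 2 * h * h"
      using d'(2)[OF h(1,3)] by (simp add: add_ac diff_diff_eq)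
    have "(h * h) * cmod (?c - ?c') = cmod ((h * h) *\<^sub>R (?c - ?c'))"
      by simp
    also have "\<dots> = cmod ((?D - (h * h) *\<^sub>R ?c') - (?D - (h * h) *\<^sub>R ?c))"
      by (rule arg_cong[where f = cmod]) (simp only: algebra_simps)
    also have "\<dots> \<le> e / 2 * h * h + e / 2 * h * h"
      by (rule order_trans[OF norm_triangle_ineq4 add_mono[OF 2 1]])
    also have "\<dots> = (h * h) * e" by simp
    finally show ?thesis using h by simp
  qed
  then have "cmod (?c - ?c') \<le> 0" by (rule field_le_epsilon)
  then show "?c = ?c'" by simp
qed

lemma foldr_partial_perm:
  assumes f: "smooth f" and "mset is = mset js"
  shows "foldr partial is f = foldr partial js f"
proof -
  \<comment> \<open>Cut off outside the smooth functions, the partial derivatives commute unconditionally.\<close>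
  define P where "P i g = (if smooth g then partial i g else g)" for i and g :: "real ^ 'a \<Rightarrow> complex"
  have P: "foldr P ks f = foldr partial ks f" for ks
    by (induction ks) (auto simp: P_def smooth_foldr_partial f)
  have "P i \<circ> P j = P j \<circ> P i" for i j
    by (auto simp: P_def fun_eq_iff smooth_partial partial_commute)
  then have "fold P (rev is) = fold P (rev js)"
    by (intro fold_multiset_equiv) (use assms(2) in auto)
  then have "foldr P is f = foldr P js f"
    by (simp add: foldr_conv_fold)
  then show ?thesis by (simp add: P)
qed

lemma coord_order: "distinct (coord_order :: 'n::finite list)" "set (coord_order :: 'n list) = UNIV"
proof -
  have "\<exists>is :: 'n list. distinct is \<and> set is = UNIV"
    using finite_distinct_list[of "UNIV :: 'n set"] by auto
  from someI_ex[OF this] show "distinct (coord_order :: 'n list)" "set (coord_order :: 'n list) = UNIV"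
    by (auto simp: coord_order_def)
qed

text \<open>Spelling a multi-index out as a word, in the order in which \<^const>\<open>mderiv\<close> takes the derivatives,
  makes inductions over words available for \<open>\<partial>\<^sup>\<alpha>\<close>.\<close>

definition mword :: "('n::finite \<Rightarrow> nat) \<Rightarrow> 'n list" where
  "mword \<alpha> = concat (map (\<lambda>i. replicate (\<alpha> i) i) coord_order)"

lemma mderiv_mword: "mderiv \<alpha> f = foldr partial (mword \<alpha>) f"
proof -
  have rep: "foldr partial (replicate n i) f = (partial i ^^ n) f" for n i f
    by (induction n) auto
  have "foldr (\<lambda>i. partial i ^^ \<alpha> i) xs f = foldr partial (concat (map (\<lambda>i. replicate (\<alpha> i) i) xs)) f"
    for xs
    by (induction xs) (auto simp: rep)
  then show ?thesis by (simp add: mderiv_def mword_def)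
qed

lemma count_mset_concat_replicate:
  "distinct xs \<Longrightarrow> count (mset (concat (map (\<lambda>i. replicate (\<alpha> i) i) xs))) j = (if j \<in> set xs then \<alpha> j else 0)"
  by (induction xs) auto

lemma count_mword: "count (mset (mword \<alpha>)) j = \<alpha> j"
  unfolding mword_def using coord_order by (subst count_mset_concat_replicate) auto

lemma length_mword: "length (mword \<alpha>) = msize \<alpha>"
proof -
  have "length (mword \<alpha>) = (\<Sum>i\<leftarrow>coord_order. \<alpha> i)"
    by (simp add: mword_def length_concat o_def)
  also have "\<dots> = (\<Sum>i\<in>UNIV. \<alpha> i)"
    using coord_order sum_list_distinct_conv_sum_set by metis
  finally show ?thesis by (simp add: msize_def)
qed

lemma foldr_partial_mderiv:
  assumes "smooth f"
  shows "foldr partial is f = mderiv (count (mset is)) f"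
  unfolding mderiv_mword
  by (rule foldr_partial_perm[OF assms]) (simp add: multiset_eq_iff count_mword)

lemma partial_pow_mderiv:
  assumes "smooth f"
  shows "(partial i ^^ j) f = mderiv (\<lambda>i'. if i' = i then j else 0) f"
proof -
  have "(partial i ^^ j) f = foldr partial (replicate j i) f"
    by (induction j) auto
  moreover have "count (mset (replicate j i)) = (\<lambda>i'. if i' = i then j else 0)"
    by auto
  ultimately show ?thesis
    by (simp only: foldr_partial_mderiv[OF assms])
qed

subsection \<open>The Schwartz space\<close>

definition rapid_decay :: "(real ^ 'n::finite \<Rightarrow> complex) \<Rightarrow> bool" where
  "rapid_decay f \<longleftrightarrow> (\<forall>\<beta>. bounded (range (\<lambda>x. mpower x \<beta> *\<^sub>R f x)))"

lemma rapid_decay_add: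
  assumes "rapid_decay f" "rapid_decay g"
  shows "rapid_decay (\<lambda>x. f x + g x)"
  unfolding rapid_decay_def scaleR_add_right
  using assms by (auto intro!: bounded_plus_comp simp: rapid_decay_def)

lemma rapid_decay_scale:
  assumes "rapid_decay f"
  shows "rapid_decay (\<lambda>x. c * f x)"
  unfolding rapid_decay_def
proof
  fix \<beta>
  obtain B where "\<And>x. cmod (mpower x \<beta> *\<^sub>R f x) \<le> B"
    using assms by (auto simp: rapid_decay_def bounded_iff)
  then have "cmod (mpower x \<beta> *\<^sub>R (c * f x)) \<le> cmod c * B" for x
    using mult_left_mono[of "cmod (mpower x \<beta> *\<^sub>R f x)" B "cmod c"] by (simp add: norm_mult mult_ac)
  then show "bounded (range (\<lambda>x. mpower x \<beta> *\<^sub>R (c * f x)))"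
    by (auto simp: bounded_iff)
qed

lemma mpower_Suc: "mpower x (\<beta>(i := Suc (\<beta> i))) = x $ i * mpower x \<beta>"
proof -
  have "mpower x (\<beta>(i := Suc (\<beta> i)))
      = (x $ i) ^ Suc (\<beta> i) * (\<Prod>j\<in>UNIV - {i}. (x $ j) ^ (\<beta>(i := Suc (\<beta> i))) j)"
    unfolding mpower_def by (subst prod.remove[of _ i]) auto
  also have "\<dots> = x $ i * ((x $ i) ^ \<beta> i * (\<Prod>j\<in>UNIV - {i}. (x $ j) ^ \<beta> j))"
    by (auto intro!: prod.cong)
  also have "\<dots> = x $ i * mpower x \<beta>"
    unfolding mpower_def by (subst (2) prod.remove[of _ i]) auto
  finally show ?thesis .
qed

lemma mpower_0 [simp]: "mpower x (\<lambda>i. 0) = 1"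
  by (simp add: mpower_def)

lemma rapid_decay_component:
  assumes "rapid_decay f"
  shows "rapid_decay (\<lambda>x. of_real (x $ i) * f x)"
  unfolding rapid_decay_def
proof
  fix \<beta>
  have "(\<lambda>x. mpower x \<beta> *\<^sub>R (of_real (x $ i) * f x)) = (\<lambda>x. mpower x (\<beta>(i := Suc (\<beta> i))) *\<^sub>R f x)"
    by (auto simp: mpower_Suc scaleR_conv_of_real mult_ac)
  then show "bounded (range (\<lambda>x. mpower x \<beta> *\<^sub>R (of_real (x $ i) * f x)))"
    using assms unfolding rapid_decay_def by metis
qed

lemma rapid_decay_bounded:
  assumes "rapid_decay f"
  obtains B where "\<And>x. cmod (f x) \<le> B"
  using spec[OF assms[unfolded rapid_decay_def], of "\<lambda>i. 0"] by (auto simp: bounded_iff)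

text \<open>By symmetry of the derivatives a word may be sorted into the order of a multi-index. In terms of
  words it is visible that the Schwartz space is closed under each \<open>\<partial>\<^sub>i\<close>.\<close>

lemma schwartz_iff: "f \<in> schwartz \<longleftrightarrow> smooth f \<and> (\<forall>is. rapid_decay (foldr partial is f))"
proof
  assume "f \<in> schwartz"
  then show "smooth f \<and> (\<forall>is. rapid_decay (foldr partial is f))"
    by (auto simp: schwartz_def rapid_decay_def foldr_partial_mderiv)
next
  assume "smooth f \<and> (\<forall>is. rapid_decay (foldr partial is f))"
  then show "f \<in> schwartz"
    by (auto simp: schwartz_def rapid_decay_def mderiv_mword)
qed

lemma schwartz_smooth: "f \<in> schwartz \<Longrightarrow> smooth f"
  by (simp add: schwartz_iff)

lemma schwartz_rapid_decay: "f \<in> schwartz \<Longrightarrow> rapid_decay f"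
  using spec[of "\<lambda>is. rapid_decay (foldr partial is f)" "[]"] by (simp add: schwartz_iff)

lemma schwartz_foldr_partial: "f \<in> schwartz \<Longrightarrow> foldr partial is f \<in> schwartz"
  unfolding schwartz_iff by (metis foldr_append o_apply smooth_foldr_partial)

lemma schwartz_partial: "f \<in> schwartz \<Longrightarrow> partial i f \<in> schwartz"
  using schwartz_foldr_partial[of f "[i]"] by simp

lemma schwartz_add: "f \<in> schwartz \<Longrightarrow> g \<in> schwartz \<Longrightarrow> (\<lambda>x. f x + g x) \<in> schwartz"
  by (auto simp: schwartz_iff smooth_add foldr_partial_add rapid_decay_add)

lemma schwartz_scale: "f \<in> schwartz \<Longrightarrow> (\<lambda>x. c * f x) \<in> schwartz"
  by (auto simp: schwartz_iff foldr_partial_scale rapid_decay_scale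
      intro: smooth_mult[OF smooth_const])

lemma schwartz_component:
  assumes "f \<in> schwartz"
  shows "(\<lambda>x. of_real (x $ i) * f x) \<in> schwartz"
proof -
  have "\<forall>f\<in>schwartz. rapid_decay (foldr partial is (\<lambda>x. of_real (x $ i) * f x))" for "is"
  proof (induction "is" rule: rev_induct)
    case Nil
    then show ?case by (auto intro: rapid_decay_component schwartz_rapid_decay)
  next
    case (snoc j js)
    show ?case
    proof
      fix f :: "real ^ 'a \<Rightarrow> complex" assume f: "f \<in> schwartz"
      have "partial j (\<lambda>x. of_real (x $ i) * f x)
        = (\<lambda>x. of_real (x $ i) * partial j f x + (if i = j then 1 else 0) * f x)"
        by (rule ext) (subst partial_mult, auto intro: smooth_differentiable smooth_component
            schwartz_smooth f simp: partial_component)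
      moreover have "rapid_decay (foldr partial js (\<lambda>x. (if i = j then 1 else 0) * f x))"
        using schwartz_scale[OF f] by (simp only: schwartz_iff)
      moreover have "rapid_decay (foldr partial js (\<lambda>x. of_real (x $ i) * partial j f x))"
        using snoc schwartz_partial[OF f] by blast
      ultimately show "rapid_decay (foldr partial (js @ [j]) (\<lambda>x. of_real (x $ i) * f x))"
        using f by (auto simp: foldr_partial_add smooth_mult smooth_component smooth_partial
            schwartz_smooth smooth_const rapid_decay_add)
    qed
  qed
  then show ?thesis
    using assms by (auto simp: schwartz_iff[of "\<lambda>x. of_real (x $ i) * f x"]
        intro: smooth_mult smooth_component schwartz_smooth)
qed

lemma foldr_partial_support:
  assumes "smooth \<phi>" "x \<notin> closure {x. \<phi> x \<noteq> 0}"
  shows "foldr partial is \<phi> x = 0"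
  using assms(2)
proof (induction "is" arbitrary: x)
  case Nil
  then show ?case using closure_subset[of "{x. \<phi> x \<noteq> 0}"] by auto
next
  case (Cons i "is")
  let ?S = "- closure {x. \<phi> x \<noteq> 0}"
  have "((\<lambda>x. 0) has_derivative (\<lambda>x. 0)) (at x)" by (rule has_derivative_const)
  then have "(foldr partial is \<phi> has_derivative (\<lambda>x. 0)) (at x)"
    by (rule has_derivative_transform_within_open[where s = ?S]) (use Cons in auto)
  from partialI[OF this] show ?case by simp
qed

lemma test_function_schwartz:
  assumes "\<phi> \<in> test_functions"
  shows "\<phi> \<in> schwartz"
  unfolding schwartz_iff rapid_decay_def
proof (intro conjI allI)
  show \<phi>: "smooth \<phi>" using assms by (simp add: test_functions_def)
  fix "is" \<beta>
  let ?K = "closure {x. \<phi> x \<noteq> 0}" and ?g = "\<lambda>x. mpower x \<beta> *\<^sub>R foldr partial is \<phi> x"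
  have "compact (?g ` ?K)"
  proof (rule compact_continuous_image)
    show "continuous_on ?K ?g"
      unfolding mpower_def
      by (intro continuous_intros smooth_continuous smooth_foldr_partial \<phi>)
    show "compact ?K" using assms by (simp add: test_functions_def)
  qed
  then have "bounded (insert 0 (?g ` ?K))"
    using compact_imp_bounded by auto
  moreover have "range ?g \<subseteq> insert 0 (?g ` ?K)"
  proof
    fix y assume "y \<in> range ?g"
    then obtain x where y: "y = ?g x" by blast
    show "y \<in> insert 0 (?g ` ?K)"
      by (cases "x \<in> ?K") (use y foldr_partial_support[OF \<phi>, of x] in auto)
  qed
  ultimately show "bounded (range ?g)" by (rule bounded_subset)
qed

lemma test_function_mult:
  assumes "smooth f" "\<phi> \<in> test_functions"
  shows "(\<lambda>x. f x * \<phi> x) \<in> test_functions"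
proof -
  have "compact (closure {x. f x * \<phi> x \<noteq> 0})"
  proof (rule compact_closure[THEN iffD2], rule bounded_subset)
    show "bounded {x. \<phi> x \<noteq> 0}"
      using assms compact_closure[of "{x. \<phi> x \<noteq> 0}"] by (auto simp: test_functions_def)
  qed auto
  then show ?thesis using assms by (auto simp: test_functions_def smooth_mult)
qed

section \<open>Integration over \<open>\<real>\<^sup>n\<close>\<close>

text \<open>Lebesgue measure on \<^typ>\<open>real ^ 'n\<close> is the image of a product measure over the basis vectors;
  along the bijection \<open>i \<mapsto> axis i 1\<close> Fubini's theorem for that product becomes a product over the
  coordinates.\<close>

lemma lborel_integral_tensor:
  fixes g :: "'n::finite \<Rightarrow> real \<Rightarrow> complex"
  assumes g: "\<And>i. integrable lborel (g i)"
  shows "integrable lborel (\<lambda>x :: real ^ 'n. \<Prod>i\<in>UNIV. g i (x $ i))"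
    "(\<integral>x. (\<Prod>i\<in>UNIV. g i (x $ i)) \<partial>(lborel :: (real ^ 'n) measure)) = (\<Prod>i\<in>UNIV. \<integral>t. g i t \<partial>lborel)"
proof -
  interpret P: product_sigma_finite "\<lambda>_ :: real ^ 'n. lborel :: real measure"
    by standard
  let ?e = "\<lambda>i. axis i 1 :: real ^ 'n"
  have inj: "inj ?e" by (auto simp: inj_def axis_eq_axis)
  have B: "Basis = range ?e" by (auto simp: Basis_vec_def)
  let ?T = "\<lambda>f. \<Sum>b\<in>Basis. f b *\<^sub>R b :: real ^ 'n"
  let ?F = "\<lambda>x :: real ^ 'n. \<Prod>i\<in>UNIV. g i (x $ i)"
  have T: "?T f $ i = f (?e i)" for f :: "real ^ 'n \<Rightarrow> real" and i
  proof -
    have "?T f $ i = (\<Sum>j\<in>UNIV. f (?e j) * ?e j $ i)"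
      unfolding B by (subst sum.reindex[OF inj]) simp
    also have "\<dots> = (\<Sum>j\<in>UNIV. if j = i then f (?e j) else 0)"
      by (intro sum.cong) (auto simp: axis_def)
    finally show ?thesis by simp
  qed
  have [measurable]: "g i \<in> borel_measurable borel" for i
    using borel_measurable_integrable[OF g[of i]] by simp
  have F: "?F \<in> borel_measurable borel" by measurable
  have FT: "?F (?T f) = (\<Prod>b\<in>Basis. g (inv ?e b) (f b))" for f
    unfolding B by (subst prod.reindex[OF inj]) (simp only: T[unfolded B] inv_f_f[OF inj] o_def)
  have Tm: "?T \<in> measurable (Pi\<^sub>M Basis (\<lambda>_. lborel)) borel"
    by measurable
  show "integrable lborel ?F"
    by (subst lborel_eq, subst integrable_distr_eq[OF Tm F], unfold FT)
      (rule P.product_integrable_prod[OF finite_Basis g])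
  have "(\<integral>x. ?F x \<partial>lborel) = (\<integral>f. ?F (?T f) \<partial>Pi\<^sub>M Basis (\<lambda>_. lborel))"
    by (subst lborel_eq, subst integral_distr[OF Tm F]) simp
  also have "\<dots> = (\<Prod>b\<in>Basis. \<integral>t. g (inv ?e b) t \<partial>lborel)"
    unfolding FT by (rule P.product_integral_prod[OF finite_Basis g])
  also have "\<dots> = (\<Prod>i\<in>UNIV. \<integral>t. g i t \<partial>lborel)"
    unfolding B by (subst prod.reindex[OF inj]) (simp add: inv_f_f[OF inj])
  finally show "(\<integral>x. ?F x \<partial>lborel) = (\<Prod>i\<in>UNIV. \<integral>t. g i t \<partial>lborel)" .
qed

lemma lebesgue_borel:
  fixes f :: "'a::euclidean_space \<Rightarrow> complex"
  assumes "f \<in> borel_measurable borel"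
  shows "integrable lebesgue f \<longleftrightarrow> integrable lborel f" "(\<integral>x. f x \<partial>lebesgue) = (\<integral>x. f x \<partial>lborel)"
    "f \<in> borel_measurable lebesgue"
proof -
  have f: "f \<in> borel_measurable lborel" using assms by simp
  show "integrable lebesgue f \<longleftrightarrow> integrable lborel f" by (rule integrable_completion[OF f])
  show "(\<integral>x. f x \<partial>lebesgue) = (\<integral>x. f x \<partial>lborel)" by (rule integral_completion[OF f])
  show "f \<in> borel_measurable lebesgue" by (rule measurable_completion[OF f])
qed

lemma integrable_inverse_one_plus_square: "integrable lborel (\<lambda>t::real. complex_of_real (inverse (1 + t\<^sup>2)))"
proof -
  have "integrable lborel (\<lambda>t::real. inverse (1 + t\<^sup>2))"
    using integrable_inverse_1_plus_square
    by (simp add: set_integrable_def einterval_def)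
  then show ?thesis by (rule integrable_of_real)
qed

text \<open>Rapid decay survives multiplication by \<open>\<Prod>\<^sub>i (1 + x\<^sub>i\<^sup>2)\<close>, and the reciprocal of this product is
  integrable as a product of functions of one coordinate.\<close>

lemma rapid_decay_integrable:
  fixes f :: "real ^ 'n::finite \<Rightarrow> complex"
  assumes f: "f \<in> borel_measurable lebesgue" and d: "rapid_decay f"
  shows "integrable lebesgue f"
proof -
  have "finite A \<Longrightarrow> rapid_decay (\<lambda>x. of_real (\<Prod>i\<in>A. 1 + (x $ i)\<^sup>2) * f x)" for A :: "'n set"
  proof (induction A rule: finite_induct)
    case (insert i A)
    let ?g = "\<lambda>x. of_real (\<Prod>i\<in>A. 1 + (x $ i)\<^sup>2) * f x"
    have "rapid_decay (\<lambda>x. ?g x + of_real (x $ i) * (of_real (x $ i) * ?g x))"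
      by (intro rapid_decay_add rapid_decay_component insert)
    moreover have "(\<lambda>x. ?g x + of_real (x $ i) * (of_real (x $ i) * ?g x))
      = (\<lambda>x. of_real (\<Prod>i\<in>insert i A. 1 + (x $ i)\<^sup>2) * f x)"
      using insert by (simp add: fun_eq_iff algebra_simps power2_eq_square)
    ultimately show ?case by simp
  qed (use d in simp)
  then obtain B where B: "\<And>x. cmod (of_real (\<Prod>i\<in>UNIV. 1 + (x $ i)\<^sup>2) * f x) \<le> B"
    using rapid_decay_bounded[of "\<lambda>x. of_real (\<Prod>i\<in>UNIV. 1 + (x $ i)\<^sup>2) * f x"] by auto
  let ?G = "\<lambda>x :: real ^ 'n. \<Prod>i\<in>UNIV. complex_of_real (inverse (1 + (x $ i)\<^sup>2))"
  have G: "integrable lborel ?G"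
    by (rule lborel_integral_tensor(1)) (rule integrable_inverse_one_plus_square)
  then have "integrable lebesgue ?G"
    using lebesgue_borel(1)[of ?G] borel_measurable_integrable[OF G] by auto
  then have "integrable lebesgue (\<lambda>x. of_real B * ?G x)"
    by simp
  then show ?thesis
  proof (rule Bochner_Integration.integrable_bound[OF _ f], intro AE_I2)
    fix x :: "real ^ 'n"
    let ?p = "\<Prod>i\<in>UNIV. 1 + (x $ i)\<^sup>2"
    have p: "?p > 0" by (intro prod_pos) (auto simp: add_pos_nonneg)
    have "cmod (f x) \<le> B * inverse ?p"
      using B[of x] p by (simp add: norm_mult field_simps prod_nonneg del: of_real_prod)
    also have "B * inverse ?p = B * cmod (?G x)"
    proof -
      have "?G x = of_real (inverse ?p)"
        by (simp add: prod_inversef[symmetric])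
      then have "cmod (?G x) = inverse ?p"
        using p by (simp only: norm_of_real abs_of_pos positive_imp_inverse_positive)
      then show ?thesis by simp
    qed
    also have "\<dots> \<le> norm (of_real B * ?G x)"
      unfolding norm_mult norm_of_real by (intro mult_right_mono) auto
    finally show "norm (f x) \<le> norm (of_real B * ?G x)" .
  qed
qed

lemma rapid_decay_L2:
  assumes f: "f \<in> borel_measurable lebesgue" and d: "rapid_decay f"
  shows "f \<in> L2"
proof -
  obtain B where B: "\<And>x. cmod (f x) \<le> B" using rapid_decay_bounded[OF d] by blast
  show ?thesis
  proof (rule L2I[OF f])
    show "integrable lebesgue (\<lambda>x. B * cmod (f x))"
      using rapid_decay_integrable[OF f d] by simp
    show "(cmod (f x))\<^sup>2 \<le> B * cmod (f x)" for x
      using B[of x] by (simp add: power2_eq_square mult_right_mono)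
  qed
qed

lemma smooth_borel_measurable: "smooth f \<Longrightarrow> f \<in> borel_measurable borel"
  by (rule borel_measurable_continuous_onI) (rule smooth_continuous)

lemma smooth_measurable: "smooth f \<Longrightarrow> f \<in> borel_measurable lebesgue"
  by (rule lebesgue_borel(3)) (rule smooth_borel_measurable)

lemma schwartz_integrable: "f \<in> schwartz \<Longrightarrow> integrable lebesgue f"
  by (intro rapid_decay_integrable schwartz_rapid_decay smooth_measurable schwartz_smooth)

lemma schwartz_L2: "f \<in> schwartz \<Longrightarrow> f \<in> L2"
  by (intro rapid_decay_L2 schwartz_rapid_decay smooth_measurable schwartz_smooth)

subsection \<open>Integration by parts\<close>

lemma lborel_integral_shift:
  fixes u :: "'a::euclidean_space \<Rightarrow> 'b::{banach, second_countable_topology}"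
  assumes [measurable]: "u \<in> borel_measurable borel"
  shows "integrable lborel (\<lambda>x. u (x + c)) \<longleftrightarrow> integrable lborel u"
    "(\<integral>x. u (x + c) \<partial>lborel) = (\<integral>x. u x \<partial>lborel)"
proof -
  have "integrable lborel u \<longleftrightarrow> integrable (distr lborel borel ((+) c)) u"
    by (simp add: lborel_distr_plus)
  also have "\<dots> \<longleftrightarrow> integrable lborel (\<lambda>x. u (c + x))"
    by (rule integrable_distr_eq) auto
  finally show "integrable lborel (\<lambda>x. u (x + c)) \<longleftrightarrow> integrable lborel u"
    by (simp add: add.commute)
  have "(\<integral>x. u x \<partial>lborel) = (\<integral>x. u x \<partial>distr lborel borel ((+) c))"
    by (simp add: lborel_distr_plus)
  also have "\<dots> = (\<integral>x. u (c + x) \<partial>lborel)"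
    by (rule integral_distr) auto
  finally show "(\<integral>x. u (x + c) \<partial>lborel) = (\<integral>x. u x \<partial>lborel)"
    by (simp add: add.commute)
qed

text \<open>Translation invariance gives \<open>0 = \<integral> (u (x + e\<^sub>i) - u x) dx = \<integral> \<integral>\<^sub>0\<^sup>1 (\<partial>\<^sub>i u) (x + s e\<^sub>i) ds dx\<close>, and
  exchanging the integrals turns the right hand side into \<open>\<integral> \<partial>\<^sub>i u\<close>.\<close>

lemma integral_partial_eq_0:
  fixes u :: "real ^ 'n::finite \<Rightarrow> complex"
  assumes d: "\<And>x. u differentiable (at x)" and c: "continuous_on UNIV (partial i u)"
    and u: "integrable lebesgue u" and v: "integrable lebesgue (partial i u)"
  shows "(\<integral>x. partial i u x \<partial>lebesgue) = 0"
proof -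
  let ?e = "axis i 1 :: real ^ 'n" and ?v = "partial i u"
  have "continuous_on UNIV u"
    using d by (intro continuous_at_imp_continuous_on) (auto intro: differentiable_imp_continuous_within)
  then have um [measurable]: "u \<in> borel_measurable borel" by (rule borel_measurable_continuous_onI)
  have vm [measurable]: "?v \<in> borel_measurable borel" using c by (rule borel_measurable_continuous_onI)
  have u': "integrable lborel u" and v': "integrable lborel ?v"
    using u v by (simp_all add: lebesgue_borel um vm)
  let ?w = "\<lambda>(s, x). indicator {0..1::real} s *\<^sub>R ?v (x + s *\<^sub>R ?e)"
  have FTC: "(\<integral>s. ?w (s, x) \<partial>lborel) = u (x + ?e) - u x" for x
  proof -
    have "(\<integral>s. indicator {0..1} s *\<^sub>R ?v (x + s *\<^sub>R ?e) \<partial>lborel)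
      = u (x + 1 *\<^sub>R ?e) - u (x + 0 *\<^sub>R ?e)"
    proof (rule integral_FTC_Icc)
      show "continuous_on {0..1} (\<lambda>s. ?v (x + s *\<^sub>R ?e))"
        by (rule continuous_on_compose2[OF c]) (auto intro!: continuous_intros)
      show "((\<lambda>s. u (x + s *\<^sub>R ?e)) has_vector_derivative ?v (x + s *\<^sub>R ?e)) (at s within {0..1})" for s
        by (intro has_vector_derivative_at_within[OF has_vector_derivative_partial] d)
    qed simp
    then show ?thesis by simp
  qed
  have w: "integrable (lborel \<Otimes>\<^sub>M lborel) ?w"
  proof (rule lborel_pair.Fubini_integrable)
    show "?w \<in> borel_measurable (lborel \<Otimes>\<^sub>M lborel)"
      by measurable
    have "(\<lambda>s. \<integral>x. norm (?w (s, x)) \<partial>lborel)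
      = (\<lambda>s. indicator {0..1} s * (\<integral>x. norm (?v x) \<partial>lborel))"
      using lborel_integral_shift(2)[of "\<lambda>x. norm (?v x)"] by (auto simp: fun_eq_iff)
    then show "integrable lborel (\<lambda>s. \<integral>x. norm (?w (s, x)) \<partial>lborel)"
      by (simp add: integrable_real_indicator)
    show "AE s in lborel. integrable lborel (\<lambda>x. ?w (s, x))"
      using lborel_integral_shift(1)[OF vm] v' by auto
  qed
  have "0 = (\<integral>x. u (x + ?e) - u x \<partial>lborel)"
    using lborel_integral_shift[OF um, of ?e] u' by simp
  also have "\<dots> = (\<integral>x. \<integral>s. ?w (s, x) \<partial>lborel \<partial>lborel)"
    by (simp only: FTC)
  also have "\<dots> = (\<integral>s. \<integral>x. ?w (s, x) \<partial>lborel \<partial>lborel)"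
    using lborel_pair.Fubini_integral[of "\<lambda>s x. ?w (s, x)"] w by simp
  also have "\<dots> = (\<integral>s. indicator {0..1::real} s *\<^sub>R (\<integral>x. ?v x \<partial>lborel) \<partial>lborel)"
    using lborel_integral_shift(2)[OF vm] by simp
  also have "\<dots> = (\<integral>x. ?v x \<partial>lborel)"
    by simp
  finally show ?thesis by (simp add: lebesgue_borel vm)
qed

lemma schwartz_integration_by_parts:
  assumes f: "f \<in> schwartz" and g: "g \<in> schwartz"
  shows "(\<integral>x. partial i f x * g x \<partial>lebesgue) = - (\<integral>x. f x * partial i g x \<partial>lebesgue)"
proof -
  let ?u = "\<lambda>x. f x * g x"
  have s: "smooth ?u" using f g by (intro smooth_mult schwartz_smooth)
  have p: "partial i ?u = (\<lambda>x. f x * partial i g x + partial i f x * g x)"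
    using f g by (intro ext partial_mult smooth_differentiable schwartz_smooth)
  have ints: "integrable lebesgue (\<lambda>x. f x * partial i g x)" "integrable lebesgue (\<lambda>x. partial i f x * g x)"
    using f g by (auto intro!: L2_mult_integrable schwartz_L2 schwartz_partial)
  have "(\<integral>x. partial i ?u x \<partial>lebesgue) = 0"
  proof (rule integral_partial_eq_0)
    show "integrable lebesgue ?u" using f g by (intro L2_mult_integrable schwartz_L2)
    show "integrable lebesgue (partial i ?u)" using ints by (simp add: p)
    show "?u differentiable (at x)" for x by (rule smooth_differentiable[OF s])
    show "continuous_on UNIV (partial i ?u)" by (rule smooth_continuous[OF smooth_partial[OF s]])
  qed
  moreover have "(\<integral>x. partial i ?u x \<partial>lebesgue) =
      (\<integral>x. f x * partial i g x \<partial>lebesgue) + (\<integral>x. partial i f x * g x \<partial>lebesgue)"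
    unfolding p by (rule Bochner_Integration.integral_add[OF ints])
  ultimately show ?thesis
    by (simp only: eq_neg_iff_add_eq_0 add.commute)
qed

section \<open>Hermite functions\<close>

subsection \<open>One variable\<close>

text \<open>The derivatives of \<open>e\<^bsup>-t\<^sup>2\<^esup>\<close>, defined by their three-term recursion so that only the derivative
  property is left to prove.\<close>

fun gauss_deriv :: "nat \<Rightarrow> real \<Rightarrow> real" where
  "gauss_deriv 0 t = exp (- t\<^sup>2)"
| "gauss_deriv (Suc 0) t = - 2 * t * exp (- t\<^sup>2)"
| "gauss_deriv (Suc (Suc k)) t = - 2 * t * gauss_deriv (Suc k) t - 2 * (real k + 1) * gauss_deriv k t"

lemma gauss_deriv_has_derivative: "(gauss_deriv k has_real_derivative gauss_deriv (Suc k) t) (at t)"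
proof (induction k t rule: gauss_deriv.induct)
  case (1 u)
  show ?case
    by (auto intro!: derivative_eq_intros simp: gauss_deriv.simps(1)[abs_def])
next
  case (2 u)
  have "gauss_deriv (Suc 0) = (\<lambda>t. - 2 * t * exp (- t\<^sup>2))" by (simp add: fun_eq_iff)
  then show ?case
    by (auto intro!: derivative_eq_intros simp: algebra_simps)
next
  case (3 k u)
  have "gauss_deriv (Suc (Suc k)) =
      (\<lambda>t. - 2 * t * gauss_deriv (Suc k) t - 2 * (real k + 1) * gauss_deriv k t)"
    by (simp add: fun_eq_iff)
  then show ?case
    by (auto intro!: derivative_eq_intros 3 simp: algebra_simps)
qed

lemma deriv_power_gauss: "(deriv ^^ k) (\<lambda>s. exp (- s\<^sup>2)) = gauss_deriv k"
proof (induction k)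
  case (Suc k)
  have "deriv (gauss_deriv k) = gauss_deriv (Suc k)"
    using DERIV_imp_deriv[OF gauss_deriv_has_derivative] by (rule ext)
  with Suc show ?case by simp
qed (simp add: fun_eq_iff)

lemma gauss_deriv_rec: "gauss_deriv (Suc k) t = - 2 * t * gauss_deriv k t - 2 * real k * gauss_deriv (k - 1) t"
  by (cases k) (simp_all add: algebra_simps)

lemma hermite_fun1_gauss_deriv:
  "hermite_fun1 k t = (-1) ^ k / sqrt (2 ^ k * fact k * sqrt pi) * exp (t\<^sup>2 / 2) * gauss_deriv k t"
proof -
  have "exp (t\<^sup>2) * exp (- t\<^sup>2 / 2) = exp (t\<^sup>2 / 2)" by (simp add: exp_add[symmetric])
  then show ?thesis
    by (simp add: hermite_fun1_def hermite_poly_def deriv_power_gauss mult_ac)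
qed

text \<open>The factors \<open>sqrt ((k + 1) / 2)\<close> and \<open>sqrt (k / 2)\<close> turn the normalizing constants of \<open>h\<^sub>k\<^sub>+\<^sub>1\<close> and
  \<open>h\<^sub>k\<^sub>-\<^sub>1\<close> into multiples of the one of \<open>h\<^sub>k\<close>. With them, relations between neighbours are relations
  between derivatives of the Gaussian.\<close>

lemma hermite_fun1_Suc_scaled:
  "sqrt (real (Suc k) / 2) * hermite_fun1 (Suc k) t
    = - ((-1) ^ k / sqrt (2 ^ k * fact k * sqrt pi) * exp (t\<^sup>2 / 2) * gauss_deriv (Suc k) t) / 2"
proof -
  have "sqrt (2 ^ Suc k * fact (Suc k) * sqrt pi) = sqrt (4 * ((real (Suc k) / 2) * (2 ^ k * fact k * sqrt pi)))"
    by (simp add: algebra_simps)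
  also have "\<dots> = 2 * (sqrt (real (Suc k) / 2) * sqrt (2 ^ k * fact k * sqrt pi))"
    by (simp only: real_sqrt_mult real_sqrt_four)
  finally have s: "sqrt (2 ^ Suc k * fact (Suc k) * sqrt pi) = \<dots>" .
  have nz: "sqrt (real (Suc k) / 2) \<noteq> 0" by simp
  show ?thesis
    unfolding hermite_fun1_gauss_deriv s using nz by (simp add: divide_simps del: gauss_deriv.simps)
qed

lemma hermite_fun1_pred_scaled:
  "sqrt (real k / 2) * hermite_fun1 (k - 1) t
    = - real k * ((-1) ^ k / sqrt (2 ^ k * fact k * sqrt pi) * exp (t\<^sup>2 / 2) * gauss_deriv (k - 1) t)"
proof (cases k)
  case (Suc j)
  have "sqrt (2 ^ Suc j * fact (Suc j) * sqrt pi) = sqrt (4 * ((real (Suc j) / 2) * (2 ^ j * fact j * sqrt pi)))"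
    by (simp add: algebra_simps)
  also have "\<dots> = 2 * (sqrt (real (Suc j) / 2) * sqrt (2 ^ j * fact j * sqrt pi))"
    by (simp only: real_sqrt_mult real_sqrt_four)
  finally have s: "sqrt (2 ^ Suc j * fact (Suc j) * sqrt pi) = \<dots>" .
  have sq: "sqrt (real (Suc j) / 2) * sqrt (real (Suc j) / 2) = real (Suc j) / 2"
    by (simp only: real_sqrt_mult_self abs_of_nonneg of_nat_0_le_iff divide_nonneg_nonneg zero_le_numeral)
  have "N / (2 * r) = r" if "r * r = N / 2" "r \<noteq> 0" for r N :: real
  proof -
    have "N = 2 * (r * r)" using that by simp
    then show ?thesis using that(2) by simp
  qed
  from this[OF sq] have r: "real (Suc j) / (2 * sqrt (real (Suc j) / 2)) = sqrt (real (Suc j) / 2)"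
    by simp
  have alg: "(N / (2 * r)) * (e / S * x * g) = - N * ((- 1 * e) / (2 * (r * S)) * x * g)"
    for N r e S x g :: real
    by (simp only: divide_inverse inverse_mult_distrib mult_minus_left mult_minus_right minus_minus
        mult_1_left mult_ac)
  show ?thesis
    using alg[of "real (Suc j)" "sqrt (real (Suc j) / 2)" "(- 1) ^ j" "sqrt (2 ^ j * fact j * sqrt pi)"
        "exp (t\<^sup>2 / 2)" "gauss_deriv j t"]
    unfolding hermite_fun1_gauss_deriv Suc diff_Suc_1 s r unfolding power_Suc .
qed simp

lemma hermite_fun1_mult:
  "t * hermite_fun1 k t =
    sqrt (real k / 2) * hermite_fun1 (k - 1) t + sqrt (real (Suc k) / 2) * hermite_fun1 (Suc k) t"
proof -
  have "t * (K * g) = - n * (K * g') + - (K * (- 2 * t * g - 2 * n * g')) / 2" for K g n g' :: real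
    by (simp add: algebra_simps)
  then show ?thesis
    unfolding hermite_fun1_Suc_scaled hermite_fun1_pred_scaled hermite_fun1_gauss_deriv[of k t]
      gauss_deriv_rec .
qed

lemma hermite_fun1_has_derivative:
  "(hermite_fun1 k has_real_derivative
    sqrt (real k / 2) * hermite_fun1 (k - 1) t - sqrt (real (Suc k) / 2) * hermite_fun1 (Suc k) t) (at t)"
proof -
  let ?c = "(-1) ^ k / sqrt (2 ^ k * fact k * sqrt pi)"
  have "((\<lambda>t. ?c * (exp (t\<^sup>2 / 2) * gauss_deriv k t)) has_real_derivative
      ?c * (exp (t\<^sup>2 / 2) * (t * gauss_deriv k t + gauss_deriv (Suc k) t))) (at t)"
    by (rule DERIV_cmult)
      (auto intro!: derivative_eq_intros gauss_deriv_has_derivative simp: algebra_simps simp del: gauss_deriv.simps)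
  moreover have "?c * (exp (t\<^sup>2 / 2) * (t * gauss_deriv k t + gauss_deriv (Suc k) t))
    = sqrt (real k / 2) * hermite_fun1 (k - 1) t - sqrt (real (Suc k) / 2) * hermite_fun1 (Suc k) t"
  proof -
    have "c * (e * (t * g + (- 2 * t * g - 2 * n * g'))) =
      - n * (c * e * g') - - (c * e * (- 2 * t * g - 2 * n * g')) / 2" for c e g n g' :: real
      by (simp add: algebra_simps)
    then show ?thesis
      unfolding hermite_fun1_Suc_scaled hermite_fun1_pred_scaled gauss_deriv_rec .
  qed
  moreover have "hermite_fun1 k = (\<lambda>t. ?c * (exp (t\<^sup>2 / 2) * gauss_deriv k t))"
    by (simp add: fun_eq_iff hermite_fun1_gauss_deriv mult_ac)
  ultimately show ?thesis by simp
qed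

lemma hermite_fun1_0: "hermite_fun1 0 t = exp (- t\<^sup>2 / 2) / sqrt (sqrt pi)"
  by (simp add: hermite_fun1_def hermite_poly_def exp_add[symmetric])

lemma bounded_power_gauss: "\<exists>B. \<forall>t::real. \<bar>t ^ p * exp (- t\<^sup>2 / 2)\<bar> \<le> B"
proof -
  have "\<bar>t ^ p * exp (- t\<^sup>2 / 2)\<bar> \<le> 1 + 2 ^ p * fact p" for t :: real
  proof (cases "\<bar>t\<bar> \<le> 1")
    case True
    then have "\<bar>t\<bar> ^ p * exp (- t\<^sup>2 / 2) \<le> 1 * 1"
      by (intro mult_mono power_le_one) auto
    then show ?thesis by (simp add: abs_mult power_abs add_increasing2)
  next
    case False
    have "(t\<^sup>2 / 2) ^ p / fact p \<le> exp (t\<^sup>2 / 2)"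
    proof -
      let ?x = "t\<^sup>2 / 2"
      have "summable (\<lambda>n. ?x ^ n /\<^sub>R fact n)" by (rule summable_exp_generic)
      moreover have "0 \<le> ?x ^ n /\<^sub>R fact n" for n
        by (intro scaleR_nonneg_nonneg zero_le_power) simp_all
      ultimately have "sum (\<lambda>n. ?x ^ n /\<^sub>R fact n) {p} \<le> suminf (\<lambda>n. ?x ^ n /\<^sub>R fact n)"
        by (intro sum_le_suminf) simp_all
      then show ?thesis
        unfolding sums_unique[OF exp_converges, symmetric]
        by (simp only: sum.insert finite.emptyI sum.empty empty_iff not_False_eq_True add_0_right
            real_scaleR_def divide_inverse_commute)
    qed
    then have "(t\<^sup>2) ^ p / (2 ^ p * fact p) \<le> exp (t\<^sup>2 / 2)"
      by (simp only: power_divide divide_divide_eq_left)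
    then have le: "(t\<^sup>2) ^ p \<le> exp (t\<^sup>2 / 2) * (2 ^ p * fact p)"
      by (simp only: pos_divide_le_eq zero_less_mult_iff fact_gt_zero zero_less_power zero_less_numeral simp_thms)
    have "\<bar>t\<bar> ^ p \<le> (t\<^sup>2) ^ p"
    proof (rule power_mono)
      show "\<bar>t\<bar> \<le> t\<^sup>2"
        using False mult_right_mono[of 1 "\<bar>t\<bar>" "\<bar>t\<bar>"] by (simp add: power2_eq_square)
    qed simp
    then have "\<bar>t\<bar> ^ p * exp (- t\<^sup>2 / 2) \<le> exp (t\<^sup>2 / 2) * (2 ^ p * fact p) * exp (- t\<^sup>2 / 2)"
      using le by (intro mult_right_mono) auto
    also have "\<dots> = (exp (t\<^sup>2 / 2) * exp (- t\<^sup>2 / 2)) * (2 ^ p * fact p)"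
      by (simp only: mult_ac)
    also have "exp (t\<^sup>2 / 2) * exp (- t\<^sup>2 / 2) = 1"
      by (simp add: exp_add[symmetric])
    finally have "\<bar>t\<bar> ^ p * exp (- t\<^sup>2 / 2) \<le> 2 ^ p * fact p" by simp
    then show ?thesis by (simp add: abs_mult power_abs)
  qed
  then show ?thesis by blast
qed

lemma bounded_power_hermite_fun1: "\<exists>B. \<forall>t. \<bar>t ^ p * hermite_fun1 k t\<bar> \<le> B"
proof (induction k arbitrary: p rule: less_induct)
  case (less k)
  show ?case
  proof (cases k)
    case 0
    obtain B where B: "\<And>t::real. \<bar>t ^ p * exp (- t\<^sup>2 / 2)\<bar> \<le> B" using bounded_power_gauss by blast
    have "\<bar>t ^ p * hermite_fun1 k t\<bar> \<le> B / sqrt (sqrt pi)" for t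
      using divide_right_mono[OF B[of t], of "sqrt (sqrt pi)"] by (simp add: 0 hermite_fun1_0 abs_mult)
    then show ?thesis by blast
  next
    case (Suc j)
    obtain B where B: "\<And>t. \<bar>t ^ Suc p * hermite_fun1 j t\<bar> \<le> B" using less[of j "Suc p"] Suc by blast
    have "j - 1 < k" using Suc by linarith
    then obtain C where C: "\<And>t. \<bar>t ^ p * hermite_fun1 (j - 1) t\<bar> \<le> C" using less[of "j - 1" p] by blast
    let ?s = "sqrt (real (Suc j) / 2)" and ?r = "sqrt (real j / 2)"
    have "\<bar>t ^ p * hermite_fun1 k t\<bar> \<le> (B + ?r * C) / ?s" for t
    proof -
      have "?s * (t ^ p * hermite_fun1 k t) = t ^ Suc p * hermite_fun1 j t - ?r * (t ^ p * hermite_fun1 (j - 1) t)"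
        using arg_cong[OF hermite_fun1_mult[of t j], of "\<lambda>z. t ^ p * z"] by (simp add: Suc algebra_simps)
      also have "\<bar>\<dots>\<bar> \<le> B + ?r * C"
        using mult_left_mono[OF C[of t], of ?r] B[of t]
        by (intro order_trans[OF abs_triangle_ineq4]) (simp add: abs_mult)
      finally have "?s * \<bar>t ^ p * hermite_fun1 k t\<bar> \<le> B + ?r * C"
        by (simp add: abs_mult)
      then show ?thesis by (simp add: field_simps)
    qed
    then show ?thesis by blast
  qed
qed

subsection \<open>Several variables\<close>

lemma has_derivative_comp_component:
  assumes "(g has_real_derivative d) (at (x $ i))"
  shows "((\<lambda>x. complex_of_real (g (x $ i))) has_derivative (\<lambda>y. of_real (d * y $ i))) (at x)"
proof -
  have "((\<lambda>x. x $ i) has_derivative (\<lambda>y. y $ i)) (at x)"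
    by (intro bounded_linear_imp_has_derivative bounded_linear_vec_nth)
  from has_derivative_compose[OF this, of g "\<lambda>t. d * t"] assms
  have "((\<lambda>x. g (x $ i)) has_derivative (\<lambda>y. d * y $ i)) (at x)"
    by (simp add: has_field_derivative_def)
  then show ?thesis by (rule has_derivative_of_real)
qed

lemma partial_comp_component:
  assumes "(g has_real_derivative d) (at (x $ i))"
  shows "(\<lambda>x. complex_of_real (g (x $ i))) differentiable (at x)"
    "partial j (\<lambda>x. complex_of_real (g (x $ i))) x = (if i = j then of_real d else 0)"
  using has_derivative_comp_component[OF assms]
  by (auto simp: differentiable_def partialI[OF has_derivative_comp_component[OF assms]] axis_def)

lemma partial_tensor_other:
  assumes "\<And>j. j \<in> A \<Longrightarrow> (g j has_real_derivative d j) (at (x $ j))" "i \<notin> A"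
  shows "(\<lambda>x. complex_of_real (\<Prod>j\<in>A. g j (x $ j))) differentiable (at x) \<and>
    partial i (\<lambda>x. complex_of_real (\<Prod>j\<in>A. g j (x $ j))) x = 0"
  using assms
proof (induction A rule: infinite_finite_induct)
  case (insert j A)
  then have *: "(\<lambda>x. complex_of_real (\<Prod>j\<in>insert j A. g j (x $ j)))
      = (\<lambda>x. complex_of_real (g j (x $ j)) * complex_of_real (\<Prod>j\<in>A. g j (x $ j)))"
    by (simp add: fun_eq_iff)
  have ji: "j \<noteq> i" using insert by auto
  have g: "(g j has_real_derivative d j) (at (x $ j))" using insert by auto
  have IH: "(\<lambda>x. complex_of_real (\<Prod>j\<in>A. g j (x $ j))) differentiable (at x)"
    "partial i (\<lambda>x. complex_of_real (\<Prod>j\<in>A. g j (x $ j))) x = 0"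
    using insert by auto
  show ?case
    unfolding * using partial_comp_component(1)[OF g] partial_comp_component(2)[OF g, of i] IH ji
    by (simp only: partial_mult differentiable_mult) simp
qed auto

lemma partial_tensor:
  fixes x :: "real ^ 'n::finite"
  assumes "\<And>j. (g j has_real_derivative d j) (at (x $ j))"
  shows "(\<lambda>x. complex_of_real (\<Prod>j\<in>UNIV. g j (x $ j))) differentiable (at x)"
    "partial i (\<lambda>x. complex_of_real (\<Prod>j\<in>UNIV. g j (x $ j))) x
      = of_real (d i * (\<Prod>j\<in>UNIV - {i}. g j (x $ j)))"
proof -
  have *: "(\<lambda>x. complex_of_real (\<Prod>j\<in>UNIV. g j (x $ j)))
      = (\<lambda>x. complex_of_real (g i (x $ i)) * complex_of_real (\<Prod>j\<in>UNIV - {i}. g j (x $ j)))" for i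
    by (simp add: fun_eq_iff prod.remove[of _ i])
  have o: "(\<lambda>x. complex_of_real (\<Prod>j\<in>UNIV - {i}. g j (x $ j))) differentiable (at x) \<and>
    partial i (\<lambda>x. complex_of_real (\<Prod>j\<in>UNIV - {i}. g j (x $ j))) x = 0" for i
    by (rule partial_tensor_other[where d = d]) (use assms in auto)
  show "(\<lambda>x. complex_of_real (\<Prod>j\<in>UNIV. g j (x $ j))) differentiable (at x)"
    unfolding *[of i] using o[of i] partial_comp_component[OF assms[of i]] by (intro differentiable_mult) auto
  show "partial i (\<lambda>x. complex_of_real (\<Prod>j\<in>UNIV. g j (x $ j))) x
      = of_real (d i * (\<Prod>j\<in>UNIV - {i}. g j (x $ j)))"
    unfolding *[of i] using o[of i] partial_comp_component[OF assms[of i]]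
    by (subst partial_mult) auto
qed

definition up :: "'n \<Rightarrow> ('n \<Rightarrow> nat) \<Rightarrow> ('n \<Rightarrow> nat)" where
  "up i \<alpha> = \<alpha>(i := Suc (\<alpha> i))"

text \<open>At \<open>\<alpha> i = 0\<close> the truncated subtraction returns \<open>\<alpha>\<close> itself; there the factor \<open>sqrt (\<alpha> i / 2)\<close> of
  the lower neighbour vanishes.\<close>

definition down :: "'n \<Rightarrow> ('n \<Rightarrow> nat) \<Rightarrow> ('n \<Rightarrow> nat)" where
  "down i \<alpha> = \<alpha>(i := \<alpha> i - 1)"

lemma down_up [simp]: "down i (up i \<alpha>) = \<alpha>"
  by (simp add: up_def down_def)

lemma up_down [simp]: "\<alpha> i \<noteq> 0 \<Longrightarrow> up i (down i \<alpha>) = \<alpha>"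
  by (simp add: up_def down_def)

lemma up_apply [simp]: "up i \<alpha> i = Suc (\<alpha> i)"
  by (simp add: up_def)

lemma down_apply [simp]: "down i \<alpha> i = \<alpha> i - 1"
  by (simp add: down_def)

lemma inj_up: "inj (up i)"
  by (metis down_up injI)

lemma msize_up [simp]: "msize (up i \<alpha>) = Suc (msize \<alpha>)" for \<alpha> :: "'n::finite \<Rightarrow> nat"
proof -
  have "msize (up i \<alpha>) = up i \<alpha> i + (\<Sum>j\<in>UNIV - {i}. up i \<alpha> j)"
    unfolding msize_def by (rule sum.remove) auto
  also have "(\<Sum>j\<in>UNIV - {i}. up i \<alpha> j) = (\<Sum>j\<in>UNIV - {i}. \<alpha> j)"
    by (rule sum.cong) (auto simp: up_def)
  finally have "msize (up i \<alpha>) = Suc (\<alpha> i + (\<Sum>j\<in>UNIV - {i}. \<alpha> j))" by simp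
  moreover have "msize \<alpha> = \<alpha> i + (\<Sum>j\<in>UNIV - {i}. \<alpha> j)"
    unfolding msize_def by (rule sum.remove) auto
  ultimately show ?thesis by simp
qed

lemma hermite_fun_update:
  "hermite_fun (\<alpha>(i := k)) x = of_real (hermite_fun1 k (x $ i) * (\<Prod>j\<in>UNIV - {i}. hermite_fun1 (\<alpha> j) (x $ j)))"
  unfolding hermite_fun_def by (subst prod.remove[of _ i]) (auto intro!: prod.cong)

lemma hermite_fun_split:
  "hermite_fun \<alpha> x = of_real (hermite_fun1 (\<alpha> i) (x $ i) * (\<Prod>j\<in>UNIV - {i}. hermite_fun1 (\<alpha> j) (x $ j)))"
  using hermite_fun_update[of \<alpha> i "\<alpha> i" x] by simp

lemma hermite_fun_mult:
  "of_real (x $ i) * hermite_fun \<alpha> x =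
    of_real (sqrt (real (\<alpha> i) / 2)) * hermite_fun (down i \<alpha>) x +
    of_real (sqrt (real (Suc (\<alpha> i)) / 2)) * hermite_fun (up i \<alpha>) x"
proof -
  let ?P = "\<Prod>j\<in>UNIV - {i}. hermite_fun1 (\<alpha> j) (x $ j)"
  have "of_real (x $ i) * hermite_fun \<alpha> x = of_real (x $ i * hermite_fun1 (\<alpha> i) (x $ i) * ?P)"
    by (simp add: hermite_fun_split[of \<alpha> x i])
  also have "\<dots> = of_real (sqrt (real (\<alpha> i) / 2) * (hermite_fun1 (\<alpha> i - 1) (x $ i) * ?P)
      + sqrt (real (Suc (\<alpha> i)) / 2) * (hermite_fun1 (Suc (\<alpha> i)) (x $ i) * ?P))"
    by (subst hermite_fun1_mult) (simp only: ring_distribs mult.assoc)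
  finally show ?thesis
    unfolding up_def down_def hermite_fun_update of_real_add of_real_mult .
qed

lemma hermite_fun_differentiable: "hermite_fun \<alpha> differentiable (at x)"
  unfolding hermite_fun_def[abs_def] by (rule partial_tensor(1)[OF hermite_fun1_has_derivative])

lemma partial_hermite_fun:
  "partial i (hermite_fun \<alpha>) x =
    of_real (sqrt (real (\<alpha> i) / 2)) * hermite_fun (down i \<alpha>) x -
    of_real (sqrt (real (Suc (\<alpha> i)) / 2)) * hermite_fun (up i \<alpha>) x"
proof -
  have "partial i (hermite_fun \<alpha>) x = of_real ((sqrt (real (\<alpha> i) / 2) * hermite_fun1 (\<alpha> i - 1) (x $ i)
      - sqrt (real (Suc (\<alpha> i)) / 2) * hermite_fun1 (Suc (\<alpha> i)) (x $ i))
      * (\<Prod>j\<in>UNIV - {i}. hermite_fun1 (\<alpha> j) (x $ j)))"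
    unfolding hermite_fun_def[abs_def] by (rule partial_tensor(2)[OF hermite_fun1_has_derivative])
  then show ?thesis
    unfolding up_def down_def hermite_fun_update of_real_mult of_real_diff
    by (simp only: ring_distribs mult.assoc)
qed

subsection \<open>Finite linear combinations\<close>

text \<open>The finite linear combinations of Hermite functions, built up one term at a time.\<close>

inductive_set hspan :: "(real ^ 'n::finite \<Rightarrow> complex) set" where
  hspan_zero: "(\<lambda>x. 0) \<in> hspan"
| hspan_insert: "f \<in> hspan \<Longrightarrow> (\<lambda>x. c * hermite_fun \<alpha> x + f x) \<in> hspan"

lemma hspan_add:
  assumes "f \<in> hspan" "g \<in> hspan"
  shows "(\<lambda>x. f x + g x) \<in> hspan"
  using assms(1)
proof (induction rule: hspan.induct)
  case (hspan_insert f c \<alpha>)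
  from hspan.hspan_insert[OF hspan_insert.IH, of c \<alpha>] show ?case by (simp add: add.assoc)
qed (use assms(2) in simp)

lemma hspan_scale: "f \<in> hspan \<Longrightarrow> (\<lambda>x. c * f x) \<in> hspan"
proof (induction rule: hspan.induct)
  case (hspan_insert f d \<alpha>)
  from hspan.hspan_insert[OF hspan_insert.IH, of "c * d" \<alpha>] show ?case by (simp add: algebra_simps)
qed (simp add: hspan_zero)

lemma hspan_hermite_fun: "hermite_fun \<alpha> \<in> hspan"
  using hspan_insert[OF hspan_zero, of 1 \<alpha>] by simp

lemma hspan_sum: "(\<And>a. a \<in> A \<Longrightarrow> f a \<in> hspan) \<Longrightarrow> (\<lambda>x. \<Sum>a\<in>A. f a x) \<in> hspan"
  by (induction A rule: infinite_finite_induct) (auto intro: hspan_zero hspan_add)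

lemma hspan_diff: "f \<in> hspan \<Longrightarrow> g \<in> hspan \<Longrightarrow> (\<lambda>x. f x - g x) \<in> hspan"
  using hspan_add[OF _ hspan_scale[of g "-1"], of f] by simp

lemma hspan_component: "f \<in> hspan \<Longrightarrow> (\<lambda>x. of_real (x $ i) * f x) \<in> hspan"
proof (induction rule: hspan.induct)
  case (hspan_insert f c \<alpha>)
  have "(\<lambda>x. c * (of_real (x $ i) * hermite_fun \<alpha> x) + of_real (x $ i) * f x) \<in> hspan"
    unfolding hermite_fun_mult
    by (intro hspan_add hspan_scale hspan_hermite_fun hspan_insert)
  then show ?case by (simp add: algebra_simps)
qed (simp add: hspan_zero)

lemma hspan_partial: "f \<in> hspan \<Longrightarrow> (\<forall>x. f differentiable (at x)) \<and> partial i f \<in> hspan"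
proof (induction rule: hspan.induct)
  case (hspan_insert f c \<alpha>)
  have d: "(\<lambda>x. c * hermite_fun \<alpha> x) differentiable (at x)" for x
    by (intro differentiable_mult hermite_fun_differentiable) auto
  have "partial i (\<lambda>x. c * hermite_fun \<alpha> x + f x) = (\<lambda>x. c * partial i (hermite_fun \<alpha>) x + partial i f x)"
    using hspan_insert by (simp add: fun_eq_iff partial_add d partial_scale hermite_fun_differentiable)
  moreover have "\<dots> \<in> hspan"
    unfolding partial_hermite_fun using hspan_insert
    by (intro hspan_add hspan_scale hspan_diff hspan_hermite_fun) auto
  ultimately show ?case
    using hspan_insert d by (auto intro!: differentiable_add)
qed (auto simp: hspan_zero)

lemma hspan_foldr_partial: "f \<in> hspan \<Longrightarrow> foldr partial is f \<in> hspan"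
  by (induction "is") (auto simp: hspan_partial)

lemma hspan_smooth: "f \<in> hspan \<Longrightarrow> smooth f"
  by (rule smooth_coinduct[where P = "\<lambda>f. f \<in> hspan"]) (auto simp: hspan_partial)

lemma hspan_bounded: "f \<in> hspan \<Longrightarrow> \<exists>B. \<forall>x. cmod (f x) \<le> B"
proof (induction rule: hspan.induct)
  case (hspan_insert f c \<alpha>)
  then obtain B where B: "\<And>x. cmod (f x) \<le> B" by blast
  have "\<forall>i. \<exists>B. \<forall>t. \<bar>hermite_fun1 (\<alpha> i) t\<bar> \<le> B"
    using bounded_power_hermite_fun1[of 0] by simp
  then obtain C where C: "\<And>i t. \<bar>hermite_fun1 (\<alpha> i) t\<bar> \<le> C i" by metis
  have h: "cmod (hermite_fun \<alpha> x) \<le> (\<Prod>i\<in>UNIV. C i)" for x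
    unfolding hermite_fun_def norm_of_real abs_prod by (intro prod_mono) (auto simp: C)
  have "cmod (c * hermite_fun \<alpha> x + f x) \<le> cmod c * (\<Prod>i\<in>UNIV. C i) + B" for x
    using mult_left_mono[OF h[of x], of "cmod c"] B[of x]
    by (intro order_trans[OF norm_triangle_ineq]) (simp add: norm_mult)
  then show ?case by blast
qed auto

lemma hspan_rapid_decay:
  fixes f :: "real ^ 'n::finite \<Rightarrow> complex"
  assumes "f \<in> hspan"
  shows "rapid_decay f"
  unfolding rapid_decay_def
proof
  fix \<beta> :: "'n \<Rightarrow> nat"
  have p: "g \<in> hspan \<Longrightarrow> (\<lambda>x. of_real (x $ i) ^ p * g x) \<in> hspan" for g :: "real ^ 'n \<Rightarrow> complex" and p i
  proof (induction p)
    case (Suc p)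
    from hspan_component[OF Suc.IH[OF Suc.prems], of i] show ?case by (simp add: mult.assoc)
  qed simp
  have "finite A \<Longrightarrow> (\<lambda>x. (\<Prod>i\<in>A. of_real (x $ i) ^ \<beta> i) * f x) \<in> hspan" for A :: "'n set"
  proof (induction A rule: finite_induct)
    case (insert i A)
    from p[OF insert.IH, of i "\<beta> i"] insert show ?case by (simp add: mult.assoc)
  qed (simp add: assms)
  from hspan_bounded[OF this[of UNIV]] show "bounded (range (\<lambda>x. mpower x \<beta> *\<^sub>R f x))"
    by (auto simp: bounded_iff mpower_def scaleR_conv_of_real)
qed

lemma hspan_schwartz: "f \<in> hspan \<Longrightarrow> f \<in> schwartz"
  by (auto simp: schwartz_iff hspan_smooth hspan_rapid_decay hspan_foldr_partial)

lemma hspan_L2: "f \<in> hspan \<Longrightarrow> f \<in> L2"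
  by (intro schwartz_L2 hspan_schwartz)

lemma hermite_fun_schwartz: "hermite_fun \<alpha> \<in> schwartz"
  by (intro hspan_schwartz hspan_hermite_fun)

lemma hermite_fun_L2: "hermite_fun \<alpha> \<in> L2"
  by (intro hspan_L2 hspan_hermite_fun)

lemma cnj_hermite_fun [simp]: "cnj (hermite_fun \<alpha> x) = hermite_fun \<alpha> x"
  by (simp add: hermite_fun_def del: of_real_prod)

lemma hermite_coeff_eq: "hermite_coeff \<alpha> f = (\<integral>x. f x * hermite_fun \<alpha> x \<partial>lebesgue)"
  by (simp add: hermite_coeff_def)

subsection \<open>Orthonormality\<close>

lemma hermite_fun_0: "hermite_fun (\<lambda>i. 0) x = (\<Prod>i\<in>UNIV. of_real (exp (- (x $ i)\<^sup>2 / 2) / sqrt (sqrt pi)))"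
  by (simp add: hermite_fun_def hermite_fun1_0)

lemma msize_eq_0 [simp]: "msize \<alpha> = 0 \<longleftrightarrow> \<alpha> = (\<lambda>i. 0)"
  by (auto simp: msize_def fun_eq_iff)

lemma msize_zero [simp]: "msize (\<lambda>i. 0) = 0"
  by (simp add: msize_def)

lemma hermite_fun_0_norm: "(\<integral>x. hermite_fun (\<lambda>i. 0) x * hermite_fun (\<lambda>i. 0) x \<partial>lebesgue) = 1"
proof -
  let ?h = "hermite_fun (\<lambda>i. 0) :: real ^ 'a \<Rightarrow> complex"
  let ?g = "\<lambda>t. complex_of_real (normal_density 0 (1 / sqrt 2) t)"
  have sq: "sqrt (sqrt pi) * sqrt (sqrt pi) = sqrt pi"
    by (rule real_sqrt_mult_self[THEN trans]) simp
  have e: "?h x * ?h x = (\<Prod>i\<in>UNIV. ?g (x $ i))" for x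
    unfolding hermite_fun_0 prod.distrib[symmetric]
  proof (rule prod.cong)
    fix i
    have "exp (- (x $ i)\<^sup>2 / 2) * exp (- (x $ i)\<^sup>2 / 2) = exp (- (x $ i)\<^sup>2)"
      by (simp add: exp_add[symmetric])
    then have "exp (- (x $ i)\<^sup>2 / 2) / sqrt (sqrt pi) * (exp (- (x $ i)\<^sup>2 / 2) / sqrt (sqrt pi))
        = normal_density 0 (1 / sqrt 2) (x $ i)"
      by (simp add: normal_density_def sq power_divide)
    then show "complex_of_real (exp (- (x $ i)\<^sup>2 / 2) / sqrt (sqrt pi))
        * complex_of_real (exp (- (x $ i)\<^sup>2 / 2) / sqrt (sqrt pi)) = ?g (x $ i)"
      by (metis of_real_mult)
  qed simp
  have int: "integrable lborel ?g"
    by (intro integrable_of_real) simp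
  have one: "(\<integral>t. ?g t \<partial>lborel) = 1"
    by (subst integral_complex_of_real) simp
  have "(\<integral>x. ?h x * ?h x \<partial>lebesgue) = (\<integral>x. ?h x * ?h x \<partial>lborel)"
    by (rule lebesgue_borel(2))
      (intro borel_measurable_times smooth_borel_measurable schwartz_smooth hermite_fun_schwartz)
  also have "\<dots> = (\<Prod>i\<in>(UNIV :: 'a set). \<integral>t. ?g t \<partial>lborel)"
    unfolding e by (rule lborel_integral_tensor(2)) (rule int)
  also have "\<dots> = 1"
    by (simp only: one prod.neutral_const)
  finally show ?thesis .
qed

text \<open>Integration by parts moves \<open>\<partial>\<^sub>i\<close> to the Hermite function, whose derivative is a combination of its
  two neighbours; multiplication by \<open>x\<^sub>i\<close> moves without a sign. In the sum of the two, the
  coefficient of \<open>x\<^sub>i f + \<partial>\<^sub>i f\<close>, only the upper neighbour survives.\<close>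

lemma hermite_coeff_partial:
  assumes f: "f \<in> schwartz"
  shows "hermite_coeff \<alpha> (partial i f) =
    of_real (sqrt (real (Suc (\<alpha> i)) / 2)) * hermite_coeff (up i \<alpha>) f -
    of_real (sqrt (real (\<alpha> i) / 2)) * hermite_coeff (down i \<alpha>) f"
proof -
  have int: "integrable lebesgue (\<lambda>x. f x * hermite_fun \<beta> x)" for \<beta>
    by (intro L2_mult_integrable hermite_fun_L2 schwartz_L2 f)
  have "hermite_coeff \<alpha> (partial i f) = - (\<integral>x. f x * partial i (hermite_fun \<alpha>) x \<partial>lebesgue)"
    unfolding hermite_coeff_eq by (rule schwartz_integration_by_parts[OF f hermite_fun_schwartz])
  also have "(\<integral>x. f x * partial i (hermite_fun \<alpha>) x \<partial>lebesgue) =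
     (\<integral>x. of_real (sqrt (real (\<alpha> i) / 2)) * (f x * hermite_fun (down i \<alpha>) x) -
       of_real (sqrt (real (Suc (\<alpha> i)) / 2)) * (f x * hermite_fun (up i \<alpha>) x) \<partial>lebesgue)"
    unfolding partial_hermite_fun by (simp only: ring_distribs mult_ac)
  also have "\<dots> = of_real (sqrt (real (\<alpha> i) / 2)) * hermite_coeff (down i \<alpha>) f -
      of_real (sqrt (real (Suc (\<alpha> i)) / 2)) * hermite_coeff (up i \<alpha>) f"
    unfolding hermite_coeff_eq
    using Bochner_Integration.integral_diff[OF integrable_mult_right[OF int]
        integrable_mult_right[OF int]] by (simp only: integral_mult_right_zero)
  finally show ?thesis by simp
qed

lemma hermite_coeff_component:
  assumes f: "f \<in> L2"
  shows "hermite_coeff \<alpha> (\<lambda>x. of_real (x $ i) * f x) =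
    of_real (sqrt (real (Suc (\<alpha> i)) / 2)) * hermite_coeff (up i \<alpha>) f +
    of_real (sqrt (real (\<alpha> i) / 2)) * hermite_coeff (down i \<alpha>) f"
proof -
  have int: "integrable lebesgue (\<lambda>x. f x * hermite_fun \<beta> x)" for \<beta>
    by (intro L2_mult_integrable hermite_fun_L2 f)
  have "hermite_coeff \<alpha> (\<lambda>x. of_real (x $ i) * f x) = (\<integral>x. f x * (of_real (x $ i) * hermite_fun \<alpha> x) \<partial>lebesgue)"
    unfolding hermite_coeff_eq by (simp only: mult_ac)
  also have "\<dots> = (\<integral>x. of_real (sqrt (real (Suc (\<alpha> i)) / 2)) * (f x * hermite_fun (up i \<alpha>) x) +
       of_real (sqrt (real (\<alpha> i) / 2)) * (f x * hermite_fun (down i \<alpha>) x) \<partial>lebesgue)"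
    unfolding hermite_fun_mult by (simp only: ring_distribs mult_ac add_ac)
  also have "\<dots> = of_real (sqrt (real (Suc (\<alpha> i)) / 2)) * hermite_coeff (up i \<alpha>) f +
    of_real (sqrt (real (\<alpha> i) / 2)) * hermite_coeff (down i \<alpha>) f"
    unfolding hermite_coeff_eq
    using Bochner_Integration.integral_add[OF integrable_mult_right[OF int]
        integrable_mult_right[OF int]] by (simp only: integral_mult_right_zero)
  finally show ?thesis .
qed

text \<open>The annihilation and creation operators of the harmonic oscillator, without the usual factor
  \<open>1 / sqrt 2\<close>.\<close>

definition lower :: "'n \<Rightarrow> (real ^ 'n \<Rightarrow> complex) \<Rightarrow> (real ^ 'n \<Rightarrow> complex)" where
  "lower i f x = of_real (x $ i) * f x + partial i f x"

definition raise :: "'n \<Rightarrow> (real ^ 'n \<Rightarrow> complex) \<Rightarrow> (real ^ 'n \<Rightarrow> complex)" where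
  "raise i f x = of_real (x $ i) * f x - partial i f x"

lemma two_sqrt_half: "2 * sqrt (x / 2) = sqrt (2 * x)"
proof -
  have "sqrt (2 * x) = sqrt (4 * (x / 2))" by simp
  then show ?thesis by (simp only: real_sqrt_mult real_sqrt_four)
qed

lemma raise_hermite_fun:
  "raise i (hermite_fun \<alpha>) = (\<lambda>x. of_real (sqrt (2 * real (Suc (\<alpha> i)))) * hermite_fun (up i \<alpha>) x)"
  unfolding raise_def hermite_fun_mult partial_hermite_fun two_sqrt_half[symmetric]
  by (simp add: fun_eq_iff)

lemma schwartz_lower: "f \<in> schwartz \<Longrightarrow> lower i f \<in> schwartz"
  unfolding lower_def by (intro schwartz_add schwartz_component schwartz_partial)

lemma hspan_lower: "f \<in> hspan \<Longrightarrow> lower i f \<in> hspan"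
  unfolding lower_def by (intro hspan_add hspan_component conjunct2[OF hspan_partial])

lemma hermite_coeff_add:
  assumes "f \<in> L2" "g \<in> L2"
  shows "hermite_coeff \<alpha> (\<lambda>x. f x + g x) = hermite_coeff \<alpha> f + hermite_coeff \<alpha> g"
  unfolding hermite_coeff_eq ring_distribs
  by (intro Bochner_Integration.integral_add L2_mult_integrable assms hermite_fun_L2)

lemma hermite_coeff_diff:
  assumes "f \<in> L2" "g \<in> L2"
  shows "hermite_coeff \<alpha> (\<lambda>x. f x - g x) = hermite_coeff \<alpha> f - hermite_coeff \<alpha> g"
  unfolding hermite_coeff_eq ring_distribs
  by (intro Bochner_Integration.integral_diff L2_mult_integrable assms hermite_fun_L2)

lemma hermite_coeff_scale: "hermite_coeff \<alpha> (\<lambda>x. c * f x) = c * hermite_coeff \<alpha> f"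
  unfolding hermite_coeff_eq by (simp add: mult.assoc)

lemma hermite_coeff_zero [simp]: "hermite_coeff \<alpha> (\<lambda>x. 0) = 0"
  by (simp add: hermite_coeff_def)

lemma hermite_coeff_sum:
  assumes "\<And>a. a \<in> A \<Longrightarrow> f a \<in> L2"
  shows "hermite_coeff \<alpha> (\<lambda>x. \<Sum>a\<in>A. f a x) = (\<Sum>a\<in>A. hermite_coeff \<alpha> (f a))"
  using assms by (induction A rule: infinite_finite_induct) (auto simp: hermite_coeff_add L2_sum)

lemma hermite_coeff_lower:
  assumes f: "f \<in> schwartz"
  shows "hermite_coeff \<alpha> (lower i f) = of_real (sqrt (2 * real (Suc (\<alpha> i)))) * hermite_coeff (up i \<alpha>) f"
  unfolding lower_def two_sqrt_half[symmetric]
  by (subst hermite_coeff_add)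
    (auto simp: hermite_coeff_component schwartz_L2 hermite_coeff_partial schwartz_partial
      schwartz_component f)

lemma lower_hermite_fun:
  "lower i (hermite_fun \<alpha>) = (\<lambda>x. of_real (sqrt (2 * real (\<alpha> i))) * hermite_fun (down i \<alpha>) x)"
  unfolding lower_def hermite_fun_mult partial_hermite_fun two_sqrt_half[symmetric]
  by (simp add: fun_eq_iff)

lemma exists_up:
  assumes "\<alpha> \<noteq> (\<lambda>i. 0 :: nat)"
  obtains i \<beta> where "\<alpha> = up i \<beta>"
proof -
  from assms obtain i where "\<alpha> i \<noteq> 0" by (auto simp: fun_eq_iff)
  then have "\<alpha> = up i (down i \<alpha>)" by simp
  then show ?thesis by (rule that)
qed

text \<open>Lowering \<open>h\<^sub>\<alpha>\<close> lowers both indices of the pairing, until one of them is \<open>0\<close>. There either lowering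
  annihilates \<open>h\<^sub>0\<close> or the Gaussian integral remains.\<close>

lemma hermite_coeff_hermite_fun:
  "hermite_coeff \<beta> (hermite_fun \<alpha>) = (if \<alpha> = \<beta> then 1 else 0)"
proof (induction "msize \<beta>" arbitrary: \<alpha> \<beta>)
  case 0
  then have \<beta>: "\<beta> = (\<lambda>i. 0)" by simp
  show ?case
  proof (cases "\<alpha> = (\<lambda>i. 0)")
    case True
    then show ?thesis by (simp add: \<beta> hermite_coeff_eq hermite_fun_0_norm)
  next
    case False
    then obtain i \<gamma> where \<alpha>: "\<alpha> = up i \<gamma>" by (rule exists_up)
    have "of_real (sqrt (2 * real (Suc (\<gamma> i)))) * hermite_coeff \<alpha> (hermite_fun \<beta>)
      = hermite_coeff \<gamma> (lower i (hermite_fun \<beta>))"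
      by (simp only: hermite_coeff_lower[OF hermite_fun_schwartz] \<alpha>)
    also have "\<dots> = 0"
      by (simp add: lower_hermite_fun \<beta>)
    finally have "hermite_coeff \<alpha> (hermite_fun \<beta>) = 0" by simp
    moreover have "hermite_coeff \<alpha> (hermite_fun \<beta>) = hermite_coeff \<beta> (hermite_fun \<alpha>)"
      by (simp add: hermite_coeff_eq mult.commute)
    ultimately show ?thesis using False \<beta> by simp
  qed
next
  case (Suc n)
  then have "\<beta> \<noteq> (\<lambda>i. 0)" using msize_eq_0[of \<beta>] by auto
  then obtain i \<gamma> where \<beta>: "\<beta> = up i \<gamma>" by (rule exists_up)
  have n: "n = msize \<gamma>" using Suc(2) by (simp add: \<beta>)
  have "of_real (sqrt (2 * real (Suc (\<gamma> i)))) * hermite_coeff \<beta> (hermite_fun \<alpha>)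
      = hermite_coeff \<gamma> (lower i (hermite_fun \<alpha>))"
    by (simp only: hermite_coeff_lower[OF hermite_fun_schwartz] \<beta>)
  also have "\<dots> = of_real (sqrt (2 * real (\<alpha> i))) * (if down i \<alpha> = \<gamma> then 1 else 0)"
    unfolding lower_hermite_fun hermite_coeff_scale Suc(1)[OF n] ..
  also have "\<dots> = of_real (sqrt (2 * real (Suc (\<gamma> i)))) * (if \<alpha> = \<beta> then 1 else 0)"
  proof (cases "\<alpha> i = 0")
    case True
    then have "\<alpha> \<noteq> \<beta>" by (auto simp: \<beta>)
    with True show ?thesis by simp
  next
    case False
    then have "down i \<alpha> = \<gamma> \<longleftrightarrow> \<alpha> = \<beta>" unfolding \<beta> by (metis down_up up_down)
    then show ?thesis by (auto simp: \<beta>)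
  qed
  finally show ?case by (simp only: mult_cancel_left of_real_eq_0_iff real_sqrt_eq_0_iff) auto
qed

section \<open>Hermite functions under the Fourier transform\<close>

text \<open>This is the characteristic function of the standard normal distribution.\<close>

lemma gauss_fourier1:
  "integrable lborel (\<lambda>t::real. exp (\<i> * of_real (s * t)) * of_real (exp (- t\<^sup>2 / 2)))"
  "(\<integral>t. exp (\<i> * of_real (s * t)) * of_real (exp (- t\<^sup>2 / 2)) \<partial>lborel) = of_real (sqrt (2 * pi) * exp (- s\<^sup>2 / 2))"
proof -
  have nd: "std_normal_density t = exp (- t\<^sup>2 / 2) / sqrt (2 * pi)" for t
    by (simp add: std_normal_density_def)
  have e: "exp (\<i> * of_real (s * t)) * of_real (exp (- t\<^sup>2 / 2))
      = of_real (sqrt (2 * pi)) * (std_normal_density t *\<^sub>R iexp (s * t))" for t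
    by (simp add: nd scaleR_conv_of_real)
  have int: "integrable lborel (\<lambda>t. std_normal_density t *\<^sub>R iexp (s * t))"
  proof (rule Bochner_Integration.integrable_bound)
    show "integrable lborel std_normal_density" by simp
    show "AE t in lborel. norm (std_normal_density t *\<^sub>R iexp (s * t)) \<le> norm (std_normal_density t)"
      by (auto simp: norm_mult)
  qed simp
  show "integrable lborel (\<lambda>t::real. exp (\<i> * of_real (s * t)) * of_real (exp (- t\<^sup>2 / 2)))"
    unfolding e using int by (rule integrable_mult_right)
  have "(\<integral>t. std_normal_density t *\<^sub>R iexp (s * t) \<partial>lborel) = char std_normal_distribution s"
    unfolding char_def by (rule integral_density[symmetric]) auto
  then show "(\<integral>t. exp (\<i> * of_real (s * t)) * of_real (exp (- t\<^sup>2 / 2)) \<partial>lborel)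
      = of_real (sqrt (2 * pi) * exp (- s\<^sup>2 / 2))"
    unfolding e integral_mult_right_zero unfolding char_std_normal_distribution of_real_mult by simp
qed

lemma norm_exp_i [simp]: "cmod (exp (\<i> * of_real t)) = 1"
  by (simp add: norm_exp_eq_Re)

lemma integrable_exp_mult:
  fixes f :: "real ^ 'n::finite \<Rightarrow> complex"
  assumes "integrable lebesgue f"
  shows "integrable lebesgue (\<lambda>x. exp (\<i> * of_real (s * (x \<bullet> y))) * f x)"
proof (rule Bochner_Integration.integrable_bound[OF assms])
  have "(\<lambda>x. exp (\<i> * of_real (s * (x \<bullet> y)))) \<in> borel_measurable lebesgue"
    by (intro lebesgue_borel(3) borel_measurable_continuous_onI continuous_intros)
  then show "(\<lambda>x. exp (\<i> * of_real (s * (x \<bullet> y))) * f x) \<in> borel_measurable lebesgue"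
    using borel_measurable_times borel_measurable_integrable[OF assms] by blast
qed (simp add: norm_mult)

lemma has_derivative_exp_inner:
  "((\<lambda>x. exp (\<i> * of_real (s * (x \<bullet> y)))) has_derivative
    (\<lambda>h. (\<i> * of_real (s * (h \<bullet> y))) * exp (\<i> * of_real (s * (x \<bullet> y))))) (at x)"
proof -
  have "((\<lambda>x. \<i> * complex_of_real (s * (x \<bullet> y))) has_derivative (\<lambda>h. \<i> * of_real (s * (h \<bullet> y)))) (at x)"
    by (auto intro!: derivative_eq_intros)
  moreover have "(exp has_derivative (\<lambda>h. exp z * h)) (at z)" for z :: complex
    using DERIV_exp[of z] by (simp only: has_field_derivative_def)
  ultimately have "((\<lambda>x. exp (\<i> * complex_of_real (s * (x \<bullet> y)))) has_derivative
      (\<lambda>h. exp (\<i> * of_real (s * (x \<bullet> y))) * (\<i> * of_real (s * (h \<bullet> y))))) (at x)"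
    by (rule has_derivative_compose)
  then show ?thesis by (simp only: mult.commute)
qed

text \<open>Integration by parts applied to the product with the exponential, which is not a Schwartz function.\<close>

lemma fourier_integral_partial:
  fixes f :: "real ^ 'n::finite \<Rightarrow> complex"
  assumes f: "f \<in> schwartz"
  shows "(\<integral>x. exp (\<i> * of_real (s * (x \<bullet> y))) * partial i f x \<partial>lebesgue) =
    - (\<i> * of_real (s * y $ i)) * (\<integral>x. exp (\<i> * of_real (s * (x \<bullet> y))) * f x \<partial>lebesgue)"
proof -
  let ?E = "\<lambda>x. exp (\<i> * of_real (s * (x \<bullet> y)))"
  let ?u = "\<lambda>x. ?E x * f x"
  have dE: "?E differentiable (at x)" "partial i ?E x = (\<i> * of_real (s * y $ i)) * ?E x" for x
  proof -
    show "?E differentiable (at x)"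
      using has_derivative_exp_inner unfolding differentiable_def by blast
    show "partial i ?E x = (\<i> * of_real (s * y $ i)) * ?E x"
      unfolding partialI[OF has_derivative_exp_inner] by (simp only: inner_axis' inner_real_def mult_1_left)
  qed
  have df: "f differentiable (at x)" for x
    using f by (intro smooth_differentiable schwartz_smooth)
  have p: "partial i ?u = (\<lambda>x. ?E x * partial i f x + (\<i> * of_real (s * y $ i)) * ?u x)"
    by (rule ext) (simp only: partial_mult[OF dE(1) df] dE(2) mult.assoc)
  have i1: "integrable lebesgue (\<lambda>x. ?E x * partial i f x)"
    by (intro integrable_exp_mult schwartz_integrable schwartz_partial f)
  have i2: "integrable lebesgue ?u"
    by (intro integrable_exp_mult schwartz_integrable f)
  have i3: "integrable lebesgue (\<lambda>x. (\<i> * of_real (s * y $ i)) * ?u x)"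
    using i2 by (rule integrable_mult_right)
  have "(\<integral>x. partial i ?u x \<partial>lebesgue) = 0"
  proof (rule integral_partial_eq_0)
    show "?u differentiable (at x)" for x
      by (intro differentiable_mult dE df)
    have "continuous_on UNIV f" "continuous_on UNIV (partial i f)"
      using smooth_continuous[OF schwartz_smooth[OF f]]
        smooth_continuous[OF smooth_partial[OF schwartz_smooth[OF f]]] by auto
    then show "continuous_on UNIV (partial i ?u)"
      unfolding p by (intro continuous_intros)
    show "integrable lebesgue (partial i ?u)"
      unfolding p by (rule Bochner_Integration.integrable_add[OF i1 i3])
  qed (rule i2)
  moreover have "(\<integral>x. partial i ?u x \<partial>lebesgue) =
      (\<integral>x. ?E x * partial i f x \<partial>lebesgue) + (\<i> * of_real (s * y $ i)) * (\<integral>x. ?u x \<partial>lebesgue)"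
    unfolding p by (subst Bochner_Integration.integral_add[OF i1 i3]) (simp only: integral_mult_right_zero)
  ultimately show ?thesis
    by (simp only: add_eq_0_iff mult_minus_left minus_minus)
qed

text \<open>The relation for \<open>\<partial>\<^sub>i h\<^sub>\<beta>\<close> expresses the upper neighbour of \<open>h\<^sub>\<beta>\<close> by \<open>\<partial>\<^sub>i h\<^sub>\<beta>\<close> and the lower neighbour, and
  the Fourier integral of \<open>\<partial>\<^sub>i h\<^sub>\<beta>\<close> at \<open>y\<close> is a multiple of \<open>y\<^sub>i\<close> times that of \<open>h\<^sub>\<beta>\<close>. So the Fourier integrals
  obey a three-term recursion, and by the relation for \<open>y\<^sub>i h\<^sub>\<beta>\<close> so do the functions \<open>(\<plusminus>\<i>)\<^bsup>|\<alpha>|\<^esup> h\<^sub>\<alpha>\<close>.\<close>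

lemma fourier_hermite_fun:
  fixes \<alpha> :: "'n::finite \<Rightarrow> nat"
  assumes s: "s = 1 \<or> s = -1"
  shows "(\<integral>x. exp (\<i> * of_real (s * (x \<bullet> y))) * hermite_fun \<alpha> x \<partial>lebesgue) =
    of_real ((2 * pi) powr (real CARD('n) / 2)) * (of_real s * \<i>) ^ msize \<alpha> * hermite_fun \<alpha> y"
proof (induction "msize \<alpha>" arbitrary: \<alpha> rule: less_induct)
  case less
  let ?F = "\<lambda>\<alpha>. \<integral>x. exp (\<i> * of_real (s * (x \<bullet> y))) * hermite_fun \<alpha> x \<partial>lebesgue"
  let ?c = "complex_of_real ((2 * pi) powr (real CARD('n) / 2))"
  let ?j = "of_real s * \<i>"
  show ?case
  proof (cases "\<alpha> = (\<lambda>i. 0)")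
    case True
    let ?h = "hermite_fun \<alpha> :: real ^ 'n \<Rightarrow> complex"
    let ?k = "complex_of_real (sqrt (sqrt pi))"
    let ?g = "\<lambda>i t. exp (\<i> * of_real ((s * y $ i) * t)) * of_real (exp (- t\<^sup>2 / 2)) / ?k"
    have h: "?h x = (\<Prod>i\<in>UNIV. of_real (exp (- (x $ i)\<^sup>2 / 2)) / ?k)" for x
      unfolding True hermite_fun_0 by simp
    have e: "exp (\<i> * of_real (s * (x \<bullet> y))) = (\<Prod>i\<in>UNIV. exp (\<i> * of_real ((s * y $ i) * x $ i)))" for x
      by (simp add: inner_vec_def sum_distrib_left exp_sum[symmetric] mult_ac)
    have "?F \<alpha> = (\<integral>x. (\<Prod>i\<in>UNIV. ?g i (x $ i)) \<partial>lebesgue)"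
      unfolding h e prod.distrib[symmetric] by (simp only: times_divide_eq_right)
    also have "\<dots> = (\<integral>x. (\<Prod>i\<in>UNIV. ?g i (x $ i)) \<partial>lborel)"
      by (rule lebesgue_borel(2)) measurable
    also have "\<dots> = (\<Prod>i\<in>UNIV. \<integral>t. ?g i t \<partial>lborel)"
      by (rule lborel_integral_tensor(2)) (intro integrable_divide gauss_fourier1)
    also have "\<dots> = (\<Prod>i\<in>UNIV. of_real (sqrt (2 * pi)) * (of_real (exp (- (y $ i)\<^sup>2 / 2)) / ?k))"
    proof (rule prod.cong[OF refl])
      fix i
      have "(s * y $ i)\<^sup>2 = (y $ i)\<^sup>2" using s by (auto simp: power_mult_distrib)
      then show "(\<integral>t. ?g i t \<partial>lborel) = of_real (sqrt (2 * pi)) * (of_real (exp (- (y $ i)\<^sup>2 / 2)) / ?k)"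
        unfolding integral_divide_zero gauss_fourier1(2) by simp
    qed
    also have "\<dots> = of_real (sqrt (2 * pi) ^ CARD('n)) * ?h y"
      unfolding h prod.distrib by simp
    also have "sqrt (2 * pi) ^ CARD('n) = (2 * pi) powr (real CARD('n) / 2)"
      by (simp add: powr_half_sqrt[symmetric] powr_realpow[symmetric] powr_powr)
    finally show ?thesis using True by simp
  next
    case False
    then obtain i \<beta> where \<alpha>: "\<alpha> = up i \<beta>" by (rule exists_up)
    have IH1: "?F \<beta> = ?c * ?j ^ msize \<beta> * hermite_fun \<beta> y"
      by (rule less) (simp add: \<alpha>)
    let ?r = "complex_of_real (sqrt (real (\<beta> i) / 2))"
    let ?q = "complex_of_real (sqrt (real (Suc (\<beta> i)) / 2))"
    have jj: "?j * ?j = - 1" using s by auto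
    have IH2: "?r * ?F (down i \<beta>) = ?r * (- ?c * ?j ^ Suc (msize \<beta>) * hermite_fun (down i \<beta>) y)"
    proof (cases "\<beta> i = 0")
      case False
      have m: "msize \<beta> = Suc (msize (down i \<beta>))"
        using msize_up[of i "down i \<beta>"] up_down[of \<beta> i] False by simp
      have "?F (down i \<beta>) = ?c * ?j ^ msize (down i \<beta>) * hermite_fun (down i \<beta>) y"
        by (rule less) (simp add: \<alpha> m)
      moreover have "?j ^ Suc (msize \<beta>) = - (?j ^ msize (down i \<beta>))"
      proof -
        have "?j ^ Suc (msize \<beta>) = (?j * ?j) * ?j ^ msize (down i \<beta>)"
          by (simp only: m power_Suc mult.assoc)
        then show ?thesis unfolding jj by simp
      qed
      ultimately show ?thesis by simp
    qed simp
    have int: "integrable lebesgue (\<lambda>x. exp (\<i> * of_real (s * (x \<bullet> y))) * hermite_fun \<gamma> x)" for \<gamma> :: "'n \<Rightarrow> nat"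
      by (intro integrable_exp_mult schwartz_integrable hermite_fun_schwartz)
    have "- (\<i> * of_real (s * y $ i)) * ?F \<beta> =
        (\<integral>x. exp (\<i> * of_real (s * (x \<bullet> y))) * partial i (hermite_fun \<beta>) x \<partial>lebesgue)"
      by (rule fourier_integral_partial[OF hermite_fun_schwartz, symmetric])
    also have "\<dots> = (\<integral>x. ?r * (exp (\<i> * of_real (s * (x \<bullet> y))) * hermite_fun (down i \<beta>) x) -
        ?q * (exp (\<i> * of_real (s * (x \<bullet> y))) * hermite_fun (up i \<beta>) x) \<partial>lebesgue)"
      unfolding partial_hermite_fun by (simp only: right_diff_distrib mult.left_commute)
    also have "\<dots> = ?r * ?F (down i \<beta>) - ?q * ?F (up i \<beta>)"
      by (subst Bochner_Integration.integral_diff[OF integrable_mult_right[OF int] integrable_mult_right[OF int]])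
        (simp only: integral_mult_right_zero)
    finally have "?q * ?F (up i \<beta>) = ?r * ?F (down i \<beta>) + \<i> * of_real (s * y $ i) * ?F \<beta>"
      by (simp add: algebra_simps)
    also have "\<dots> = ?c * ?j ^ Suc (msize \<beta>) *
        (of_real (y $ i) * hermite_fun \<beta> y - ?r * hermite_fun (down i \<beta>) y)"
      unfolding IH1 IH2 by (simp add: algebra_simps)
    also have "of_real (y $ i) * hermite_fun \<beta> y - ?r * hermite_fun (down i \<beta>) y = ?q * hermite_fun (up i \<beta>) y"
      by (simp only: hermite_fun_mult add_diff_cancel_left')
    finally have "?q * ?F \<alpha> = ?q * (?c * ?j ^ msize \<alpha> * hermite_fun \<alpha> y)"
      by (simp add: \<alpha> mult_ac)
    then show ?thesis by simp
  qed
qed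

section \<open>Completeness of the Hermite functions\<close>

abbreviation gauss :: "real \<Rightarrow> real ^ 'n::finite \<Rightarrow> complex" where
  "gauss a x \<equiv> of_real (exp (- a * (norm x)\<^sup>2))"

lemma hspan_polynomial:
  fixes p :: "real ^ 'n::finite \<Rightarrow> real"
  assumes "real_polynomial_function p" "v \<in> hspan"
  shows "(\<lambda>x. of_real (p x) * v x) \<in> hspan"
  using assms
proof (induction arbitrary: v rule: real_polynomial_function.induct)
  case (linear f)
  have "f x = (\<Sum>i\<in>UNIV. x $ i * f (axis i 1))" for x
  proof -
    interpret bounded_linear f by fact
    have "f x = f (\<Sum>i\<in>UNIV. x $ i *\<^sub>R axis i 1)"
      using arg_cong[OF basis_expansion[of x, symmetric], of f] by (simp only: scalar_mult_eq_scaleR)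
    then show ?thesis by (simp only: sum scale real_scaleR_def)
  qed
  note lin = this
  have "of_real (f x) * v x = (\<Sum>i\<in>UNIV. of_real (f (axis i 1)) * (of_real (x $ i) * v x))" for x
  proof -
    have "complex_of_real (f x) * v x = of_real (\<Sum>i\<in>UNIV. x $ i * f (axis i 1)) * v x"
      by (simp only: lin[of x])
    also have "\<dots> = (\<Sum>i\<in>UNIV. of_real (f (axis i 1)) * (of_real (x $ i) * v x))"
      unfolding of_real_sum of_real_mult sum_distrib_right by (intro sum.cong refl) (simp only: mult_ac)
    finally show ?thesis .
  qed
  then have "(\<lambda>x. of_real (f x) * v x) = (\<lambda>x. \<Sum>i\<in>UNIV. of_real (f (axis i 1)) * (of_real (x $ i) * v x))"
    by (rule ext)
  then show ?case
    using linear by (auto intro!: hspan_sum hspan_scale hspan_component)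
next
  case (const c)
  then show ?case by (rule hspan_scale)
next
  case (add f g)
  from hspan_add[OF add.IH(1)[OF add.prems] add.IH(2)[OF add.prems]]
  show ?case by (simp only: of_real_add ring_distribs)
next
  case (mult f g)
  from mult(3)[OF mult(4)[OF mult.prems]] show ?case by (simp only: of_real_mult mult.assoc)
qed

lemma hermite_fun_0_gauss:
  "\<exists>c::real. c > 0 \<and> (\<forall>x::real ^ 'n::finite. hermite_fun (\<lambda>i. 0) x = of_real c * gauss (1/2) x)"
proof -
  let ?c = "(1 / sqrt (sqrt pi)) ^ CARD('n)"
  have "hermite_fun (\<lambda>i. 0) x = of_real ?c * gauss (1/2) x" for x :: "real ^ 'n"
  proof -
    have n: "(norm x)\<^sup>2 = (\<Sum>i\<in>UNIV. (x $ i)\<^sup>2)"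
      unfolding power2_norm_eq_inner inner_vec_def by (simp only: inner_real_def power2_eq_square)
    have "exp (- (1/2) * (norm x)\<^sup>2) = (\<Prod>i\<in>UNIV. exp (- (x $ i)\<^sup>2 / 2))"
      unfolding n by (simp add: exp_sum[symmetric] sum_negf sum_divide_distrib)
    moreover have "hermite_fun (\<lambda>i. 0) x = of_real ((\<Prod>i\<in>UNIV. exp (- (x $ i)\<^sup>2 / 2)) / sqrt (sqrt pi) ^ CARD('n))"
      unfolding hermite_fun_0 of_real_prod[symmetric] prod_dividef by simp
    ultimately show ?thesis by (simp add: power_divide)
  qed
  moreover have "?c > 0" by simp
  ultimately show ?thesis by blast
qed

lemma polynomial_gauss_bounded:
  fixes p :: "real ^ 'n::finite \<Rightarrow> real"
  assumes "real_polynomial_function p" "a > 0"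
  shows "\<exists>B. \<forall>x. \<bar>p x\<bar> * exp (- a * (norm x)\<^sup>2) \<le> B"
  using assms
proof (induction arbitrary: a rule: real_polynomial_function.induct)
  case (linear f)
  then obtain K where K: "\<And>x. norm (f x) \<le> norm x * K" "K > 0"
    using bounded_linear.pos_bounded by blast
  have "\<bar>f x\<bar> * exp (- a * (norm x)\<^sup>2) \<le> K * (1 + 1 / a)" for x
  proof -
    have "norm x \<le> 1 + (norm x)\<^sup>2"
      using zero_le_power2[of "norm x - 1"] by (simp add: power2_eq_square algebra_simps) (smt (verit) norm_ge_zero mult_nonneg_nonneg)
    also have "\<dots> \<le> 1 + exp (a * (norm x)\<^sup>2) / a"
    proof -
      have "a * (norm x)\<^sup>2 \<le> exp (a * (norm x)\<^sup>2)"
        using exp_ge_add_one_self[of "a * (norm x)\<^sup>2"] by linarith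
      then show ?thesis using linear by (simp add: pos_le_divide_eq mult.commute)
    qed
    also have "\<dots> \<le> exp (a * (norm x)\<^sup>2) * (1 + 1 / a)"
      using linear one_le_exp_iff[of "a * (norm x)\<^sup>2"] by (simp add: ring_distribs)
    finally have "norm x * exp (- a * (norm x)\<^sup>2) \<le> exp (a * (norm x)\<^sup>2) * (1 + 1 / a) * exp (- a * (norm x)\<^sup>2)"
      by (rule mult_right_mono) simp
    also have "\<dots> = (exp (a * (norm x)\<^sup>2) * exp (- a * (norm x)\<^sup>2)) * (1 + 1 / a)"
      by (simp only: mult_ac)
    also have "\<dots> = 1 + 1 / a" by (simp add: exp_add[symmetric])
    finally have "K * (norm x * exp (- a * (norm x)\<^sup>2)) \<le> K * (1 + 1 / a)"
      using K(2) by (intro mult_left_mono) auto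
    moreover have "\<bar>f x\<bar> * exp (- a * (norm x)\<^sup>2) \<le> (norm x * K) * exp (- a * (norm x)\<^sup>2)"
      using K(1)[of x] by (intro mult_right_mono) auto
    ultimately show ?thesis by (simp only: mult_ac)
  qed
  then show ?case by blast
next
  case (const c)
  have "\<bar>c\<bar> * exp (- a * (norm x)\<^sup>2) \<le> \<bar>c\<bar> * 1" for x :: "real ^ 'n"
    using const by (intro mult_left_mono) auto
  then show ?case by blast
next
  case (add f g)
  from add.IH(1)[OF add.prems] add.IH(2)[OF add.prems] obtain B C where
    B: "\<And>x. \<bar>f x\<bar> * exp (- a * (norm x)\<^sup>2) \<le> B" and C: "\<And>x. \<bar>g x\<bar> * exp (- a * (norm x)\<^sup>2) \<le> C"
    by blast
  have "\<bar>f x + g x\<bar> * exp (- a * (norm x)\<^sup>2) \<le> B + C" for x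
  proof -
    have "\<bar>f x + g x\<bar> * exp (- a * (norm x)\<^sup>2) \<le> (\<bar>f x\<bar> + \<bar>g x\<bar>) * exp (- a * (norm x)\<^sup>2)"
      by (intro mult_right_mono) auto
    also have "\<dots> \<le> B + C" unfolding ring_distribs by (intro add_mono B C)
    finally show ?thesis .
  qed
  then show ?case by blast
next
  case (mult f g)
  have "a / 2 > 0" using mult.prems by simp
  with mult.IH obtain B C where
    B: "\<And>x. \<bar>f x\<bar> * exp (- (a / 2) * (norm x)\<^sup>2) \<le> B" and C: "\<And>x. \<bar>g x\<bar> * exp (- (a / 2) * (norm x)\<^sup>2) \<le> C"
    by blast
  have "\<bar>f x * g x\<bar> * exp (- a * (norm x)\<^sup>2) \<le> B * C" for x
  proof -
    have "exp (- a * (norm x)\<^sup>2) = exp (- (a / 2) * (norm x)\<^sup>2) * exp (- (a / 2) * (norm x)\<^sup>2)"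
      by (simp add: exp_add[symmetric])
    then have "\<bar>f x * g x\<bar> * exp (- a * (norm x)\<^sup>2) =
        (\<bar>f x\<bar> * exp (- (a / 2) * (norm x)\<^sup>2)) * (\<bar>g x\<bar> * exp (- (a / 2) * (norm x)\<^sup>2))"
      by (simp only: abs_mult mult_ac)
    also have "\<dots> \<le> B * C"
      by (intro mult_mono B C mult_nonneg_nonneg order_trans[OF _ B[of x]]) auto
    finally show ?thesis .
  qed
  then show ?case by blast
qed

lemma continuous_on_real_polynomial_function: "real_polynomial_function p \<Longrightarrow> continuous_on S p"
  by (intro continuous_on_polymonial_function) (simp add: real_polynomial_function_eq)

lemma measurable_real_polynomial_gauss:
  fixes p :: "real ^ 'n::finite \<Rightarrow> real"
  assumes "real_polynomial_function p"
  shows "(\<lambda>x. of_real (p x) * gauss a x) \<in> borel_measurable lebesgue"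
  by (intro lebesgue_borel(3) borel_measurable_continuous_onI continuous_intros
      continuous_on_real_polynomial_function assms)

text \<open>The algebra generated by the coordinates and \<open>e\<^bsup>-|x|\<^sup>2/4\<^esup>\<close>. The orthogonality relations will extend
  from polynomials to this algebra, which contains enough bounded functions for the
  Stone-Weierstrass theorem.\<close>

inductive gauss_poly :: "(real ^ 'n::finite \<Rightarrow> real) \<Rightarrow> bool" where
  base: "real_polynomial_function p \<Longrightarrow> gauss_poly (\<lambda>x. p x * exp (- (1/4) * (norm x)\<^sup>2) ^ j)"
| add: "gauss_poly f \<Longrightarrow> gauss_poly g \<Longrightarrow> gauss_poly (\<lambda>x. f x + g x)"

lemma gauss_poly_mult:
  assumes "gauss_poly f" "gauss_poly g"
  shows "gauss_poly (\<lambda>x. f x * g x)"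
  using assms(1)
proof (induction rule: gauss_poly.induct)
  case f: (base p j)
  show ?case
    using assms(2)
  proof (induction rule: gauss_poly.induct)
    case (base q k)
    from gauss_poly.base[OF real_polynomial_function.intros(4)[OF f base], of "j + k"]
    moreover have "p x * exp (- (1/4) * (norm x)\<^sup>2) ^ j * (q x * exp (- (1/4) * (norm x)\<^sup>2) ^ k)
        = p x * q x * exp (- (1/4) * (norm x)\<^sup>2) ^ (j + k)" for x
      unfolding power_add by algebra
    ultimately show ?case by (simp only:)
  qed (simp only: ring_distribs gauss_poly.add)
qed (simp only: ring_distribs gauss_poly.add)

lemma lebesgue_ex_borel:
  fixes f :: "'a::euclidean_space \<Rightarrow> complex"
  assumes [measurable]: "f \<in> borel_measurable lebesgue"
  obtains g where "g \<in> borel_measurable borel" "AE x in lebesgue. f x = g x"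
proof -
  have "(\<lambda>x. Re (f x)) \<in> borel_measurable lebesgue" "(\<lambda>x. Im (f x)) \<in> borel_measurable lebesgue"
    by measurable
  then obtain a b where ab: "a \<in> borel_measurable lborel" "AE x in lborel. Re (f x) = a x"
      "b \<in> borel_measurable lborel" "AE x in lborel. Im (f x) = b x"
    using completion_ex_borel_measurable_real by metis
  have [measurable]: "a \<in> borel_measurable borel" "b \<in> borel_measurable borel"
    using ab by auto
  have "(\<lambda>x. Complex (a x) (b x)) \<in> borel_measurable borel"
    unfolding Complex_eq by measurable
  moreover have "AE x in lborel. f x = Complex (a x) (b x)"
    using ab(2,4) by eventually_elim (simp add: complex_eq_iff)
  then have "AE x in lebesgue. f x = Complex (a x) (b x)"
    by (rule AE_completion)
  ultimately show ?thesis by (rule that)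
qed

lemma AE_eq_0_if_integral_sets_eq_0:
  fixes g :: "'a::euclidean_space \<Rightarrow> real"
  assumes int: "integrable lborel g" and z: "\<And>A. A \<in> sets borel \<Longrightarrow> (\<integral>x. indicator A x * g x \<partial>lborel) = 0"
  shows "AE x in lborel. g x = 0"
proof -
  have [measurable]: "g \<in> borel_measurable borel"
    using borel_measurable_integrable[OF int] by simp
  have "AE x in lborel. indicator {x. 0 < s * g x} x * (s * g x) = 0" for s :: real
  proof -
    let ?A = "{x. 0 < s * g x}"
    have A: "?A \<in> sets borel" by measurable
    have i: "integrable lborel (\<lambda>x. indicator ?A x * g x)"
      using integrable_mult_indicator[of ?A lborel g] A int by simp
    have "(\<integral>x. indicator ?A x * (s * g x) \<partial>lborel) = 0"
      using z[OF A] by (simp add: mult.left_commute[of _ s])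
    then show ?thesis
      using integral_nonneg_eq_0_iff_AE[of lborel "\<lambda>x. indicator ?A x * (s * g x)"] i
      by (auto simp: mult.left_commute[of _ s] split: split_indicator)
  qed
  from this[of 1] this[of "-1"] show ?thesis
    by eventually_elim (auto split: split_indicator_asm)
qed

text \<open>The closed sets generate the Borel sets and are stable under intersection, so the integrals vanish
  over all Borel sets.\<close>

lemma AE_eq_0_if_integral_closed_eq_0:
  fixes f :: "'a::euclidean_space \<Rightarrow> complex"
  assumes int: "integrable lebesgue f" and z: "\<And>C. closed C \<Longrightarrow> (\<integral>x. indicator C x *\<^sub>R f x \<partial>lebesgue) = 0"
  shows "AE x in lebesgue. f x = 0"
proof -
  obtain g where g: "g \<in> borel_measurable borel" "AE x in lebesgue. f x = g x"
    using lebesgue_ex_borel borel_measurable_integrable[OF int] by blast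
  have [measurable]: "g \<in> borel_measurable borel" "f \<in> borel_measurable lebesgue"
    using g borel_measurable_integrable[OF int] by auto
  have gm: "g \<in> borel_measurable lebesgue" by (rule lebesgue_borel(3)) (rule g)
  have "integrable lebesgue g"
    using int g(2) gm by (subst integrable_cong_AE[of _ _ f]) auto
  then have ig: "integrable lborel g" by (simp add: lebesgue_borel(1)[OF g(1)])
  have ind: "integrable lborel (\<lambda>x. indicator A x *\<^sub>R g x)" if "A \<in> sets borel" for A
    using integrable_mult_indicator[of A lborel g] that ig by simp
  have closed: "(\<integral>x. indicator C x *\<^sub>R g x \<partial>lborel) = 0" if "closed C" for C
  proof -
    have C: "C \<in> sets borel" using that by simp
    have "(\<integral>x. indicator C x *\<^sub>R g x \<partial>lborel) = (\<integral>x. indicator C x *\<^sub>R g x \<partial>lebesgue)"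
      by (intro lebesgue_borel(2)[symmetric] borel_measurable_scaleR borel_measurable_indicator C g(1))
    also have "\<dots> = (\<integral>x. indicator C x *\<^sub>R f x \<partial>lebesgue)"
      using g(2) C by (intro integral_cong_AE borel_measurable_scaleR borel_measurable_indicator gm) auto
    finally show ?thesis using z[OF that] by simp
  qed
  have all: "(\<integral>x. indicator A x *\<^sub>R g x \<partial>lborel) = 0" if "A \<in> sets borel" for A
  proof -
    have sb: "sets (borel :: 'a measure) = sigma_sets UNIV (Collect closed)"
      by (subst borel_eq_closed) simp
    have "Int_stable (Collect (closed :: 'a set \<Rightarrow> bool))"
      by (auto simp: Int_stable_def)
    moreover have "Collect closed \<subseteq> Pow (UNIV :: 'a set)" by simp
    moreover note that[unfolded sb]
    ultimately show ?thesis
    proof (induction A rule: sigma_sets_induct_disjoint)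
      case (basic A)
      then show ?case using closed by simp
    next
      case (compl A)
      have A: "A \<in> sets borel" using compl by (simp add: sb)
      have "indicator (UNIV - A) x *\<^sub>R g x = g x - indicator A x *\<^sub>R g x" for x
        by (auto split: split_indicator)
      then have "(\<integral>x. indicator (UNIV - A) x *\<^sub>R g x \<partial>lborel) = (\<integral>x. g x \<partial>lborel) - 0"
        using Bochner_Integration.integral_diff[OF ig ind[OF A]] compl by simp
      then show ?case using closed[of UNIV] by simp
    next
      case (union A)
      have A: "A i \<in> sets borel" for i using union by (auto simp: sb)
      then have U: "(\<Union>i. A i) \<in> sets borel" by auto
      have "(LINT x:(\<Union>i. A i)|lborel. g x) = (\<Sum>i. (LINT x:(A i)|lborel. g x))"
      proof (rule lebesgue_integral_countable_add)
        show "A i \<inter> A j = {}" if "i \<noteq> j" for i j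
          using union(1) that by (auto simp: disjoint_family_on_def)
        show "set_integrable lborel (\<Union>i. A i) g"
          unfolding set_integrable_def by (rule ind[OF U])
      qed (use A in simp)
      then show ?case
        using union by (simp add: set_lebesgue_integral_def)
    qed auto
  qed
  have ReIm: "AE x in lborel. T (g x) = 0" if T: "bounded_linear T" for T :: "complex \<Rightarrow> real"
  proof (rule AE_eq_0_if_integral_sets_eq_0)
    interpret T: bounded_linear T by (rule T)
    show "integrable lborel (\<lambda>x. T (g x))"
      by (rule integrable_bounded_linear[OF T ig])
    fix A :: "'a set" assume A: "A \<in> sets borel"
    have "(\<integral>x. indicator A x * T (g x) \<partial>lborel) = (\<integral>x. T (indicator A x *\<^sub>R g x) \<partial>lborel)"
      by (simp add: T.scaleR)
    also have "\<dots> = T (\<integral>x. indicator A x *\<^sub>R g x \<partial>lborel)"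
      by (rule integral_bounded_linear[OF T ind[OF A]])
    finally show "(\<integral>x. indicator A x * T (g x) \<partial>lborel) = 0"
      using all[OF A] by (simp add: T.zero)
  qed
  have "AE x in lborel. g x = 0"
    using ReIm[OF bounded_linear_Re] ReIm[OF bounded_linear_Im]
    by eventually_elim (simp add: complex_eq_iff)
  then have "AE x in lebesgue. g x = 0" by (rule AE_completion)
  with g(2) show ?thesis by eventually_elim simp
qed

lemma real_polynomial_norm_square: "real_polynomial_function (\<lambda>x :: real ^ 'n::finite. c * (norm x)\<^sup>2)"
proof -
  have "(\<lambda>x :: real ^ 'n. c * (norm x)\<^sup>2) = (\<lambda>x. c * (\<Sum>i\<in>UNIV. x $ i * x $ i))"
    unfolding power2_norm_eq_inner inner_vec_def by (simp only: inner_real_def)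
  moreover have "real_polynomial_function (\<lambda>x :: real ^ 'n. c * (\<Sum>i\<in>UNIV. x $ i * x $ i))"
    by (intro real_polynomial_function.intros(4) real_polynomial_function.intros(2) real_polynomial_function_sum
        real_polynomial_function.intros(1) bounded_linear_vec_nth) auto
  ultimately show ?thesis by (simp only:)
qed

text \<open>Integrability against Gaussians, rather than membership in \<open>L\<^sup>2\<close>, is what the argument needs. It
  covers bounded functions and integrable functions of compact support as well.\<close>

locale hermite_orthogonal =
  fixes u :: "real ^ 'n::finite \<Rightarrow> complex"
  assumes meas: "u \<in> borel_measurable lebesgue"
    and int: "\<And>a. a > 0 \<Longrightarrow> integrable lebesgue (\<lambda>x. u x * gauss a x)"
    and inth: "\<And>\<alpha>. integrable lebesgue (\<lambda>x. u x * hermite_fun \<alpha> x)"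
    and orth: "\<And>\<alpha>. (\<integral>x. u x * hermite_fun \<alpha> x \<partial>lebesgue) = 0"
begin

lemma integrable_polynomial_gauss:
  assumes p: "real_polynomial_function p" and a: "a > 0"
  shows "integrable lebesgue (\<lambda>x. u x * (of_real (p x) * gauss a x))"
proof -
  obtain B where B: "\<And>x. \<bar>p x\<bar> * exp (- (a / 2) * (norm x)\<^sup>2) \<le> B"
    using polynomial_gauss_bounded[OF p, of "a / 2"] a by auto
  have "integrable lebesgue (\<lambda>x. of_real B * (u x * gauss (a / 2) x))"
    using int[of "a / 2"] a by (intro integrable_mult_right) auto
  then show ?thesis
  proof (rule Bochner_Integration.integrable_bound)
    show "(\<lambda>x. u x * (of_real (p x) * gauss a x)) \<in> borel_measurable lebesgue"
      by (intro borel_measurable_times meas measurable_real_polynomial_gauss p)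
    show "AE x in lebesgue. norm (u x * (of_real (p x) * gauss a x)) \<le> norm (of_real B * (u x * gauss (a / 2) x))"
    proof (intro AE_I2)
      fix x :: "real ^ 'n"
      have "exp (- a * (norm x)\<^sup>2) = exp (- (a / 2) * (norm x)\<^sup>2) * exp (- (a / 2) * (norm x)\<^sup>2)"
        by (simp add: exp_add[symmetric])
      note e = this
      have "norm (u x * (of_real (p x) * gauss a x)) = \<bar>p x\<bar> * (cmod (u x) * exp (- a * (norm x)\<^sup>2))"
        by (simp only: norm_mult norm_of_real abs_exp_cancel mult_ac)
      also have "\<dots> =
          (\<bar>p x\<bar> * exp (- (a / 2) * (norm x)\<^sup>2)) * (cmod (u x) * exp (- (a / 2) * (norm x)\<^sup>2))"
        unfolding e by (simp only: mult_ac)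
      also have "\<dots> \<le> \<bar>B\<bar> * (cmod (u x) * exp (- (a / 2) * (norm x)\<^sup>2))"
        using B[of x] by (intro mult_right_mono) auto
      finally show "norm (u x * (of_real (p x) * gauss a x)) \<le> norm (of_real B * (u x * gauss (a / 2) x))"
        by (simp only: norm_mult norm_of_real abs_exp_cancel)
    qed
  qed
qed

text \<open>Multiplication by polynomials preserves the span of the Hermite functions, and \<open>h\<^sub>0\<close> is a multiple
  of \<open>e\<^bsup>-|x|\<^sup>2/2\<^esup>\<close>.\<close>

lemma orthogonal_half:
  assumes p: "real_polynomial_function p"
  shows "(\<integral>x. u x * (of_real (p x) * gauss (1/2) x) \<partial>lebesgue) = 0"
proof -
  have *: "(\<integral>x. u x * v x \<partial>lebesgue) = 0 \<and> integrable lebesgue (\<lambda>x. u x * v x)" if "v \<in> hspan" for v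
    using that
  proof (induction rule: hspan.induct)
    case (hspan_insert f c \<alpha>)
    have e: "(\<lambda>x. u x * (c * hermite_fun \<alpha> x + f x)) = (\<lambda>x. c * (u x * hermite_fun \<alpha> x) + u x * f x)"
      by (simp add: fun_eq_iff algebra_simps)
    have i: "integrable lebesgue (\<lambda>x. c * (u x * hermite_fun \<alpha> x))"
      using inth by (rule integrable_mult_right)
    show ?case
      unfolding e using hspan_insert.IH Bochner_Integration.integrable_add[OF i]
        Bochner_Integration.integral_add[OF i] orth[of \<alpha>] by simp
  qed simp
  obtain d where d: "d > 0" "\<And>x::real ^ 'n. hermite_fun (\<lambda>i. 0) x = of_real d * gauss (1/2) x"
    using hermite_fun_0_gauss by blast
  have "(\<integral>x. u x * (of_real (p x) * hermite_fun (\<lambda>i. 0) x) \<partial>lebesgue) = 0"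
    using *[OF hspan_polynomial[OF p hspan_hermite_fun]] by blast
  then have "(\<integral>x. of_real d * (u x * (of_real (p x) * gauss (1/2) x)) \<partial>lebesgue) = 0"
    unfolding d(2) by (simp only: mult.left_commute)
  then show ?thesis using d(1) by (simp only: integral_mult_right_zero) simp
qed

text \<open>Expand the additional factor \<open>e\<^bsup>-|x|\<^sup>2/4\<^esup>\<close> into its Taylor series: the partial sums are polynomials,
  and after multiplication by \<open>e\<^bsup>-a |x|\<^sup>2\<^esup>\<close> they are dominated by \<open>e\<^bsup>-(a - 1/4) |x|\<^sup>2\<^esup>\<close>, where still
  \<open>a - 1/4 > 0\<close>.\<close>

lemma orthogonal_step:
  assumes a: "a \<ge> 1/2"
    and z: "\<And>p. real_polynomial_function p \<Longrightarrow> (\<integral>x. u x * (of_real (p x) * gauss a x) \<partial>lebesgue) = 0"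
    and p: "real_polynomial_function p"
  shows "(\<integral>x. u x * (of_real (p x) * gauss (a + 1/4) x) \<partial>lebesgue) = 0"
proof -
  define q where "q x = - (1/4) * (norm x)\<^sup>2" for x :: "real ^ 'n"
  define S where "S N x = (\<Sum>k<N. q x ^ k /\<^sub>R fact k)" for N x
  have q: "real_polynomial_function q"
    unfolding q_def by (rule real_polynomial_norm_square)
  have S: "real_polynomial_function (\<lambda>x. p x * S N x)" for N
    unfolding S_def real_scaleR_def
    by (intro real_polynomial_function.intros(4) p real_polynomial_function_sum
        real_polynomial_function.intros(2) real_polynomial_function_power q) auto
  let ?s = "\<lambda>N x. u x * (of_real (p x * S N x) * gauss a x)"
  let ?f = "\<lambda>x. u x * (of_real (p x) * gauss (a + 1/4) x)"
  let ?w = "\<lambda>x. norm (u x * (of_real (p x) * gauss (a - 1/4) x))"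
  have "(\<lambda>N. \<integral>x. ?s N x \<partial>lebesgue) \<longlonglongrightarrow> (\<integral>x. ?f x \<partial>lebesgue)"
  proof (rule integral_dominated_convergence[where w = ?w])
    show "?f \<in> borel_measurable lebesgue" "\<And>N. ?s N \<in> borel_measurable lebesgue"
      by (intro borel_measurable_times meas measurable_real_polynomial_gauss p S)+
    show "integrable lebesgue ?w"
      using a by (intro integrable_norm integrable_polynomial_gauss p) auto
    show "AE x in lebesgue. (\<lambda>N. ?s N x) \<longlonglongrightarrow> ?f x"
    proof (intro AE_I2)
      fix x
      have "(\<lambda>N. S N x) \<longlonglongrightarrow> exp (q x)"
        unfolding S_def using exp_converges[of "q x"] by (simp add: sums_def)
      then have "(\<lambda>N. ?s N x) \<longlonglongrightarrow> u x * (of_real (p x * exp (q x)) * gauss a x)"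
        by (intro tendsto_intros)
      also have "exp (q x) * exp (- a * (norm x)\<^sup>2) = exp (- (a + 1/4) * (norm x)\<^sup>2)"
        by (simp add: exp_add[symmetric] q_def algebra_simps)
      then have "of_real (p x * exp (q x)) * gauss a x = of_real (p x) * gauss (a + 1/4) x"
        by (metis (no_types, lifting) mult.assoc of_real_mult)
      finally show "(\<lambda>N. ?s N x) \<longlonglongrightarrow> ?f x" .
    qed
    show "AE x in lebesgue. norm (?s N x) \<le> ?w x" for N
    proof (intro AE_I2)
      fix x
      have "\<bar>S N x\<bar> \<le> (\<Sum>k<N. \<bar>q x\<bar> ^ k /\<^sub>R fact k)"
        unfolding S_def by (rule order_trans[OF sum_abs]) (simp add: abs_mult power_abs)
      also have "\<dots> \<le> (\<Sum>k. \<bar>q x\<bar> ^ k /\<^sub>R fact k)"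
        by (rule sum_le_suminf[OF summable_exp_generic]) auto
      also have "\<dots> = exp \<bar>q x\<bar>" by (rule sums_unique[OF exp_converges, symmetric])
      finally have le: "\<bar>S N x\<bar> \<le> exp \<bar>q x\<bar>" .
      have "\<bar>q x\<bar> = 1/4 * (norm x)\<^sup>2" by (simp add: q_def)
      then have ee: "exp \<bar>q x\<bar> * exp (- a * (norm x)\<^sup>2) = exp (- (a - 1/4) * (norm x)\<^sup>2)"
        by (simp add: exp_add[symmetric] algebra_simps)
      have "norm (?s N x) = cmod (u x) * \<bar>p x\<bar> * (\<bar>S N x\<bar> * exp (- a * (norm x)\<^sup>2))"
        by (simp only: norm_mult norm_of_real abs_mult abs_exp_cancel mult.assoc)
      also have "\<dots> \<le> cmod (u x) * \<bar>p x\<bar> * (exp \<bar>q x\<bar> * exp (- a * (norm x)\<^sup>2))"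
        using le by (intro mult_left_mono mult_right_mono) auto
      also have "\<dots> = ?w x"
        unfolding ee by (simp only: norm_mult norm_of_real abs_exp_cancel mult.assoc)
      finally show "norm (?s N x) \<le> ?w x" .
    qed
  qed
  then have "(\<lambda>N. 0) \<longlonglongrightarrow> (\<integral>x. ?f x \<partial>lebesgue)"
    unfolding z[OF S] .
  from LIMSEQ_unique[OF this tendsto_const] show ?thesis .
qed

lemma orthogonal_level:
  "real_polynomial_function p \<Longrightarrow> (\<integral>x. u x * (of_real (p x) * gauss (1/2 + real j / 4) x) \<partial>lebesgue) = 0"
proof (induction j arbitrary: p)
  case 0
  then show ?case using orthogonal_half by simp
next
  case (Suc j)
  have "1/2 + real (Suc j) / 4 = (1/2 + real j / 4) + 1/4" by (simp add: field_simps)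
  then show ?case
    using orthogonal_step[of "1/2 + real j / 4" p] Suc by auto
qed

lemma orthogonal_gauss_poly:
  assumes "gauss_poly G"
  shows "(\<integral>x. (u x * gauss (1/2) x) * of_real (G x) \<partial>lebesgue) = 0 \<and>
    integrable lebesgue (\<lambda>x. (u x * gauss (1/2) x) * of_real (G x))"
  using assms
proof (induction rule: gauss_poly.induct)
  case (base p j)
  have "exp (- (1/2) * (norm x)\<^sup>2) * exp (- (1/4) * (norm x)\<^sup>2) ^ j = exp (- (1/2 + real j / 4) * (norm x)\<^sup>2)"
    for x :: "real ^ 'n"
    by (simp add: exp_of_nat_mult[symmetric] exp_add[symmetric] algebra_simps)
  then have e: "(u x * gauss (1/2) x) * of_real (p x * exp (- (1/4) * (norm x)\<^sup>2) ^ j)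
      = u x * (of_real (p x) * gauss (1/2 + real j / 4) x)" for x
    by (metis (no_types, lifting) mult.assoc mult.left_commute of_real_mult)
  show ?case
    unfolding e using orthogonal_level[OF base] integrable_polynomial_gauss[OF base, of "1/2 + real j / 4"]
    by (auto simp: add_pos_nonneg)
next
  case (add f g)
  then show ?case
    by (simp add: ring_distribs)
qed

text \<open>The points \<open>(e\<^bsup>-|x|\<^sup>2/4\<^esup>, e\<^bsup>-|x|\<^sup>2/4\<^esup> x)\<close> determine \<open>x\<close> and stay in a compact set. There polynomials
  are uniformly dense in the continuous functions, and a polynomial of these points belongs to
  \<^const>\<open>gauss_poly\<close>.\<close>

lemma orthogonal_compactified:
  fixes \<psi> :: "real \<times> (real ^ 'n) \<Rightarrow> real"
  assumes \<psi>: "continuous_on UNIV \<psi>"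
  defines "\<Phi> \<equiv> \<lambda>x :: real ^ 'n. (exp (- (1/4) * (norm x)\<^sup>2), exp (- (1/4) * (norm x)\<^sup>2) *\<^sub>R x)"
  shows "(\<integral>x. (u x * gauss (1/2) x) * of_real (\<psi> (\<Phi> x)) \<partial>lebesgue) = 0"
proof -
  let ?W = "\<lambda>x. u x * gauss (1/2) x"
  have W: "integrable lebesgue ?W" by (rule int) simp
  have cont: "continuous_on UNIV \<Phi>"
    unfolding \<Phi>_def by (intro continuous_intros)
  have K: "\<Phi> x \<in> cball 0 2" for x
  proof -
    let ?E = "exp (- (1/4) * (norm x)\<^sup>2)"
    have "norm x \<le> 1 + 1/4 * (norm x)\<^sup>2"
      using zero_le_power2[of "norm x / 2 - 1"] by (simp add: power2_eq_square algebra_simps)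
    also have "\<dots> \<le> exp (1/4 * (norm x)\<^sup>2)" by (rule exp_ge_add_one_self)
    finally have "?E * norm x \<le> ?E * exp (1/4 * (norm x)\<^sup>2)" by (intro mult_left_mono) auto
    also have "\<dots> = 1" by (simp add: exp_add[symmetric])
    finally have "?E * norm x \<le> 1" .
    moreover have "?E \<le> 1" by simp
    moreover have "norm ?E + norm (?E *\<^sub>R x) = ?E + ?E * norm x" by simp
    ultimately have "norm ?E + norm (?E *\<^sub>R x) \<le> 2" by linarith
    then show ?thesis
      unfolding \<Phi>_def using norm_Pair_le[of ?E "?E *\<^sub>R x"] by simp
  qed
  have \<psi>\<Phi>: "(\<lambda>x. complex_of_real (\<psi> (\<Phi> x))) \<in> borel_measurable (lebesgue :: (real ^ 'n) measure)"
    if "continuous_on UNIV \<psi>" for \<psi> :: "real \<times> (real ^ 'n) \<Rightarrow> real"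
    using continuous_on_compose2[OF that cont]
    by (intro lebesgue_borel(3) borel_measurable_continuous_onI continuous_intros) auto
  have "cmod (\<integral>x. ?W x * of_real (\<psi> (\<Phi> x)) \<partial>lebesgue) \<le> 0 + e * (\<integral>x. cmod (?W x) \<partial>lebesgue)"
    if e: "e > 0" for e
  proof -
    define P where "P G \<longleftrightarrow> continuous_on UNIV G \<and> gauss_poly (\<lambda>x. G (\<Phi> x))" for G :: "real \<times> (real ^ 'n) \<Rightarrow> real"
    have "\<exists>G. P G \<and> (\<forall>z\<in>cball 0 2. \<bar>\<psi> z - G z\<bar> < e)"
    proof (rule Stone_Weierstrass_HOL)
      show "compact (cball 0 2 :: (real \<times> (real ^ 'n)) set)" by simp
      show "P (\<lambda>z. c)" for c
        unfolding P_def using gauss_poly.base[OF real_polynomial_function.intros(2), of c 0] by simp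
      show "continuous_on (cball 0 2) G" if "P G" for G
        using that unfolding P_def by (auto intro: continuous_on_subset)
      show "P (\<lambda>z. G z + G' z)" if "P G \<and> P G'" for G G'
        using that unfolding P_def by (auto intro: gauss_poly.add continuous_intros)
      show "P (\<lambda>z. G z * G' z)" if "P G \<and> P G'" for G G'
        using that unfolding P_def by (auto intro: gauss_poly_mult continuous_intros)
      have Pf: "P fst"
        unfolding P_def \<Phi>_def
        using gauss_poly.base[OF real_polynomial_function.intros(2), of 1 1]
        by (auto intro: continuous_intros)
      have Ps: "P (\<lambda>z. snd z $ i)" for i
        unfolding P_def \<Phi>_def
        using gauss_poly.base[OF real_polynomial_function.intros(1)[OF bounded_linear_vec_nth], of i 1]
        by (auto intro!: continuous_intros simp: mult.commute)
      show "\<exists>G. P G \<and> G z \<noteq> G z'" if "z \<in> cball 0 2 \<and> z' \<in> cball 0 2 \<and> z \<noteq> z'" for z z'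
      proof (cases "fst z = fst z'")
        case True
        then have "snd z \<noteq> snd z'" using that by (auto simp: prod_eq_iff)
        then obtain i where "snd z $ i \<noteq> snd z' $ i" by (auto simp: vec_eq_iff)
        with Ps show ?thesis by blast
      qed (use Pf in blast)
      show "continuous_on (cball 0 2) \<psi>" using \<psi> by (rule continuous_on_subset) auto
    qed (rule e)
    then obtain G where G: "P G" "\<And>z. z \<in> cball 0 2 \<Longrightarrow> \<bar>\<psi> z - G z\<bar> < e" by blast
    have Gz: "(\<integral>x. ?W x * of_real (G (\<Phi> x)) \<partial>lebesgue) = 0"
      "integrable lebesgue (\<lambda>x. ?W x * of_real (G (\<Phi> x)))"
      using orthogonal_gauss_poly G(1) by (auto simp: P_def)
    have d: "integrable lebesgue (\<lambda>x. ?W x * of_real (\<psi> (\<Phi> x) - G (\<Phi> x))) \<and>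
      cmod (\<integral>x. ?W x * of_real (\<psi> (\<Phi> x) - G (\<Phi> x)) \<partial>lebesgue) \<le> (\<integral>x. e * cmod (?W x) \<partial>lebesgue)"
    proof
      have b: "norm (?W x * of_real (\<psi> (\<Phi> x) - G (\<Phi> x))) \<le> e * cmod (?W x)" for x
      proof -
        have "norm (?W x * of_real (\<psi> (\<Phi> x) - G (\<Phi> x))) = cmod (?W x) * \<bar>\<psi> (\<Phi> x) - G (\<Phi> x)\<bar>"
          by (simp only: norm_mult norm_of_real)
        also have "\<dots> \<le> cmod (?W x) * e"
          using G(2)[OF K[of x]] by (intro mult_left_mono) auto
        finally show ?thesis
          by (simp only: mult.commute)
      qed
      have i: "integrable lebesgue (\<lambda>x. e * cmod (?W x))"
        using W by (intro integrable_mult_right integrable_norm)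
      show d: "integrable lebesgue (\<lambda>x. ?W x * of_real (\<psi> (\<Phi> x) - G (\<Phi> x)))"
      proof (rule Bochner_Integration.integrable_bound[OF i])
        have "(\<lambda>x. complex_of_real (\<psi> (\<Phi> x) - G (\<Phi> x))) \<in> borel_measurable lebesgue"
          using G(1) \<psi> unfolding P_def of_real_diff
          by (intro borel_measurable_diff \<psi>\<Phi>) auto
        then show "(\<lambda>x. ?W x * of_real (\<psi> (\<Phi> x) - G (\<Phi> x))) \<in> borel_measurable lebesgue"
          by (rule borel_measurable_times[OF borel_measurable_integrable[OF W]])
        show "AE x in lebesgue. norm (?W x * of_real (\<psi> (\<Phi> x) - G (\<Phi> x))) \<le> norm (e * cmod (?W x))"
          by (intro AE_I2 order_trans[OF b]) simp
      qed
      show "cmod (\<integral>x. ?W x * of_real (\<psi> (\<Phi> x) - G (\<Phi> x)) \<partial>lebesgue) \<le> (\<integral>x. e * cmod (?W x) \<partial>lebesgue)"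
        by (rule order_trans[OF integral_norm_bound integral_mono[OF integrable_norm[OF d] i b]])
    qed
    have "(\<integral>x. ?W x * of_real (\<psi> (\<Phi> x)) \<partial>lebesgue) =
        (\<integral>x. ?W x * of_real (\<psi> (\<Phi> x) - G (\<Phi> x)) + ?W x * of_real (G (\<Phi> x)) \<partial>lebesgue)"
      by (simp add: algebra_simps)
    also have "\<dots> = (\<integral>x. ?W x * of_real (\<psi> (\<Phi> x) - G (\<Phi> x)) \<partial>lebesgue)"
      using Bochner_Integration.integral_add[OF conjunct1[OF d] Gz(2)] Gz(1) by simp
    finally show ?thesis using d by simp
  qed
  note small = this
  have "cmod (\<integral>x. ?W x * of_real (\<psi> (\<Phi> x)) \<partial>lebesgue) \<le> 0 + d" if "d > 0" for d
  proof -
    define c where "c = (\<integral>x. cmod (?W x) \<partial>lebesgue)"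
    have c: "c \<ge> 0" unfolding c_def by (rule Bochner_Integration.integral_nonneg) simp
    have "cmod (\<integral>x. ?W x * of_real (\<psi> (\<Phi> x)) \<partial>lebesgue) \<le> 0 + d / (c + 1) * c"
      unfolding c_def by (rule small, fold c_def) (use that c in simp)
    also have "\<dots> \<le> 0 + d" using that c by (simp add: field_simps)
    finally show ?thesis .
  qed
  then have "cmod (\<integral>x. ?W x * of_real (\<psi> (\<Phi> x)) \<partial>lebesgue) \<le> 0"
    by (rule field_le_epsilon)
  then show ?thesis by simp
qed

text \<open>In the coordinates \<open>s = e\<^bsup>-|x|\<^sup>2/4\<^esup>\<close> and \<open>y = s x\<close> a function of \<open>x = y / s\<close> is singular at \<open>s = 0\<close>. The factor
  \<open>max 0 (s - d)\<close> removes the singularity; for \<open>d \<rightarrow> 0\<close> it leaves a factor \<open>s\<close>, which raises the exponent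
  from \<open>1/2\<close> to \<open>3/4\<close>.\<close>

lemma orthogonal_bounded_continuous:
  fixes f :: "real ^ 'n \<Rightarrow> real"
  assumes f: "continuous_on UNIV f" and B: "\<And>x. \<bar>f x\<bar> \<le> B"
  shows "(\<integral>x. (u x * gauss (3/4) x) * of_real (f x) \<partial>lebesgue) = 0"
proof -
  let ?W = "\<lambda>x. u x * gauss (1/2) x"
  let ?E = "\<lambda>x :: real ^ 'n. exp (- (1/4) * (norm x)\<^sup>2)"
  let ?d = "\<lambda>n. 1 / real (Suc n)"
  let ?s = "\<lambda>n x. ?W x * of_real (max 0 (?E x - ?d n) * f x)"
  have W: "integrable lebesgue ?W" by (rule int) simp
  have fm: "(\<lambda>x. complex_of_real (h x)) \<in> borel_measurable lebesgue" if "continuous_on UNIV h" for h :: "real ^ 'n \<Rightarrow> real"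
    using that by (intro lebesgue_borel(3) borel_measurable_continuous_onI continuous_intros)
  have z': "(\<integral>x. ?W x * of_real (max 0 (?E x - d) * f x) \<partial>lebesgue) = 0" if d: "d > 0" for d
  proof -
    let ?\<psi> = "\<lambda>(s, y). max 0 (s - d) * f (y /\<^sub>R max s d)"
    have e: "max 0 (?E x - d) * f ((?E x *\<^sub>R x) /\<^sub>R max (?E x) d) = max 0 (?E x - d) * f x" for x
    proof (cases "?E x \<ge> d")
      case True
      then have "max (?E x) d = ?E x" by simp
      then show ?thesis by (simp only:) simp
    next
      case False
      then have "max 0 (?E x - d) = 0" by simp
      then show ?thesis by (simp only: mult_zero_left)
    qed
    have nz: "max s d \<noteq> 0" for s
      using d by (simp add: max_def)
    have c: "continuous_on UNIV ?\<psi>"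
      unfolding split_def
      by (intro continuous_intros continuous_on_compose2[OF f]) (auto simp: nz)
    show ?thesis
      using orthogonal_compactified[OF c] by (simp only: prod.case e)
  qed
  have z: "(\<integral>x. ?s n x \<partial>lebesgue) = 0" for n
    by (rule z') simp
  have "(\<lambda>n. \<integral>x. ?s n x \<partial>lebesgue) \<longlonglongrightarrow> (\<integral>x. ?W x * of_real (?E x * f x) \<partial>lebesgue)"
  proof (rule integral_dominated_convergence[where w = "\<lambda>x. cmod (?W x) * B"])
    show "(\<lambda>x. ?W x * of_real (?E x * f x)) \<in> borel_measurable lebesgue"
      by (rule borel_measurable_times[OF borel_measurable_integrable[OF W] fm])
        (intro continuous_intros f)
    show "?s n \<in> borel_measurable lebesgue" for n
      by (rule borel_measurable_times[OF borel_measurable_integrable[OF W] fm])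
        (intro continuous_intros f)
    show "integrable lebesgue (\<lambda>x. cmod (?W x) * B)"
      using W by (intro integrable_mult_left integrable_norm)
    show "AE x in lebesgue. (\<lambda>n. ?s n x) \<longlonglongrightarrow> ?W x * of_real (?E x * f x)"
    proof (intro AE_I2)
      fix x
      have "?d \<longlonglongrightarrow> 0" using LIMSEQ_inverse_real_of_nat by (simp add: inverse_eq_divide)
      then have "(\<lambda>n. max 0 (?E x - ?d n)) \<longlonglongrightarrow> max 0 (?E x - 0)"
        by (intro tendsto_intros)
      also have "max 0 (?E x - 0) = ?E x" by simp
      finally show "(\<lambda>n. ?s n x) \<longlonglongrightarrow> ?W x * of_real (?E x * f x)"
        by (intro tendsto_intros)
    qed
    show "AE x in lebesgue. norm (?s n x) \<le> cmod (?W x) * B" for n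
    proof (intro AE_I2)
      fix x
      have "?E x \<le> 1" "?d n \<ge> 0" by simp_all
      then have "max 0 (?E x - ?d n) \<le> 1" by (intro max.boundedI) linarith+
      then have "\<bar>max 0 (?E x - ?d n)\<bar> \<le> 1" by (simp only: abs_of_nonneg max.cobounded1)
      then have "\<bar>max 0 (?E x - ?d n)\<bar> * \<bar>f x\<bar> \<le> 1 * B"
        using B[of x] by (intro mult_mono) auto
      then show "norm (?s n x) \<le> cmod (?W x) * B"
        unfolding norm_mult norm_of_real abs_mult by (intro mult_left_mono) auto
    qed
  qed
  then have "(\<lambda>n. 0) \<longlonglongrightarrow> (\<integral>x. ?W x * of_real (?E x * f x) \<partial>lebesgue)"
    unfolding z .
  then have "(\<integral>x. ?W x * of_real (?E x * f x) \<partial>lebesgue) = 0"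
    by (rule LIMSEQ_unique[OF _ tendsto_const])
  moreover have "?W x * of_real (?E x * f x) = (u x * gauss (3/4) x) * of_real (f x)" for x
  proof -
    have "exp (- (1/2) * (norm x)\<^sup>2) * ?E x = exp (- (3/4) * (norm x)\<^sup>2)"
      by (simp add: exp_add[symmetric])
    then have "gauss (1/2) x * of_real (?E x) = gauss (3/4) x"
      by (simp only: of_real_mult[symmetric])
    then show ?thesis
      by (metis (no_types, lifting) mult.assoc of_real_mult)
  qed
  ultimately show ?thesis by (simp only:)
qed

lemma AE_eq_0: "AE x in lebesgue. u x = 0"
proof -
  let ?W = "\<lambda>x. u x * gauss (3/4) x"
  have W: "integrable lebesgue ?W" by (rule int) simp
  have "AE x in lebesgue. ?W x = 0"
  proof (rule AE_eq_0_if_integral_closed_eq_0[OF W])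
    fix C :: "(real ^ 'n) set" assume C: "closed C"
    show "(\<integral>x. indicator C x *\<^sub>R ?W x \<partial>lebesgue) = 0"
    proof (cases "C = {}")
      case False
      define f where "f n x = max 0 (1 - real n * infdist x C)" for n x
      have fc: "continuous_on UNIV (f n)" for n
        unfolding f_def by (intro continuous_intros)
      have fb: "\<bar>f n x\<bar> \<le> 1" for n x
        using infdist_nonneg[of x C] by (simp add: f_def)
      have lim: "(\<lambda>n. f n x) \<longlonglongrightarrow> indicator C x" for x
      proof (cases "x \<in> C")
        case True
        then show ?thesis by (simp add: f_def)
      next
        case out: False
        then have pos: "infdist x C > 0"
          using in_closed_iff_infdist_zero[OF C \<open>C \<noteq> {}\<close>, of x] infdist_nonneg[of x C] by linarith
        obtain N where N: "1 < real N * infdist x C" using reals_Archimedean3[OF pos] by blast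
        have "f n x = 0" if "n \<ge> N" for n
        proof -
          have "real N * infdist x C \<le> real n * infdist x C"
            using that pos by (intro mult_right_mono) auto
          then show ?thesis using N by (simp add: f_def)
        qed
        then have "eventually (\<lambda>n. f n x = indicator C x) sequentially"
          using out by (auto simp: eventually_sequentially)
        then show ?thesis by (rule tendsto_eventually)
      qed
      have "(\<lambda>n. \<integral>x. ?W x * of_real (f n x) \<partial>lebesgue) \<longlonglongrightarrow> (\<integral>x. indicator C x *\<^sub>R ?W x \<partial>lebesgue)"
      proof (rule integral_dominated_convergence[where w = "\<lambda>x. cmod (?W x)"])
        show "(\<lambda>x. indicator C x *\<^sub>R ?W x) \<in> borel_measurable lebesgue"
          using C by (intro borel_measurable_scaleR borel_measurable_indicator borel_measurable_integrable[OF W]) auto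
        have "(\<lambda>x. complex_of_real (f n x)) \<in> borel_measurable lebesgue" for n
          using fc by (intro lebesgue_borel(3) borel_measurable_continuous_onI continuous_intros)
        then show "(\<lambda>x. ?W x * of_real (f n x)) \<in> borel_measurable lebesgue" for n
          by (rule borel_measurable_times[OF borel_measurable_integrable[OF W]])
        show "integrable lebesgue (\<lambda>x. cmod (?W x))"
          using W by (rule integrable_norm)
        show "AE x in lebesgue. (\<lambda>n. ?W x * of_real (f n x)) \<longlonglongrightarrow> indicator C x *\<^sub>R ?W x"
        proof (intro AE_I2)
          fix x
          have "(\<lambda>n. ?W x * of_real (f n x)) \<longlonglongrightarrow> ?W x * of_real (indicator C x)"
            by (intro tendsto_intros lim)
          then show "(\<lambda>n. ?W x * of_real (f n x)) \<longlonglongrightarrow> indicator C x *\<^sub>R ?W x"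
            by (simp only: scaleR_conv_of_real mult.commute)
        qed
        show "AE x in lebesgue. norm (?W x * of_real (f n x)) \<le> cmod (?W x)" for n
          using fb[of n] by (intro AE_I2) (simp only: norm_mult norm_of_real, intro mult_left_le, auto)
      qed
      then have "(\<lambda>n. 0) \<longlonglongrightarrow> (\<integral>x. indicator C x *\<^sub>R ?W x \<partial>lebesgue)"
        unfolding orthogonal_bounded_continuous[OF fc fb] .
      then show ?thesis by (rule LIMSEQ_unique[OF _ tendsto_const])
    qed simp
  qed
  then show ?thesis by eventually_elim simp
qed

end

section \<open>Hermite expansions\<close>

lemma gauss_integrable:
  assumes a: "a > 0"
  shows "integrable lebesgue (gauss a :: real ^ 'n::finite \<Rightarrow> complex)"
proof -
  have e: "gauss a x = (\<Prod>i\<in>UNIV. complex_of_real (exp (- a * (x $ i)\<^sup>2)))" for x :: "real ^ 'n"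
  proof -
    have "- a * (norm x)\<^sup>2 = (\<Sum>i\<in>UNIV. - a * (x $ i)\<^sup>2)"
      unfolding power2_norm_eq_inner inner_vec_def
      by (simp only: inner_real_def power2_eq_square sum_distrib_left)
    then show ?thesis by (simp only: exp_sum finite of_real_prod)
  qed
  have "exp (- a * t\<^sup>2) = sqrt (pi / a) * normal_density 0 (sqrt (1 / (2 * a))) t" for t
  proof -
    have s: "(sqrt (1 / (2 * a)))\<^sup>2 = 1 / (2 * a)" using a by simp
    show ?thesis unfolding normal_density_def s using a by simp
  qed
  then have "integrable lborel (\<lambda>t. complex_of_real (exp (- a * t\<^sup>2)))"
    using a by (auto intro!: integrable_of_real integrable_mult_right simp del: of_real_mult)
  then have int: "integrable lborel (gauss a :: real ^ 'n \<Rightarrow> complex)"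
    unfolding e by (intro lborel_integral_tensor(1))
  have "(gauss a :: real ^ 'n \<Rightarrow> complex) \<in> borel_measurable borel"
    using borel_measurable_integrable[OF int] by simp
  from lebesgue_borel(1)[OF this] int show ?thesis by blast
qed

lemma gauss_L2:
  assumes a: "a > 0"
  shows "gauss a \<in> L2"
proof (rule L2I)
  show "gauss a \<in> borel_measurable lebesgue"
    using gauss_integrable[OF a] by (rule borel_measurable_integrable)
  show "integrable lebesgue (\<lambda>x. norm (gauss (2 * a) x))"
    using gauss_integrable[of "2 * a"] a by (intro integrable_norm) auto
  show "(cmod (gauss a x))\<^sup>2 \<le> norm (gauss (2 * a) x)" for x
    by (simp add: power2_eq_square exp_add[symmetric])
qed

text \<open>The bounded summand makes uniqueness applicable to Fourier integrals before they are known to be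
  square integrable.\<close>

lemma AE_eq_0_if_hermite_coeff_eq_0:
  fixes v w :: "real ^ 'n::finite \<Rightarrow> complex"
  assumes v: "v \<in> L2" and w: "w \<in> borel_measurable lebesgue" "\<And>x. cmod (w x) \<le> B"
    and z: "\<And>\<alpha>. hermite_coeff \<alpha> (\<lambda>x. v x + w x) = 0"
  shows "AE x in lebesgue. v x + w x = 0"
proof -
  have ib: "integrable lebesgue (\<lambda>x. w x * g x)" if "integrable lebesgue g" for g :: "real ^ 'n \<Rightarrow> complex"
  proof (rule Bochner_Integration.integrable_bound[OF integrable_mult_right[OF that, of "of_real B"]])
    show "(\<lambda>x. w x * g x) \<in> borel_measurable lebesgue"
      by (intro borel_measurable_times w borel_measurable_integrable that)
    show "AE x in lebesgue. norm (w x * g x) \<le> norm (of_real B * g x)"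
      using w(2) by (auto simp: norm_mult intro!: AE_I2 mult_right_mono order_trans[OF _ abs_ge_self])
  qed
  interpret hermite_orthogonal "\<lambda>x. v x + w x"
  proof
    show "(\<lambda>x. v x + w x) \<in> borel_measurable lebesgue"
      using L2_measurable[OF v] w by (intro borel_measurable_add)
    show "integrable lebesgue (\<lambda>x. (v x + w x) * gauss a x)" if "a > 0" for a
      unfolding ring_distribs using that
      by (intro Bochner_Integration.integrable_add L2_mult_integrable v gauss_L2 ib gauss_integrable)
    show "integrable lebesgue (\<lambda>x. (v x + w x) * hermite_fun \<alpha> x)" for \<alpha>
      unfolding ring_distribs
      by (intro Bochner_Integration.integrable_add L2_mult_integrable v hermite_fun_L2 ib
          schwartz_integrable hermite_fun_schwartz)
    show "(\<integral>x. (v x + w x) * hermite_fun \<alpha> x \<partial>lebesgue) = 0" for \<alpha>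
      using z by (simp only: hermite_coeff_eq)
  qed
  show ?thesis by (rule AE_eq_0)
qed

lemma hermite_coeff_unique:
  assumes f: "f \<in> L2" and g: "g \<in> L2" and eq: "\<And>\<alpha>. hermite_coeff \<alpha> f = hermite_coeff \<alpha> g"
  shows "AE x in lebesgue. f x = g x"
proof -
  have "AE x in lebesgue. (f x - g x) + 0 = 0"
    by (rule AE_eq_0_if_hermite_coeff_eq_0[where B = 0])
      (auto simp: hermite_coeff_diff f g eq)
  then show ?thesis by simp
qed

lemma hermite_coeff_cong_AE:
  assumes f: "f \<in> L2" and g: "g \<in> borel_measurable lebesgue" and eq: "AE x in lebesgue. f x = g x"
  shows "hermite_coeff \<alpha> f = hermite_coeff \<alpha> g"
  unfolding hermite_coeff_eq
proof (rule integral_cong_AE)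
  show "AE x in lebesgue. f x * hermite_fun \<alpha> x = g x * hermite_fun \<alpha> x"
    using eq by eventually_elim simp
qed (intro borel_measurable_times L2_measurable f hermite_fun_L2 g)+

definition hermite_sum :: "('n::finite \<Rightarrow> nat) set \<Rightarrow> (('n \<Rightarrow> nat) \<Rightarrow> complex) \<Rightarrow> real ^ 'n \<Rightarrow> complex" where
  "hermite_sum A a x = (\<Sum>\<alpha>\<in>A. a \<alpha> * hermite_fun \<alpha> x)"

lemma hermite_sum_hspan: "hermite_sum A a \<in> hspan"
  unfolding hermite_sum_def by (intro hspan_sum hspan_scale hspan_hermite_fun)

lemma hermite_sum_L2: "hermite_sum A a \<in> L2"
  by (intro hspan_L2 hermite_sum_hspan)

lemma hermite_coeff_hermite_sum:
  assumes "finite A"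
  shows "hermite_coeff \<beta> (hermite_sum A a) = (if \<beta> \<in> A then a \<beta> else 0)"
proof -
  have "hermite_coeff \<beta> (hermite_sum A a) = (\<Sum>\<alpha>\<in>A. a \<alpha> * (if \<alpha> = \<beta> then 1 else 0))"
    unfolding hermite_sum_def
    by (subst hermite_coeff_sum) (auto simp: hermite_coeff_scale hermite_coeff_hermite_fun intro: hermite_fun_L2)
  also have "\<dots> = (\<Sum>\<alpha>\<in>A. if \<alpha> = \<beta> then a \<beta> else 0)"
    by (intro sum.cong) auto
  finally show ?thesis using assms by simp
qed

lemma hspan_hermite_sum:
  assumes "f \<in> hspan"
  obtains A a where "finite A" "f = hermite_sum A a"
proof -
  have "\<exists>A a. finite A \<and> f = hermite_sum A a"
    using assms
  proof (induction rule: hspan.induct)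
    case hspan_zero
    show ?case by (intro exI[of _ "{}"]) (auto simp: hermite_sum_def)
  next
    case (hspan_insert f c \<alpha>)
    then obtain A a where A: "finite A" "f = hermite_sum A a" by blast
    let ?b = "\<lambda>\<beta>. (if \<beta> \<in> A then a \<beta> else 0) + (if \<beta> = \<alpha> then c else 0)"
    have "hermite_sum (insert \<alpha> A) ?b x = c * hermite_fun \<alpha> x + f x" for x
    proof -
      have "hermite_sum (insert \<alpha> A) ?b x
          = (\<Sum>\<beta>\<in>insert \<alpha> A. if \<beta> \<in> A then a \<beta> * hermite_fun \<beta> x else 0)
          + (\<Sum>\<beta>\<in>insert \<alpha> A. if \<beta> = \<alpha> then c * hermite_fun \<beta> x else 0)"
        unfolding hermite_sum_def sum.distrib[symmetric] by (intro sum.cong) (auto simp: ring_distribs)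
      also have "(\<Sum>\<beta>\<in>insert \<alpha> A. if \<beta> \<in> A then a \<beta> * hermite_fun \<beta> x else 0) = f x"
        unfolding A(2) hermite_sum_def using A(1) by (intro sum.mono_neutral_cong_right) auto
      also have "(\<Sum>\<beta>\<in>insert \<alpha> A. if \<beta> = \<alpha> then c * hermite_fun \<beta> x else 0) = c * hermite_fun \<alpha> x"
        using A(1) by (subst sum.delta) auto
      finally show ?thesis by simp
    qed
    then show ?case using A(1) by (intro exI[of _ "insert \<alpha> A"] exI[of _ ?b]) (auto simp: fun_eq_iff)
  qed
  then show ?thesis using that by blast
qed

lemma hspan_expansion:
  assumes "f \<in> hspan"
  obtains A where "finite A" "f = hermite_sum A (\<lambda>\<alpha>. hermite_coeff \<alpha> f)"
    "\<forall>\<alpha>. \<alpha> \<notin> A \<longrightarrow> hermite_coeff \<alpha> f = 0"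
proof -
  obtain A a where A: "finite A" "f = hermite_sum A a" using hspan_hermite_sum[OF assms] .
  have c: "hermite_coeff \<beta> f = (if \<beta> \<in> A then a \<beta> else 0)" for \<beta>
    by (simp add: A hermite_coeff_hermite_sum)
  have "hermite_sum A (\<lambda>\<alpha>. hermite_coeff \<alpha> f) = f"
    unfolding c by (subst A(2)) (auto simp: hermite_sum_def fun_eq_iff intro: sum.cong)
  then show ?thesis using that[of A] A(1) c by auto
qed

lemma hermite_sum_diff:
  assumes "finite A" "B \<subseteq> A"
  shows "(\<lambda>x. hermite_sum A a x - hermite_sum B a x) = hermite_sum (A - B) a"
  unfolding hermite_sum_def by (rule ext) (rule sum_diff[OF assms, symmetric])

lemma integral_mult_cnj_hermite_sum:
  assumes f: "f \<in> L2"
  shows "(\<integral>x. f x * cnj (hermite_sum A a x) \<partial>lebesgue) = (\<Sum>\<alpha>\<in>A. cnj (a \<alpha>) * hermite_coeff \<alpha> f)"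
proof -
  have i: "integrable lebesgue (\<lambda>x. f x * hermite_fun \<alpha> x)" for \<alpha>
    by (intro L2_mult_integrable f hermite_fun_L2)
  have "(\<integral>x. f x * cnj (hermite_sum A a x) \<partial>lebesgue)
      = (\<integral>x. (\<Sum>\<alpha>\<in>A. cnj (a \<alpha>) * (f x * hermite_fun \<alpha> x)) \<partial>lebesgue)"
    by (simp add: hermite_sum_def sum_distrib_left mult_ac)
  also have "\<dots> = (\<Sum>\<alpha>\<in>A. \<integral>x. cnj (a \<alpha>) * (f x * hermite_fun \<alpha> x) \<partial>lebesgue)"
    by (rule Bochner_Integration.integral_sum) (intro integrable_mult_right i)
  finally show ?thesis by (simp only: hermite_coeff_eq integral_mult_right_zero)
qed

lemma l2norm_square_complex: "complex_of_real ((l2norm f)\<^sup>2) = (\<integral>x. f x * cnj (f x) \<partial>lebesgue)"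
  unfolding l2norm_square complex_norm_square[symmetric] by (simp only: integral_complex_of_real)

lemma l2norm_hermite_sum:
  assumes "finite A"
  shows "(l2norm (hermite_sum A a))\<^sup>2 = (\<Sum>\<alpha>\<in>A. (cmod (a \<alpha>))\<^sup>2)"
proof -
  have "complex_of_real ((l2norm (hermite_sum A a))\<^sup>2) = (\<Sum>\<alpha>\<in>A. cnj (a \<alpha>) * a \<alpha>)"
    unfolding l2norm_square_complex integral_mult_cnj_hermite_sum[OF hermite_sum_L2]
    using assms by (intro sum.cong) (auto simp: hermite_coeff_hermite_sum)
  also have "\<dots> = complex_of_real (\<Sum>\<alpha>\<in>A. (cmod (a \<alpha>))\<^sup>2)"
    unfolding of_real_sum complex_norm_square by (simp only: mult.commute)
  finally show ?thesis by (simp only: of_real_eq_iff)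
qed

lemma l2norm_diff_hermite_sum:
  assumes f: "f \<in> L2" and A: "finite A"
  shows "(l2norm (\<lambda>x. f x - hermite_sum A (\<lambda>\<alpha>. hermite_coeff \<alpha> f) x))\<^sup>2
    = (l2norm f)\<^sup>2 - (\<Sum>\<alpha>\<in>A. (cmod (hermite_coeff \<alpha> f))\<^sup>2)"
proof -
  let ?S = "hermite_sum A (\<lambda>\<alpha>. hermite_coeff \<alpha> f)"
  let ?s = "\<Sum>\<alpha>\<in>A. (cmod (hermite_coeff \<alpha> f))\<^sup>2"
  have i: "integrable lebesgue (\<lambda>x. (cmod (f x))\<^sup>2)" "integrable lebesgue (\<lambda>x. (cmod (?S x))\<^sup>2)"
    by (intro L2_integrable_square f hermite_sum_L2)+
  have ic: "integrable lebesgue (\<lambda>x. f x * cnj (?S x))"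
    by (intro L2_mult_integrable f L2_cnj hermite_sum_L2)
  have ir: "integrable lebesgue (\<lambda>x. Re (f x * cnj (?S x)))"
    by (rule integrable_Re[OF ic])
  have "(\<integral>x. f x * cnj (?S x) \<partial>lebesgue) = (\<Sum>\<alpha>\<in>A. cnj (hermite_coeff \<alpha> f) * hermite_coeff \<alpha> f)"
    by (rule integral_mult_cnj_hermite_sum[OF f])
  also have "\<dots> = complex_of_real ?s"
    unfolding of_real_sum complex_norm_square by (simp only: mult.commute)
  finally have r: "(\<integral>x. Re (f x * cnj (?S x)) \<partial>lebesgue) = ?s"
    using integral_Re[OF ic] by (simp only: Re_complex_of_real)
  have "(l2norm (\<lambda>x. f x - ?S x))\<^sup>2 = (\<integral>x. ((cmod (f x))\<^sup>2 - 2 * Re (f x * cnj (?S x))) + (cmod (?S x))\<^sup>2 \<partial>lebesgue)"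
    unfolding l2norm_square
  proof (rule Bochner_Integration.integral_cong[OF refl])
    fix x
    show "(cmod (f x - ?S x))\<^sup>2 = ((cmod (f x))\<^sup>2 - 2 * Re (f x * cnj (?S x))) + (cmod (?S x))\<^sup>2"
      unfolding cmod_power2 by (simp add: power2_eq_square algebra_simps)
  qed
  also have "\<dots> = (l2norm f)\<^sup>2 - 2 * ?s + (l2norm ?S)\<^sup>2"
  proof -
    define R where "R x = Re (f x * cnj (?S x))" for x
    show ?thesis
      unfolding l2norm_square r[symmetric] R_def[symmetric] using i ir[folded R_def] by simp
  qed
  also have "(l2norm ?S)\<^sup>2 = ?s" by (rule l2norm_hermite_sum[OF A])
  finally show ?thesis by simp
qed

lemma Bessel:
  assumes "f \<in> L2" "finite A"
  shows "(\<Sum>\<alpha>\<in>A. (cmod (hermite_coeff \<alpha> f))\<^sup>2) \<le> (l2norm f)\<^sup>2"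
  using l2norm_diff_hermite_sum[OF assms]
    zero_le_power2[of "l2norm (\<lambda>x. f x - hermite_sum A (\<lambda>\<alpha>. hermite_coeff \<alpha> f) x)"] by linarith

text \<open>An increasing sequence of finite index sets that exhausts all of them. Along it, unconditional sums
  become limits of sequences.\<close>

definition index_ball :: "nat \<Rightarrow> ('n::finite \<Rightarrow> nat) set" where
  "index_ball N = {\<alpha>. msize \<alpha> < N}"

lemma finite_index_ball [simp]: "finite (index_ball N)"
proof (rule finite_subset)
  have "\<alpha> i \<le> msize \<alpha>" for \<alpha> :: "'a \<Rightarrow> nat" and i
    unfolding msize_def by (rule member_le_sum) auto
  then show "index_ball N \<subseteq> (UNIV :: 'a set) \<rightarrow>\<^sub>E {..<N}"
    by (auto simp: index_ball_def intro: order_le_less_trans)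
  show "finite ((UNIV :: 'a set) \<rightarrow>\<^sub>E {..<N})"
    by (intro finite_PiE) auto
qed

lemma index_ball_mono: "M \<le> N \<Longrightarrow> index_ball M \<subseteq> index_ball N"
  by (auto simp: index_ball_def)

lemma index_ball_exhausts: "finite A \<Longrightarrow> \<exists>N. A \<subseteq> index_ball N"
proof -
  assume A: "finite A"
  have "A \<subseteq> index_ball (Suc (Max (msize ` A)))"
    using A by (auto simp: index_ball_def less_Suc_eq_le)
  then show ?thesis by blast
qed

lemma Riesz_Fischer:
  fixes a :: "('n::finite \<Rightarrow> nat) \<Rightarrow> complex"
  assumes B: "\<And>A. finite A \<Longrightarrow> (\<Sum>\<alpha>\<in>A. (cmod (a \<alpha>))\<^sup>2) \<le> B"
  obtains g where "g \<in> L2" "\<And>\<alpha>. hermite_coeff \<alpha> g = a \<alpha>"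
    "(\<lambda>N. l2norm (\<lambda>x. hermite_sum (index_ball N) a x - g x)) \<longlonglongrightarrow> 0"
proof -
  let ?s = "\<lambda>N. \<Sum>\<alpha>\<in>index_ball N. (cmod (a \<alpha>))\<^sup>2"
  have "incseq ?s" by (intro monoI sum_mono2 index_ball_mono) auto
  moreover have "bdd_above (range ?s)"
    by (rule bdd_aboveI2) (rule B[OF finite_index_ball])
  ultimately have "?s \<longlonglongrightarrow> (SUP N. ?s N)" by (intro LIMSEQ_incseq_SUP)
  then have Cauchy: "Cauchy ?s" by (rule LIMSEQ_imp_Cauchy)
  have d: "(l2norm (\<lambda>x. hermite_sum (index_ball M) a x - hermite_sum (index_ball N) a x))\<^sup>2 = \<bar>?s M - ?s N\<bar>"
    for M N
  proof -
    have *: "(l2norm (\<lambda>x. hermite_sum (index_ball M) a x - hermite_sum (index_ball N) a x))\<^sup>2 = \<bar>?s M - ?s N\<bar>"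
      if "N \<le> M" for M N
    proof -
      have "?s M = ?s N + (\<Sum>\<alpha>\<in>index_ball M - index_ball N. (cmod (a \<alpha>))\<^sup>2)"
        using sum.subset_diff[OF index_ball_mono[OF that], of "\<lambda>\<alpha>. (cmod (a \<alpha>))\<^sup>2"] by simp
      then show ?thesis
        unfolding hermite_sum_diff[OF finite_index_ball index_ball_mono[OF that]]
        by (subst l2norm_hermite_sum) (auto simp: sum_nonneg)
    qed
    show ?thesis
    proof (cases "N \<le> M")
      case False
      then show ?thesis
        using *[of M N] by (simp add: l2norm_minus_commute[of "hermite_sum (index_ball M) a"] abs_minus_commute)
    qed (rule *)
  qed
  obtain g where g: "g \<in> L2" "(\<lambda>N. l2norm (\<lambda>x. hermite_sum (index_ball N) a x - g x)) \<longlonglongrightarrow> 0"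
  proof (rule L2_complete[of "\<lambda>N. hermite_sum (index_ball N) a"])
    fix e :: real assume e: "e > 0"
    then obtain M where M: "\<And>m n. m \<ge> M \<Longrightarrow> n \<ge> M \<Longrightarrow> \<bar>?s m - ?s n\<bar> < e\<^sup>2"
      using CauchyD[OF Cauchy, of "e\<^sup>2"] by auto
    have "l2norm (\<lambda>x. hermite_sum (index_ball m) a x - hermite_sum (index_ball n) a x) < e"
      if "m \<ge> M" "n \<ge> M" for m n
      by (rule power2_less_imp_less) (use d[of m n] M[OF that] e in auto)
    then show "\<exists>N. \<forall>m\<ge>N. \<forall>n\<ge>N. l2norm (\<lambda>x. hermite_sum (index_ball m) a x - hermite_sum (index_ball n) a x) < e"
      by blast
  qed (auto intro: hermite_sum_L2)
  have "hermite_coeff \<alpha> g = a \<alpha>" for \<alpha>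
  proof (rule LIMSEQ_unique)
    show "(\<lambda>N. hermite_coeff \<alpha> (hermite_sum (index_ball N) a)) \<longlonglongrightarrow> hermite_coeff \<alpha> g"
      unfolding hermite_coeff_eq
      by (rule L2_tendsto_integral_mult) (auto intro: hermite_sum_L2 hermite_fun_L2 g)
    have "eventually (\<lambda>N. hermite_coeff \<alpha> (hermite_sum (index_ball N) a) = a \<alpha>) sequentially"
      using eventually_gt_at_top[of "msize \<alpha>"]
      by eventually_elim (simp add: hermite_coeff_hermite_sum, simp add: index_ball_def)
    then show "(\<lambda>N. hermite_coeff \<alpha> (hermite_sum (index_ball N) a)) \<longlonglongrightarrow> a \<alpha>"
      by (rule tendsto_eventually)
  qed
  with g show ?thesis using that by blast
qed

lemma Riesz_Fischer_ex:
  assumes "\<And>A. finite A \<Longrightarrow> (\<Sum>\<alpha>\<in>A. (cmod (a \<alpha>))\<^sup>2) \<le> B"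
  shows "\<exists>g\<in>L2. \<forall>\<alpha>. hermite_coeff \<alpha> g = a \<alpha>"
  by (rule Riesz_Fischer[of a B, OF assms]) auto

text \<open>The Riesz-Fischer theorem provides a limit of the partial sums, and completeness of the Hermite
  functions identifies it with \<open>f\<close>.\<close>

lemma Parseval:
  assumes f: "f \<in> L2"
  shows "((\<lambda>\<alpha>. (cmod (hermite_coeff \<alpha> f))\<^sup>2) has_sum (l2norm f)\<^sup>2) UNIV"
proof -
  let ?c = "\<lambda>\<alpha>. hermite_coeff \<alpha> f" and ?q = "\<lambda>\<alpha>. (cmod (hermite_coeff \<alpha> f))\<^sup>2"
  obtain g where g: "g \<in> L2" "\<And>\<alpha>. hermite_coeff \<alpha> g = ?c \<alpha>"
    "(\<lambda>N. l2norm (\<lambda>x. hermite_sum (index_ball N) ?c x - g x)) \<longlonglongrightarrow> 0"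
    using Riesz_Fischer[of ?c "(l2norm f)\<^sup>2"] Bessel[OF f] by blast
  have fg: "AE x in lebesgue. f x = g x"
    by (rule hermite_coeff_unique[OF f g(1)]) (simp add: g(2))
  have "l2norm (\<lambda>x. hermite_sum (index_ball N) ?c x - g x) = l2norm (\<lambda>x. f x - hermite_sum (index_ball N) ?c x)" for N
  proof -
    have "l2norm (\<lambda>x. hermite_sum (index_ball N) ?c x - g x) = l2norm (\<lambda>x. hermite_sum (index_ball N) ?c x - f x)"
      using fg by (intro l2norm_cong_AE L2_measurable L2_diff hermite_sum_L2 f g) auto
    then show ?thesis by (simp only: l2norm_minus_commute[of f])
  qed
  with g(3) have "(\<lambda>N. (l2norm (\<lambda>x. f x - hermite_sum (index_ball N) ?c x))\<^sup>2) \<longlonglongrightarrow> 0\<^sup>2"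
    by (intro tendsto_power) simp
  then have "(\<lambda>N. (l2norm f)\<^sup>2 - (\<Sum>\<alpha>\<in>index_ball N. ?q \<alpha>)) \<longlonglongrightarrow> 0"
    by (simp add: l2norm_diff_hermite_sum[OF f])
  then have "(\<lambda>N. (l2norm f)\<^sup>2 - ((l2norm f)\<^sup>2 - (\<Sum>\<alpha>\<in>index_ball N. ?q \<alpha>))) \<longlonglongrightarrow> (l2norm f)\<^sup>2 - 0"
    by (intro tendsto_diff tendsto_const)
  then have lim: "(\<lambda>N. \<Sum>\<alpha>\<in>index_ball N. ?q \<alpha>) \<longlonglongrightarrow> (l2norm f)\<^sup>2" by simp
  have s: "?q summable_on UNIV"
    using Bessel[OF f] by (intro nonneg_bdd_above_summable_on bdd_aboveI[where M = "(l2norm f)\<^sup>2"]) auto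
  have "infsum ?q UNIV \<le> (l2norm f)\<^sup>2"
    using Bessel[OF f] by (intro infsum_le_finite_sums s) auto
  moreover have "(l2norm f)\<^sup>2 \<le> infsum ?q UNIV"
    by (rule LIMSEQ_le_const2[OF lim]) (auto intro!: finite_sum_le_infsum s)
  ultimately show ?thesis using has_sum_infsum[OF s] by simp
qed

lemma l2norm_le_if_finite_sums:
  assumes f: "f \<in> L2" and B: "0 \<le> B" "\<And>A. finite A \<Longrightarrow> (\<Sum>\<alpha>\<in>A. (cmod (hermite_coeff \<alpha> f))\<^sup>2) \<le> B\<^sup>2"
  shows "l2norm f \<le> B"
proof (rule power2_le_imp_le[OF _ B(1)])
  show "(l2norm f)\<^sup>2 \<le> B\<^sup>2"
    using B(2) has_sum_le_finite_sums[OF Parseval[OF f]] by blast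
qed

lemma L2_tendsto_hermite_sum:
  fixes f :: "real ^ 'n::finite \<Rightarrow> complex"
  assumes f: "f \<in> L2"
  shows "((\<lambda>A. l2norm (\<lambda>x. hermite_sum A (\<lambda>\<alpha>. hermite_coeff \<alpha> f) x - f x)) \<longlongrightarrow> 0) (finite_subsets_at_top UNIV)"
proof -
  let ?S = "\<lambda>A. hermite_sum A (\<lambda>\<alpha>. hermite_coeff \<alpha> f)"
  have "((\<lambda>A. \<Sum>\<alpha>\<in>A. (cmod (hermite_coeff \<alpha> f))\<^sup>2) \<longlongrightarrow> (l2norm f)\<^sup>2) (finite_subsets_at_top UNIV)"
    using Parseval[OF f] by (simp add: has_sum_def)
  then have "((\<lambda>A. sqrt ((l2norm f)\<^sup>2 - (\<Sum>\<alpha>\<in>A. (cmod (hermite_coeff \<alpha> f))\<^sup>2))) \<longlongrightarrow>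
      sqrt ((l2norm f)\<^sup>2 - (l2norm f)\<^sup>2)) (finite_subsets_at_top UNIV)"
    by (intro tendsto_intros)
  moreover have "\<forall>\<^sub>F A in finite_subsets_at_top UNIV. sqrt ((l2norm f)\<^sup>2 - (\<Sum>\<alpha>\<in>A. (cmod (hermite_coeff \<alpha> f))\<^sup>2))
      = l2norm (\<lambda>x. ?S A x - f x)"
  proof (rule eventually_finite_subsets_at_top_weakI)
    fix A :: "('n \<Rightarrow> nat) set" assume elim: "finite A"
    then show "sqrt ((l2norm f)\<^sup>2 - (\<Sum>\<alpha>\<in>A. (cmod (hermite_coeff \<alpha> f))\<^sup>2)) = l2norm (\<lambda>x. ?S A x - f x)"
      by (simp only: l2norm_diff_hermite_sum[OF f, symmetric] l2norm_minus_commute[of f] real_sqrt_abs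
          abs_of_nonneg[OF l2norm_nonneg])
  qed
  ultimately show ?thesis by (simp add: tendsto_cong)
qed

lemma filterlim_index_ball:
  "filterlim (index_ball :: nat \<Rightarrow> ('n::finite \<Rightarrow> nat) set) (finite_subsets_at_top UNIV) sequentially"
  unfolding filterlim_finite_subsets_at_top
proof (intro allI impI)
  fix X :: "('n \<Rightarrow> nat) set" assume "finite X \<and> X \<subseteq> UNIV"
  then obtain N where "X \<subseteq> index_ball N" using index_ball_exhausts by blast
  then have "X \<subseteq> index_ball n" if "n \<ge> N" for n
    using index_ball_mono[OF that] by blast
  then show "\<forall>\<^sub>F N in sequentially. finite (index_ball N) \<and> X \<subseteq> index_ball N \<and> index_ball N \<subseteq> UNIV"
    by (auto simp: eventually_sequentially)
qed

lemma LIMSEQ_hermite_sum: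
  fixes f :: "real ^ 'n::finite \<Rightarrow> complex"
  assumes f: "f \<in> L2"
  shows "(\<lambda>N. l2norm (\<lambda>x. hermite_sum (index_ball N) (\<lambda>\<alpha>. hermite_coeff \<alpha> f) x - f x)) \<longlonglongrightarrow> 0"
  by (rule filterlim_compose[OF L2_tendsto_hermite_sum[OF f] filterlim_index_ball])

section \<open>Powers of the Hermite operator and Hermite-Sobolev spaces\<close>

lemma hermite_eigenvalue_ge_1: "hermite_eigenvalue \<alpha> \<ge> 1" for \<alpha> :: "'n::finite \<Rightarrow> nat"
proof -
  have "1 \<le> CARD('n)" by (simp add: Suc_le_eq)
  then have "real 1 \<le> real CARD('n)" by (rule of_nat_mono)
  then show ?thesis
    unfolding hermite_eigenvalue_def using of_nat_0_le_iff[of "msize \<alpha>", where ?'a = real] by linarith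
qed

lemma hermite_eigenvalue_pos: "hermite_eigenvalue \<alpha> > 0"
  using hermite_eigenvalue_ge_1[of \<alpha>] by linarith

lemma hermite_eigenvalue_up: "hermite_eigenvalue (up i \<alpha>) = hermite_eigenvalue \<alpha> + 2"
  by (simp add: hermite_eigenvalue_def)

text \<open>An \<open>L\<^sup>2\<close> limit of Hermite sums is determined by its coefficients, so \<open>H\<^sup>s\<close> acts diagonally on
  coefficients.\<close>

lemma is_hermite_power_iff:
  "is_hermite_power s f g \<longleftrightarrow> f \<in> L2 \<and> g \<in> L2 \<and>
    (\<forall>\<alpha>. hermite_coeff \<alpha> g = of_real (hermite_eigenvalue \<alpha> powr s) * hermite_coeff \<alpha> f)"
proof -
  let ?b = "\<lambda>\<alpha>. of_real (hermite_eigenvalue \<alpha> powr s) * hermite_coeff \<alpha> f"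
  have *: "(\<lambda>A x. \<Sum>\<alpha>\<in>A. of_real (hermite_eigenvalue \<alpha> powr s) * hermite_coeff \<alpha> f * hermite_fun \<alpha> x)
      = (\<lambda>A. hermite_sum A ?b)"
    by (simp add: fun_eq_iff hermite_sum_def)
  show ?thesis
    unfolding is_hermite_power_def * L2_tendsto_def
  proof safe
    fix \<alpha> assume g: "g \<in> L2" "((\<lambda>A. l2norm (\<lambda>x. hermite_sum A ?b x - g x)) \<longlongrightarrow> 0) (finite_subsets_at_top UNIV)"
    have 1: "((\<lambda>A. hermite_coeff \<alpha> (hermite_sum A ?b)) \<longlongrightarrow> hermite_coeff \<alpha> g) (finite_subsets_at_top UNIV)"
      unfolding hermite_coeff_eq[of \<alpha> g] hermite_coeff_eq[of \<alpha> "hermite_sum _ _"]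
      by (rule L2_tendsto_integral_mult[OF hermite_sum_L2 g(1) hermite_fun_L2 g(2)])
    have "eventually (\<lambda>A. finite A \<and> {\<alpha>} \<subseteq> A \<and> A \<subseteq> UNIV) (finite_subsets_at_top UNIV)"
      unfolding eventually_finite_subsets_at_top by (intro exI[of _ "{\<alpha>}"]) auto
    then have "eventually (\<lambda>A. hermite_coeff \<alpha> (hermite_sum A ?b) = ?b \<alpha>) (finite_subsets_at_top UNIV)"
      by eventually_elim (simp add: hermite_coeff_hermite_sum)
    then have 2: "((\<lambda>A. hermite_coeff \<alpha> (hermite_sum A ?b)) \<longlongrightarrow> ?b \<alpha>) (finite_subsets_at_top UNIV)"
      by (rule tendsto_eventually)
    show "hermite_coeff \<alpha> g = ?b \<alpha>"
      by (rule tendsto_unique[OF _ 1 2]) simp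
  next
    assume g: "g \<in> L2" and "\<forall>\<alpha>. hermite_coeff \<alpha> g = ?b \<alpha>"
    then have "(\<lambda>\<alpha>. hermite_coeff \<alpha> g) = ?b" by auto
    then show "((\<lambda>A. l2norm (\<lambda>x. hermite_sum A ?b x - g x)) \<longlongrightarrow> 0) (finite_subsets_at_top UNIV)"
      using L2_tendsto_hermite_sum[OF g] by simp
  qed (rule hermite_sum_L2)
qed

text \<open>The share of the index \<open>\<alpha>\<close> in the squared norm of \<open>W\<^sub>H\<^sup>k\<^sup>,\<^sup>2\<close>.\<close>

definition energy :: "nat \<Rightarrow> (real ^ 'n \<Rightarrow> complex) \<Rightarrow> ('n::finite \<Rightarrow> nat) \<Rightarrow> real" where
  "energy k f \<alpha> = hermite_eigenvalue \<alpha> ^ k * (cmod (hermite_coeff \<alpha> f))\<^sup>2"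

lemma energy_nonneg [simp]: "0 \<le> energy k f \<alpha>"
  using hermite_eigenvalue_pos[of \<alpha>] by (simp add: energy_def)

lemma eigenvalue_powr_half: "(hermite_eigenvalue \<alpha> powr (real k / 2))\<^sup>2 = hermite_eigenvalue \<alpha> ^ k"
proof -
  have "(hermite_eigenvalue \<alpha> powr (real k / 2))\<^sup>2 = hermite_eigenvalue \<alpha> powr (real k / 2 + real k / 2)"
    unfolding power2_eq_square powr_add ..
  then show ?thesis using hermite_eigenvalue_pos[of \<alpha>] by (simp add: powr_realpow)
qed

lemma energy_hermite_power:
  assumes "is_hermite_power (real k / 2) f g"
  shows "(\<lambda>\<alpha>. (cmod (hermite_coeff \<alpha> g))\<^sup>2) = energy k f"
proof
  fix \<alpha>
  have "hermite_coeff \<alpha> g = of_real (hermite_eigenvalue \<alpha> powr (real k / 2)) * hermite_coeff \<alpha> f"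
    using assms by (simp add: is_hermite_power_iff)
  then show "(cmod (hermite_coeff \<alpha> g))\<^sup>2 = energy k f \<alpha>"
    by (simp add: energy_def norm_mult power_mult_distrib eigenvalue_powr_half)
qed

lemma hermite_sobolevI:
  assumes f: "f \<in> L2" and B: "\<And>A. finite A \<Longrightarrow> sum (energy k f) A \<le> B"
  shows "f \<in> hermite_sobolev k"
proof -
  let ?a = "\<lambda>\<alpha>. of_real (hermite_eigenvalue \<alpha> powr (real k / 2)) * hermite_coeff \<alpha> f"
  have "(\<lambda>\<alpha>. (cmod (?a \<alpha>))\<^sup>2) = energy k f"
    by (simp add: fun_eq_iff energy_def norm_mult power_mult_distrib eigenvalue_powr_half)
  then have "(\<Sum>\<alpha>\<in>A. (cmod (?a \<alpha>))\<^sup>2) \<le> B" if "finite A" for A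
    using B[OF that] by (simp only:)
  then have "\<exists>g\<in>L2. \<forall>\<alpha>. hermite_coeff \<alpha> g = ?a \<alpha>"
    by (rule Riesz_Fischer_ex)
  then show ?thesis
    using f by (auto simp: hermite_sobolev_def is_hermite_power_iff)
qed

lemma hermite_sobolev_has_sum:
  assumes "f \<in> hermite_sobolev k"
  shows "(energy k f has_sum (hermite_sobolev_norm k f)\<^sup>2) UNIV"
proof -
  have "\<exists>g. is_hermite_power (real k / 2) f g"
    using assms unfolding hermite_sobolev_def by blast
  then have p: "is_hermite_power (real k / 2) f (hermite_power (real k / 2) f)"
    unfolding hermite_power_def by (rule someI_ex)
  then have "hermite_power (real k / 2) f \<in> L2"
    unfolding is_hermite_power_iff by blast
  from Parseval[OF this] show ?thesis
    unfolding energy_hermite_power[OF p] hermite_sobolev_norm_def[symmetric] .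
qed

lemma hermite_sobolev_L2: "f \<in> hermite_sobolev k \<Longrightarrow> f \<in> L2"
  by (simp add: hermite_sobolev_def)

lemma hermite_sobolev_norm_nonneg [simp]: "0 \<le> hermite_sobolev_norm k f"
  by (simp add: hermite_sobolev_norm_def)

lemma sum_energy_le:
  assumes "f \<in> hermite_sobolev k"
  shows "sum (energy k f) A \<le> (hermite_sobolev_norm k f)\<^sup>2"
proof (cases "finite A")
  case True
  then show ?thesis
    using finite_sum_le_has_sum[OF hermite_sobolev_has_sum[OF assms], of A] by simp
qed simp

lemma hermite_sobolev_norm_le:
  assumes f: "f \<in> L2" and B: "0 \<le> B" "\<And>A. finite A \<Longrightarrow> sum (energy k f) A \<le> B\<^sup>2"
  shows "f \<in> hermite_sobolev k" "hermite_sobolev_norm k f \<le> B"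
proof -
  show W: "f \<in> hermite_sobolev k" by (rule hermite_sobolevI[OF f B(2)])
  have "(hermite_sobolev_norm k f)\<^sup>2 \<le> B\<^sup>2"
    using has_sum_le_finite_sums[OF hermite_sobolev_has_sum[OF W]] B(2) by blast
  then show "hermite_sobolev_norm k f \<le> B"
    using B(1) by (rule power2_le_imp_le)
qed

lemma hermite_sobolev_mono:
  assumes f: "f \<in> hermite_sobolev k" and j: "j \<le> k"
  shows "f \<in> hermite_sobolev j" "hermite_sobolev_norm j f \<le> hermite_sobolev_norm k f"
proof -
  have le: "sum (energy j f) A \<le> (hermite_sobolev_norm k f)\<^sup>2" for A
  proof -
    have "sum (energy j f) A \<le> sum (energy k f) A"
      unfolding energy_def using hermite_eigenvalue_ge_1 j
      by (intro sum_mono mult_right_mono power_increasing) auto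
    then show ?thesis using sum_energy_le[OF f, of A] by linarith
  qed
  show "f \<in> hermite_sobolev j" "hermite_sobolev_norm j f \<le> hermite_sobolev_norm k f"
    by (rule hermite_sobolev_norm_le[OF hermite_sobolev_L2[OF f] hermite_sobolev_norm_nonneg le])+
qed

lemma energy_0: "energy 0 f = (\<lambda>\<alpha>. (cmod (hermite_coeff \<alpha> f))\<^sup>2)"
  by (simp add: energy_def fun_eq_iff)

lemma hermite_sobolev_0:
  assumes f: "f \<in> L2"
  shows "f \<in> hermite_sobolev 0" "hermite_sobolev_norm 0 f = l2norm f"
proof -
  show W: "f \<in> hermite_sobolev 0"
    by (rule hermite_sobolevI[OF f, of 0 "(l2norm f)\<^sup>2"]) (simp add: energy_0 Bessel[OF f])
  have "(hermite_sobolev_norm 0 f)\<^sup>2 = (l2norm f)\<^sup>2"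
    using has_sum_unique[OF hermite_sobolev_has_sum[OF W]] Parseval[OF f] by (simp add: energy_0)
  then show "hermite_sobolev_norm 0 f = l2norm f" by simp
qed

lemma l2norm_le_hermite_sobolev_norm: "f \<in> hermite_sobolev k \<Longrightarrow> l2norm f \<le> hermite_sobolev_norm k f"
  using hermite_sobolev_mono(2)[of f k 0] hermite_sobolev_0(2)[OF hermite_sobolev_L2[of f k]] by simp

lemma hermite_sobolev_norm_finite:
  assumes f: "f \<in> L2" and A: "finite A" "\<And>\<alpha>. \<alpha> \<notin> A \<Longrightarrow> hermite_coeff \<alpha> f = 0"
  shows "f \<in> hermite_sobolev k" "(hermite_sobolev_norm k f)\<^sup>2 = sum (energy k f) A"
proof -
  have z: "energy k f \<alpha> = 0" if "\<alpha> \<notin> A" for \<alpha> using A(2)[OF that] by (simp add: energy_def)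
  have "sum (energy k f) B \<le> sum (energy k f) A" if "finite B" for B
  proof -
    have "sum (energy k f) B = sum (energy k f) (B \<inter> A)"
      by (rule sum.mono_neutral_right) (use that z in auto)
    also have "\<dots> \<le> sum (energy k f) A" by (rule sum_mono2) (use A in auto)
    finally show ?thesis .
  qed
  then show W: "f \<in> hermite_sobolev k" by (rule hermite_sobolevI[OF f])
  have "(energy k f has_sum sum (energy k f) A) UNIV"
    using has_sum_finite_neutralI[OF A(1), of UNIV "energy k f"] z by auto
  from has_sum_unique[OF hermite_sobolev_has_sum[OF W] this]
  show "(hermite_sobolev_norm k f)\<^sup>2 = sum (energy k f) A" .
qed

lemma hspan_hermite_sobolev:
  assumes f: "f \<in> hspan"
  shows "f \<in> hermite_sobolev k"
proof -
  obtain A where "finite A" "f = hermite_sum A (\<lambda>\<alpha>. hermite_coeff \<alpha> f)"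
    "\<forall>\<alpha>. \<alpha> \<notin> A \<longrightarrow> hermite_coeff \<alpha> f = 0"
    using hspan_expansion[OF f] .
  then show ?thesis by (intro hermite_sobolev_norm_finite(1)[OF hspan_L2[OF f]]) auto
qed

section \<open>The Fourier transform on \<open>L\<^sup>2\<close>\<close>

definition fourier_integral :: "real \<Rightarrow> (real ^ 'n \<Rightarrow> complex) \<Rightarrow> real ^ 'n \<Rightarrow> complex" where
  "fourier_integral s g y = of_real ((2 * pi) powr (- real CARD('n) / 2)) *
     (\<integral>x. exp (\<i> * of_real (s * (x \<bullet> y))) * g x \<partial>lebesgue)"

lemma fourier_integral_measurable:
  fixes g :: "real ^ 'n::finite \<Rightarrow> complex"
  assumes g: "integrable lebesgue g"
  shows "fourier_integral s g \<in> borel_measurable borel"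
    "\<And>y. cmod (fourier_integral s g y) \<le> (2 * pi) powr (- real CARD('n) / 2) * (\<integral>x. cmod (g x) \<partial>lebesgue)"
proof -
  obtain g' where g': "g' \<in> borel_measurable borel" "AE x in lebesgue. g x = g' x"
    using lebesgue_ex_borel[OF borel_measurable_integrable[OF g]] .
  have [measurable]: "g' \<in> borel_measurable borel" by fact
  let ?e = "\<lambda>x y. exp (\<i> * complex_of_real (s * (x \<bullet> y)))"
  have em: "(\<lambda>x. ?e x y) \<in> borel_measurable borel" for y :: "real ^ 'n"
    by measurable
  have eq: "(\<integral>x. ?e x y * g x \<partial>lebesgue) = (\<integral>x. ?e x y * g' x \<partial>lborel)" for y
  proof -
    have "(\<integral>x. ?e x y * g x \<partial>lebesgue) = (\<integral>x. ?e x y * g' x \<partial>lebesgue)"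
    proof (rule integral_cong_AE)
      show "(\<lambda>x. ?e x y * g x) \<in> borel_measurable lebesgue"
        by (rule borel_measurable_integrable[OF integrable_exp_mult[OF g]])
      show "(\<lambda>x. ?e x y * g' x) \<in> borel_measurable lebesgue"
        by (intro lebesgue_borel(3)) measurable
      show "AE x in lebesgue. ?e x y * g x = ?e x y * g' x"
        using g'(2) by eventually_elim simp
    qed
    also have "\<dots> = (\<integral>x. ?e x y * g' x \<partial>lborel)"
      by (intro lebesgue_borel(2)) measurable
    finally show ?thesis .
  qed
  have "(\<lambda>y. \<integral>x. ?e x y * g' x \<partial>lborel) \<in> borel_measurable borel"
    by (rule lborel.borel_measurable_lebesgue_integral) measurable
  then show "fourier_integral s g \<in> borel_measurable borel"
    unfolding fourier_integral_def[abs_def] eq by measurable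
  show "cmod (fourier_integral s g y) \<le> (2 * pi) powr (- real CARD('n) / 2) * (\<integral>x. cmod (g x) \<partial>lebesgue)" for y
  proof -
    have "cmod (\<integral>x. ?e x y * g x \<partial>lebesgue) \<le> (\<integral>x. cmod (?e x y * g x) \<partial>lebesgue)"
      by (rule integral_norm_bound)
    also have "\<dots> = (\<integral>x. cmod (g x) \<partial>lebesgue)"
      by (simp only: norm_mult norm_exp_i mult_1_left)
    finally show ?thesis
      unfolding fourier_integral_def norm_mult norm_of_real abs_of_nonneg[OF powr_ge_zero]
      by (intro mult_left_mono) auto
  qed
qed

text \<open>By Fubini's theorem the exponential is integrated against \<open>h\<^sub>\<alpha>\<close> first, which is an eigenfunction.\<close>

lemma hermite_coeff_fourier_integral:
  fixes g :: "real ^ 'n::finite \<Rightarrow> complex"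
  assumes g: "integrable lebesgue g" and s: "s = 1 \<or> s = -1"
  shows "hermite_coeff \<alpha> (fourier_integral s g) = (of_real s * \<i>) ^ msize \<alpha> * hermite_coeff \<alpha> g"
proof -
  obtain g' where g': "g' \<in> borel_measurable borel" "AE x in lebesgue. g x = g' x"
    using lebesgue_ex_borel[OF borel_measurable_integrable[OF g]] .
  note gm [measurable] = g'(1)
  let ?e = "\<lambda>x y. exp (\<i> * complex_of_real (s * (x \<bullet> y)))"
  let ?h = "hermite_fun \<alpha> :: real ^ 'n \<Rightarrow> complex"
  let ?c = "complex_of_real ((2 * pi) powr (real CARD('n) / 2))"
  let ?d = "complex_of_real ((2 * pi) powr (- real CARD('n) / 2))"
  have hm [measurable]: "?h \<in> borel_measurable borel"
    by (intro smooth_borel_measurable schwartz_smooth hermite_fun_schwartz)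
  have gl: "g' \<in> borel_measurable lebesgue" by (rule lebesgue_borel(3)[OF gm])
  have "integrable lebesgue g'"
    using g by (rule Bochner_Integration.integrable_cong_AE_imp[OF _ gl])
      (use g'(2) in \<open>eventually_elim; simp\<close>)
  then have ig: "integrable lborel g'" by (simp only: lebesgue_borel(1)[OF gm])
  have "integrable lebesgue ?h" by (intro schwartz_integrable hermite_fun_schwartz)
  then have ih: "integrable lborel ?h" by (simp only: lebesgue_borel(1)[OF hm])
  have four: "fourier_integral s g y = ?d * (\<integral>x. ?e x y * g' x \<partial>lborel)" for y
  proof -
    have "(\<integral>x. ?e x y * g x \<partial>lebesgue) = (\<integral>x. ?e x y * g' x \<partial>lebesgue)"
    proof (rule integral_cong_AE)
      show "(\<lambda>x. ?e x y * g x) \<in> borel_measurable lebesgue"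
        by (rule borel_measurable_integrable[OF integrable_exp_mult[OF g]])
      show "(\<lambda>x. ?e x y * g' x) \<in> borel_measurable lebesgue"
        by (intro lebesgue_borel(3)) measurable
      show "AE x in lebesgue. ?e x y * g x = ?e x y * g' x"
        using g'(2) by eventually_elim simp
    qed
    also have "\<dots> = (\<integral>x. ?e x y * g' x \<partial>lborel)"
      by (intro lebesgue_borel(2)) measurable
    finally show ?thesis unfolding fourier_integral_def by (simp only:)
  qed
  let ?w = "\<lambda>(x, y). ?e x y * g' x * ?h y"
  have w: "integrable (lborel \<Otimes>\<^sub>M lborel) ?w"
  proof (rule lborel_pair.Fubini_integrable)
    show "?w \<in> borel_measurable (lborel \<Otimes>\<^sub>M lborel)" by measurable
    have "(\<lambda>x. \<integral>y. norm (?w (x, y)) \<partial>lborel) = (\<lambda>x. cmod (g' x) * (\<integral>y. cmod (?h y) \<partial>lborel))"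
      by (simp only: prod.case norm_mult norm_exp_i mult_1_left integral_mult_right_zero)
    then show "integrable lborel (\<lambda>x. \<integral>y. norm (?w (x, y)) \<partial>lborel)"
      using integrable_mult_left[OF integrable_norm[OF ig]] by (simp only:)
    show "AE x in lborel. integrable lborel (\<lambda>y. ?w (x, y))"
    proof (intro AE_I2)
      fix x
      have "integrable lborel (\<lambda>y. g' x * ?h y)" using ih by (rule integrable_mult_right)
      then show "integrable lborel (\<lambda>y. ?w (x, y))"
        by (rule Bochner_Integration.integrable_bound) (auto simp: norm_mult)
    qed
  qed
  have inner: "(\<integral>y. ?w (x, y) \<partial>lborel) = ?c * (of_real s * \<i>) ^ msize \<alpha> * (g' x * ?h x)" for x
  proof -
    have "(\<integral>y. ?w (x, y) \<partial>lborel) = g' x * (\<integral>y. ?e y x * ?h y \<partial>lborel)"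
      unfolding prod.case integral_mult_right_zero[symmetric] inner_commute[of x] by (simp only: mult_ac)
    also have "(\<integral>y. ?e y x * ?h y \<partial>lborel) = (\<integral>y. ?e y x * ?h y \<partial>lebesgue)"
      by (rule lebesgue_borel(2)[symmetric]) measurable
    also have "\<dots> = ?c * (of_real s * \<i>) ^ msize \<alpha> * ?h x"
      by (rule fourier_hermite_fun[OF s])
    finally show ?thesis by (simp only: mult_ac)
  qed
  have "hermite_coeff \<alpha> (fourier_integral s g) = (\<integral>y. fourier_integral s g y * ?h y \<partial>lborel)"
    unfolding hermite_coeff_eq
    by (rule lebesgue_borel(2)) (intro borel_measurable_times fourier_integral_measurable g hm)
  also have "\<dots> = ?d * (\<integral>y. (\<integral>x. ?w (x, y) \<partial>lborel) \<partial>lborel)"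
    unfolding four prod.case integral_mult_right_zero[symmetric] integral_mult_left_zero[symmetric]
    by (simp only: mult.assoc)
  also have "(\<integral>y. (\<integral>x. ?w (x, y) \<partial>lborel) \<partial>lborel) = (\<integral>x. (\<integral>y. ?w (x, y) \<partial>lborel) \<partial>lborel)"
    using lborel_pair.Fubini_integral[of "\<lambda>x y. ?w (x, y)"] w by (simp only: case_prod_eta prod.case)
  also have "\<dots> = ?c * (of_real s * \<i>) ^ msize \<alpha> * (\<integral>x. g' x * ?h x \<partial>lborel)"
    unfolding inner by (rule integral_mult_right_zero)
  also have "(\<integral>x. g' x * ?h x \<partial>lborel) = (\<integral>x. g' x * ?h x \<partial>lebesgue)"
    by (rule lebesgue_borel(2)[symmetric]) measurable
  also have "\<dots> = (\<integral>x. g x * ?h x \<partial>lebesgue)"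
  proof (rule integral_cong_AE)
    show "AE x in lebesgue. g' x * ?h x = g x * ?h x" using g'(2) by eventually_elim simp
  qed (intro borel_measurable_times gl lebesgue_borel(3)[OF hm] borel_measurable_integrable[OF g])+
  also have "?d * (?c * (of_real s * \<i>) ^ msize \<alpha> * (\<integral>x. g x * ?h x \<partial>lebesgue))
      = (?d * ?c) * ((of_real s * \<i>) ^ msize \<alpha> * (\<integral>x. g x * ?h x \<partial>lebesgue))"
    by (simp only: mult.assoc)
  also have "?d * ?c = 1"
    unfolding of_real_mult[symmetric] powr_add[symmetric] by simp
  finally show ?thesis by (simp only: hermite_coeff_eq mult_1_left)
qed

lemma norm_unit_power:
  assumes "s = 1 \<or> s = -1"
  shows "cmod ((of_real s * \<i>) ^ n) = 1"
  using assms by (auto simp: norm_power norm_mult)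

lemma rotated_coefficients:
  assumes f: "f \<in> L2" and s: "s = 1 \<or> s = -1"
  shows "\<exists>g\<in>L2. \<forall>\<alpha>. hermite_coeff \<alpha> g = (of_real s * \<i>) ^ msize \<alpha> * hermite_coeff \<alpha> f"
  by (rule Riesz_Fischer_ex[of _ "(l2norm f)\<^sup>2"])
    (simp only: norm_mult norm_unit_power[OF s] mult_1_left Bessel[OF f])

text \<open>Plancherel for \<open>g \<in> L\<^sup>1 \<inter> L\<^sup>2\<close>: the Fourier integral is a bounded function, and it has the Hermite
  coefficients of an \<open>L\<^sup>2\<close> function.\<close>

lemma fourier_integral_L2:
  fixes g :: "real ^ 'n::finite \<Rightarrow> complex"
  assumes g: "integrable lebesgue g" "g \<in> L2" and s: "s = 1 \<or> s = -1"
  shows "fourier_integral s g \<in> L2"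
proof -
  let ?F = "fourier_integral s g"
  obtain G where G: "G \<in> L2" "\<And>\<alpha>. hermite_coeff \<alpha> G = (of_real s * \<i>) ^ msize \<alpha> * hermite_coeff \<alpha> g"
    using rotated_coefficients[OF g(2) s] by blast
  have Fm: "?F \<in> borel_measurable lebesgue"
    by (rule lebesgue_borel(3)[OF fourier_integral_measurable(1)[OF g(1)]])
  have wm: "(\<lambda>x. - ?F x) \<in> borel_measurable lebesgue"
    using Fm by (rule borel_measurable_uminus)
  obtain B where B: "\<And>x. cmod (?F x) \<le> B" using fourier_integral_measurable(2)[OF g(1)] by blast
  have "AE x in lebesgue. G x + (- ?F x) = 0"
  proof (rule AE_eq_0_if_hermite_coeff_eq_0[OF G(1) wm])
    show "cmod (- ?F x) \<le> B" for x using B by simp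
    fix \<alpha> :: "'n \<Rightarrow> nat"
    have i1: "integrable lebesgue (\<lambda>x. G x * hermite_fun \<alpha> x)"
      by (intro L2_mult_integrable G hermite_fun_L2)
    have i2: "integrable lebesgue (\<lambda>x. ?F x * hermite_fun \<alpha> x)"
    proof (rule Bochner_Integration.integrable_bound)
      show "integrable lebesgue (\<lambda>x. of_real B * hermite_fun \<alpha> x)"
        by (intro integrable_mult_right schwartz_integrable hermite_fun_schwartz)
      show "(\<lambda>x. ?F x * hermite_fun \<alpha> x) \<in> borel_measurable lebesgue"
        by (intro borel_measurable_times Fm L2_measurable hermite_fun_L2)
      show "AE x in lebesgue. norm (?F x * hermite_fun \<alpha> x) \<le> norm (of_real B * hermite_fun \<alpha> x)"
        unfolding norm_mult norm_of_real
        by (intro AE_I2 mult_right_mono order_trans[OF B abs_ge_self]) auto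
    qed
    have "hermite_coeff \<alpha> (\<lambda>x. G x + - ?F x) = hermite_coeff \<alpha> G - hermite_coeff \<alpha> ?F"
      unfolding hermite_coeff_eq using Bochner_Integration.integral_diff[OF i1 i2]
      by (simp add: algebra_simps)
    then show "hermite_coeff \<alpha> (\<lambda>x. G x + - ?F x) = 0"
      by (simp add: G(2) hermite_coeff_fourier_integral[OF g(1) s])
  qed
  then have "AE x in lebesgue. G x = ?F x" by eventually_elim simp
  from L2_cong_AE[OF G(1) Fm this] show ?thesis .
qed

lemma truncation_L2:
  fixes f :: "real ^ 'n::finite \<Rightarrow> complex"
  assumes f: "f \<in> L2"
  shows "(\<lambda>x. indicator (cball 0 R) x *\<^sub>R f x) \<in> L2" "integrable lebesgue (\<lambda>x. indicator (cball 0 R) x *\<^sub>R f x)"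
    "((\<lambda>R. l2norm (\<lambda>x. indicator (cball 0 R) x *\<^sub>R f x - f x)) \<longlongrightarrow> 0) at_top"
proof -
  have fm [measurable]: "f \<in> borel_measurable lebesgue" by (rule L2_measurable[OF f])
  have B: "cball 0 R \<in> sets (lebesgue :: (real ^ 'n) measure)" for R by simp
  have gm: "(\<lambda>x. indicator (cball 0 R) x *\<^sub>R f x) \<in> borel_measurable lebesgue" for R
    by (intro borel_measurable_scaleR borel_measurable_indicator B fm)
  show "(\<lambda>x. indicator (cball 0 R) x *\<^sub>R f x) \<in> L2"
    by (rule L2I[OF gm L2_integrable_square[OF f]]) (auto split: split_indicator)
  have "emeasure lebesgue (cball 0 R :: (real ^ 'n) set) < \<infinity>"
    using emeasure_lborel_cball_finite[of 0 R] by simp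
  then have ii: "integrable lebesgue (indicator (cball 0 R) :: real ^ 'n \<Rightarrow> real)"
    using B by (intro integrable_real_indicator) auto
  show "integrable lebesgue (\<lambda>x. indicator (cball 0 R) x *\<^sub>R f x)"
  proof (rule Bochner_Integration.integrable_bound)
    show "integrable lebesgue (\<lambda>x. indicator (cball 0 R) x + (cmod (f x))\<^sup>2)"
      by (intro Bochner_Integration.integrable_add ii L2_integrable_square f)
    show "AE x in lebesgue. norm (indicator (cball 0 R) x *\<^sub>R f x) \<le> norm (indicator (cball 0 R) x + (cmod (f x))\<^sup>2)"
    proof (intro AE_I2)
      fix x
      have "2 * cmod (f x) \<le> 1 + (cmod (f x))\<^sup>2"
        using sum_squares_bound[of 1 "cmod (f x)"] by simp
      then have "cmod (f x) \<le> 1 + (cmod (f x))\<^sup>2"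
        using norm_ge_zero[of "f x"] by linarith
      then show "norm (indicator (cball 0 R) x *\<^sub>R f x) \<le> norm (indicator (cball 0 R) x + (cmod (f x))\<^sup>2)"
        by (auto split: split_indicator)
    qed
  qed (rule gm)
  have "((\<lambda>R. \<integral>x. (cmod (indicator (cball 0 R) x *\<^sub>R f x - f x))\<^sup>2 \<partial>lebesgue) \<longlongrightarrow> (\<integral>x. 0 \<partial>(lebesgue :: (real ^ 'n) measure))) at_top"
  proof (rule integral_dominated_convergence_at_top[where w = "\<lambda>x. (cmod (f x))\<^sup>2"])
    show "(\<lambda>x. (cmod (indicator (cball 0 R) x *\<^sub>R f x - f x))\<^sup>2) \<in> borel_measurable lebesgue" for R
      by (intro borel_measurable_power borel_measurable_norm borel_measurable_diff gm fm
          measurable_compose[OF _ borel_measurable_norm])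
    show "integrable lebesgue (\<lambda>x. (cmod (f x))\<^sup>2)" by (rule L2_integrable_square[OF f])
    show "AE x in lebesgue. ((\<lambda>R. (cmod (indicator (cball 0 R) x *\<^sub>R f x - f x))\<^sup>2) \<longlongrightarrow> 0) at_top"
    proof (intro AE_I2 tendsto_eventually)
      fix x :: "real ^ 'n"
      show "\<forall>\<^sub>F R in at_top. (cmod (indicator (cball 0 R) x *\<^sub>R f x - f x))\<^sup>2 = 0"
        using eventually_ge_at_top[of "norm x"] by eventually_elim simp
    qed
    show "\<forall>\<^sub>F R in at_top. AE x in lebesgue. norm ((cmod (indicator (cball 0 R) x *\<^sub>R f x - f x))\<^sup>2) \<le> (cmod (f x))\<^sup>2"
      by (intro always_eventually allI AE_I2) (auto split: split_indicator)
  qed simp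
  then have "((\<lambda>R. sqrt (\<integral>x. (cmod (indicator (cball 0 R) x *\<^sub>R f x - f x))\<^sup>2 \<partial>lebesgue)) \<longlongrightarrow> sqrt 0) at_top"
    by (intro tendsto_real_sqrt) simp
  then show "((\<lambda>R. l2norm (\<lambda>x. indicator (cball 0 R) x *\<^sub>R f x - f x)) \<longlongrightarrow> 0) at_top"
    by (simp add: l2norm_def)
qed

lemma truncated_fourier_eq:
  "truncated_fourier s f R = fourier_integral s (\<lambda>x. indicator (cball 0 R) x *\<^sub>R f x)"
  by (simp add: fun_eq_iff truncated_fourier_def fourier_integral_def set_lebesgue_integral_def)

text \<open>The error of the truncated Fourier integral and the error of the truncation of \<open>f\<close> have Hermite
  coefficients of the same absolute values, hence the same norm.\<close>

lemma truncated_fourier_tendsto: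
  fixes f :: "real ^ 'n::finite \<Rightarrow> complex"
  assumes f: "f \<in> L2" and s: "s = 1 \<or> s = -1" and G: "G \<in> L2"
    and c: "\<And>\<alpha>. hermite_coeff \<alpha> G = (of_real s * \<i>) ^ msize \<alpha> * hermite_coeff \<alpha> f"
  shows "L2_tendsto (truncated_fourier s f) G at_top"
  unfolding L2_tendsto_def
proof (intro conjI allI G)
  let ?t = "\<lambda>R x. indicator (cball 0 R) x *\<^sub>R f x"
  show T: "truncated_fourier s f R \<in> L2" for R
    unfolding truncated_fourier_eq by (intro fourier_integral_L2 truncation_L2 f s)
  have "l2norm (\<lambda>x. truncated_fourier s f R x - G x) = l2norm (\<lambda>x. ?t R x - f x)" for R
  proof -
    let ?u = "\<lambda>x. truncated_fourier s f R x - G x" and ?v = "\<lambda>x. ?t R x - f x"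
    have uv: "?u \<in> L2" "?v \<in> L2" by (intro L2_diff T G truncation_L2 f)+
    have "hermite_coeff \<alpha> (truncated_fourier s f R) = (of_real s * \<i>) ^ msize \<alpha> * hermite_coeff \<alpha> (?t R)" for \<alpha>
      unfolding truncated_fourier_eq by (rule hermite_coeff_fourier_integral[OF truncation_L2(2)[OF f] s])
    then have "hermite_coeff \<alpha> ?u = (of_real s * \<i>) ^ msize \<alpha> * hermite_coeff \<alpha> ?v" for \<alpha>
      unfolding hermite_coeff_diff[OF T G] hermite_coeff_diff[OF truncation_L2(1)[OF f] f] c
      by (simp only: right_diff_distrib)
    then have "(\<lambda>\<alpha>. (cmod (hermite_coeff \<alpha> ?u))\<^sup>2) = (\<lambda>\<alpha>. (cmod (hermite_coeff \<alpha> ?v))\<^sup>2)"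
      by (simp only: norm_mult norm_unit_power[OF s] mult_1_left)
    then have "((\<lambda>\<alpha>. (cmod (hermite_coeff \<alpha> ?v))\<^sup>2) has_sum (l2norm ?u)\<^sup>2) UNIV"
      using Parseval[OF uv(1)] by (simp only:)
    from has_sum_unique[OF this Parseval[OF uv(2)]] have "(l2norm ?u)\<^sup>2 = (l2norm ?v)\<^sup>2" .
    then show ?thesis by simp
  qed
  then show "((\<lambda>R. l2norm (\<lambda>x. truncated_fourier s f R x - G x)) \<longlongrightarrow> 0) at_top"
    using truncation_L2(3)[OF f] by simp
qed

lemma L2_tendsto_unique_coeff:
  assumes "L2_tendsto u f F" "L2_tendsto u g F" "F \<noteq> bot"
  shows "hermite_coeff \<alpha> f = hermite_coeff \<alpha> g"
  unfolding hermite_coeff_eq using assms(3)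
  by (rule tendsto_unique) (use assms in \<open>auto simp: L2_tendsto_def intro!: L2_tendsto_integral_mult hermite_fun_L2\<close>)

lemma limit_of_truncated_fourier:
  fixes f :: "real ^ 'n::finite \<Rightarrow> complex"
  assumes f: "f \<in> L2" and s: "s = 1 \<or> s = -1"
  shows "(SOME g. L2_tendsto (truncated_fourier s f) g at_top) \<in> L2"
    "hermite_coeff \<alpha> (SOME g. L2_tendsto (truncated_fourier s f) g at_top)
      = (of_real s * \<i>) ^ msize \<alpha> * hermite_coeff \<alpha> f"
proof -
  obtain G where G: "G \<in> L2" "\<And>\<alpha>. hermite_coeff \<alpha> G = (of_real s * \<i>) ^ msize \<alpha> * hermite_coeff \<alpha> f"
    using rotated_coefficients[OF f s] by blast
  have T: "L2_tendsto (truncated_fourier s f) G at_top"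
    by (rule truncated_fourier_tendsto[OF f s G])
  then have S: "L2_tendsto (truncated_fourier s f) (SOME g. L2_tendsto (truncated_fourier s f) g at_top) at_top"
    by (rule someI[where P = "\<lambda>g. L2_tendsto (truncated_fourier s f) g at_top"])
  then show "(SOME g. L2_tendsto (truncated_fourier s f) g at_top) \<in> L2"
    unfolding L2_tendsto_def[of _ "Eps _"] by blast
  show "hermite_coeff \<alpha> (SOME g. L2_tendsto (truncated_fourier s f) g at_top)
      = (of_real s * \<i>) ^ msize \<alpha> * hermite_coeff \<alpha> f"
    using L2_tendsto_unique_coeff[OF S T] by (simp add: G(2))
qed

lemma fourier_L2:
  assumes "f \<in> L2"
  shows "fourier f \<in> L2" "hermite_coeff \<alpha> (fourier f) = (- \<i>) ^ msize \<alpha> * hermite_coeff \<alpha> f"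
  using limit_of_truncated_fourier[OF assms, of "-1"] by (simp_all add: fourier_def)

lemma inverse_fourier_L2:
  assumes "f \<in> L2"
  shows "inverse_fourier f \<in> L2" "hermite_coeff \<alpha> (inverse_fourier f) = \<i> ^ msize \<alpha> * hermite_coeff \<alpha> f"
  using limit_of_truncated_fourier[OF assms, of 1] by (simp_all add: inverse_fourier_def)

lemma energy_fourier: "f \<in> L2 \<Longrightarrow> energy k (fourier f) = energy k f"
  by (simp add: fun_eq_iff energy_def fourier_L2 norm_mult norm_power)

lemma energy_inverse_fourier: "f \<in> L2 \<Longrightarrow> energy k (inverse_fourier f) = energy k f"
  by (simp add: fun_eq_iff energy_def inverse_fourier_L2 norm_mult norm_power)

lemma hermite_sobolev_cong_energy:
  assumes f: "f \<in> hermite_sobolev k" and g: "g \<in> L2" and e: "energy k g = energy k f"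
  shows "g \<in> hermite_sobolev k" "hermite_sobolev_norm k g = hermite_sobolev_norm k f"
proof -
  show W: "g \<in> hermite_sobolev k"
    by (rule hermite_sobolevI[OF g]) (unfold e, rule sum_energy_le[OF f])
  have "(hermite_sobolev_norm k g)\<^sup>2 = (hermite_sobolev_norm k f)\<^sup>2"
    using has_sum_unique[OF hermite_sobolev_has_sum[OF W]] hermite_sobolev_has_sum[OF f] by (simp add: e)
  then show "hermite_sobolev_norm k g = hermite_sobolev_norm k f" by simp
qed

lemma hermite_sobolev_cong_AE:
  assumes f: "f \<in> hermite_sobolev k" and g: "g \<in> borel_measurable lebesgue" and e: "AE x in lebesgue. f x = g x"
  shows "g \<in> hermite_sobolev k" "hermite_sobolev_norm k g = hermite_sobolev_norm k f"
proof -
  have L: "g \<in> L2" by (rule L2_cong_AE[OF hermite_sobolev_L2[OF f] g e])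
  have "energy k g = energy k f"
    unfolding energy_def[abs_def] hermite_coeff_cong_AE[OF hermite_sobolev_L2[OF f] g e] ..
  from hermite_sobolev_cong_energy[OF f L this]
  show "g \<in> hermite_sobolev k" "hermite_sobolev_norm k g = hermite_sobolev_norm k f" .
qed

text \<open>The Fourier transform only changes the phases of the Hermite coefficients. So it is an isometry of
  \<open>W\<^sub>H\<^sup>k\<^sup>,\<^sup>2\<close>, and conjugation with it turns Fourier multipliers into pointwise multipliers.\<close>

lemma hermite_multipliers_iff:
  fixes m :: "real ^ 'n::finite \<Rightarrow> complex"
  assumes m: "m \<in> borel_measurable lebesgue"
  shows "m \<in> hermite_multipliers k \<longleftrightarrow> (\<exists>C. \<forall>g\<in>hermite_sobolev k.
    (\<lambda>x. m x * g x) \<in> hermite_sobolev k \<and>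
    hermite_sobolev_norm k (\<lambda>x. m x * g x) \<le> C * hermite_sobolev_norm k g)"
    (is "_ \<longleftrightarrow> (\<exists>C. \<forall>g\<in>?W. ?P C g)")
proof
  assume "m \<in> hermite_multipliers k"
  then obtain C where C: "\<And>f. f \<in> ?W \<Longrightarrow> (\<lambda>\<xi>. m \<xi> * fourier f \<xi>) \<in> L2 \<and>
       fourier_multiplier m f \<in> ?W \<and>
       hermite_sobolev_norm k (fourier_multiplier m f) \<le> C * hermite_sobolev_norm k f"
    by (auto simp: hermite_multipliers_def)
  have "?P C g" if g: "g \<in> ?W" for g
  proof -
    have gL: "g \<in> L2" by (rule hermite_sobolev_L2[OF g])
    let ?f = "inverse_fourier g"
    have fL: "?f \<in> L2" by (rule inverse_fourier_L2(1)[OF gL])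
    note f = hermite_sobolev_cong_energy[OF g fL energy_inverse_fourier[OF gL]]
    have "hermite_coeff \<alpha> (fourier ?f) = hermite_coeff \<alpha> g" for \<alpha>
      by (simp add: fourier_L2(2)[OF fL] inverse_fourier_L2(2)[OF gL] mult.assoc[symmetric]
          power_mult_distrib[symmetric])
    then have ae: "AE x in lebesgue. fourier ?f x = g x"
      by (rule hermite_coeff_unique[OF fourier_L2(1)[OF fL] gL])
    let ?u = "\<lambda>x. m x * fourier ?f x"
    have u: "?u \<in> L2" using C[OF f(1)] by blast
    have uW: "?u \<in> ?W" "hermite_sobolev_norm k ?u = hermite_sobolev_norm k (fourier_multiplier m ?f)"
      using hermite_sobolev_cong_energy[of "fourier_multiplier m ?f" k ?u] C[OF f(1)] u
      by (simp_all add: fourier_multiplier_def energy_inverse_fourier)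
    have mm: "(\<lambda>x. m x * g x) \<in> borel_measurable lebesgue"
      by (intro borel_measurable_times m L2_measurable gL)
    have "AE x in lebesgue. ?u x = m x * g x" using ae by eventually_elim simp
    from hermite_sobolev_cong_AE[OF uW(1) mm this] show ?thesis
      using C[OF f(1)] f(2) uW(2) by simp
  qed
  then show "\<exists>C. \<forall>g\<in>?W. ?P C g" by blast
next
  assume "\<exists>C. \<forall>g\<in>?W. ?P C g"
  then obtain C where C: "\<And>g. g \<in> ?W \<Longrightarrow> ?P C g" by blast
  have "(\<lambda>\<xi>. m \<xi> * fourier f \<xi>) \<in> L2 \<and> fourier_multiplier m f \<in> ?W \<and>
      hermite_sobolev_norm k (fourier_multiplier m f) \<le> C * hermite_sobolev_norm k f"
    if f: "f \<in> ?W" for f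
  proof -
    have fL: "f \<in> L2" by (rule hermite_sobolev_L2[OF f])
    note g = hermite_sobolev_cong_energy[OF f fourier_L2(1)[OF fL] energy_fourier[OF fL]]
    let ?u = "\<lambda>x. m x * fourier f x"
    have u: "?u \<in> ?W" "hermite_sobolev_norm k ?u \<le> C * hermite_sobolev_norm k f"
      using C[OF g(1)] g(2) by auto
    have uL: "?u \<in> L2" by (rule hermite_sobolev_L2[OF u(1)])
    show ?thesis
      using hermite_sobolev_cong_energy[OF u(1) inverse_fourier_L2(1)[OF uL] energy_inverse_fourier[OF uL]] u uL
      by (simp add: fourier_multiplier_def)
  qed
  then show "m \<in> hermite_multipliers k"
    using m by (auto simp: hermite_multipliers_def)
qed

section \<open>Multipliers\<close>

subsection \<open>Extension from Hermite sums\<close>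

text \<open>The estimate is demanded for finite Hermite sums only, which are smooth and decay rapidly. It extends
  to the whole space by density.\<close>

definition mult_bounded :: "nat \<Rightarrow> (real ^ 'n::finite \<Rightarrow> complex) \<Rightarrow> real \<Rightarrow> bool" where
  "mult_bounded k m C \<longleftrightarrow> 0 \<le> C \<and> (\<forall>f\<in>hspan. (\<lambda>x. m x * f x) \<in> hermite_sobolev k \<and>
     hermite_sobolev_norm k (\<lambda>x. m x * f x) \<le> C * hermite_sobolev_norm k f)"

abbreviation partial_sum :: "nat \<Rightarrow> (real ^ 'n::finite \<Rightarrow> complex) \<Rightarrow> real ^ 'n \<Rightarrow> complex" where
  "partial_sum N g \<equiv> hermite_sum (index_ball N) (\<lambda>\<alpha>. hermite_coeff \<alpha> g)"

lemma hermite_sobolev_norm_hermite_sum: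
  assumes "finite A"
  shows "(hermite_sobolev_norm k (hermite_sum A c))\<^sup>2 = (\<Sum>\<alpha>\<in>A. hermite_eigenvalue \<alpha> ^ k * (cmod (c \<alpha>))\<^sup>2)"
  using hermite_sobolev_norm_finite(2)[OF hermite_sum_L2 assms, of _ c k] assms
  by (simp add: energy_def hermite_coeff_hermite_sum)

lemma energy_partial_sum: "energy k (partial_sum N g) \<alpha> = (if \<alpha> \<in> index_ball N then energy k g \<alpha> else 0)"
  by (simp add: energy_def hermite_coeff_hermite_sum)

lemma hermite_sobolev_norm_partial_sum:
  assumes "g \<in> hermite_sobolev k"
  shows "hermite_sobolev_norm k (partial_sum N g) \<le> hermite_sobolev_norm k g"
proof (rule hermite_sobolev_norm_le(2)[OF hermite_sum_L2 hermite_sobolev_norm_nonneg])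
  fix A :: "('a \<Rightarrow> nat) set"
  have "sum (energy k (partial_sum N g)) A \<le> sum (energy k g) A"
    by (intro sum_mono) (simp add: energy_partial_sum)
  also have "\<dots> \<le> (hermite_sobolev_norm k g)\<^sup>2" by (rule sum_energy_le[OF assms])
  finally show "sum (energy k (partial_sum N g)) A \<le> (hermite_sobolev_norm k g)\<^sup>2" .
qed

lemma hermite_sobolev_remainder:
  fixes g :: "real ^ 'n::finite \<Rightarrow> complex"
  assumes g: "g \<in> hermite_sobolev k"
  shows "(\<lambda>x. partial_sum N g x - g x) \<in> hermite_sobolev k"
    "(\<lambda>N. hermite_sobolev_norm k (\<lambda>x. partial_sum N g x - g x)) \<longlonglongrightarrow> 0"
proof -
  have gL: "g \<in> L2" by (rule hermite_sobolev_L2[OF g])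
  let ?r = "\<lambda>N x. partial_sum N g x - g x"
  have rL: "?r N \<in> L2" for N by (intro L2_diff hermite_sum_L2 gL)
  have e: "energy k (?r N) \<alpha> = (if \<alpha> \<in> index_ball N then 0 else energy k g \<alpha>)" for N \<alpha>
    by (simp add: energy_def hermite_coeff_diff[OF hermite_sum_L2 gL] hermite_coeff_hermite_sum)
  have W: "?r N \<in> hermite_sobolev k" for N
  proof (rule hermite_sobolevI[OF rL])
    fix A :: "('n \<Rightarrow> nat) set"
    have "sum (energy k (?r N)) A \<le> sum (energy k g) A"
      by (intro sum_mono) (simp add: e)
    also have "\<dots> \<le> (hermite_sobolev_norm k g)\<^sup>2" by (rule sum_energy_le[OF g])
    finally show "sum (energy k (?r N)) A \<le> (hermite_sobolev_norm k g)\<^sup>2" .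
  qed
  then show "?r N \<in> hermite_sobolev k" .
  let ?S = "(hermite_sobolev_norm k g)\<^sup>2"
  have sq: "(hermite_sobolev_norm k (?r N))\<^sup>2 = ?S - sum (energy k g) (index_ball N)" for N
  proof -
    have "(energy k g has_sum (?S - sum (energy k g) (index_ball N))) (UNIV - index_ball N)"
      by (intro has_sum_Diff hermite_sobolev_has_sum[OF g] has_sum_finite) auto
    then have "(energy k (?r N) has_sum (?S - sum (energy k g) (index_ball N))) UNIV"
      by (subst has_sum_cong_neutral[where g = "energy k g" and T = "UNIV - index_ball N"]) (auto simp: e)
    from has_sum_unique[OF hermite_sobolev_has_sum[OF W] this] show ?thesis .
  qed
  have "(\<lambda>N. sum (energy k g) (index_ball N)) \<longlonglongrightarrow> ?S"
    using filterlim_compose[OF _ filterlim_index_ball] hermite_sobolev_has_sum[OF g]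
    unfolding has_sum_def by blast
  then have "(\<lambda>N. sqrt (?S - sum (energy k g) (index_ball N))) \<longlonglongrightarrow> sqrt (?S - ?S)"
    by (intro tendsto_intros)
  moreover have "sqrt (?S - sum (energy k g) (index_ball N)) = hermite_sobolev_norm k (?r N)" for N
    unfolding sq[symmetric] by simp
  ultimately show "(\<lambda>N. hermite_sobolev_norm k (?r N)) \<longlonglongrightarrow> 0" by simp
qed

text \<open>A priori \<open>m\<close> may be unbounded, so multiplication by \<open>m\<close> need not be continuous on \<open>L\<^sup>2\<close>. Fatou's lemma
  along an almost everywhere convergent subsequence of partial sums \<open>g\<^sub>N\<close> puts \<open>m g\<close> into \<open>L\<^sup>2\<close>; the
  resulting bound, applied to the remainders \<open>g\<^sub>N - g\<close>, then gives \<open>m g\<^sub>N \<rightarrow> m g\<close> in \<open>L\<^sup>2\<close>.\<close>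

lemma mult_bounded_extend_L2:
  assumes mb: "mult_bounded k m C" and m: "m \<in> borel_measurable lebesgue" and g: "g \<in> hermite_sobolev k"
  shows "(\<lambda>x. m x * g x) \<in> L2" "l2norm (\<lambda>x. m x * g x) \<le> C * hermite_sobolev_norm k g"
proof -
  have C: "0 \<le> C" using mb by (simp add: mult_bounded_def)
  have gL: "g \<in> L2" by (rule hermite_sobolev_L2[OF g])
  obtain r where r: "strict_mono r" "AE x in lebesgue. (\<lambda>n. partial_sum (r n) g x) \<longlonglongrightarrow> g x"
    using L2_tendsto_AE_subseq[OF hermite_sum_L2 gL LIMSEQ_hermite_sum[OF gL]] by blast
  have u: "(\<lambda>x. m x * partial_sum n g x) \<in> L2 \<and>
      l2norm (\<lambda>x. m x * partial_sum n g x) \<le> C * hermite_sobolev_norm k g" for n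
  proof -
    have *: "(\<lambda>x. m x * partial_sum n g x) \<in> hermite_sobolev k"
      "hermite_sobolev_norm k (\<lambda>x. m x * partial_sum n g x) \<le> C * hermite_sobolev_norm k (partial_sum n g)"
      using mb hermite_sum_hspan unfolding mult_bounded_def by blast+
    have "l2norm (\<lambda>x. m x * partial_sum n g x) \<le> C * hermite_sobolev_norm k (partial_sum n g)"
      using l2norm_le_hermite_sobolev_norm[OF *(1)] *(2) by linarith
    also have "\<dots> \<le> C * hermite_sobolev_norm k g"
      by (intro mult_left_mono C hermite_sobolev_norm_partial_sum g)
    finally show ?thesis using hermite_sobolev_L2[OF *(1)] by blast
  qed
  have mm: "(\<lambda>x. m x * g x) \<in> borel_measurable lebesgue"
    by (intro borel_measurable_times m L2_measurable gL)
  have "AE x in lebesgue. (\<lambda>n. m x * partial_sum (r n) g x) \<longlonglongrightarrow> m x * g x"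
    using r(2) by eventually_elim (intro tendsto_mult tendsto_const)
  note F = L2_Fatou[OF conjunct1[OF u] conjunct2[OF u] mm this]
  show "(\<lambda>x. m x * g x) \<in> L2" "l2norm (\<lambda>x. m x * g x) \<le> C * hermite_sobolev_norm k g"
    by (rule F(1), rule F(2))
qed

lemma mult_bounded_extend:
  assumes mb: "mult_bounded k m C" and m: "m \<in> borel_measurable lebesgue" and g: "g \<in> hermite_sobolev k"
  shows "(\<lambda>x. m x * g x) \<in> hermite_sobolev k"
    "hermite_sobolev_norm k (\<lambda>x. m x * g x) \<le> C * hermite_sobolev_norm k g"
proof -
  let ?u = "\<lambda>N x. m x * partial_sum N g x" and ?v = "\<lambda>x. m x * g x"
  have C: "0 \<le> C" using mb by (simp add: mult_bounded_def)
  have W: "?u N \<in> hermite_sobolev k"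
      "hermite_sobolev_norm k (?u N) \<le> C * hermite_sobolev_norm k (partial_sum N g)" for N
    using mb hermite_sum_hspan unfolding mult_bounded_def by blast+
  have uL: "?u N \<in> L2" for N by (rule hermite_sobolev_L2[OF W(1)])
  have vL: "?v \<in> L2" by (rule mult_bounded_extend_L2(1)[OF mb m g])
  have lim: "(\<lambda>N. l2norm (\<lambda>x. ?u N x - ?v x)) \<longlonglongrightarrow> 0"
  proof (rule tendsto_sandwich[of "\<lambda>_. 0"])
    have "l2norm (\<lambda>x. ?u N x - ?v x) \<le> C * hermite_sobolev_norm k (\<lambda>x. partial_sum N g x - g x)" for N
      using mult_bounded_extend_L2(2)[OF mb m hermite_sobolev_remainder(1)[OF g, of N]]
      by (simp only: right_diff_distrib)
    then show "\<forall>\<^sub>F N in sequentially. l2norm (\<lambda>x. ?u N x - ?v x)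
        \<le> C * hermite_sobolev_norm k (\<lambda>x. partial_sum N g x - g x)" by simp
    show "(\<lambda>N. C * hermite_sobolev_norm k (\<lambda>x. partial_sum N g x - g x)) \<longlonglongrightarrow> 0"
      using tendsto_mult[OF tendsto_const hermite_sobolev_remainder(2)[OF g], of C] by simp
  qed auto
  have B: "0 \<le> C * hermite_sobolev_norm k g" using C by simp
  have "sum (energy k ?v) A \<le> (C * hermite_sobolev_norm k g)\<^sup>2" for A
  proof (rule LIMSEQ_le_const2)
    have "(\<lambda>N. hermite_coeff \<alpha> (?u N)) \<longlonglongrightarrow> hermite_coeff \<alpha> ?v" for \<alpha>
      using L2_tendsto_integral_mult[OF uL vL hermite_fun_L2 lim, of \<alpha>]
      by (simp only: hermite_coeff_eq[symmetric])
    then show "(\<lambda>N. sum (energy k (?u N)) A) \<longlonglongrightarrow> sum (energy k ?v) A"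
      unfolding energy_def by (intro tendsto_intros)
    have "sum (energy k (?u N)) A \<le> (C * hermite_sobolev_norm k g)\<^sup>2" for N
    proof -
      have "hermite_sobolev_norm k (?u N) \<le> C * hermite_sobolev_norm k g"
        using W(2)[of N] mult_left_mono[OF hermite_sobolev_norm_partial_sum[OF g, of N] C] by linarith
      then have "(hermite_sobolev_norm k (?u N))\<^sup>2 \<le> (C * hermite_sobolev_norm k g)\<^sup>2"
        by (intro power_mono) auto
      then show ?thesis using sum_energy_le[OF W(1), of N A] by linarith
    qed
    then show "\<exists>N. \<forall>n\<ge>N. sum (energy k (?u n)) A \<le> (C * hermite_sobolev_norm k g)\<^sup>2" by blast
  qed
  note le = this
  show "?v \<in> hermite_sobolev k" by (rule hermite_sobolev_norm_le(1)[OF vL B le])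
  show "hermite_sobolev_norm k ?v \<le> C * hermite_sobolev_norm k g"
    by (rule hermite_sobolev_norm_le(2)[OF vL B le])
qed

lemma hermite_multipliers_mult_bounded:
  assumes m: "m \<in> borel_measurable lebesgue"
  shows "m \<in> hermite_multipliers k \<longleftrightarrow> (\<exists>C. mult_bounded k m C)"
proof
  assume "m \<in> hermite_multipliers k"
  then obtain C where C: "\<And>g. g \<in> hermite_sobolev k \<Longrightarrow> (\<lambda>x. m x * g x) \<in> hermite_sobolev k \<and>
    hermite_sobolev_norm k (\<lambda>x. m x * g x) \<le> C * hermite_sobolev_norm k g"
    using hermite_multipliers_iff[OF m] by blast
  have "mult_bounded k m \<bar>C\<bar>"
    unfolding mult_bounded_def
  proof (intro conjI ballI)
    fix f :: "real ^ 'a \<Rightarrow> complex" assume "f \<in> hspan"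
    then have f: "f \<in> hermite_sobolev k" by (rule hspan_hermite_sobolev)
    show "(\<lambda>x. m x * f x) \<in> hermite_sobolev k" using C[OF f] by blast
    have "hermite_sobolev_norm k (\<lambda>x. m x * f x) \<le> C * hermite_sobolev_norm k f" using C[OF f] by blast
    also have "\<dots> \<le> \<bar>C\<bar> * hermite_sobolev_norm k f" by (intro mult_right_mono) auto
    finally show "hermite_sobolev_norm k (\<lambda>x. m x * f x) \<le> \<bar>C\<bar> * hermite_sobolev_norm k f" .
  qed simp
  then show "\<exists>C. mult_bounded k m C" by blast
next
  assume "\<exists>C. mult_bounded k m C"
  then obtain C where "mult_bounded k m C" by blast
  note E = mult_bounded_extend[OF this m]
  show "m \<in> hermite_multipliers k"
    unfolding hermite_multipliers_iff[OF m] using E by blast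
qed

subsection \<open>Multipliers are bounded functions\<close>

text \<open>The multiplier \<open>m\<^sup>N\<close> has norm at most \<open>C\<^sup>N\<close>. Applied to the Gaussian \<open>h\<^sub>0 > 0\<close> this gives
  \<open>\<integral> |m|\<^bsup>2N\<^esup> h\<^sub>0\<^sup>2 \<le> C\<^bsup>2N\<^esup> K\<close>, which for \<open>N \<rightarrow> \<infinity>\<close> leaves no mass where \<open>|m| > C\<close>.\<close>

lemma mult_bounded_power:
  assumes mb: "mult_bounded k m C" and m: "m \<in> borel_measurable lebesgue" and g: "g \<in> hermite_sobolev k"
  shows "(\<lambda>x. m x ^ N * g x) \<in> hermite_sobolev k \<and>
    hermite_sobolev_norm k (\<lambda>x. m x ^ N * g x) \<le> C ^ N * hermite_sobolev_norm k g"
proof (induction N)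
  case (Suc N)
  have C: "0 \<le> C" using mb by (simp add: mult_bounded_def)
  note E = mult_bounded_extend[OF mb m conjunct1[OF Suc.IH]]
  have "hermite_sobolev_norm k (\<lambda>x. m x * (m x ^ N * g x)) \<le> C * (C ^ N * hermite_sobolev_norm k g)"
    using E(2) mult_left_mono[OF conjunct2[OF Suc.IH] C] by linarith
  with E(1) show ?case by (simp only: power_Suc mult.assoc simp_thms)
qed (use g in simp)

lemma mult_bounded_AE_le:
  fixes m :: "real ^ 'n::finite \<Rightarrow> complex"
  assumes mb: "mult_bounded k m C" and m: "m \<in> borel_measurable lebesgue"
  shows "AE x in lebesgue. cmod (m x) \<le> C"
proof -
  have C: "0 \<le> C" using mb by (simp add: mult_bounded_def)
  let ?h = "hermite_fun (\<lambda>i. 0) :: real ^ 'n \<Rightarrow> complex"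
  let ?K = "hermite_sobolev_norm k ?h"
  have h: "?h \<in> hermite_sobolev k" by (intro hspan_hermite_sobolev hspan_hermite_fun)
  have h0: "?h x \<noteq> 0" for x
  proof -
    obtain c where "c > 0" "\<And>x :: real ^ 'n. ?h x = of_real c * gauss (1/2) x"
      using hermite_fun_0_gauss by blast
    then show ?thesis by simp
  qed
  have above: "AE x in lebesgue. cmod (m x) < a" if a: "C < a" for a
  proof -
    have a0: "a > 0" using a C by linarith
    define S where "S = {x. a \<le> cmod (m x)}"
    have S: "S \<in> sets lebesgue"
    proof -
      have "{x \<in> space lebesgue. a \<le> cmod (m x)} \<in> sets lebesgue"
        using measurable_compose[OF m borel_measurable_norm]
        by (intro borel_measurable_le borel_measurable_const) auto
      then show ?thesis by (simp add: S_def)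
    qed
    let ?q = "\<lambda>x. indicator S x * (cmod (?h x))\<^sup>2"
    have ih: "integrable lebesgue (\<lambda>x. (cmod (?h x))\<^sup>2)" by (intro L2_integrable_square hermite_fun_L2)
    have iq: "integrable lebesgue ?q"
      using integrable_mult_indicator[OF S ih] by simp
    have le: "(\<integral>x. ?q x \<partial>lebesgue) \<le> ((C / a)\<^sup>2) ^ N * ?K\<^sup>2" for N
    proof -
      let ?u = "\<lambda>x. m x ^ N * ?h x"
      note P = mult_bounded_power[OF mb m h, of N]
      have uL: "?u \<in> L2" by (rule hermite_sobolev_L2[OF conjunct1[OF P]])
      have "(a\<^sup>2) ^ N * (\<integral>x. ?q x \<partial>lebesgue) = (\<integral>x. (a\<^sup>2) ^ N * ?q x \<partial>lebesgue)" by simp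
      also have "\<dots> \<le> (\<integral>x. (cmod (?u x))\<^sup>2 \<partial>lebesgue)"
      proof (rule integral_mono)
        show "integrable lebesgue (\<lambda>x. (a\<^sup>2) ^ N * ?q x)" using iq by simp
        show "integrable lebesgue (\<lambda>x. (cmod (?u x))\<^sup>2)" by (rule L2_integrable_square[OF uL])
        fix x
        have "(cmod (?u x))\<^sup>2 = ((cmod (m x))\<^sup>2) ^ N * (cmod (?h x))\<^sup>2"
          by (simp only: norm_mult norm_power power_mult_distrib power_mult[symmetric] mult.commute[of N 2])
        moreover have "(a\<^sup>2) ^ N \<le> ((cmod (m x))\<^sup>2) ^ N" if "x \<in> S"
          using that a0 by (intro power_mono) (auto simp: S_def)
        ultimately show "(a\<^sup>2) ^ N * ?q x \<le> (cmod (?u x))\<^sup>2"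
          by (auto split: split_indicator intro!: mult_right_mono)
      qed
      also have "\<dots> = (l2norm ?u)\<^sup>2" by (rule l2norm_square[symmetric])
      also have "\<dots> \<le> (C ^ N * ?K)\<^sup>2"
        using l2norm_le_hermite_sobolev_norm[OF conjunct1[OF P]] conjunct2[OF P]
        by (intro power_mono) auto
      also have "\<dots> = (C\<^sup>2) ^ N * ?K\<^sup>2"
        by (simp only: power_mult_distrib power_mult[symmetric] mult.commute[of N 2])
      finally have "(\<integral>x. ?q x \<partial>lebesgue) \<le> (C\<^sup>2) ^ N * ?K\<^sup>2 / (a\<^sup>2) ^ N"
        using a0 by (subst pos_le_divide_eq) (auto simp: mult.commute)
      then show ?thesis by (simp add: power_divide)
    qed
    have "(\<lambda>N. ((C / a)\<^sup>2) ^ N * ?K\<^sup>2) \<longlonglongrightarrow> 0 * ?K\<^sup>2"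
    proof (intro tendsto_mult tendsto_const LIMSEQ_realpow_zero)
      have "C / a < 1" "0 \<le> C / a" using a a0 C by auto
      then show "(C / a)\<^sup>2 < 1" by (simp add: power_less_one_iff abs_square_less_1)
    qed simp
    then have "(\<integral>x. ?q x \<partial>lebesgue) \<le> 0 * ?K\<^sup>2"
      by (rule LIMSEQ_le_const) (use le in blast)
    moreover have "0 \<le> (\<integral>x. ?q x \<partial>lebesgue)" by (rule Bochner_Integration.integral_nonneg) simp
    ultimately have "(\<integral>x. ?q x \<partial>lebesgue) = 0" by simp
    then have "AE x in lebesgue. ?q x = 0"
      using integral_nonneg_eq_0_iff_AE[OF iq] by simp
    then show ?thesis
    proof eventually_elim
      case (elim x)
      then have "x \<notin> S" using h0[of x] by auto
      then show ?case by (simp add: S_def not_le)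
    qed
  qed
  have "AE x in lebesgue. \<forall>n. cmod (m x) < C + 1 / real (Suc n)"
    unfolding AE_all_countable by (intro allI above) simp
  then show ?thesis
  proof eventually_elim
    case (elim x)
    have "(\<lambda>n. C + 1 / real (Suc n)) \<longlonglongrightarrow> C + 0"
      by (intro tendsto_add tendsto_const) (use LIMSEQ_inverse_real_of_nat in \<open>simp add: inverse_eq_divide\<close>)
    then have "cmod (m x) \<le> C + 0"
      by (rule LIMSEQ_le_const) (use elim less_imp_le in blast)
    then show ?case by simp
  qed
qed

subsection \<open>Interpolation\<close>

text \<open>For \<open>0 < j < k\<close> the power \<open>\<lambda>\<^sup>j\<close> is comparable to \<open>\<Sum>\<^sub>i 2\<^bsup>ij\<^esup> min 1 ((\<lambda>/2\<^sup>i)\<^sup>k)\<close>: both tails are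
  geometric around the \<open>i\<close> with \<open>2\<^sup>i \<le> \<lambda> < 2\<^bsup>i+1\<^esup>\<close>.\<close>

lemma dyadic_exponent:
  fixes l :: real
  assumes "1 \<le> l"
  obtains n where "2 ^ n \<le> l" "l < 2 ^ Suc n"
proof -
  obtain N where N: "l < 2 ^ N" using real_arch_pow[of 2 l] by auto
  define n where "n = (LEAST n. l < 2 ^ n)"
  have n: "l < 2 ^ n" unfolding n_def by (rule LeastI[of "\<lambda>n. l < 2 ^ n", OF N])
  then have "n \<noteq> 0" using assms by (cases n) auto
  then obtain p where p: "n = Suc p" by (cases n) auto
  have "\<not> l < 2 ^ p" using not_less_Least[of p "\<lambda>n. l < 2 ^ n"] p by (simp add: n_def)
  then show ?thesis using that[of p] n p by simp
qed

lemma dyadic_sum_lower: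
  fixes l :: real
  assumes l: "1 \<le> l" "l < 2 ^ I"
  shows "l ^ j \<le> 2 ^ j * (\<Sum>i<I. 2 ^ (i * j) * min 1 ((l / 2 ^ i) ^ k))"
proof -
  obtain n where n: "2 ^ n \<le> l" "l < 2 ^ Suc n" using dyadic_exponent[OF l(1)] .
  have "(2::real) ^ n < 2 ^ I" using n l by linarith
  then have nI: "n < I" by simp
  have "1 \<le> (l / 2 ^ n) ^ k" using n by (intro one_le_power) simp
  then have "2 ^ (n * j) = 2 ^ (n * j) * min 1 ((l / 2 ^ n) ^ k)" by simp
  also have "\<dots> \<le> (\<Sum>i<I. 2 ^ (i * j) * min 1 ((l / 2 ^ i) ^ k))"
    by (rule member_le_sum) (use nI l in auto)
  finally have "2 ^ j * 2 ^ (n * j) \<le> 2 ^ j * (\<Sum>i<I. 2 ^ (i * j) * min 1 ((l / 2 ^ i) ^ k))"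
    by (intro mult_left_mono) auto
  moreover have "l ^ j \<le> (2 ^ Suc n) ^ j"
    using n l by (intro power_mono) auto
  moreover have "(2 ^ Suc n) ^ j = (2::real) ^ j * 2 ^ (n * j)"
    by (simp add: power_mult_distrib power_mult)
  ultimately show ?thesis by linarith
qed

lemma sum_power_le: "j \<ge> 1 \<Longrightarrow> (\<Sum>i\<le>n. (2::real) ^ (i * j)) \<le> 2 * 2 ^ (n * j)"
proof (induction n)
  case (Suc n)
  have "(2::real) ^ Suc (n * j) \<le> 2 ^ (Suc n * j)"
    using Suc.prems by (intro power_increasing) auto
  then show ?case using Suc by simp
qed simp

lemma sum_power_half_le:
  assumes "d \<ge> 1"
  shows "(\<Sum>i<n. (1 / 2 ^ (i * d))) \<le> (2::real) - 2 / 2 ^ n"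
proof (induction n)
  case (Suc n)
  have "1 / 2 ^ (n * d) \<le> (1::real) / 2 ^ n"
    using assms by (intro divide_left_mono power_increasing) auto
  moreover have "2 / 2 ^ Suc n = (1::real) / 2 ^ n" by simp
  moreover have "2 / 2 ^ n = 2 * ((1::real) / 2 ^ n)" by simp
  ultimately show ?case using Suc unfolding sum.lessThan_Suc by linarith
qed simp

lemma sum_lessThan_add: "(\<Sum>i<a + b. t i) = (\<Sum>i<a. t i) + (\<Sum>i<b. t (a + i))"
  for t :: "nat \<Rightarrow> real"
  by (induction b) (auto simp: add.assoc)

lemma dyadic_sum_upper:
  fixes l :: real
  assumes l: "1 \<le> l" and j: "1 \<le> j" "j < k"
  shows "(\<Sum>i<I. 2 ^ (i * j) * min 1 ((l / 2 ^ i) ^ k)) \<le> 4 * l ^ j"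
proof -
  obtain n where n: "2 ^ n \<le> l" "l < 2 ^ Suc n" using dyadic_exponent[OF l] .
  let ?t = "\<lambda>i. 2 ^ (i * j) * min 1 ((l / 2 ^ i) ^ k)"
  have t0: "0 \<le> ?t i" for i using l by simp
  define d where "d = k - j"
  have d: "k = j + d" "d \<ge> 1" using j by (auto simp: d_def)
  have "(\<Sum>i<I. ?t i) \<le> (\<Sum>i<Suc n + I. ?t i)"
    by (rule sum_mono2) (use t0 in auto)
  also have "\<dots> = (\<Sum>i<Suc n. ?t i) + (\<Sum>i<I. ?t (Suc n + i))"
    by (rule sum_lessThan_add)
  also have "(\<Sum>i<Suc n. ?t i) \<le> 2 * l ^ j"
  proof -
    have "(\<Sum>i<Suc n. ?t i) \<le> (\<Sum>i\<le>n. 2 ^ (i * j))"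
      unfolding lessThan_Suc_atMost by (intro sum_mono) (simp add: mult_left_le)
    also have "\<dots> \<le> 2 * 2 ^ (n * j)" by (rule sum_power_le[OF j(1)])
    also have "\<dots> \<le> 2 * l ^ j"
      using power_mono[OF n(1), of j] by (simp add: power_mult)
    finally show ?thesis .
  qed
  also have "(\<Sum>i<I. ?t (Suc n + i)) \<le> 2 * l ^ j"
  proof -
    have "?t (Suc n + i) \<le> l ^ j * (1 / 2 ^ (i * d))" for i
    proof -
      let ?p = "(2::real) ^ (Suc n + i)"
      have "?t (Suc n + i) \<le> 2 ^ ((Suc n + i) * j) * (l / ?p) ^ k"
        by (intro mult_left_mono) auto
      also have "2 ^ ((Suc n + i) * j) * (l / ?p) ^ k = l ^ j * (l / ?p) ^ d"
      proof -
        have "p ^ j * (l / p) ^ (j + d) = l ^ j * (l / p) ^ d" if "p \<noteq> 0" for p :: real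
          using that by (simp add: power_add power_divide)
        from this[of ?p] show ?thesis unfolding power_mult d(1) by simp
      qed
      also have "\<dots> \<le> l ^ j * (1 / 2 ^ i) ^ d"
      proof (intro mult_left_mono power_mono)
        have "l / ?p \<le> 2 ^ Suc n / ?p" using n by (intro divide_right_mono) auto
        also have "\<dots> = 1 / 2 ^ i" by (simp add: power_add)
        finally show "l / ?p \<le> 1 / 2 ^ i" .
      qed (use l in auto)
      also have "(1 / 2 ^ i) ^ d = (1::real) / 2 ^ (i * d)"
        by (simp add: power_divide power_mult)
      finally show ?thesis .
    qed
    then have "(\<Sum>i<I. ?t (Suc n + i)) \<le> (\<Sum>i<I. l ^ j * (1 / 2 ^ (i * d)))" by (intro sum_mono)
    also have "\<dots> = l ^ j * (\<Sum>i<I. 1 / 2 ^ (i * d))" by (simp only: sum_distrib_left)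
    also have "\<dots> \<le> l ^ j * 2"
    proof (rule mult_left_mono)
      have "(0::real) \<le> 2 / 2 ^ I" by simp
      then show "(\<Sum>i<I. 1 / 2 ^ (i * d)) \<le> (2::real)" using sum_power_half_le[OF d(2), of I] by linarith
    qed (use l in simp)
    finally show ?thesis by simp
  qed
  finally show ?thesis by simp
qed

text \<open>The weight \<open>min 1 ((\<lambda>/2\<^sup>i)\<^sup>k)\<close> is at most both the weight of \<open>L\<^sup>2\<close> and \<open>2\<^bsup>-ik\<^esup>\<close> times that of \<open>W\<^sub>H\<^sup>k\<^sup>,\<^sup>2\<close>, with
  equality above, respectively below, the eigenvalue \<open>2\<^sup>i\<close>. Splitting \<open>f\<close> there, the high part of \<open>f\<close> is
  estimated in \<open>L\<^sup>2\<close> and the low part in \<open>W\<^sub>H\<^sup>k\<^sup>,\<^sup>2\<close>.\<close>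

lemma mult_bounded_cutoff:
  fixes f :: "real ^ 'n::finite \<Rightarrow> complex"
  assumes mb: "mult_bounded k m C" and m: "m \<in> borel_measurable lebesgue"
    and S: "finite S" "f = hermite_sum S c" and A: "finite A"
    and q: "\<And>\<alpha>. q \<alpha> = min 1 ((hermite_eigenvalue \<alpha> / 2 ^ i) ^ k)"
  shows "(\<Sum>\<beta>\<in>A. q \<beta> * (cmod (hermite_coeff \<beta> (\<lambda>x. m x * f x)))\<^sup>2) \<le> 2 * C\<^sup>2 * (\<Sum>\<alpha>\<in>S. q \<alpha> * (cmod (c \<alpha>))\<^sup>2)"
proof -
  have C: "0 \<le> C" using mb by (simp add: mult_bounded_def)
  note q_def = q
  have q0: "0 \<le> q \<beta>" for \<beta> using hermite_eigenvalue_pos[of \<beta>] by (simp add: q)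
  define L where "L = {\<alpha> \<in> S. hermite_eigenvalue \<alpha> \<le> 2 ^ i}"
  define lo hi where "lo = hermite_sum L c" and "hi = hermite_sum (S - L) c"
  have LS: "L \<subseteq> S" "finite L" using S by (auto simp: L_def)
  have f: "f x = lo x + hi x" for x
    using sum.subset_diff[OF LS(1) S(1), of "\<lambda>\<alpha>. c \<alpha> * hermite_fun \<alpha> x"]
    by (simp add: S(2) lo_def hi_def hermite_sum_def)
  have loW: "(\<lambda>x. m x * lo x) \<in> hermite_sobolev k"
      "hermite_sobolev_norm k (\<lambda>x. m x * lo x) \<le> C * hermite_sobolev_norm k lo"
    using mb hermite_sum_hspan unfolding mult_bounded_def lo_def by blast+
  have hiL: "(\<lambda>x. m x * hi x) \<in> L2" "l2norm (\<lambda>x. m x * hi x) \<le> C * l2norm hi"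
    using L2_mult_bounded[OF hermite_sum_L2 m mult_bounded_AE_le[OF mb m]] unfolding hi_def by blast+
  have loL: "(\<lambda>x. m x * lo x) \<in> L2" by (rule hermite_sobolev_L2[OF loW(1)])
  let ?a = "\<lambda>\<beta>. hermite_coeff \<beta> (\<lambda>x. m x * lo x)" and ?b = "\<lambda>\<beta>. hermite_coeff \<beta> (\<lambda>x. m x * hi x)"
  have co: "hermite_coeff \<beta> (\<lambda>x. m x * f x) = ?a \<beta> + ?b \<beta>" for \<beta>
    unfolding f ring_distribs by (rule hermite_coeff_add[OF loL hiL(1)])
  have pt: "q \<beta> * (cmod (?a \<beta> + ?b \<beta>))\<^sup>2 \<le>
      2 * ((1 / 2 ^ i) ^ k * energy k (\<lambda>x. m x * lo x) \<beta>) + 2 * (cmod (?b \<beta>))\<^sup>2" for \<beta>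
  proof -
    have "(cmod (?a \<beta> + ?b \<beta>))\<^sup>2 \<le> (cmod (?a \<beta>) + cmod (?b \<beta>))\<^sup>2"
      by (intro power_mono norm_triangle_ineq) auto
    also have "\<dots> \<le> 2 * (cmod (?a \<beta>))\<^sup>2 + 2 * (cmod (?b \<beta>))\<^sup>2"
      using sum_squares_bound[of "cmod (?a \<beta>)" "cmod (?b \<beta>)"] by (simp add: power2_sum)
    finally have "q \<beta> * (cmod (?a \<beta> + ?b \<beta>))\<^sup>2 \<le> 2 * (q \<beta> * (cmod (?a \<beta>))\<^sup>2) + 2 * (q \<beta> * (cmod (?b \<beta>))\<^sup>2)"
      using mult_left_mono[OF _ q0[of \<beta>]] by (fastforce simp: ring_distribs)
    moreover have "q \<beta> * (cmod (?a \<beta>))\<^sup>2 \<le> (hermite_eigenvalue \<beta> / 2 ^ i) ^ k * (cmod (?a \<beta>))\<^sup>2"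
      by (intro mult_right_mono) (auto simp: q_def)
    moreover have "(hermite_eigenvalue \<beta> / 2 ^ i) ^ k * (cmod (?a \<beta>))\<^sup>2
        = (1 / 2 ^ i) ^ k * energy k (\<lambda>x. m x * lo x) \<beta>"
      by (simp add: energy_def power_divide)
    moreover have "q \<beta> * (cmod (?b \<beta>))\<^sup>2 \<le> 1 * (cmod (?b \<beta>))\<^sup>2"
      by (intro mult_right_mono) (auto simp: q_def)
    ultimately show ?thesis by linarith
  qed
  have nlo: "(hermite_sobolev_norm k lo)\<^sup>2 = (\<Sum>\<alpha>\<in>L. hermite_eigenvalue \<alpha> ^ k * (cmod (c \<alpha>))\<^sup>2)"
    unfolding lo_def by (rule hermite_sobolev_norm_hermite_sum[OF LS(2)])
  have "(\<Sum>\<beta>\<in>A. q \<beta> * (cmod (hermite_coeff \<beta> (\<lambda>x. m x * f x)))\<^sup>2)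
      \<le> (\<Sum>\<beta>\<in>A. 2 * ((1 / 2 ^ i) ^ k * energy k (\<lambda>x. m x * lo x) \<beta>) + 2 * (cmod (?b \<beta>))\<^sup>2)"
    unfolding co by (intro sum_mono pt)
  also have "\<dots> = 2 * (1 / 2 ^ i) ^ k * sum (energy k (\<lambda>x. m x * lo x)) A + 2 * (\<Sum>\<beta>\<in>A. (cmod (?b \<beta>))\<^sup>2)"
    by (simp only: sum.distrib sum_distrib_left mult.assoc)
  also have "\<dots> \<le> 2 * (1 / 2 ^ i) ^ k * (C * hermite_sobolev_norm k lo)\<^sup>2 + 2 * (C * l2norm hi)\<^sup>2"
  proof (intro add_mono mult_left_mono)
    show "sum (energy k (\<lambda>x. m x * lo x)) A \<le> (C * hermite_sobolev_norm k lo)\<^sup>2"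
      using sum_energy_le[OF loW(1), of A] power_mono[OF loW(2), of 2] by simp
    show "(\<Sum>\<beta>\<in>A. (cmod (?b \<beta>))\<^sup>2) \<le> (C * l2norm hi)\<^sup>2"
      using Bessel[OF hiL(1) A] power_mono[OF hiL(2), of 2] by simp
  qed auto
  also have "\<dots> = 2 * C\<^sup>2 * ((1 / 2 ^ i) ^ k * (hermite_sobolev_norm k lo)\<^sup>2 + (l2norm hi)\<^sup>2)"
    by (simp add: power_mult_distrib algebra_simps)
  also have "(1 / 2 ^ i) ^ k * (hermite_sobolev_norm k lo)\<^sup>2 = (\<Sum>\<alpha>\<in>L. q \<alpha> * (cmod (c \<alpha>))\<^sup>2)"
    unfolding nlo sum_distrib_left
  proof (rule sum.cong[OF refl])
    fix \<alpha> assume "\<alpha> \<in> L"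
    then have "(hermite_eigenvalue \<alpha> / 2 ^ i) ^ k \<le> 1"
      using hermite_eigenvalue_pos[of \<alpha>] by (intro power_le_one) (auto simp: L_def)
    then have "q \<alpha> = (hermite_eigenvalue \<alpha> / 2 ^ i) ^ k"
      by (simp only: q_def min_absorb2)
    then have "q \<alpha> = (1 / 2 ^ i) ^ k * hermite_eigenvalue \<alpha> ^ k"
      by (simp add: power_divide)
    then show "(1 / 2 ^ i) ^ k * (hermite_eigenvalue \<alpha> ^ k * (cmod (c \<alpha>))\<^sup>2) = q \<alpha> * (cmod (c \<alpha>))\<^sup>2"
      by (simp only: mult.assoc)
  qed
  also have "(l2norm hi)\<^sup>2 = (\<Sum>\<alpha>\<in>S - L. q \<alpha> * (cmod (c \<alpha>))\<^sup>2)"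
    unfolding hi_def l2norm_hermite_sum[OF finite_Diff[OF S(1)]]
  proof (rule sum.cong[OF refl])
    fix \<alpha> assume "\<alpha> \<in> S - L"
    then have "1 \<le> (hermite_eigenvalue \<alpha> / 2 ^ i) ^ k"
      by (intro one_le_power) (auto simp: L_def)
    then show "(cmod (c \<alpha>))\<^sup>2 = q \<alpha> * (cmod (c \<alpha>))\<^sup>2" by (simp add: q_def)
  qed
  also have "(\<Sum>\<alpha>\<in>L. q \<alpha> * (cmod (c \<alpha>))\<^sup>2) + (\<Sum>\<alpha>\<in>S - L. q \<alpha> * (cmod (c \<alpha>))\<^sup>2) = (\<Sum>\<alpha>\<in>S. q \<alpha> * (cmod (c \<alpha>))\<^sup>2)"
    using sum.subset_diff[OF LS(1) S(1), of "\<lambda>\<alpha>. q \<alpha> * (cmod (c \<alpha>))\<^sup>2"] by linarith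
  finally show ?thesis .
qed

lemma mult_bounded_0:
  assumes "AE x in lebesgue. cmod (m x) \<le> C" "0 \<le> C" "m \<in> borel_measurable lebesgue"
  shows "mult_bounded 0 m C"
  unfolding mult_bounded_def
proof (intro conjI ballI assms(2))
  fix f :: "real ^ 'a \<Rightarrow> complex" assume f: "f \<in> hspan"
  note b = L2_mult_bounded[OF hspan_L2[OF f] assms(3,1)]
  show "(\<lambda>x. m x * f x) \<in> hermite_sobolev 0"
    by (rule hermite_sobolev_0(1)[OF b(1)])
  show "hermite_sobolev_norm 0 (\<lambda>x. m x * f x) \<le> C * hermite_sobolev_norm 0 f"
    unfolding hermite_sobolev_0(2)[OF b(1)] hermite_sobolev_0(2)[OF hspan_L2[OF f]] by (rule b(2))
qed

text \<open>Summing the estimates for the weights \<open>min 1 ((\<lambda>/2\<^sup>i)\<^sup>k)\<close> with the factors \<open>2\<^bsup>ij\<^esup>\<close> gives the one for the weight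
  \<open>\<lambda>\<^sup>j\<close>: this is real interpolation between \<open>L\<^sup>2\<close> and \<open>W\<^sub>H\<^sup>k\<^sup>,\<^sup>2\<close>.\<close>

lemma mult_bounded_mono:
  fixes m :: "real ^ 'n::finite \<Rightarrow> complex"
  assumes mb: "mult_bounded k m C" and m: "m \<in> borel_measurable lebesgue" and jk: "j \<le> k"
  shows "\<exists>C'. mult_bounded j m C'"
proof -
  have C: "0 \<le> C" using mb by (simp add: mult_bounded_def)
  consider "j = 0" | "j = k" | "1 \<le> j" "j < k" using jk by linarith
  then show ?thesis
  proof cases
    case 1
    then show ?thesis using mult_bounded_0[OF mult_bounded_AE_le[OF mb m] C m] by blast
  next
    case 2
    then show ?thesis using mb by blast
  next
    case 3
    let ?D = "sqrt (8 * 2 ^ j) * C"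
    have D2: "?D\<^sup>2 = 2 ^ j * (2 * C\<^sup>2) * 4" by (simp add: power_mult_distrib)
    have "mult_bounded j m ?D"
      unfolding mult_bounded_def
    proof (intro conjI ballI)
      show "0 \<le> ?D" using C by simp
      fix f :: "real ^ 'n \<Rightarrow> complex" assume f: "f \<in> hspan"
      obtain S c where S: "finite S" "f = hermite_sum S c" using hspan_hermite_sum[OF f] .
      have fL: "f \<in> L2" by (rule hspan_L2[OF f])
      have mL: "(\<lambda>x. m x * f x) \<in> L2" by (rule L2_mult_bounded(1)[OF fL m mult_bounded_AE_le[OF mb m]])
      let ?q = "\<lambda>i \<alpha>. min 1 ((hermite_eigenvalue \<alpha> / 2 ^ i) ^ k)"
      have nf: "(hermite_sobolev_norm j f)\<^sup>2 = (\<Sum>\<alpha>\<in>S. hermite_eigenvalue \<alpha> ^ j * (cmod (c \<alpha>))\<^sup>2)"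
        unfolding S(2) by (rule hermite_sobolev_norm_hermite_sum[OF S(1)])
      have le: "sum (energy j (\<lambda>x. m x * f x)) A \<le> (?D * hermite_sobolev_norm j f)\<^sup>2" if A: "finite A" for A
      proof -
        have "\<exists>I. \<forall>\<beta>\<in>A. hermite_eigenvalue \<beta> < 2 ^ I"
        proof -
          have "\<forall>\<beta>. \<exists>I. hermite_eigenvalue \<beta> < 2 ^ I" using real_arch_pow[of 2] by simp
          then obtain J where J: "\<And>\<beta> :: 'n \<Rightarrow> nat. hermite_eigenvalue \<beta> < 2 ^ J \<beta>" by metis
          have "hermite_eigenvalue \<beta> < 2 ^ (\<Sum>\<beta>\<in>A. J \<beta>)" if "\<beta> \<in> A" for \<beta>
          proof -
            have "J \<beta> \<le> (\<Sum>\<beta>\<in>A. J \<beta>)" by (rule member_le_sum) (use A that in auto)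
            then have "(2::real) ^ J \<beta> \<le> 2 ^ (\<Sum>\<beta>\<in>A. J \<beta>)" by (intro power_increasing) auto
            then show ?thesis using J[of \<beta>] by linarith
          qed
          then show ?thesis by blast
        qed
        then obtain I where I: "\<And>\<beta>. \<beta> \<in> A \<Longrightarrow> hermite_eigenvalue \<beta> < 2 ^ I" by blast
        let ?c = "\<lambda>\<beta>. (cmod (hermite_coeff \<beta> (\<lambda>x. m x * f x)))\<^sup>2"
        have "sum (energy j (\<lambda>x. m x * f x)) A \<le> (\<Sum>\<beta>\<in>A. (2 ^ j * (\<Sum>i<I. 2 ^ (i * j) * ?q i \<beta>)) * ?c \<beta>)"
          unfolding energy_def
          by (intro sum_mono mult_right_mono dyadic_sum_lower hermite_eigenvalue_ge_1 I) auto
        also have "\<dots> = 2 ^ j * (\<Sum>\<beta>\<in>A. \<Sum>i<I. 2 ^ (i * j) * (?q i \<beta> * ?c \<beta>))"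
          by (simp only: sum_distrib_left sum_distrib_right mult.assoc)
        also have "\<dots> = 2 ^ j * (\<Sum>i<I. 2 ^ (i * j) * (\<Sum>\<beta>\<in>A. ?q i \<beta> * ?c \<beta>))"
          by (subst sum.swap) (simp only: sum_distrib_left)
        also have "\<dots> \<le> 2 ^ j * (\<Sum>i<I. 2 ^ (i * j) * (2 * C\<^sup>2 * (\<Sum>\<alpha>\<in>S. ?q i \<alpha> * (cmod (c \<alpha>))\<^sup>2)))"
          by (intro mult_left_mono sum_mono mult_bounded_cutoff[OF mb m S A refl]) auto
        also have "\<dots> = 2 ^ j * (2 * C\<^sup>2) * (\<Sum>\<alpha>\<in>S. (\<Sum>i<I. 2 ^ (i * j) * ?q i \<alpha>) * (cmod (c \<alpha>))\<^sup>2)"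
        proof -
          have "(\<Sum>\<alpha>\<in>S. (\<Sum>i<I. 2 ^ (i * j) * ?q i \<alpha>) * (cmod (c \<alpha>))\<^sup>2)
              = (\<Sum>\<alpha>\<in>S. \<Sum>i<I. 2 ^ (i * j) * (?q i \<alpha> * (cmod (c \<alpha>))\<^sup>2))"
            by (simp only: sum_distrib_right mult.assoc)
          also have "\<dots> = (\<Sum>i<I. 2 ^ (i * j) * (\<Sum>\<alpha>\<in>S. ?q i \<alpha> * (cmod (c \<alpha>))\<^sup>2))"
            by (subst sum.swap) (simp only: sum_distrib_left)
          finally show ?thesis
            by (simp only: sum_distrib_left mult.left_commute mult.assoc)
        qed
        also have "\<dots> \<le> 2 ^ j * (2 * C\<^sup>2) * (\<Sum>\<alpha>\<in>S. (4 * hermite_eigenvalue \<alpha> ^ j) * (cmod (c \<alpha>))\<^sup>2)"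
          by (intro mult_left_mono sum_mono mult_right_mono dyadic_sum_upper hermite_eigenvalue_ge_1 3) auto
        also have "\<dots> = 2 ^ j * (2 * C\<^sup>2) * 4 * (hermite_sobolev_norm j f)\<^sup>2"
          unfolding nf by (simp only: sum_distrib_left mult.assoc)
        also have "\<dots> = (?D * hermite_sobolev_norm j f)\<^sup>2"
          unfolding D2[symmetric] by (rule power_mult_distrib[symmetric])
        finally show ?thesis .
      qed
      have D0: "0 \<le> ?D * hermite_sobolev_norm j f" using C by simp
      show "(\<lambda>x. m x * f x) \<in> hermite_sobolev j"
        by (rule hermite_sobolev_norm_le(1)[OF mL D0 le])
      show "hermite_sobolev_norm j (\<lambda>x. m x * f x) \<le> ?D * hermite_sobolev_norm j f"
        by (rule hermite_sobolev_norm_le(2)[OF mL D0 le])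
    qed
    then show ?thesis by blast
  qed
qed

section \<open>Smooth cutoffs\<close>

text \<open>The polynomial makes the family of these functions closed under differentiation, also at \<open>0\<close>, where
  all of them vanish to infinite order.\<close>

definition flat :: "real poly \<Rightarrow> real \<Rightarrow> real" where
  "flat p t = (if t > 0 then poly p (1 / t) * exp (- (1 / t)) else 0)"

lemma poly_exp_tendsto_0: "((\<lambda>s. poly p s * s ^ k * exp (- s)) \<longlongrightarrow> (0::real)) at_top"
proof (induction p arbitrary: k rule: pCons_induct)
  case (pCons a p)
  have "((\<lambda>s::real. s ^ k / exp s) \<longlongrightarrow> 0) at_top" by (rule tendsto_power_div_exp_0)
  then have "((\<lambda>s. a * (s ^ k / exp s) + poly p s * s ^ Suc k * exp (- s)) \<longlongrightarrow> a * 0 + 0) at_top"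
    by (intro tendsto_add tendsto_mult tendsto_const pCons.IH)
  moreover have "(\<lambda>s. a * (s ^ k / exp s) + poly p s * s ^ Suc k * exp (- s))
      = (\<lambda>s. poly (pCons a p) s * s ^ k * exp (- s))"
    by (simp add: fun_eq_iff exp_minus field_simps)
  ultimately show ?case by simp
qed simp

lemma flat_has_derivative:
  "(flat p has_real_derivative flat ([:0, 0, 1:] * (p - pderiv p)) t) (at t)"
proof -
  let ?q = "[:0, 0, 1:] * (p - pderiv p)"
  consider "t > 0" | "t < 0" | "t = 0" by linarith
  then show ?thesis
  proof cases
    case 1
    have "((\<lambda>t. poly p (1 / t) * exp (- (1 / t))) has_real_derivative
        poly p (1 / t) * (exp (- (1 / t)) * (1 / t\<^sup>2)) + (poly (pderiv p) (1 / t) * (- 1 / t\<^sup>2)) * exp (- (1 / t))) (at t)"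
      using 1 by (auto intro!: derivative_eq_intros DERIV_chain2[OF poly_DERIV] simp: power2_eq_square)
    moreover have "poly p (1 / t) * (exp (- (1 / t)) * (1 / t\<^sup>2)) + (poly (pderiv p) (1 / t) * (- 1 / t\<^sup>2)) * exp (- (1 / t))
        = flat ?q t"
      using 1 by (simp add: flat_def power2_eq_square algebra_simps)
    ultimately have "((\<lambda>t. poly p (1 / t) * exp (- (1 / t))) has_real_derivative flat ?q t) (at t)" by simp
    then show ?thesis
      by (rule has_field_derivative_transform_within_open[of _ _ _ "{0<..}"]) (use 1 in \<open>auto simp: flat_def\<close>)
  next
    case 2
    have "((\<lambda>t. 0) has_real_derivative flat ?q t) (at t)" using 2 by (simp add: flat_def)
    then show ?thesis
      by (rule has_field_derivative_transform_within_open[of _ _ _ "{..<0}"]) (use 2 in \<open>auto simp: flat_def\<close>)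
  next
    case 3
    have right: "((\<lambda>h. flat p h / h) \<longlongrightarrow> 0) (at_right 0)"
    proof -
      have "((\<lambda>s. poly p s * s ^ 1 * exp (- s)) \<longlongrightarrow> 0) at_top" by (rule poly_exp_tendsto_0)
      from filterlim_compose[OF this filterlim_inverse_at_top_right]
      have "((\<lambda>h. poly p (inverse h) * inverse h ^ 1 * exp (- inverse h)) \<longlongrightarrow> 0) (at_right 0)" .
      moreover have "\<forall>\<^sub>F h in at_right 0. poly p (inverse h) * inverse h ^ 1 * exp (- inverse h) = flat p h / h"
        using eventually_at_right_less[of 0] by eventually_elim (simp add: flat_def field_simps)
      ultimately show ?thesis by (rule Lim_transform_eventually)
    qed
    have left: "((\<lambda>h. flat p h / h) \<longlongrightarrow> 0) (at_left 0)"
    proof (rule tendsto_eventually)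
      have "\<forall>\<^sub>F h :: real in at_left 0. h < 0" by (simp add: eventually_at_filter)
      then show "\<forall>\<^sub>F h in at_left 0. flat p h / h = 0" by eventually_elim (simp add: flat_def)
    qed
    have "((\<lambda>h. flat p h / h) \<longlongrightarrow> 0) (at 0)"
      using left right by (simp add: filterlim_at_split)
    then show ?thesis by (simp add: 3 DERIV_def flat_def)
  qed
qed

lemma smooth_flat:
  "smooth (\<lambda>x :: real ^ 'n::finite. complex_of_real (flat p (1 + s * x $ i)))"
proof (rule smooth_coinduct[where P = "\<lambda>F. \<exists>c p. F = (\<lambda>x. c * complex_of_real (flat p (1 + s * x $ i)))"])
  show "\<exists>c p'. (\<lambda>x :: real ^ 'n. complex_of_real (flat p (1 + s * x $ i))) = (\<lambda>x. c * complex_of_real (flat p' (1 + s * x $ i)))"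
    by (intro exI[of _ 1] exI[of _ p]) simp
  have d: "((\<lambda>t. flat q (1 + s * t)) has_real_derivative s * flat ([:0, 0, 1:] * (q - pderiv q)) (1 + s * t)) (at t)" for q t
  proof -
    have "((\<lambda>t. 1 + s * t) has_real_derivative s) (at t)" by (auto intro!: derivative_eq_intros)
    from DERIV_chain2[OF flat_has_derivative this] show ?thesis by (simp only: mult.commute)
  qed
  fix F :: "real ^ 'n \<Rightarrow> complex"
  assume "\<exists>c p. F = (\<lambda>x. c * complex_of_real (flat p (1 + s * x $ i)))"
  then obtain c q where F: "F = (\<lambda>x. c * complex_of_real (flat q (1 + s * x $ i)))" by blast
  note pc = partial_comp_component[OF d]
  show "F differentiable (at x)" for x
    unfolding F by (intro differentiable_mult pc(1)) auto
  fix j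
  have "partial j F x = (if i = j then c * of_real s else 0) * of_real (flat ([:0, 0, 1:] * (q - pderiv q)) (1 + s * x $ i))" for x
    unfolding F partial_scale[OF pc(1)] pc(2) by simp
  then show "\<exists>c p. partial j F = (\<lambda>x. c * complex_of_real (flat p (1 + s * x $ i)))"
    by (intro exI[of _ "if i = j then c * of_real s else 0"] exI[of _ "[:0, 0, 1:] * (q - pderiv q)"] ext)
qed

text \<open>Supported where \<open>|x\<^sub>i| \<le> 1/r\<close> for all \<open>i\<close>. The factor \<open>exp 2\<close> normalizes the value at the origin to \<open>1\<close>,
  so that \<open>cutoff r\<close> tends to \<open>1\<close> for \<open>r \<rightarrow> 0\<close>.\<close>

definition cutoff :: "real \<Rightarrow> real ^ 'n::finite \<Rightarrow> complex" where
  "cutoff r x = (\<Prod>i\<in>UNIV. of_real (exp 2) * (of_real (flat 1 (1 + r * x $ i)) * of_real (flat 1 (1 + (- r) * x $ i))))"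

lemma smooth_cutoff: "smooth (cutoff r)"
  unfolding cutoff_def[abs_def]
  by (intro smooth_prod smooth_mult smooth_const smooth_flat)

lemma cutoff_eq_0:
  assumes "1 \<le> \<bar>r * x $ i\<bar>"
  shows "cutoff r x = 0"
proof -
  have "flat 1 (1 + r * x $ i) = 0 \<or> flat 1 (1 + (- r) * x $ i) = 0"
    using assms by (auto simp: flat_def abs_if split: if_splits)
  then show ?thesis unfolding cutoff_def by (intro prod_zero) auto
qed

lemma cutoff_neq_0:
  assumes "\<And>i. \<bar>r * x $ i\<bar> < 1"
  shows "cutoff r x \<noteq> 0"
proof -
  have "flat 1 (1 + r * x $ i) \<noteq> 0 \<and> flat 1 (1 + (- r) * x $ i) \<noteq> 0" for i
  proof -
    have "0 < 1 + r * x $ i" "0 < 1 + (- r) * x $ i" using assms[of i] by (auto simp: abs_less_iff)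
    then show ?thesis by (simp add: flat_def)
  qed
  then show ?thesis unfolding cutoff_def by (simp add: prod_zero_iff)
qed

lemma cutoff_support:
  assumes r: "r > 0"
  shows "{x. cutoff r x \<noteq> 0} \<subseteq> cball (0 :: real ^ 'n::finite) (real CARD('n) / r)"
proof
  fix x :: "real ^ 'n" assume "x \<in> {x. cutoff r x \<noteq> 0}"
  then have x: "cutoff r x \<noteq> 0" by simp
  have i: "\<bar>x $ i\<bar> \<le> 1 / r" for i
  proof -
    have "\<bar>r * x $ i\<bar> \<le> 1" using cutoff_eq_0[of r x i] x by linarith
    then show ?thesis using r by (simp add: abs_mult pos_le_divide_eq mult.commute)
  qed
  have "norm x \<le> (\<Sum>i\<in>UNIV. \<bar>x $ i\<bar>)" by (rule norm_le_l1_cart)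
  also have "\<dots> \<le> (\<Sum>i\<in>(UNIV :: 'n set). 1 / r)" by (intro sum_mono i)
  finally show "x \<in> cball 0 (real CARD('n) / r)" by simp
qed

lemma cutoff_test_function:
  assumes "r > 0"
  shows "cutoff r \<in> test_functions"
proof -
  have "bounded {x. cutoff r x \<noteq> 0}"
    by (rule bounded_subset[OF bounded_cball cutoff_support[OF assms]])
  then show ?thesis
    by (simp add: test_functions_def smooth_cutoff compact_closure)
qed

lemma partial_dilate:
  fixes g :: "real ^ 'n \<Rightarrow> complex"
  assumes "smooth g"
  shows "partial i (\<lambda>x. g (r *\<^sub>R x)) x = of_real r * partial i g (r *\<^sub>R x)"
    "(\<lambda>x. g (r *\<^sub>R x)) differentiable (at x)"
proof -
  obtain D where D: "(g has_derivative D) (at (r *\<^sub>R x))"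
    using smooth_differentiable[OF assms] by (auto simp: differentiable_def)
  have "((\<lambda>x. r *\<^sub>R x) has_derivative (\<lambda>h. r *\<^sub>R h)) (at x)" by (auto intro!: derivative_eq_intros)
  from has_derivative_compose[OF this D]
  have d: "((\<lambda>x. g (r *\<^sub>R x)) has_derivative (\<lambda>h. D (r *\<^sub>R h))) (at x)" .
  have "D (r *\<^sub>R h) = r *\<^sub>R D h" for h
    using D by (simp add: has_derivative_def bounded_linear.linear linear_scale)
  then show "partial i (\<lambda>x. g (r *\<^sub>R x)) x = of_real r * partial i g (r *\<^sub>R x)"
    by (simp only: partialI[OF d] partialI[OF D] scaleR_conv_of_real[where 'a = complex])
  show "(\<lambda>x. g (r *\<^sub>R x)) differentiable (at x)" using d by (auto simp: differentiable_def)
qed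

lemma cutoff_dilate: "cutoff r = (\<lambda>x. cutoff 1 (r *\<^sub>R x))"
  by (simp add: fun_eq_iff cutoff_def)

text \<open>Every derivative of a dilation gains a factor \<open>r\<close>. So for \<open>r \<le> 1\<close> the derivatives are bounded uniformly
  in \<open>r\<close>, and for \<open>r \<rightarrow> 0\<close> all but the function itself tend to \<open>0\<close>.\<close>

lemma foldr_partial_cutoff:
  "foldr partial w (cutoff r) = (\<lambda>x. of_real r ^ length w * foldr partial w (cutoff 1) (r *\<^sub>R x))"
proof (induction w)
  case Nil
  show ?case by (simp add: cutoff_dilate[of r])
next
  case (Cons i w)
  have s: "smooth (foldr partial w (cutoff 1))" by (intro smooth_foldr_partial smooth_cutoff)
  show ?case
    by (rule ext) (simp add: Cons partial_scale[OF partial_dilate(2)[OF s]] partial_dilate(1)[OF s] mult_ac)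
qed

lemma cutoff_bounded: "\<exists>B. \<forall>r x. 0 < r \<longrightarrow> r \<le> 1 \<longrightarrow> cmod (foldr partial w (cutoff r) x) \<le> B"
proof -
  have "foldr partial w (cutoff 1) \<in> schwartz"
    by (intro schwartz_foldr_partial test_function_schwartz cutoff_test_function) simp
  then obtain B where B: "\<And>x. cmod (foldr partial w (cutoff 1) x) \<le> B"
    using rapid_decay_bounded schwartz_rapid_decay by blast
  have "cmod (foldr partial w (cutoff r) x) \<le> B" if "0 < r" "r \<le> 1" for r x
  proof -
    have "cmod (foldr partial w (cutoff r) x) = r ^ length w * cmod (foldr partial w (cutoff 1) (r *\<^sub>R x))"
      using that by (simp only: foldr_partial_cutoff[of w r] norm_mult norm_power norm_of_real abs_of_pos)
    also have "\<dots> \<le> 1 * B"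
      using that B by (intro mult_mono power_le_one) auto
    finally show ?thesis by simp
  qed
  then show ?thesis by blast
qed

lemma foldr_partial_one: "foldr partial w (\<lambda>x. 1) = (\<lambda>x. if w = [] then 1 else 0)"
proof (induction w)
  case (Cons i w)
  then show ?case by (cases "w = []") simp_all
qed simp

lemma foldr_partial_cutoff_tendsto:
  "(\<lambda>n. foldr partial w (cutoff (1 / real (Suc n))) x) \<longlonglongrightarrow> foldr partial w (\<lambda>x. 1) x"
proof -
  let ?r = "\<lambda>n. 1 / real (Suc n)"
  have r: "?r \<longlonglongrightarrow> 0" using LIMSEQ_inverse_real_of_nat by (simp add: inverse_eq_divide)
  have "isCont (foldr partial w (cutoff 1)) (0 *\<^sub>R x)"
    by (intro differentiable_imp_continuous_within smooth_differentiable smooth_foldr_partial smooth_cutoff)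
  moreover have "(\<lambda>n. ?r n *\<^sub>R x) \<longlonglongrightarrow> 0 *\<^sub>R x" by (intro tendsto_intros r)
  ultimately have "(\<lambda>n. foldr partial w (cutoff 1) (?r n *\<^sub>R x)) \<longlonglongrightarrow> foldr partial w (cutoff 1) (0 *\<^sub>R x)"
    by (rule isCont_tendsto_compose)
  moreover have "(\<lambda>n. complex_of_real (?r n) ^ length w) \<longlonglongrightarrow> of_real 0 ^ length w"
    by (intro tendsto_intros r)
  ultimately have "(\<lambda>n. complex_of_real (?r n) ^ length w * foldr partial w (cutoff 1) (?r n *\<^sub>R x))
      \<longlonglongrightarrow> of_real 0 ^ length w * foldr partial w (cutoff 1) (0 *\<^sub>R x)"
    by (intro tendsto_mult)
  moreover have "of_real 0 ^ length w * foldr partial w (cutoff 1) (0 *\<^sub>R x) = foldr partial w (\<lambda>x. 1) x"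
  proof (cases w)
    case Nil
    have "exp 2 * (exp (- 1) * exp (- 1)) = (1::real)" by (simp add: exp_add[symmetric])
    then have "complex_of_real (exp 2) * (of_real (exp (- 1)) * of_real (exp (- 1))) = 1"
      by (simp only: of_real_mult[symmetric] of_real_1)
    then have "cutoff 1 (0 :: real ^ 'a) = 1" by (simp add: cutoff_def flat_def)
    then show ?thesis by (simp add: Nil)
  qed (simp add: foldr_partial_one)
  moreover have "foldr partial w (cutoff (?r n)) x
      = complex_of_real (?r n) ^ length w * foldr partial w (cutoff 1) (?r n *\<^sub>R x)" for n
    by (rule fun_cong[OF foldr_partial_cutoff])
  ultimately show ?thesis by (simp only:)
qed

text \<open>A Hermite function times a cutoff is a test function. So \<open>u\<close> times the cutoff is orthogonal to all
  Hermite functions, and their completeness replaces mollification.\<close>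

lemma AE_eq_0_if_test_functions:
  fixes u :: "real ^ 'n::finite \<Rightarrow> complex"
  assumes u: "locally_integrable u" "u \<in> borel_measurable lebesgue"
    and z: "\<And>\<phi>. \<phi> \<in> test_functions \<Longrightarrow> (\<integral>x. u x * \<phi> x \<partial>lebesgue) = 0"
  shows "AE x in lebesgue. u x = 0"
proof -
  have cut: "AE x in lebesgue. u x * cutoff r x = 0" if r: "0 < r" "r \<le> 1" for r
  proof -
    let ?K = "cball (0 :: real ^ 'n) (real CARD('n) / r)"
    let ?c = "cutoff r :: real ^ 'n \<Rightarrow> complex"
    obtain B where B: "\<And>x. cmod (?c x) \<le> B" using cutoff_bounded[of "[]"] r by auto
    have uK: "integrable lebesgue (\<lambda>x. indicator ?K x *\<^sub>R u x)"
      using u(1) unfolding locally_integrable_def set_integrable_def by (metis compact_cball)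
    have cm: "?c \<in> borel_measurable lebesgue" by (intro smooth_measurable smooth_cutoff)
    have bd: "integrable lebesgue (\<lambda>x. (u x * ?c x) * g x)"
      if g: "g \<in> borel_measurable lebesgue" "\<And>x. cmod (g x) \<le> D" for g D
    proof (rule Bochner_Integration.integrable_bound)
      show "integrable lebesgue (\<lambda>x. (B * D) *\<^sub>R (indicator ?K x *\<^sub>R u x))"
        using uK by (rule integrable_scaleR_right)
      show "(\<lambda>x. (u x * ?c x) * g x) \<in> borel_measurable lebesgue"
        by (intro borel_measurable_times u cm g)
      show "AE x in lebesgue. norm ((u x * ?c x) * g x) \<le> norm ((B * D) *\<^sub>R (indicator ?K x *\<^sub>R u x))"
      proof (intro AE_I2)
        fix x
        show "norm ((u x * ?c x) * g x) \<le> norm ((B * D) *\<^sub>R (indicator ?K x *\<^sub>R u x))"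
        proof (cases "?c x = 0")
          case False
          then have "x \<in> ?K" using cutoff_support[OF r(1)] by blast
          have BD: "0 \<le> B" "0 \<le> D"
            using order_trans[OF norm_ge_zero B] order_trans[OF norm_ge_zero g(2)] by blast+
          have "cmod (?c x) * cmod (g x) \<le> B * D" by (intro mult_mono B g BD) auto
          then have "cmod (u x) * (cmod (?c x) * cmod (g x)) \<le> cmod (u x) * (B * D)"
            by (intro mult_left_mono) auto
          then show ?thesis using \<open>x \<in> ?K\<close> BD by (simp add: norm_mult abs_mult mult_ac)
        qed simp
      qed
    qed
    interpret hermite_orthogonal "\<lambda>x. u x * ?c x"
    proof
      show "(\<lambda>x. u x * ?c x) \<in> borel_measurable lebesgue" by (intro borel_measurable_times u cm)
      show "integrable lebesgue (\<lambda>x. (u x * ?c x) * gauss a x)" if "a > 0" for a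
      proof (rule bd[where D = 1])
        show "gauss a \<in> borel_measurable lebesgue" by (rule borel_measurable_integrable[OF gauss_integrable[OF that]])
        show "cmod (gauss a x) \<le> 1" for x using that by simp
      qed
      fix \<alpha> :: "'n \<Rightarrow> nat"
      obtain D where D: "\<And>x. cmod (hermite_fun \<alpha> x) \<le> D" using hspan_bounded[OF hspan_hermite_fun] by blast
      show "integrable lebesgue (\<lambda>x. (u x * ?c x) * hermite_fun \<alpha> x)"
        by (rule bd[OF L2_measurable[OF hermite_fun_L2] D])
      have "(\<lambda>x. hermite_fun \<alpha> x * ?c x) \<in> test_functions"
        by (intro test_function_mult cutoff_test_function r schwartz_smooth hermite_fun_schwartz)
      from z[OF this] show "(\<integral>x. (u x * ?c x) * hermite_fun \<alpha> x \<partial>lebesgue) = 0"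
        by (simp only: mult_ac)
    qed
    show ?thesis by (rule AE_eq_0)
  qed
  have "AE x in lebesgue. \<forall>n. u x * cutoff (1 / real (Suc n)) x = 0"
    unfolding AE_all_countable by (intro allI cut) simp_all
  then show ?thesis
  proof eventually_elim
    case (elim x)
    obtain n where n: "norm x < real n" using reals_Archimedean2 by blast
    have "\<bar>1 / real (Suc n) * x $ i\<bar> < 1" for i
    proof -
      have "\<bar>x $ i\<bar> < real (Suc n)" using component_le_norm_cart[of x i] n by simp
      then show ?thesis by (simp add: abs_mult)
    qed
    from cutoff_neq_0[OF this] show ?case using elim by (metis mult_eq_0_iff)
  qed
qed

section \<open>Raising and lowering\<close>

lemma sum_list_integrable:
  fixes f :: "'b \<Rightarrow> 'a \<Rightarrow> complex"
  assumes "\<And>p. p \<in> set ps \<Longrightarrow> integrable M (f p)"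
  shows "integrable M (\<lambda>x. \<Sum>p\<leftarrow>ps. f p x)" "(\<integral>x. (\<Sum>p\<leftarrow>ps. f p x) \<partial>M) = (\<Sum>p\<leftarrow>ps. \<integral>x. f p x \<partial>M)"
  using assms by (induction ps) auto

lemma sum_list_L2:
  assumes "\<And>p. p \<in> set ps \<Longrightarrow> g p \<in> L2"
  shows "(\<lambda>x. \<Sum>p\<leftarrow>ps. g p x) \<in> L2" "l2norm (\<lambda>x. \<Sum>p\<leftarrow>ps. g p x) \<le> (\<Sum>p\<leftarrow>ps. l2norm (g p))"
proof -
  have "(\<lambda>x. \<Sum>p\<leftarrow>ps. g p x) \<in> L2 \<and> l2norm (\<lambda>x. \<Sum>p\<leftarrow>ps. g p x) \<le> (\<Sum>p\<leftarrow>ps. l2norm (g p))"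
    using assms
  proof (induction ps)
    case (Cons p ps)
    then show ?case using l2norm_triangle[of "g p" "\<lambda>x. \<Sum>p\<leftarrow>ps. g p x"] by (auto intro!: L2_add)
  qed simp
  then show "(\<lambda>x. \<Sum>p\<leftarrow>ps. g p x) \<in> L2" "l2norm (\<lambda>x. \<Sum>p\<leftarrow>ps. g p x) \<le> (\<Sum>p\<leftarrow>ps. l2norm (g p))" by auto
qed

lemma integrable_foldr_partial_mult:
  assumes "f \<in> schwartz" "g \<in> schwartz"
  shows "integrable lebesgue (foldr partial w (\<lambda>x. f x * g x))"
  unfolding foldr_partial_mult[OF assms[THEN schwartz_smooth]] split_def
  by (intro sum_list_integrable(1) L2_mult_integrable schwartz_L2 schwartz_foldr_partial assms)

lemma funpow_hspan_lower: "f \<in> hspan \<Longrightarrow> (lower i ^^ p) f \<in> hspan"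
  by (induction p) (auto intro: hspan_lower)

lemma mult_raise:
  assumes "smooth f" "smooth h"
  shows "f x * raise i h x = - partial i (\<lambda>x. f x * h x) x + lower i f x * h x"
  using assms
  by (simp add: raise_def lower_def partial_mult smooth_differentiable algebra_simps)

lemma hspan_raise: "f \<in> hspan \<Longrightarrow> raise i f \<in> hspan"
  unfolding raise_def by (intro hspan_diff hspan_component conjunct2[OF hspan_partial])

lemma funpow_partial: "(partial i ^^ n) f = foldr partial (replicate n i) f"
  by (induction n) auto

text \<open>Commuting multiplication by \<open>f\<close> past \<open>x\<^sub>i - \<partial>\<^sub>i\<close> produces only pure derivatives \<open>\<partial>\<^sub>i\<^sup>j\<close>, and the
  commutators assemble to powers of \<open>x\<^sub>i + \<partial>\<^sub>i\<close> acting on \<open>f\<close>.\<close>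

lemma mult_raise_power:
  assumes f: "f \<in> hspan" and h: "h \<in> hspan"
  shows "f x * (raise i ^^ k) h x = (\<Sum>(u, v)\<leftarrow>splits (replicate k i).
    (-1) ^ length v * (partial i ^^ length v) (\<lambda>x. (lower i ^^ length u) f x * h x) x)"
  using h
proof (induction k arbitrary: h x)
  case (Suc k)
  let ?F = "\<lambda>u. (lower i ^^ length u) f"
  have sF: "smooth (?F u)" for u :: "'a list" by (intro hspan_smooth funpow_hspan_lower f)
  have sh: "smooth h" by (rule hspan_smooth[OF Suc.prems])
  have step: "(partial i ^^ n) (\<lambda>x. ?F u x * raise i h x) x =
      - (partial i ^^ Suc n) (\<lambda>x. ?F u x * h x) x + (partial i ^^ n) (\<lambda>x. lower i (?F u) x * h x) x"
    for n x and u :: "'a list"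
  proof -
    have s1: "smooth (partial i (\<lambda>x. ?F u x * h x))" by (intro smooth_partial smooth_mult sF sh)
    have s2: "smooth (\<lambda>x. lower i (?F u) x * h x)"
      by (intro smooth_mult sh hspan_smooth hspan_lower funpow_hspan_lower f)
    have "(\<lambda>x. ?F u x * raise i h x) = (\<lambda>x. (-1) * partial i (\<lambda>x. ?F u x * h x) x + lower i (?F u) x * h x)"
      by (rule ext) (simp add: mult_raise[OF sF sh])
    then have "(partial i ^^ n) (\<lambda>x. ?F u x * raise i h x) =
        foldr partial (replicate n i) (\<lambda>x. (-1) * partial i (\<lambda>x. ?F u x * h x) x + lower i (?F u) x * h x)"
      by (simp only: funpow_partial)
    also have "\<dots> = (\<lambda>x. (-1) * foldr partial (replicate n i) (partial i (\<lambda>x. ?F u x * h x)) x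
        + foldr partial (replicate n i) (\<lambda>x. lower i (?F u) x * h x) x)"
      by (simp only: foldr_partial_add[OF smooth_mult[OF smooth_const s1] s2] foldr_partial_scale[OF s1])
    finally show ?thesis by (simp add: funpow_partial[symmetric] funpow_swap1)
  qed
  have "f x * (raise i ^^ Suc k) h x = f x * (raise i ^^ k) (raise i h) x"
    by (simp add: funpow_swap1)
  also have "\<dots> = (\<Sum>(u, v)\<leftarrow>splits (replicate k i).
      (-1) ^ length v * (partial i ^^ length v) (\<lambda>x. ?F u x * raise i h x) x)"
    by (rule Suc.IH[OF hspan_raise[OF Suc.prems]])
  also have "\<dots> = (\<Sum>(u, v)\<leftarrow>splits (replicate k i).
      (-1) ^ length v * (partial i ^^ length v) (\<lambda>x. lower i (?F u) x * h x) x)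
    + (\<Sum>(u, v)\<leftarrow>splits (replicate k i). (-1) ^ Suc (length v) * (partial i ^^ Suc (length v)) (\<lambda>x. ?F u x * h x) x)"
    unfolding step split_def sum_list_addf[symmetric]
    by (rule arg_cong[where f = sum_list], rule map_cong[OF refl]) (simp add: algebra_simps)
  also have "\<dots> = (\<Sum>(u, v)\<leftarrow>splits (i # replicate k i).
    (-1) ^ length v * (partial i ^^ length v) (\<lambda>x. (lower i ^^ length u) f x * h x) x)"
    unfolding sum_list_splits_Cons by simp
  finally show ?case by simp
qed simp

text \<open>The factor by which \<open>(x\<^sub>i - \<partial>\<^sub>i)\<^sup>k\<close> maps \<open>h\<^sub>\<beta>\<close> to the Hermite function \<open>k\<close> steps above it.\<close>

primrec raise_factor :: "'n \<Rightarrow> nat \<Rightarrow> ('n \<Rightarrow> nat) \<Rightarrow> real" where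
  "raise_factor i 0 \<beta> = 1"
| "raise_factor i (Suc k) \<beta> = sqrt (2 * real (Suc (\<beta> i))) * raise_factor i k (up i \<beta>)"

lemma raise_scale: "smooth f \<Longrightarrow> raise i (\<lambda>x. c * f x) = (\<lambda>x. c * raise i f x)"
  by (simp add: fun_eq_iff raise_def partial_scale smooth_differentiable algebra_simps)

lemma funpow_raise_scale: "f \<in> hspan \<Longrightarrow> (raise i ^^ k) (\<lambda>x. c * f x) = (\<lambda>x. c * (raise i ^^ k) f x)"
proof (induction k)
  case (Suc k)
  have "(raise i ^^ k) f \<in> hspan" by (induction k) (auto intro: hspan_raise Suc.prems)
  then show ?case using Suc by (simp add: raise_scale hspan_smooth)
qed simp

lemma raise_power_hermite_fun:
  "(raise i ^^ k) (hermite_fun \<beta>) = (\<lambda>x. of_real (raise_factor i k \<beta>) * hermite_fun ((up i ^^ k) \<beta>) x)"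
proof (induction k arbitrary: \<beta>)
  case (Suc k)
  have "(raise i ^^ Suc k) (hermite_fun \<beta>) = (raise i ^^ k) (raise i (hermite_fun \<beta>))"
    by (simp add: funpow_swap1)
  also have "\<dots> = (\<lambda>x. of_real (sqrt (2 * real (Suc (\<beta> i)))) * (raise i ^^ k) (hermite_fun (up i \<beta>)) x)"
    unfolding raise_hermite_fun by (rule funpow_raise_scale[OF hspan_hermite_fun])
  finally show ?case
    unfolding Suc.IH by (simp add: funpow_swap1 mult.assoc)
qed simp

lemma hermite_coeff_lower_power:
  assumes "f \<in> schwartz"
  shows "hermite_coeff \<beta> ((lower i ^^ k) f) = of_real (raise_factor i k \<beta>) * hermite_coeff ((up i ^^ k) \<beta>) f"
proof (induction k arbitrary: \<beta>)
  case (Suc k)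
  have s: "(lower i ^^ k) f \<in> schwartz" by (induction k) (auto intro: schwartz_lower assms)
  show ?case
    by (simp add: hermite_coeff_lower[OF s] Suc.IH funpow_swap1[of "up i"] mult.assoc)
qed simp

lemma down_power: "k \<le> \<alpha> i \<Longrightarrow> (up i ^^ k) (\<alpha>(i := \<alpha> i - k)) = \<alpha>"
proof (induction k arbitrary: \<alpha>)
  case (Suc k)
  have "(up i ^^ k) ((down i \<alpha>)(i := down i \<alpha> i - k)) = down i \<alpha>"
    by (rule Suc.IH) (use Suc.prems in simp)
  moreover have "(down i \<alpha>)(i := down i \<alpha> i - k) = \<alpha>(i := \<alpha> i - Suc k)"
    by (auto simp: down_def)
  ultimately have "(up i ^^ Suc k) (\<alpha>(i := \<alpha> i - Suc k)) = up i (down i \<alpha>)"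
    by (simp only: funpow.simps o_apply)
  also have "\<dots> = \<alpha>" using Suc.prems by (intro up_down) simp
  finally show ?case .
qed simp

lemma raise_factor_lower: "(2 * real (Suc (\<beta> i))) ^ k \<le> (raise_factor i k \<beta>)\<^sup>2"
proof (induction k arbitrary: \<beta>)
  case (Suc k)
  have "(2 * real (Suc (\<beta> i))) ^ k \<le> (2 * real (Suc (up i \<beta> i))) ^ k" by (intro power_mono) auto
  also have "\<dots> \<le> (raise_factor i k (up i \<beta>))\<^sup>2" by (rule Suc.IH)
  finally have "(2 * real (Suc (\<beta> i))) * (2 * real (Suc (\<beta> i))) ^ k \<le> (2 * real (Suc (\<beta> i))) * (raise_factor i k (up i \<beta>))\<^sup>2"
    by (intro mult_left_mono) auto
  then show ?case by (simp add: power_mult_distrib)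
qed simp

text \<open>If \<open>\<alpha>\<^sub>i\<close> is the largest entry, then \<open>\<lambda> = 2|\<alpha>| + n\<close> is at most \<open>n (2 \<alpha>\<^sub>i + 1)\<close>. For \<open>\<alpha>\<^sub>i \<ge> 2k\<close> each of the \<open>k\<close>
  lowering steps in direction \<open>i\<close> contributes a factor comparable to \<open>\<alpha>\<^sub>i\<close>, and for \<open>\<alpha>\<^sub>i < 2k\<close> the
  eigenvalue is bounded, whence the summand \<open>1\<close>.\<close>

lemma eigenvalue_power_le:
  fixes \<alpha> :: "'n::finite \<Rightarrow> nat"
  shows "hermite_eigenvalue \<alpha> ^ k \<le> (real CARD('n) * (4 * real k + 3)) ^ k *
    (1 + (\<Sum>i\<in>UNIV. if k \<le> \<alpha> i then (raise_factor i k (\<alpha>(i := \<alpha> i - k)))\<^sup>2 else 0))"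
proof -
  let ?w = "\<lambda>i. if k \<le> \<alpha> i then (raise_factor i k (\<alpha>(i := \<alpha> i - k)))\<^sup>2 else 0"
  have "\<exists>i. \<forall>j. \<alpha> j \<le> \<alpha> i"
  proof -
    have "Max (range \<alpha>) \<in> range \<alpha>" by (intro Max_in) auto
    then obtain i where "Max (range \<alpha>) = \<alpha> i" by blast
    then show ?thesis using Max_ge[of "range \<alpha>"] by (metis finite finite_imageI rangeI)
  qed
  then obtain i where i: "\<And>j. \<alpha> j \<le> \<alpha> i" by blast
  let ?a = "real (\<alpha> i)"
  have "real (msize \<alpha>) = (\<Sum>j\<in>UNIV. real (\<alpha> j))" by (simp add: msize_def)
  also have "\<dots> \<le> (\<Sum>j\<in>(UNIV :: 'n set). ?a)" using i by (intro sum_mono) simp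
  finally have "hermite_eigenvalue \<alpha> \<le> real CARD('n) * (2 * ?a + 1)"
    by (simp add: hermite_eigenvalue_def algebra_simps)
  then have "hermite_eigenvalue \<alpha> ^ k \<le> (real CARD('n) * (2 * ?a + 1)) ^ k"
    using hermite_eigenvalue_pos[of \<alpha>] by (intro power_mono) auto
  also have "(2 * ?a + 1) ^ k \<le> (4 * real k + 3) ^ k * (1 + ?w i)"
  proof (cases "2 * k \<le> \<alpha> i")
    case True
    then have "real (2 * k) \<le> ?a" by (rule of_nat_mono)
    then have b: "2 * ?a + 1 \<le> 3 * (2 * real (Suc (\<alpha> i - k)))"
      using True by (simp add: of_nat_diff)
    have "(2 * ?a + 1) ^ k \<le> (3 * (2 * real (Suc (\<alpha> i - k)))) ^ k"
      by (intro power_mono b) simp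
    also have "\<dots> = 3 ^ k * (2 * real (Suc ((\<alpha>(i := \<alpha> i - k)) i))) ^ k"
      by (simp only: power_mult_distrib fun_upd_same)
    also have "\<dots> \<le> (4 * real k + 3) ^ k * ?w i"
      using True raise_factor_lower[of "\<alpha>(i := \<alpha> i - k)" i k] by (intro mult_mono power_mono) auto
    also have "\<dots> \<le> (4 * real k + 3) ^ k * (1 + ?w i)"
      by (intro mult_left_mono) auto
    finally show ?thesis .
  next
    case False
    then have "real (\<alpha> i) \<le> real (2 * k)" by (intro of_nat_mono) simp
    then have "(2 * ?a + 1) ^ k \<le> (4 * real k + 3) ^ k"
      by (intro power_mono) auto
    also have "\<dots> \<le> (4 * real k + 3) ^ k * (1 + ?w i)"
      by (simp add: mult_le_cancel_left1)
    finally show ?thesis .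
  qed
  then have "(real CARD('n) * (2 * ?a + 1)) ^ k \<le> (real CARD('n) * (4 * real k + 3)) ^ k * (1 + ?w i)"
    unfolding power_mult_distrib mult.assoc by (intro mult_left_mono) auto
  also have "?w i \<le> (\<Sum>i\<in>UNIV. ?w i)" by (rule member_le_sum) auto
  then have "(real CARD('n) * (4 * real k + 3)) ^ k * (1 + ?w i)
      \<le> (real CARD('n) * (4 * real k + 3)) ^ k * (1 + (\<Sum>i\<in>UNIV. ?w i))"
    by (intro mult_left_mono) auto
  finally show ?thesis .
qed

text \<open>The functions \<open>v i\<close> play the role of \<open>(x\<^sub>i + \<partial>\<^sub>i)\<^sup>k u\<close>. Mixed products of the lowering operators do not
  occur, because the eigenvalue is governed by a single coordinate.\<close>

lemma hermite_sobolev_criterion: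
  fixes u :: "real ^ 'n::finite \<Rightarrow> complex"
  assumes u: "u \<in> L2" "l2norm u \<le> B"
    and v: "\<And>i. v i \<in> L2" "\<And>i. l2norm (v i) \<le> B"
    and c: "\<And>i \<beta>. hermite_coeff \<beta> (v i) = of_real (raise_factor i k \<beta>) * hermite_coeff ((up i ^^ k) \<beta>) u"
  shows "u \<in> hermite_sobolev k"
    "hermite_sobolev_norm k u \<le> sqrt ((real CARD('n) * (4 * real k + 3)) ^ k * (1 + real CARD('n))) * B"
proof -
  let ?K = "(real CARD('n) * (4 * real k + 3)) ^ k"
  let ?w = "\<lambda>i \<alpha>. if k \<le> \<alpha> i then (raise_factor i k (\<alpha>(i := \<alpha> i - k)))\<^sup>2 else 0"
  let ?c = "\<lambda>\<alpha>. (cmod (hermite_coeff \<alpha> u))\<^sup>2"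
  have B: "0 \<le> B" using u(2) l2norm_nonneg[of u] by linarith
  have K: "0 \<le> ?K" by simp
  have w: "(\<Sum>\<alpha>\<in>A. ?w i \<alpha> * ?c \<alpha>) \<le> B\<^sup>2" if A: "finite A" for A i
  proof -
    let ?A = "{\<alpha> \<in> A. k \<le> \<alpha> i}" and ?d = "\<lambda>\<alpha>. \<alpha>(i := \<alpha> i - k)"
    have inj: "inj_on ?d ?A"
    proof (rule inj_on_inverseI)
      show "(up i ^^ k) (?d \<alpha>) = \<alpha>" if "\<alpha> \<in> ?A" for \<alpha> using that by (intro down_power) simp
    qed
    have "(\<Sum>\<alpha>\<in>A. ?w i \<alpha> * ?c \<alpha>) = (\<Sum>\<alpha>\<in>?A. ?w i \<alpha> * ?c \<alpha>)"
      by (rule sum.mono_neutral_right) (use A in auto)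
    also have "\<dots> = (\<Sum>\<alpha>\<in>?A. (cmod (hermite_coeff (?d \<alpha>) (v i)))\<^sup>2)"
    proof (rule sum.cong[OF refl])
      fix \<alpha> assume a: "\<alpha> \<in> ?A"
      then have "(up i ^^ k) (?d \<alpha>) = \<alpha>" by (intro down_power) simp
      then show "?w i \<alpha> * ?c \<alpha> = (cmod (hermite_coeff (?d \<alpha>) (v i)))\<^sup>2"
        using a by (simp add: c norm_mult power_mult_distrib)
    qed
    also have "\<dots> = (\<Sum>\<beta>\<in>?d ` ?A. (cmod (hermite_coeff \<beta> (v i)))\<^sup>2)"
      by (subst sum.reindex[OF inj]) simp
    also have "\<dots> \<le> (l2norm (v i))\<^sup>2" by (rule Bessel[OF v(1)]) (use A in simp)
    also have "\<dots> \<le> B\<^sup>2" using v(2) by (intro power_mono) auto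
    finally show ?thesis .
  qed
  have le: "sum (energy k u) A \<le> (sqrt (?K * (1 + real CARD('n))) * B)\<^sup>2" if A: "finite A" for A
  proof -
    have "sum (energy k u) A \<le> (\<Sum>\<alpha>\<in>A. (?K * (1 + (\<Sum>i\<in>UNIV. ?w i \<alpha>))) * ?c \<alpha>)"
      unfolding energy_def by (intro sum_mono mult_right_mono eigenvalue_power_le) auto
    also have "\<dots> = ?K * ((\<Sum>\<alpha>\<in>A. ?c \<alpha>) + (\<Sum>\<alpha>\<in>A. \<Sum>i\<in>UNIV. ?w i \<alpha> * ?c \<alpha>))"
      unfolding sum.distrib[symmetric] sum_distrib_left by (simp only: mult.assoc ring_distribs sum_distrib_right mult_1_left)
    also have "(\<Sum>\<alpha>\<in>A. \<Sum>i\<in>UNIV. ?w i \<alpha> * ?c \<alpha>) = (\<Sum>i\<in>UNIV. \<Sum>\<alpha>\<in>A. ?w i \<alpha> * ?c \<alpha>)"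
      by (rule sum.swap)
    also have "?K * ((\<Sum>\<alpha>\<in>A. ?c \<alpha>) + (\<Sum>i\<in>UNIV. \<Sum>\<alpha>\<in>A. ?w i \<alpha> * ?c \<alpha>)) \<le> ?K * (B\<^sup>2 + (\<Sum>i\<in>(UNIV :: 'n set). B\<^sup>2))"
    proof (intro mult_left_mono add_mono sum_mono w A K)
      show "(\<Sum>\<alpha>\<in>A. ?c \<alpha>) \<le> B\<^sup>2"
        using Bessel[OF u(1) A] power_mono[OF u(2), of 2] by simp
    qed
    also have "\<dots> = (sqrt (?K * (1 + real CARD('n))) * B)\<^sup>2"
      by (simp add: power_mult_distrib algebra_simps)
    finally show ?thesis .
  qed
  have B': "0 \<le> sqrt (?K * (1 + real CARD('n))) * B" using B by simp
  show "u \<in> hermite_sobolev k" by (rule hermite_sobolev_norm_le(1)[OF u(1) B' le])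
  show "hermite_sobolev_norm k u \<le> sqrt (?K * (1 + real CARD('n))) * B"
    by (rule hermite_sobolev_norm_le(2)[OF u(1) B' le])
qed

lemma hermite_sobolev_norm_lower:
  assumes f: "f \<in> hspan"
  shows "hermite_sobolev_norm j (lower i f) \<le> hermite_sobolev_norm (Suc j) f"
proof (rule hermite_sobolev_norm_le(2)[OF hspan_L2[OF hspan_lower[OF f]] hermite_sobolev_norm_nonneg])
  fix A :: "('a \<Rightarrow> nat) set" assume A: "finite A"
  have "energy j (lower i f) \<beta> \<le> energy (Suc j) f (up i \<beta>)" for \<beta>
  proof -
    have "\<beta> i \<le> msize \<beta>" unfolding msize_def by (rule member_le_sum) auto
    then have "2 * real (Suc (\<beta> i)) \<le> hermite_eigenvalue (up i \<beta>)"
      unfolding hermite_eigenvalue_def by simp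
    moreover have "hermite_eigenvalue \<beta> ^ j \<le> hermite_eigenvalue (up i \<beta>) ^ j"
      using hermite_eigenvalue_pos[of \<beta>] by (intro power_mono) (auto simp: hermite_eigenvalue_up)
    ultimately have "hermite_eigenvalue \<beta> ^ j * (2 * real (Suc (\<beta> i))) \<le> hermite_eigenvalue (up i \<beta>) ^ j * hermite_eigenvalue (up i \<beta>)"
      using hermite_eigenvalue_pos[of "up i \<beta>"] by (intro mult_mono) auto
    then have "(hermite_eigenvalue \<beta> ^ j * (2 * real (Suc (\<beta> i)))) * (cmod (hermite_coeff (up i \<beta>) f))\<^sup>2
        \<le> hermite_eigenvalue (up i \<beta>) ^ Suc j * (cmod (hermite_coeff (up i \<beta>) f))\<^sup>2"
      by (intro mult_right_mono) (auto simp: mult.commute)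
    moreover have "energy j (lower i f) \<beta> = (hermite_eigenvalue \<beta> ^ j * (2 * real (Suc (\<beta> i)))) * (cmod (hermite_coeff (up i \<beta>) f))\<^sup>2"
      unfolding energy_def hermite_coeff_lower[OF hspan_schwartz[OF f]] norm_mult power_mult_distrib norm_of_real
      by simp
    ultimately show ?thesis by (simp only: energy_def)
  qed
  then have "sum (energy j (lower i f)) A \<le> (\<Sum>\<beta>\<in>A. energy (Suc j) f (up i \<beta>))" by (intro sum_mono)
  also have "\<dots> = sum (energy (Suc j) f) (up i ` A)"
    by (subst sum.reindex) (auto intro: inj_on_subset[OF inj_up])
  also have "\<dots> \<le> (hermite_sobolev_norm (Suc j) f)\<^sup>2"
    by (rule sum_energy_le[OF hspan_hermite_sobolev[OF f]])
  finally show "sum (energy j (lower i f)) A \<le> (hermite_sobolev_norm (Suc j) f)\<^sup>2" .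
qed

lemma hermite_sobolev_norm_lower_power:
  assumes f: "f \<in> hspan"
  shows "hermite_sobolev_norm j ((lower i ^^ p) f) \<le> hermite_sobolev_norm (j + p) f"
proof (induction p arbitrary: j)
  case (Suc p)
  have "hermite_sobolev_norm j (lower i ((lower i ^^ p) f)) \<le> hermite_sobolev_norm (Suc j) ((lower i ^^ p) f)"
    by (rule hermite_sobolev_norm_lower[OF funpow_hspan_lower[OF f]])
  also have "\<dots> \<le> hermite_sobolev_norm (Suc j + p) f" by (rule Suc.IH)
  finally show ?case by simp
qed simp

section \<open>From bounded derivatives to multipliers\<close>

lemma integrable_AE_bounded_mult:
  fixes m g :: "'a::euclidean_space \<Rightarrow> complex"
  assumes m: "m \<in> borel_measurable lebesgue" "AE x in lebesgue. cmod (m x) \<le> C" and g: "integrable lebesgue g"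
  shows "integrable lebesgue (\<lambda>x. m x * g x)"
proof (rule Bochner_Integration.integrable_bound)
  show "integrable lebesgue (\<lambda>x. C * cmod (g x))" using g by (intro integrable_mult_right integrable_norm)
  show "(\<lambda>x. m x * g x) \<in> borel_measurable lebesgue"
    by (intro borel_measurable_times m borel_measurable_integrable g)
  show "AE x in lebesgue. norm (m x * g x) \<le> norm (C * cmod (g x))"
    using m(2)
  proof eventually_elim
    case (elim x)
    then have "cmod (m x) * cmod (g x) \<le> C * cmod (g x)" by (intro mult_right_mono) auto
    then show ?case unfolding norm_mult real_norm_def by linarith
  qed
qed

lemma locally_integrable_AE_bounded:
  fixes m :: "real ^ 'n \<Rightarrow> complex"
  assumes m: "m \<in> borel_measurable lebesgue" "AE x in lebesgue. cmod (m x) \<le> C"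
  shows "locally_integrable m"
  unfolding locally_integrable_def
proof (intro allI impI)
  fix K :: "(real ^ 'n) set" assume K: "compact K"
  have Ks: "K \<in> sets lebesgue" using K by (intro sets_completionI_sets) (simp add: borel_compact)
  have "emeasure lebesgue K < \<infinity>" using emeasure_compact_finite[OF K] K by (simp add: borel_compact)
  then have i: "integrable lebesgue (indicator K :: real ^ 'n \<Rightarrow> real)"
    by (rule integrable_real_indicator[OF Ks])
  have "integrable lebesgue (\<lambda>x. m x * complex_of_real (indicator K x))"
    by (rule integrable_AE_bounded_mult[OF m integrable_of_real[OF i]])
  then show "set_integrable lebesgue K m"
    unfolding set_integrable_def scaleR_conv_of_real by (simp only: mult.commute)
qed

lemma locally_integrable_L2:
  fixes g :: "real ^ 'n \<Rightarrow> complex"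
  assumes g: "g \<in> L2"
  shows "locally_integrable g"
  unfolding locally_integrable_def set_integrable_def
proof (intro allI impI)
  fix K :: "(real ^ 'n) set" assume K: "compact K"
  have Ks: "K \<in> sets lebesgue" using K by (intro sets_completionI_sets) (simp add: borel_compact)
  have "emeasure lebesgue K < \<infinity>" using emeasure_compact_finite[OF K] K by (simp add: borel_compact)
  then have i: "integrable lebesgue (indicator K :: real ^ 'n \<Rightarrow> real)"
    by (rule integrable_real_indicator[OF Ks])
  show "integrable lebesgue (\<lambda>x. indicator K x *\<^sub>R g x)"
  proof (rule Bochner_Integration.integrable_bound)
    show "integrable lebesgue (\<lambda>x. indicator K x + (cmod (g x))\<^sup>2)"
      by (intro Bochner_Integration.integrable_add i L2_integrable_square g)
    show "(\<lambda>x. indicator K x *\<^sub>R g x) \<in> borel_measurable lebesgue"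
      by (intro borel_measurable_scaleR borel_measurable_indicator Ks L2_measurable g)
    show "AE x in lebesgue. norm (indicator K x *\<^sub>R g x) \<le> norm (indicator K x + (cmod (g x))\<^sup>2)"
    proof (intro AE_I2)
      fix x
      have "2 * cmod (g x) \<le> 1 + (cmod (g x))\<^sup>2"
        using sum_squares_bound[of 1 "cmod (g x)"] by simp
      then have "cmod (g x) \<le> 1 + (cmod (g x))\<^sup>2"
        using norm_ge_zero[of "g x"] by linarith
      then show "norm (indicator K x *\<^sub>R g x) \<le> norm (indicator K x + (cmod (g x))\<^sup>2)"
        by (auto split: split_indicator)
    qed
  qed
qed

lemma locally_integrableD:
  "locally_integrable m \<Longrightarrow> compact K \<Longrightarrow> integrable lebesgue (\<lambda>x. indicator K x *\<^sub>R m x)"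
  unfolding locally_integrable_def set_integrable_def by simp

lemma integrable_mult_test_function:
  fixes m :: "real ^ 'n::finite \<Rightarrow> complex"
  assumes m: "locally_integrable m" "m \<in> borel_measurable lebesgue" and \<phi>: "\<phi> \<in> test_functions"
  shows "integrable lebesgue (\<lambda>x. m x * \<phi> x)"
proof -
  let ?K = "closure {x. \<phi> x \<noteq> 0}"
  obtain B where B: "\<And>x. cmod (\<phi> x) \<le> B"
    by (rule rapid_decay_bounded[OF schwartz_rapid_decay[OF test_function_schwartz[OF \<phi>]]]) (rule that)
  show ?thesis
  proof (rule Bochner_Integration.integrable_bound)
    have "compact ?K" using \<phi> by (simp add: test_functions_def)
    then have "integrable lebesgue (\<lambda>x. indicator ?K x *\<^sub>R m x)"
      by (rule locally_integrableD[OF m(1)])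
    then show "integrable lebesgue (\<lambda>x. B *\<^sub>R (indicator ?K x *\<^sub>R m x))"
      by (intro integrable_scaleR_right)
    show "(\<lambda>x. m x * \<phi> x) \<in> borel_measurable lebesgue"
      by (rule borel_measurable_times[OF m(2) smooth_measurable[OF schwartz_smooth[OF test_function_schwartz[OF \<phi>]]]])
    show "AE x in lebesgue. norm (m x * \<phi> x) \<le> norm (B *\<^sub>R (indicator ?K x *\<^sub>R m x))"
    proof (intro AE_I2)
      fix x
      show "norm (m x * \<phi> x) \<le> norm (B *\<^sub>R (indicator ?K x *\<^sub>R m x))"
      proof (cases "\<phi> x = 0")
        case False
        then have "x \<in> ?K" by (intro subsetD[OF closure_subset]) (rule CollectI)
        moreover have "cmod (m x) * cmod (\<phi> x) \<le> cmod (m x) * \<bar>B\<bar>"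
          by (rule mult_left_mono[OF order_trans[OF B abs_ge_self] norm_ge_zero])
        ultimately show ?thesis
          by (simp only: norm_mult norm_scaleR indicator_simps abs_one mult_1 mult.commute[of "cmod (m x)" "\<bar>B\<bar>"])
      next
        case True
        then show ?thesis by (simp only: mult_zero_right norm_zero norm_ge_zero)
      qed
    qed
  qed
qed

lemma foldr_funpow_zero: "foldr (\<lambda>i. partial i ^^ 0) js f = f"
  by (induction js) simp_all

lemma mderiv_zero: "mderiv (\<lambda>i. 0) f = f"
  unfolding mderiv_def by (rule foldr_funpow_zero)

text \<open>For \<open>\<alpha> = 0\<close> the hypothesis identifies \<open>m f\<close> with an \<open>L\<^sup>2\<close> function as a distribution, and locally
  integrable functions that agree as distributions agree almost everywhere.\<close>

lemma deriv_mult_bounded_0: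
  fixes m :: "real ^ 'n::finite \<Rightarrow> complex"
  assumes m: "m \<in> borel_measurable lebesgue" and d: "deriv_mult_L2_bounded m (\<lambda>i. 0)"
  shows "\<exists>C. mult_bounded 0 m C"
proof -
  have li: "locally_integrable m" using d by (simp add: deriv_mult_L2_bounded_def)
  obtain C where C: "\<And>f. f \<in> schwartz \<Longrightarrow> \<exists>g\<in>L2.
      (\<forall>\<phi>\<in>test_functions. dist_mult (dist_deriv (\<lambda>i. 0) (dist_of_fun m)) f \<phi> = dist_of_fun g \<phi>) \<and>
      l2norm g \<le> C * l2norm (hermite_power (real (msize (\<lambda>i :: 'n. 0)) / 2) f)"
    using d unfolding deriv_mult_L2_bounded_def by blast
  have *: "(\<lambda>x. m x * f x) \<in> hermite_sobolev 0 \<and>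
      hermite_sobolev_norm 0 (\<lambda>x. m x * f x) \<le> \<bar>C\<bar> * hermite_sobolev_norm 0 f"
    if f: "f \<in> hspan" for f
  proof -
    have fs: "f \<in> schwartz" and fL: "f \<in> L2" using f by (auto intro: hspan_schwartz hspan_L2)
    obtain g where g: "g \<in> L2"
      "\<And>\<phi>. \<phi> \<in> test_functions \<Longrightarrow> dist_mult (dist_deriv (\<lambda>i. 0) (dist_of_fun m)) f \<phi> = dist_of_fun g \<phi>"
      "l2norm g \<le> C * l2norm (hermite_power (real (msize (\<lambda>i :: 'n. 0)) / 2) f)"
      using C[OF fs] by blast
    have nf: "l2norm (hermite_power (real (msize (\<lambda>i :: 'n. 0)) / 2) f) = l2norm f"
      unfolding hermite_sobolev_norm_def[symmetric] msize_zero by (rule hermite_sobolev_0(2)[OF fL])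
    let ?u = "\<lambda>x. m x * f x + (- g x)"
    have um: "(\<lambda>x. m x * f x) \<in> borel_measurable lebesgue"
      by (intro borel_measurable_times m L2_measurable fL)
    have "AE x in lebesgue. ?u x = 0"
    proof (rule AE_eq_0_if_test_functions)
      obtain B where B: "\<And>x. cmod (f x) \<le> B" using hspan_bounded[OF f] by blast
      show "locally_integrable ?u"
        unfolding locally_integrable_def set_integrable_def
      proof (intro allI impI)
        fix K :: "(real ^ 'n) set" assume K: "compact K"
        have i1: "integrable lebesgue (\<lambda>x. f x * (indicator K x *\<^sub>R m x))"
        proof (rule integrable_AE_bounded_mult[OF L2_measurable[OF fL]])
          show "AE x in lebesgue. cmod (f x) \<le> B" using B by simp
          show "integrable lebesgue (\<lambda>x. indicator K x *\<^sub>R m x)"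
            by (rule locally_integrableD[OF li K])
        qed
        have i2: "integrable lebesgue (\<lambda>x. indicator K x *\<^sub>R g x)"
          by (rule locally_integrableD[OF locally_integrable_L2[OF g(1)] K])
        have "(\<lambda>x. indicator K x *\<^sub>R ?u x) = (\<lambda>x. f x * (indicator K x *\<^sub>R m x) - indicator K x *\<^sub>R g x)"
          by (simp add: fun_eq_iff algebra_simps)
        then show "integrable lebesgue (\<lambda>x. indicator K x *\<^sub>R ?u x)"
          using Bochner_Integration.integrable_diff[OF i1 i2] by (simp only:)
      qed
      show "?u \<in> borel_measurable lebesgue"
        by (intro borel_measurable_add borel_measurable_uminus um L2_measurable g)
      fix \<phi> :: "real ^ 'n \<Rightarrow> complex" assume \<phi>: "\<phi> \<in> test_functions"
      have i1: "integrable lebesgue (\<lambda>x. m x * (f x * \<phi> x))"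
        by (rule integrable_mult_test_function[OF li m test_function_mult[OF hspan_smooth[OF f] \<phi>]])
      have i2: "integrable lebesgue (\<lambda>x. g x * \<phi> x)"
        by (rule L2_mult_integrable[OF g(1) schwartz_L2[OF test_function_schwartz[OF \<phi>]]])
      have "(\<integral>x. m x * (f x * \<phi> x) \<partial>lebesgue) = (\<integral>x. g x * \<phi> x \<partial>lebesgue)"
        using g(2)[OF \<phi>] by (simp add: dist_mult_def dist_deriv_def dist_of_fun_def mderiv_zero)
      moreover have "(\<integral>x. ?u x * \<phi> x \<partial>lebesgue) = (\<integral>x. m x * (f x * \<phi> x) - g x * \<phi> x \<partial>lebesgue)"
        by (simp add: algebra_simps)
      ultimately show "(\<integral>x. ?u x * \<phi> x \<partial>lebesgue) = 0"
        using Bochner_Integration.integral_diff[OF i1 i2] by simp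
    qed
    then have ae: "AE x in lebesgue. g x = m x * f x" by eventually_elim simp
    have uL: "(\<lambda>x. m x * f x) \<in> L2" by (rule L2_cong_AE[OF g(1) um ae])
    have n: "l2norm g = l2norm (\<lambda>x. m x * f x)"
      by (rule l2norm_cong_AE[OF L2_measurable[OF g(1)] um ae])
    have "l2norm (\<lambda>x. m x * f x) = l2norm g" by (rule n[symmetric])
    also have "\<dots> \<le> C * l2norm f" using g(3) unfolding nf .
    also have "\<dots> \<le> \<bar>C\<bar> * l2norm f" by (intro mult_right_mono) auto
    finally have "hermite_sobolev_norm 0 (\<lambda>x. m x * f x) \<le> \<bar>C\<bar> * hermite_sobolev_norm 0 f"
      by (simp only: hermite_sobolev_0(2)[OF uL] hermite_sobolev_0(2)[OF fL])
    then show ?thesis by (rule conjI[OF hermite_sobolev_0(1)[OF uL]])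
  qed
  then have "mult_bounded 0 m \<bar>C\<bar>" unfolding mult_bounded_def by simp
  then show ?thesis by (rule exI)
qed

text \<open>The identity passes from the test functions \<open>h \<cdot> cutoff r\<close> to \<open>h\<close> by dominated convergence, because \<open>m\<close> is
  bounded and the derivatives of the cutoffs are bounded uniformly in \<open>r\<close>.\<close>

lemma weak_derivative_test_with_hspan:
  fixes m :: "real ^ 'n::finite \<Rightarrow> complex"
  assumes m: "m \<in> borel_measurable lebesgue" "AE x in lebesgue. cmod (m x) \<le> C"
    and F: "F \<in> hspan" and h: "h \<in> hspan" and g: "g \<in> L2"
    and eq: "\<And>\<phi>. \<phi> \<in> test_functions \<Longrightarrow>
      c * (\<integral>x. m x * foldr partial w (\<lambda>x. F x * \<phi> x) x \<partial>lebesgue) = (\<integral>x. g x * \<phi> x \<partial>lebesgue)"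
  shows "c * (\<integral>x. m x * foldr partial w (\<lambda>x. F x * h x) x \<partial>lebesgue) = (\<integral>x. g x * h x \<partial>lebesgue)"
proof -
  let ?r = "\<lambda>n. 1 / real (Suc n)"
  let ?cut = "\<lambda>n. cutoff (?r n) :: real ^ 'n \<Rightarrow> complex"
  let ?G = "\<lambda>x. F x * h x"
  have Fs: "F \<in> schwartz" and hs: "h \<in> schwartz" using F h by (auto intro: hspan_schwartz)
  have sG: "smooth ?G" by (intro smooth_mult schwartz_smooth Fs hs)
  have r: "0 < ?r n" "?r n \<le> 1" for n by simp_all
  have test: "(\<lambda>x. h x * ?cut n x) \<in> test_functions" for n
    by (intro test_function_mult schwartz_smooth hs cutoff_test_function r)
  have "\<forall>v. \<exists>B. \<forall>n x. cmod (foldr partial v (?cut n) x) \<le> B"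
    using cutoff_bounded r by metis
  then obtain B where B: "\<And>v n x. cmod (foldr partial v (?cut n) x) \<le> B v" by metis
  let ?D = "\<lambda>n. foldr partial w (\<lambda>x. ?G x * ?cut n x)"
  have D: "?D n x = (\<Sum>(u, v)\<leftarrow>splits w. foldr partial u ?G x * foldr partial v (?cut n) x)" for n x
    by (rule fun_cong[OF foldr_partial_mult[OF sG smooth_cutoff]])
  have one: "foldr partial w ?G x = (\<Sum>(u, v)\<leftarrow>splits w. foldr partial u ?G x * foldr partial v (\<lambda>x. 1) x)" for x
    using fun_cong[OF foldr_partial_mult[OF sG smooth_const, of w 1], of x] by simp
  have lim1: "(\<lambda>n. \<integral>x. m x * ?D n x \<partial>lebesgue) \<longlonglongrightarrow> (\<integral>x. m x * foldr partial w ?G x \<partial>lebesgue)"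
  proof (rule integral_dominated_convergence
      [where w = "\<lambda>x. C * (\<Sum>(u, v)\<leftarrow>splits w. cmod (foldr partial u ?G x) * B v)"])
    have sm: "foldr partial u H \<in> borel_measurable lebesgue" if "smooth H" for u and H :: "real ^ 'n \<Rightarrow> complex"
      by (intro smooth_measurable smooth_foldr_partial that)
    show "(\<lambda>x. m x * foldr partial w ?G x) \<in> borel_measurable lebesgue"
      by (intro borel_measurable_times m sm sG)
    show "(\<lambda>x. m x * ?D n x) \<in> borel_measurable lebesgue" for n
      by (intro borel_measurable_times m sm smooth_mult[OF sG smooth_cutoff])
    have "integrable lebesgue (\<lambda>x. \<Sum>p\<leftarrow>ps. cmod (foldr partial (fst p) ?G x) * B (snd p))" for ps
      by (induction ps) (auto intro!: Bochner_Integration.integrable_add integrable_mult_left integrable_norm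
          integrable_foldr_partial_mult Fs hs)
    then show "integrable lebesgue (\<lambda>x. C * (\<Sum>(u, v)\<leftarrow>splits w. cmod (foldr partial u ?G x) * B v))"
      unfolding split_def by (intro integrable_mult_right)
    show "AE x in lebesgue. (\<lambda>n. m x * ?D n x) \<longlonglongrightarrow> m x * foldr partial w ?G x"
    proof (intro AE_I2 tendsto_mult tendsto_const)
      fix x
      have "(\<lambda>n. \<Sum>p\<leftarrow>ps. foldr partial (fst p) ?G x * foldr partial (snd p) (?cut n) x) \<longlonglongrightarrow>
          (\<Sum>p\<leftarrow>ps. foldr partial (fst p) ?G x * foldr partial (snd p) (\<lambda>x. 1) x)" for ps
        by (induction ps) (auto intro!: tendsto_add tendsto_mult foldr_partial_cutoff_tendsto simp del: of_nat_Suc)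
      then show "(\<lambda>n. ?D n x) \<longlonglongrightarrow> foldr partial w ?G x"
        unfolding D one split_def .
    qed
    show "AE x in lebesgue. norm (m x * ?D n x) \<le> C * (\<Sum>(u, v)\<leftarrow>splits w. cmod (foldr partial u ?G x) * B v)" for n
      using m(2)
    proof eventually_elim
      case (elim x)
      have "cmod (\<Sum>p\<leftarrow>ps. foldr partial (fst p) ?G x * foldr partial (snd p) (?cut n) x) \<le>
          (\<Sum>p\<leftarrow>ps. cmod (foldr partial (fst p) ?G x) * B (snd p))" for ps
      proof (induction ps)
        case (Cons p ps)
        have "cmod (foldr partial (fst p) ?G x * foldr partial (snd p) (?cut n) x) \<le> cmod (foldr partial (fst p) ?G x) * B (snd p)"
          unfolding norm_mult by (intro mult_left_mono B) auto
        with Cons show ?case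
          by (simp del: of_nat_Suc) (rule order_trans[OF norm_triangle_ineq], rule add_mono)
      qed simp
      then have "cmod (?D n x) \<le> (\<Sum>(u, v)\<leftarrow>splits w. cmod (foldr partial u ?G x) * B v)"
        unfolding D split_def .
      then show ?case
        unfolding norm_mult using elim by (intro mult_mono order_trans[OF norm_ge_zero elim]) auto
    qed
  qed
  have lim2: "(\<lambda>n. \<integral>x. g x * (h x * ?cut n x) \<partial>lebesgue) \<longlonglongrightarrow> (\<integral>x. g x * h x \<partial>lebesgue)"
  proof (rule integral_dominated_convergence[where w = "\<lambda>x. B [] * cmod (g x * h x)"])
    have hL: "h \<in> L2" by (rule hspan_L2[OF h])
    show "(\<lambda>x. g x * h x) \<in> borel_measurable lebesgue" by (intro borel_measurable_times L2_measurable g hL)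
    show "(\<lambda>x. g x * (h x * ?cut n x)) \<in> borel_measurable lebesgue" for n
      by (intro borel_measurable_times L2_measurable g hL smooth_measurable smooth_cutoff)
    show "integrable lebesgue (\<lambda>x. B [] * cmod (g x * h x))"
      by (intro integrable_mult_right integrable_norm L2_mult_integrable g hL)
    show "AE x in lebesgue. (\<lambda>n. g x * (h x * ?cut n x)) \<longlonglongrightarrow> g x * h x"
    proof (intro AE_I2)
      fix x
      have "(\<lambda>n. g x * (h x * ?cut n x)) \<longlonglongrightarrow> g x * (h x * 1)"
        by (intro tendsto_mult tendsto_const) (use foldr_partial_cutoff_tendsto[of "[]" x] in simp)
      then show "(\<lambda>n. g x * (h x * ?cut n x)) \<longlonglongrightarrow> g x * h x" by simp
    qed
    show "AE x in lebesgue. norm (g x * (h x * ?cut n x)) \<le> B [] * cmod (g x * h x)" for n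
    proof (intro AE_I2)
      fix x
      have "cmod (g x * h x) * cmod (?cut n x) \<le> cmod (g x * h x) * B []"
        using B[of "[]" n x] by (intro mult_left_mono) auto
      then show "norm (g x * (h x * ?cut n x)) \<le> B [] * cmod (g x * h x)"
        by (simp only: norm_mult mult_ac)
    qed
  qed
  have "(\<lambda>n. c * (\<integral>x. m x * ?D n x \<partial>lebesgue)) \<longlonglongrightarrow> c * (\<integral>x. m x * foldr partial w ?G x \<partial>lebesgue)"
    by (intro tendsto_mult tendsto_const lim1)
  moreover have "c * (\<integral>x. m x * ?D n x \<partial>lebesgue) = (\<integral>x. g x * (h x * ?cut n x) \<partial>lebesgue)" for n
    using eq[OF test[of n]] by (simp only: mult.assoc)
  ultimately have "(\<lambda>n. \<integral>x. g x * (h x * ?cut n x) \<partial>lebesgue) \<longlonglongrightarrow> c * (\<integral>x. m x * foldr partial w ?G x \<partial>lebesgue)"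
    by (simp only:)
  from LIMSEQ_unique[OF this lim2] show ?thesis .
qed

lemma pure_derivative_bounded:
  fixes m :: "real ^ 'n::finite \<Rightarrow> complex"
  assumes m: "m \<in> borel_measurable lebesgue" "AE x in lebesgue. cmod (m x) \<le> C"
    and d: "deriv_mult_L2_bounded m (\<lambda>i'. if i' = i then j else 0)"
  shows "\<exists>D\<ge>0. \<forall>F\<in>hspan. \<exists>g\<in>L2. l2norm g \<le> D * hermite_sobolev_norm j F \<and>
    (\<forall>h\<in>hspan. (-1) ^ j * (\<integral>x. m x * (partial i ^^ j) (\<lambda>x. F x * h x) x \<partial>lebesgue) = (\<integral>x. g x * h x \<partial>lebesgue))"
proof -
  let ?\<alpha> = "\<lambda>i'. if i' = i then j else 0 :: nat"
  have ms: "msize ?\<alpha> = j" by (simp add: msize_def)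
  obtain D where D: "\<And>f. f \<in> schwartz \<Longrightarrow> \<exists>g\<in>L2.
      (\<forall>\<phi>\<in>test_functions. dist_mult (dist_deriv ?\<alpha> (dist_of_fun m)) f \<phi> = dist_of_fun g \<phi>) \<and>
      l2norm g \<le> D * l2norm (hermite_power (real (msize ?\<alpha>) / 2) f)"
    using d unfolding deriv_mult_L2_bounded_def by blast
  have "\<exists>g\<in>L2. l2norm g \<le> \<bar>D\<bar> * hermite_sobolev_norm j F \<and>
    (\<forall>h\<in>hspan. (-1) ^ j * (\<integral>x. m x * (partial i ^^ j) (\<lambda>x. F x * h x) x \<partial>lebesgue) = (\<integral>x. g x * h x \<partial>lebesgue))"
    if F: "F \<in> hspan" for F
  proof -
    obtain g where g: "g \<in> L2"
      "\<And>\<phi>. \<phi> \<in> test_functions \<Longrightarrow> dist_mult (dist_deriv ?\<alpha> (dist_of_fun m)) F \<phi> = dist_of_fun g \<phi>"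
      "l2norm g \<le> D * hermite_sobolev_norm j F"
      using D[OF hspan_schwartz[OF F]] unfolding ms hermite_sobolev_norm_def[symmetric] by blast
    have "l2norm g \<le> \<bar>D\<bar> * hermite_sobolev_norm j F"
      using g(3) mult_right_mono[OF abs_ge_self[of D] hermite_sobolev_norm_nonneg[of j F]] by linarith
    moreover have "(-1) ^ j * (\<integral>x. m x * (partial i ^^ j) (\<lambda>x. F x * h x) x \<partial>lebesgue) = (\<integral>x. g x * h x \<partial>lebesgue)"
      if h: "h \<in> hspan" for h
      unfolding funpow_partial
    proof (rule weak_derivative_test_with_hspan[OF m F h g(1)])
      fix \<phi> :: "real ^ 'n \<Rightarrow> complex" assume \<phi>: "\<phi> \<in> test_functions"
      have s: "smooth (\<lambda>x. F x * \<phi> x)"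
        by (intro smooth_mult hspan_smooth F schwartz_smooth test_function_schwartz \<phi>)
      show "(-1) ^ j * (\<integral>x. m x * foldr partial (replicate j i) (\<lambda>x. F x * \<phi> x) x \<partial>lebesgue) = (\<integral>x. g x * \<phi> x \<partial>lebesgue)"
        using g(2)[OF \<phi>]
        unfolding dist_mult_def dist_deriv_def dist_of_fun_def ms partial_pow_mderiv[OF s, symmetric] funpow_partial .
    qed
    ultimately show ?thesis using g(1) by blast
  qed
  then show ?thesis by (intro exI[of _ "\<bar>D\<bar>"]) simp
qed

text \<open>Up to a factor, the coefficient of \<open>m f\<close> at an index \<open>k\<close> steps above \<open>\<beta>\<close> is the integral of \<open>m\<close> against
  \<open>f \<cdot> (x\<^sub>i - \<partial>\<^sub>i)\<^sup>k h\<^sub>\<beta>\<close>, a sum of terms \<open>\<plusminus>\<partial>\<^sub>i\<^sup>j (F h\<^sub>\<beta>)\<close> with \<open>F = (x\<^sub>i + \<partial>\<^sub>i)\<^bsup>k-j\<^esup> f\<close>. By the hypothesis on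
  \<open>\<partial>\<^sub>i\<^sup>j m\<close> each term is a coefficient of an \<open>L\<^sup>2\<close> function of norm at most a multiple of the norm of \<open>F\<close> in
  \<open>W\<^sub>H\<^sup>j\<^sup>,\<^sup>2\<close>, which the norm of \<open>f\<close> in \<open>W\<^sub>H\<^sup>k\<^sup>,\<^sup>2\<close> dominates.\<close>

lemma raised_multiplier_bounded:
  fixes m :: "real ^ 'n::finite \<Rightarrow> complex"
  assumes m: "m \<in> borel_measurable lebesgue" "AE x in lebesgue. cmod (m x) \<le> C"
    and d: "\<And>\<alpha> :: 'n \<Rightarrow> nat. msize \<alpha> \<le> k \<Longrightarrow> deriv_mult_L2_bounded m \<alpha>"
  shows "\<exists>E\<ge>0. \<forall>f\<in>hspan. \<exists>v\<in>L2. l2norm v \<le> E * hermite_sobolev_norm k f \<and>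
    (\<forall>\<beta>. hermite_coeff \<beta> v = of_real (raise_factor i k \<beta>) * hermite_coeff ((up i ^^ k) \<beta>) (\<lambda>x. m x * f x))"
proof -
  let ?Q = "\<lambda>j D. \<forall>F\<in>hspan. \<exists>g\<in>L2. l2norm g \<le> D * hermite_sobolev_norm j F \<and>
    (\<forall>h\<in>hspan. (-1) ^ j * (\<integral>x. m x * (partial i ^^ j) (\<lambda>x. F x * h x) x \<partial>lebesgue) = (\<integral>x. g x * h x \<partial>lebesgue))"
  have "\<forall>j\<in>{..k}. \<exists>D. 0 \<le> D \<and> ?Q j D"
  proof
    fix j assume "j \<in> {..k}"
    then have "msize (\<lambda>i'. if i' = i then j else 0) \<le> k" by (simp add: msize_def)
    from pure_derivative_bounded[OF m d[OF this]] show "\<exists>D. 0 \<le> D \<and> ?Q j D" .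
  qed
  from bchoice[OF this] obtain D where D': "\<forall>j\<in>{..k}. 0 \<le> D j \<and> ?Q j (D j)" by (rule exE)
  have D0: "0 \<le> D j" and DQ: "?Q j (D j)" if "j \<le> k" for j
    using bspec[OF D', of j] that by simp_all
  let ?ps = "splits (replicate k i)"
  have len: "length (fst p) + length (snd p) = k" if "p \<in> set ?ps" for p
    using splits_length[of "fst p" "snd p" "replicate k i"] that by simp
  let ?E = "\<Sum>p\<leftarrow>?ps. D (length (snd p))"
  have E: "0 \<le> ?E"
    by (rule sum_list_nonneg) (use D0 len in \<open>force\<close>)
  have "\<exists>v\<in>L2. l2norm v \<le> ?E * hermite_sobolev_norm k f \<and>
    (\<forall>\<beta>. hermite_coeff \<beta> v = of_real (raise_factor i k \<beta>) * hermite_coeff ((up i ^^ k) \<beta>) (\<lambda>x. m x * f x))"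
    if f: "f \<in> hspan" for f
  proof -
    let ?F = "\<lambda>p :: 'n list \<times> 'n list. (lower i ^^ length (fst p)) f"
    have F: "?F p \<in> hspan" for p by (rule funpow_hspan_lower[OF f])
    have "\<forall>p\<in>set ?ps. \<exists>g. g \<in> L2 \<and> l2norm g \<le> D (length (snd p)) * hermite_sobolev_norm (length (snd p)) (?F p) \<and>
      (\<forall>h\<in>hspan. (-1) ^ length (snd p) * (\<integral>x. m x * (partial i ^^ length (snd p)) (\<lambda>x. ?F p x * h x) x \<partial>lebesgue)
        = (\<integral>x. g x * h x \<partial>lebesgue))"
    proof
      fix p assume "p \<in> set ?ps"
      then have "length (snd p) \<le> k" using len by fastforce
      from bspec[OF DQ[OF this] F[of p]] show "\<exists>g. g \<in> L2 \<and> l2norm g \<le> D (length (snd p)) * hermite_sobolev_norm (length (snd p)) (?F p) \<and>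
        (\<forall>h\<in>hspan. (-1) ^ length (snd p) * (\<integral>x. m x * (partial i ^^ length (snd p)) (\<lambda>x. ?F p x * h x) x \<partial>lebesgue)
          = (\<integral>x. g x * h x \<partial>lebesgue))" by blast
    qed
    from bchoice[OF this] obtain g where g: "\<And>p. p \<in> set ?ps \<Longrightarrow> g p \<in> L2"
      "\<And>p. p \<in> set ?ps \<Longrightarrow> l2norm (g p) \<le> D (length (snd p)) * hermite_sobolev_norm (length (snd p)) (?F p)"
      "\<And>p h. p \<in> set ?ps \<Longrightarrow> h \<in> hspan \<Longrightarrow>
        (-1) ^ length (snd p) * (\<integral>x. m x * (partial i ^^ length (snd p)) (\<lambda>x. ?F p x * h x) x \<partial>lebesgue)
        = (\<integral>x. g p x * h x \<partial>lebesgue)"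
      by blast
    let ?v = "\<lambda>x. \<Sum>p\<leftarrow>?ps. g p x"
    have vL: "?v \<in> L2" "l2norm ?v \<le> (\<Sum>p\<leftarrow>?ps. l2norm (g p))"
      by (rule sum_list_L2, rule g(1), assumption)+
    note vL(2)
    also have "(\<Sum>p\<leftarrow>?ps. l2norm (g p)) \<le> (\<Sum>p\<leftarrow>?ps. D (length (snd p)) * hermite_sobolev_norm k f)"
    proof (rule sum_list_mono)
      fix p assume p: "p \<in> set ?ps"
      have "hermite_sobolev_norm (length (snd p)) (?F p) \<le> hermite_sobolev_norm k f"
        using hermite_sobolev_norm_lower_power[OF f, where i = i and j = "length (snd p)" and p = "length (fst p)"] len[OF p]
        by (simp add: add.commute)
      moreover have "0 \<le> D (length (snd p))" by (rule D0) (use len[OF p] in linarith)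
      ultimately show "l2norm (g p) \<le> D (length (snd p)) * hermite_sobolev_norm k f"
        by (intro order_trans[OF g(2)[OF p]] mult_left_mono)
    qed
    also have "\<dots> = ?E * hermite_sobolev_norm k f" by (rule sum_list_mult_const)
    finally have le: "l2norm ?v \<le> ?E * hermite_sobolev_norm k f" .
    have co: "hermite_coeff \<beta> ?v = of_real (raise_factor i k \<beta>) * hermite_coeff ((up i ^^ k) \<beta>) (\<lambda>x. m x * f x)" for \<beta>
    proof -
      let ?h = "hermite_fun \<beta> :: real ^ 'n \<Rightarrow> complex"
      let ?d = "\<lambda>p x. (-1) ^ length (snd p) * (partial i ^^ length (snd p)) (\<lambda>x. ?F p x * ?h x) x"
      have h: "?h \<in> hspan" by (rule hspan_hermite_fun)
      have id: "integrable lebesgue (\<lambda>x. m x * ?d p x)" for p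
        unfolding funpow_partial
        by (intro integrable_AE_bounded_mult[OF m] integrable_mult_right integrable_foldr_partial_mult
            hspan_schwartz F h)
      have "hermite_coeff \<beta> ?v = (\<integral>x. (\<Sum>p\<leftarrow>?ps. g p x * ?h x) \<partial>lebesgue)"
        unfolding hermite_coeff_eq by (simp only: sum_list_mult_const)
      also have "\<dots> = (\<Sum>p\<leftarrow>?ps. \<integral>x. g p x * ?h x \<partial>lebesgue)"
        by (rule sum_list_integrable(2)) (intro L2_mult_integrable g hermite_fun_L2)
      also have "\<dots> = (\<Sum>p\<leftarrow>?ps. \<integral>x. m x * ?d p x \<partial>lebesgue)"
      proof (rule arg_cong[where f = sum_list], rule map_cong[OF refl])
        fix p assume p: "p \<in> set ?ps"
        show "(\<integral>x. g p x * ?h x \<partial>lebesgue) = (\<integral>x. m x * ?d p x \<partial>lebesgue)"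
          unfolding g(3)[OF p h, symmetric] integral_mult_right_zero[symmetric] by (simp only: mult.left_commute)
      qed
      also have "\<dots> = (\<integral>x. (\<Sum>p\<leftarrow>?ps. m x * ?d p x) \<partial>lebesgue)"
        by (rule sum_list_integrable(2)[symmetric]) (rule id)
      also have "\<dots> = (\<integral>x. m x * (f x * (raise i ^^ k) ?h x) \<partial>lebesgue)"
        unfolding mult_raise_power[OF f h] split_def by (simp only: sum_list_const_mult)
      also have "\<dots> = (\<integral>x. of_real (raise_factor i k \<beta>) * ((m x * f x) * hermite_fun ((up i ^^ k) \<beta>) x) \<partial>lebesgue)"
        unfolding raise_power_hermite_fun by (simp only: mult_ac)
      finally show ?thesis unfolding hermite_coeff_eq integral_mult_right_zero .
    qed
    show ?thesis using vL(1) le co by blast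
  qed
  with E show ?thesis by blast
qed

lemma mult_bounded_if_deriv_mult_bounded:
  fixes m :: "real ^ 'n::finite \<Rightarrow> complex"
  assumes m: "m \<in> borel_measurable lebesgue"
    and d: "\<And>\<alpha> :: 'n \<Rightarrow> nat. msize \<alpha> \<le> k \<Longrightarrow> deriv_mult_L2_bounded m \<alpha>"
  shows "\<exists>C. mult_bounded k m C"
proof -
  obtain C where "mult_bounded 0 m C"
    using deriv_mult_bounded_0[OF m d] by auto
  then have C: "0 \<le> C" "AE x in lebesgue. cmod (m x) \<le> C"
    using mult_bounded_AE_le[OF _ m] by (auto simp: mult_bounded_def)
  have "\<forall>i. \<exists>E. 0 \<le> E \<and> (\<forall>f\<in>hspan. \<exists>v\<in>L2. l2norm v \<le> E * hermite_sobolev_norm k f \<and>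
    (\<forall>\<beta>. hermite_coeff \<beta> v = of_real (raise_factor i k \<beta>) * hermite_coeff ((up i ^^ k) \<beta>) (\<lambda>x. m x * f x)))"
    using raised_multiplier_bounded[OF m C(2) d] by blast
  from choice[OF this] obtain E where E: "\<And>i. 0 \<le> E i"
    "\<And>i f. f \<in> hspan \<Longrightarrow> \<exists>v\<in>L2. l2norm v \<le> E i * hermite_sobolev_norm k f \<and>
    (\<forall>\<beta>. hermite_coeff \<beta> v = of_real (raise_factor i k \<beta>) * hermite_coeff ((up i ^^ k) \<beta>) (\<lambda>x. m x * f x))"
    by blast
  let ?S = "C + (\<Sum>i\<in>UNIV. E i)"
  let ?K = "sqrt ((real CARD('n) * (4 * real k + 3)) ^ k * (1 + real CARD('n)))"
  have SE: "E i \<le> ?S" "C \<le> ?S" for i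
    using member_le_sum[of i UNIV E] E(1) C(1) sum_nonneg[of UNIV E] by auto
  have "mult_bounded k m (?K * ?S)"
    unfolding mult_bounded_def
  proof (intro conjI ballI)
    show "0 \<le> ?K * ?S" using C(1) E(1) by (intro mult_nonneg_nonneg add_nonneg_nonneg sum_nonneg) auto
    fix f :: "real ^ 'n \<Rightarrow> complex" assume f: "f \<in> hspan"
    let ?N = "hermite_sobolev_norm k f"
    have fL: "f \<in> L2" by (rule hspan_L2[OF f])
    have "\<forall>i. \<exists>v. v \<in> L2 \<and> l2norm v \<le> E i * ?N \<and>
      (\<forall>\<beta>. hermite_coeff \<beta> v = of_real (raise_factor i k \<beta>) * hermite_coeff ((up i ^^ k) \<beta>) (\<lambda>x. m x * f x))"
      using E(2)[OF f] by blast
    from choice[OF this] obtain v where v: "\<And>i. v i \<in> L2" "\<And>i. l2norm (v i) \<le> E i * ?N"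
      "\<And>i \<beta>. hermite_coeff \<beta> (v i) = of_real (raise_factor i k \<beta>) * hermite_coeff ((up i ^^ k) \<beta>) (\<lambda>x. m x * f x)"
      by blast
    have vS: "l2norm (v i) \<le> ?S * ?N" for i
      using v(2)[of i] mult_right_mono[OF SE(1)[of i] hermite_sobolev_norm_nonneg[of k f]] by linarith
    have "l2norm (\<lambda>x. m x * f x) \<le> C * l2norm f" by (rule L2_mult_bounded(2)[OF fL m C(2)])
    also have "\<dots> \<le> ?S * ?N"
      using SE(2) C(1) l2norm_le_hermite_sobolev_norm[OF hspan_hermite_sobolev[OF f]]
      by (intro mult_mono) auto
    finally have uS: "l2norm (\<lambda>x. m x * f x) \<le> ?S * ?N" .
    note cr = hermite_sobolev_criterion[OF L2_mult_bounded(1)[OF fL m C(2)] uS v(1) vS v(3)]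
    show "(\<lambda>x. m x * f x) \<in> hermite_sobolev k" by (rule cr(1))
    show "hermite_sobolev_norm k (\<lambda>x. m x * f x) \<le> ?K * ?S * ?N"
      using cr(2) by (simp only: mult.assoc)
  qed
  then show ?thesis by blast
qed

section \<open>From multipliers to bounded derivatives\<close>

text \<open>The operators \<open>x\<^sub>i + \<partial>\<^sub>i\<close> preserve the Schwartz space, which lies in \<open>L\<^sup>2\<close>.\<close>

lemma schwartz_hermite_sobolev:
  fixes f :: "real ^ 'n::finite \<Rightarrow> complex"
  assumes f: "f \<in> schwartz"
  shows "f \<in> hermite_sobolev k"
proof -
  let ?v = "\<lambda>i. (lower i ^^ k) f"
  let ?B = "l2norm f + (\<Sum>i\<in>UNIV. l2norm (?v i))"
  have s: "(lower i ^^ n) f \<in> schwartz" for i n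
    by (induction n) (auto intro: schwartz_lower f)
  have "l2norm (?v i) \<le> (\<Sum>i\<in>UNIV. l2norm (?v i))" for i
    by (rule member_le_sum) auto
  then have v: "l2norm (?v i) \<le> ?B" for i
    using add_increasing[OF l2norm_nonneg[of f]] by blast
  have u: "l2norm f \<le> ?B"
    using sum_nonneg[of UNIV "\<lambda>i. l2norm (?v i)"] by simp
  show ?thesis
    by (rule hermite_sobolev_criterion(1)[OF schwartz_L2[OF f] u schwartz_L2[OF s] v hermite_coeff_lower_power[OF f]])
qed

text \<open>The Hermite coefficients of \<open>\<partial>\<^sub>i F\<close>, as formal expressions that make sense for every \<open>F \<in> L\<^sup>2\<close>.\<close>

definition partial_coeff :: "'n \<Rightarrow> (real ^ 'n::finite \<Rightarrow> complex) \<Rightarrow> ('n \<Rightarrow> nat) \<Rightarrow> complex" where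
  "partial_coeff i F \<alpha> = of_real (sqrt (real (Suc (\<alpha> i)) / 2)) * hermite_coeff (up i \<alpha>) F
    - of_real (sqrt (real (\<alpha> i) / 2)) * hermite_coeff (down i \<alpha>) F"

lemma partial_coeff_diff:
  assumes "f \<in> L2" "g \<in> L2"
  shows "partial_coeff i (\<lambda>x. f x - g x) \<alpha> = partial_coeff i f \<alpha> - partial_coeff i g \<alpha>"
  unfolding partial_coeff_def hermite_coeff_diff[OF assms] by (simp add: algebra_simps)

lemma cmod_diff_square: "(cmod (a - b))\<^sup>2 \<le> 2 * (cmod a)\<^sup>2 + 2 * (cmod b)\<^sup>2"
proof -
  have "(cmod (a - b))\<^sup>2 \<le> (cmod a + cmod b)\<^sup>2"
    by (intro power_mono norm_triangle_ineq4) auto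
  also have "\<dots> \<le> 2 * (cmod a)\<^sup>2 + 2 * (cmod b)\<^sup>2"
    using sum_squares_bound[of "cmod a" "cmod b"] by (simp add: power2_sum)
  finally show ?thesis .
qed

text \<open>Both neighbours \<open>up i \<alpha>\<close> and \<open>down i \<alpha>\<close> have an eigenvalue comparable to that of \<open>\<alpha>\<close>, and the
  squared ladder factors are at most that eigenvalue: one derivative costs one unit of
  regularity.\<close>

lemma sum_partial_coeff_le:
  fixes F :: "real ^ 'n::finite \<Rightarrow> complex"
  assumes F: "F \<in> hermite_sobolev (Suc j)" and A: "finite A"
  shows "(\<Sum>\<alpha>\<in>A. hermite_eigenvalue \<alpha> ^ j * (cmod (partial_coeff i F \<alpha>))\<^sup>2)
    \<le> (1 + 3 ^ Suc j) * (hermite_sobolev_norm (Suc j) F)\<^sup>2"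
proof -
  let ?l = "hermite_eigenvalue :: ('n \<Rightarrow> nat) \<Rightarrow> real" and ?c = "\<lambda>\<alpha>. (cmod (hermite_coeff \<alpha> F))\<^sup>2"
  let ?N = "(hermite_sobolev_norm (Suc j) F)\<^sup>2"
  let ?D = "{\<alpha>\<in>A. \<alpha> i \<noteq> 0}"
  have comp: "real (\<alpha> i) \<le> real (msize \<alpha>)" for \<alpha> :: "'n \<Rightarrow> nat"
    unfolding msize_def of_nat_le_iff by (rule member_le_sum) auto
  have up: "?l \<alpha> ^ j * (real (Suc (\<alpha> i)) * ?c (up i \<alpha>)) \<le> energy (Suc j) F (up i \<alpha>)" for \<alpha>
  proof -
    have "?l \<alpha> ^ j \<le> ?l (up i \<alpha>) ^ j"
      using hermite_eigenvalue_pos[of \<alpha>] by (intro power_mono) (auto simp: hermite_eigenvalue_up)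
    moreover have "real (Suc (\<alpha> i)) \<le> ?l (up i \<alpha>)"
      using comp[of \<alpha>] unfolding hermite_eigenvalue_def by simp
    ultimately have "?l \<alpha> ^ j * real (Suc (\<alpha> i)) \<le> ?l (up i \<alpha>) ^ j * ?l (up i \<alpha>)"
      using hermite_eigenvalue_pos[of "up i \<alpha>"] by (intro mult_mono) auto
    then have "(?l \<alpha> ^ j * real (Suc (\<alpha> i))) * ?c (up i \<alpha>) \<le> (?l (up i \<alpha>) ^ j * ?l (up i \<alpha>)) * ?c (up i \<alpha>)"
      by (intro mult_right_mono) auto
    then show ?thesis unfolding energy_def power_Suc by (simp only: mult.assoc mult.left_commute)
  qed
  have down: "?l \<alpha> ^ j * (real (\<alpha> i) * ?c (down i \<alpha>)) \<le> 3 ^ Suc j * energy (Suc j) F (down i \<alpha>)"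
    if "\<alpha> i \<noteq> 0" for \<alpha>
  proof -
    have "?l \<alpha> = ?l (down i \<alpha>) + 2"
      using hermite_eigenvalue_up[of i "down i \<alpha>"] that by simp
    then have l: "?l \<alpha> \<le> 3 * ?l (down i \<alpha>)"
      using hermite_eigenvalue_ge_1[of "down i \<alpha>"] by linarith
    have "real (\<alpha> i) \<le> ?l \<alpha>" using comp[of \<alpha>] unfolding hermite_eigenvalue_def by simp
    then have "?l \<alpha> ^ j * real (\<alpha> i) \<le> (3 * ?l (down i \<alpha>)) ^ j * (3 * ?l (down i \<alpha>))"
      using l hermite_eigenvalue_pos[of \<alpha>] by (intro mult_mono power_mono) auto
    also have "\<dots> = 3 ^ Suc j * ?l (down i \<alpha>) ^ Suc j" by (simp add: power_mult_distrib)
    finally have "(?l \<alpha> ^ j * real (\<alpha> i)) * ?c (down i \<alpha>) \<le> (3 ^ Suc j * ?l (down i \<alpha>) ^ Suc j) * ?c (down i \<alpha>)"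
      by (intro mult_right_mono) auto
    then show ?thesis unfolding energy_def by (simp only: mult.assoc)
  qed
  have single: "?l \<alpha> ^ j * (cmod (partial_coeff i F \<alpha>))\<^sup>2
    \<le> energy (Suc j) F (up i \<alpha>) + (if \<alpha> i \<noteq> 0 then 3 ^ Suc j * energy (Suc j) F (down i \<alpha>) else 0)" for \<alpha>
  proof -
    have half: "2 * (cmod (of_real (sqrt (r / 2)) * z))\<^sup>2 = r * (cmod z)\<^sup>2" if "0 \<le> r" for r z
      using that by (simp add: norm_mult power_mult_distrib)
    have "(cmod (partial_coeff i F \<alpha>))\<^sup>2 \<le> real (Suc (\<alpha> i)) * ?c (up i \<alpha>) + real (\<alpha> i) * ?c (down i \<alpha>)"
      unfolding partial_coeff_def
      using cmod_diff_square[of "of_real (sqrt (real (Suc (\<alpha> i)) / 2)) * hermite_coeff (up i \<alpha>) F"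
          "of_real (sqrt (real (\<alpha> i) / 2)) * hermite_coeff (down i \<alpha>) F"]
      by (simp only: half[OF of_nat_0_le_iff])
    then have "?l \<alpha> ^ j * (cmod (partial_coeff i F \<alpha>))\<^sup>2
        \<le> ?l \<alpha> ^ j * (real (Suc (\<alpha> i)) * ?c (up i \<alpha>) + real (\<alpha> i) * ?c (down i \<alpha>))"
      using hermite_eigenvalue_pos[of \<alpha>] by (intro mult_left_mono) auto
    also have "\<dots> = ?l \<alpha> ^ j * (real (Suc (\<alpha> i)) * ?c (up i \<alpha>)) + ?l \<alpha> ^ j * (real (\<alpha> i) * ?c (down i \<alpha>))"
      by (rule distrib_left)
    also have "\<dots> \<le> energy (Suc j) F (up i \<alpha>) + (if \<alpha> i \<noteq> 0 then 3 ^ Suc j * energy (Suc j) F (down i \<alpha>) else 0)"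
    proof (rule add_mono[OF up])
      show "?l \<alpha> ^ j * (real (\<alpha> i) * ?c (down i \<alpha>)) \<le> (if \<alpha> i \<noteq> 0 then 3 ^ Suc j * energy (Suc j) F (down i \<alpha>) else 0)"
      proof (cases "\<alpha> i = 0")
        case False
        then show ?thesis using down[of \<alpha>] by (simp only: not_False_eq_True if_True)
      qed simp
    qed
    finally show ?thesis .
  qed
  have "(\<Sum>\<alpha>\<in>A. ?l \<alpha> ^ j * (cmod (partial_coeff i F \<alpha>))\<^sup>2)
      \<le> (\<Sum>\<alpha>\<in>A. energy (Suc j) F (up i \<alpha>)) + (\<Sum>\<alpha>\<in>A. if \<alpha> i \<noteq> 0 then 3 ^ Suc j * energy (Suc j) F (down i \<alpha>) else 0)"
    unfolding sum.distrib[symmetric] by (intro sum_mono single)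
  also have "(\<Sum>\<alpha>\<in>A. energy (Suc j) F (up i \<alpha>)) = sum (energy (Suc j) F) (up i ` A)"
    by (subst sum.reindex) (auto intro: inj_on_subset[OF inj_up])
  also have "(\<Sum>\<alpha>\<in>A. if \<alpha> i \<noteq> 0 then 3 ^ Suc j * energy (Suc j) F (down i \<alpha>) else 0)
      = (\<Sum>\<alpha>\<in>?D. 3 ^ Suc j * energy (Suc j) F (down i \<alpha>))"
    by (rule sum.inter_filter[OF A, symmetric])
  also have "\<dots> = 3 ^ Suc j * sum (energy (Suc j) F) (down i ` ?D)"
  proof -
    have "inj_on (down i) ?D" by (rule inj_on_inverseI[where g = "up i"]) simp
    then show ?thesis by (simp only: sum_distrib_left sum.reindex o_def)
  qed
  also have "sum (energy (Suc j) F) (up i ` A) + 3 ^ Suc j * sum (energy (Suc j) F) (down i ` ?D) \<le> ?N + 3 ^ Suc j * ?N"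
    by (intro add_mono mult_left_mono sum_energy_le F) auto
  finally show ?thesis by (simp only: distrib_right mult_1)
qed

text \<open>The derivative is the \<open>L\<^sup>2\<close> function with the Hermite coefficients that the ladder relations
  prescribe. Integration by parts holds for the partial sums of \<open>F\<close> and passes to the limit,
  because the estimate above, applied to the remainders, makes their derivatives converge.\<close>

lemma hermite_sobolev_weak_partial:
  fixes F :: "real ^ 'n::finite \<Rightarrow> complex"
  assumes F: "F \<in> hermite_sobolev (Suc j)"
  shows "\<exists>G\<in>hermite_sobolev j. hermite_sobolev_norm j G \<le> sqrt (1 + 3 ^ Suc j) * hermite_sobolev_norm (Suc j) F \<and>
    (\<forall>\<psi>\<in>schwartz. (\<integral>x. F x * partial i \<psi> x \<partial>lebesgue) = - (\<integral>x. G x * \<psi> x \<partial>lebesgue))"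
proof -
  have F1: "F \<in> hermite_sobolev (Suc 0)" by (rule hermite_sobolev_mono(1)[OF F]) simp
  have FL: "F \<in> L2" by (rule hermite_sobolev_L2[OF F])
  have b0: "(\<Sum>\<alpha>\<in>A. (cmod (partial_coeff i f \<alpha>))\<^sup>2) \<le> (2 * hermite_sobolev_norm (Suc 0) f)\<^sup>2"
    if "f \<in> hermite_sobolev (Suc 0)" "finite A" for f :: "real ^ 'n \<Rightarrow> complex" and A
    using sum_partial_coeff_le[OF that, of i] by (simp add: power_mult_distrib)
  from Riesz_Fischer_ex[OF b0[OF F1]]
  obtain G where G: "G \<in> L2" "\<And>\<alpha>. hermite_coeff \<alpha> G = partial_coeff i F \<alpha>" by blast
  have nn: "0 \<le> sqrt (1 + 3 ^ Suc j) * hermite_sobolev_norm (Suc j) F"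
    by (intro mult_nonneg_nonneg) auto
  have "sum (energy j G) A \<le> (sqrt (1 + 3 ^ Suc j) * hermite_sobolev_norm (Suc j) F)\<^sup>2" if "finite A" for A
  proof -
    have "(sqrt (1 + 3 ^ Suc j))\<^sup>2 = (1 + 3 ^ Suc j :: real)" by (rule real_sqrt_pow2) (simp add: add_nonneg_nonneg)
    then show ?thesis
      using sum_partial_coeff_le[OF F that, of i] by (simp only: energy_def[abs_def] G(2) power_mult_distrib)
  qed
  note Gj = hermite_sobolev_norm_le[OF G(1) nn this]
  have "(\<integral>x. F x * partial i \<psi> x \<partial>lebesgue) = - (\<integral>x. G x * \<psi> x \<partial>lebesgue)" if \<psi>: "\<psi> \<in> schwartz" for \<psi>
  proof -
    let ?P = "\<lambda>N. partial_sum N F"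
    have P: "?P N \<in> hspan" for N by (rule hermite_sum_hspan)
    have PL: "?P N \<in> L2" and DL: "partial i (?P N) \<in> L2" for N
      by (rule hspan_L2[OF P], rule schwartz_L2[OF schwartz_partial[OF hspan_schwartz[OF P]]])
    have le: "l2norm (\<lambda>x. partial i (?P N) x - G x) \<le> 2 * hermite_sobolev_norm (Suc 0) (\<lambda>x. ?P N x - F x)" for N
    proof (rule l2norm_le_if_finite_sums[OF L2_diff[OF DL G(1)]])
      show "0 \<le> 2 * hermite_sobolev_norm (Suc 0) (\<lambda>x. ?P N x - F x)" by simp
      fix A :: "('n \<Rightarrow> nat) set" assume A: "finite A"
      have "hermite_coeff \<alpha> (\<lambda>x. partial i (?P N) x - G x) = partial_coeff i (\<lambda>x. ?P N x - F x) \<alpha>" for \<alpha>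
        unfolding hermite_coeff_diff[OF DL G(1)] hermite_coeff_partial[OF hspan_schwartz[OF P]] G(2)
          partial_coeff_diff[OF PL FL] by (simp only: partial_coeff_def)
      then show "(\<Sum>\<alpha>\<in>A. (cmod (hermite_coeff \<alpha> (\<lambda>x. partial i (?P N) x - G x)))\<^sup>2)
          \<le> (2 * hermite_sobolev_norm (Suc 0) (\<lambda>x. ?P N x - F x))\<^sup>2"
        using b0[OF hermite_sobolev_remainder(1)[OF F1, of N] A] by (simp only:)
    qed
    have "(\<lambda>N. 2 * hermite_sobolev_norm (Suc 0) (\<lambda>x. ?P N x - F x)) \<longlonglongrightarrow> 2 * 0"
      by (intro tendsto_mult tendsto_const hermite_sobolev_remainder(2)[OF F1])
    then have lim: "(\<lambda>N. 2 * hermite_sobolev_norm (Suc 0) (\<lambda>x. ?P N x - F x)) \<longlonglongrightarrow> 0" by simp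
    have "(\<lambda>N. l2norm (\<lambda>x. partial i (?P N) x - G x)) \<longlonglongrightarrow> 0"
      by (rule tendsto_sandwich[OF always_eventually always_eventually tendsto_const lim])
        (rule allI, rule l2norm_nonneg, rule allI, rule le)
    from L2_tendsto_integral_mult[OF DL G(1) schwartz_L2[OF \<psi>] this]
    have l1: "(\<lambda>N. \<integral>x. partial i (?P N) x * \<psi> x \<partial>lebesgue) \<longlonglongrightarrow> (\<integral>x. G x * \<psi> x \<partial>lebesgue)" .
    have l2: "(\<lambda>N. \<integral>x. ?P N x * partial i \<psi> x \<partial>lebesgue) \<longlonglongrightarrow> (\<integral>x. F x * partial i \<psi> x \<partial>lebesgue)"
      by (rule L2_tendsto_integral_mult[OF PL FL schwartz_L2[OF schwartz_partial[OF \<psi>]] LIMSEQ_hermite_sum[OF FL]])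
    have "(\<integral>x. ?P N x * partial i \<psi> x \<partial>lebesgue) = - (\<integral>x. partial i (?P N) x * \<psi> x \<partial>lebesgue)" for N
      unfolding schwartz_integration_by_parts[OF hspan_schwartz[OF P] \<psi>] by simp
    then have "(\<lambda>N. - (\<integral>x. partial i (?P N) x * \<psi> x \<partial>lebesgue)) \<longlonglongrightarrow> (\<integral>x. F x * partial i \<psi> x \<partial>lebesgue)"
      using l2 by (simp only:)
    from LIMSEQ_unique[OF this tendsto_minus[OF l1]] show ?thesis .
  qed
  with Gj show ?thesis by blast
qed

lemma hermite_sobolev_weak_derivative:
  fixes v :: "'n::finite list"
  shows "\<exists>K\<ge>0. \<forall>F\<in>hermite_sobolev (length v). \<exists>G\<in>L2. l2norm G \<le> K * hermite_sobolev_norm (length v) F \<and>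
    (\<forall>\<psi>\<in>schwartz. (\<integral>x. F x * foldr partial v \<psi> x \<partial>lebesgue) = (-1) ^ length v * (\<integral>x. G x * \<psi> x \<partial>lebesgue))"
proof (induction v)
  case Nil
  have "\<forall>F\<in>hermite_sobolev 0. \<exists>G\<in>L2. l2norm G \<le> 1 * hermite_sobolev_norm 0 F \<and>
    (\<forall>\<psi>\<in>schwartz. (\<integral>x. F x * \<psi> x \<partial>lebesgue) = (\<integral>x. G x * \<psi> x \<partial>(lebesgue :: (real ^ 'n) measure)))"
  proof
    fix F :: "real ^ 'n \<Rightarrow> complex" assume "F \<in> hermite_sobolev 0"
    then have F: "F \<in> L2" by (rule hermite_sobolev_L2)
    then show "\<exists>G\<in>L2. l2norm G \<le> 1 * hermite_sobolev_norm 0 F \<and>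
      (\<forall>\<psi>\<in>schwartz. (\<integral>x. F x * \<psi> x \<partial>lebesgue) = (\<integral>x. G x * \<psi> x \<partial>lebesgue))"
      by (intro bexI[of _ F] conjI ballI refl) (simp_all add: hermite_sobolev_0(2))
  qed
  then show ?case by (intro exI[of _ 1]) simp
next
  case (Cons i v)
  let ?l = "length v"
  let ?c = "sqrt (1 + 3 ^ Suc ?l)"
  obtain K where K: "0 \<le> K" "\<And>F. F \<in> hermite_sobolev ?l \<Longrightarrow> \<exists>G\<in>L2. l2norm G \<le> K * hermite_sobolev_norm ?l F \<and>
    (\<forall>\<psi>\<in>schwartz. (\<integral>x. F x * foldr partial v \<psi> x \<partial>lebesgue) = (-1) ^ ?l * (\<integral>x. G x * \<psi> x \<partial>lebesgue))"
    using Cons.IH by blast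
  have "\<exists>G\<in>L2. l2norm G \<le> (K * ?c) * hermite_sobolev_norm (Suc ?l) F \<and>
    (\<forall>\<psi>\<in>schwartz. (\<integral>x. F x * partial i (foldr partial v \<psi>) x \<partial>lebesgue) = (-1) ^ Suc ?l * (\<integral>x. G x * \<psi> x \<partial>lebesgue))"
    if F: "F \<in> hermite_sobolev (Suc ?l)" for F :: "real ^ 'n \<Rightarrow> complex"
  proof -
    obtain G where G: "G \<in> hermite_sobolev ?l" "hermite_sobolev_norm ?l G \<le> ?c * hermite_sobolev_norm (Suc ?l) F"
      "\<And>\<psi>. \<psi> \<in> schwartz \<Longrightarrow> (\<integral>x. F x * partial i \<psi> x \<partial>lebesgue) = - (\<integral>x. G x * \<psi> x \<partial>lebesgue)"
      using hermite_sobolev_weak_partial[OF F, of i] by blast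
    obtain H where H: "H \<in> L2" "l2norm H \<le> K * hermite_sobolev_norm ?l G"
      "\<And>\<psi>. \<psi> \<in> schwartz \<Longrightarrow> (\<integral>x. G x * foldr partial v \<psi> x \<partial>lebesgue) = (-1) ^ ?l * (\<integral>x. H x * \<psi> x \<partial>lebesgue)"
      using K(2)[OF G(1)] by blast
    have "l2norm H \<le> K * (?c * hermite_sobolev_norm (Suc ?l) F)"
      by (rule order_trans[OF H(2) mult_left_mono[OF G(2) K(1)]])
    moreover have "(\<integral>x. F x * partial i (foldr partial v \<psi>) x \<partial>lebesgue) = (-1) ^ Suc ?l * (\<integral>x. H x * \<psi> x \<partial>lebesgue)"
      if \<psi>: "\<psi> \<in> schwartz" for \<psi>
      unfolding G(3)[OF schwartz_foldr_partial[OF \<psi>]] H(3)[OF \<psi>] by simp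
    ultimately show ?thesis using H(1) unfolding mult.assoc by blast
  qed
  moreover have "0 \<le> K * ?c" using K(1) by (intro mult_nonneg_nonneg) auto
  ultimately show ?case unfolding list.size foldr.simps o_apply add_0_right add_Suc_right by blast
qed

lemma hermite_sobolev_norm_partial:
  assumes f: "f \<in> schwartz"
  shows "hermite_sobolev_norm j (partial i f) \<le> sqrt (1 + 3 ^ Suc j) * hermite_sobolev_norm (Suc j) f"
proof (rule hermite_sobolev_norm_le(2)[OF schwartz_L2[OF schwartz_partial[OF f]]])
  show "0 \<le> sqrt (1 + 3 ^ Suc j) * hermite_sobolev_norm (Suc j) f"
    by (intro mult_nonneg_nonneg) auto
  fix A :: "('a \<Rightarrow> nat) set" assume A: "finite A"
  have "(sqrt (1 + 3 ^ Suc j))\<^sup>2 = (1 + 3 ^ Suc j :: real)" by (rule real_sqrt_pow2) (simp add: add_nonneg_nonneg)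
  then show "sum (energy j (partial i f)) A \<le> (sqrt (1 + 3 ^ Suc j) * hermite_sobolev_norm (Suc j) f)\<^sup>2"
    using sum_partial_coeff_le[OF schwartz_hermite_sobolev[OF f] A, of j i]
    by (simp only: energy_def[abs_def] hermite_coeff_partial[OF f] partial_coeff_def power_mult_distrib)
qed

lemma hermite_sobolev_norm_foldr_partial:
  fixes u :: "'n::finite list"
  shows "\<exists>K\<ge>0. \<forall>f\<in>schwartz. hermite_sobolev_norm j (foldr partial u f) \<le> K * hermite_sobolev_norm (j + length u) f"
proof (induction u arbitrary: j)
  case Nil
  show ?case by (intro exI[of _ 1]) simp
next
  case (Cons i u)
  let ?c = "sqrt (1 + 3 ^ Suc j)"
  obtain K where K: "0 \<le> K"
    "\<And>f. f \<in> schwartz \<Longrightarrow> hermite_sobolev_norm (Suc j) (foldr partial u f) \<le> K * hermite_sobolev_norm (Suc j + length u) f"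
    using Cons.IH[of "Suc j"] by blast
  have c: "0 \<le> ?c" by simp
  have "hermite_sobolev_norm j (foldr partial (i # u) f) \<le> (?c * K) * hermite_sobolev_norm (j + length (i # u)) f"
    if f: "f \<in> schwartz" for f
    using order_trans[OF hermite_sobolev_norm_partial[OF schwartz_foldr_partial[OF f, of u], of j i] mult_left_mono[OF K(2)[OF f] c]]
    by (simp only: foldr.simps o_apply list.size add_Suc add_Suc_right add_0_right mult.assoc)
  moreover have "0 \<le> ?c * K" using K(1) c by (rule mult_nonneg_nonneg[rotated])
  ultimately show ?case by blast
qed

text \<open>By interpolation \<open>m\<close> is also a multiplier of order \<open>length v\<close>. Hence \<open>m \<cdot> \<partial>\<^sup>u f\<close> lies in the space of that
  order and has the weak derivative along \<open>v\<close> in \<open>L\<^sup>2\<close>.\<close>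

lemma multiplier_weak_derivative:
  fixes m :: "real ^ 'n::finite \<Rightarrow> complex"
  assumes m: "m \<in> borel_measurable lebesgue" and mb: "mult_bounded k m C" and uv: "length v \<le> k"
  shows "\<exists>K\<ge>0. \<forall>f\<in>schwartz. \<exists>G\<in>L2. l2norm G \<le> K * hermite_sobolev_norm (length v + length u) f \<and>
    (\<forall>\<psi>\<in>schwartz. (\<integral>x. m x * foldr partial u f x * foldr partial v \<psi> x \<partial>lebesgue)
      = (-1) ^ length v * (\<integral>x. G x * \<psi> x \<partial>lebesgue))"
proof -
  let ?l = "length v"
  obtain D where D: "mult_bounded ?l m D" using mult_bounded_mono[OF mb m uv] by blast
  have D0: "0 \<le> D" using D by (simp add: mult_bounded_def)
  obtain K where K: "0 \<le> K" "\<And>F. F \<in> hermite_sobolev ?l \<Longrightarrow> \<exists>G\<in>L2. l2norm G \<le> K * hermite_sobolev_norm ?l F \<and>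
    (\<forall>\<psi>\<in>schwartz. (\<integral>x. F x * foldr partial v \<psi> x \<partial>lebesgue) = (-1) ^ ?l * (\<integral>x. G x * \<psi> x \<partial>lebesgue))"
    using hermite_sobolev_weak_derivative[of v] by blast
  obtain L where L: "0 \<le> L" "\<And>f. f \<in> schwartz \<Longrightarrow> hermite_sobolev_norm ?l (foldr partial u f) \<le> L * hermite_sobolev_norm (?l + length u) f"
    using hermite_sobolev_norm_foldr_partial[of ?l u] by blast
  have "\<exists>G\<in>L2. l2norm G \<le> (K * (D * L)) * hermite_sobolev_norm (?l + length u) f \<and>
    (\<forall>\<psi>\<in>schwartz. (\<integral>x. m x * foldr partial u f x * foldr partial v \<psi> x \<partial>lebesgue)
      = (-1) ^ ?l * (\<integral>x. G x * \<psi> x \<partial>lebesgue))" if f: "f \<in> schwartz" for f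
  proof -
    let ?F = "\<lambda>x. m x * foldr partial u f x"
    have us: "foldr partial u f \<in> hermite_sobolev ?l"
      by (rule schwartz_hermite_sobolev[OF schwartz_foldr_partial[OF f]])
    note F = mult_bounded_extend[OF D m us]
    obtain G where G: "G \<in> L2" "l2norm G \<le> K * hermite_sobolev_norm ?l ?F"
      "\<forall>\<psi>\<in>schwartz. (\<integral>x. ?F x * foldr partial v \<psi> x \<partial>lebesgue) = (-1) ^ ?l * (\<integral>x. G x * \<psi> x \<partial>lebesgue)"
      using K(2)[OF F(1)] by blast
    have "hermite_sobolev_norm ?l ?F \<le> D * (L * hermite_sobolev_norm (?l + length u) f)"
      by (rule order_trans[OF F(2) mult_left_mono[OF L(2)[OF f] D0]])
    then have "l2norm G \<le> K * (D * (L * hermite_sobolev_norm (?l + length u) f))"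
      by (rule order_trans[OF G(2) mult_left_mono[OF _ K(1)]])
    then have "l2norm G \<le> (K * (D * L)) * hermite_sobolev_norm (?l + length u) f"
      by (simp only: mult.assoc)
    with G(1,3) show ?thesis by blast
  qed
  moreover have "0 \<le> K * (D * L)" using K(1) D0 L(1) by simp
  ultimately show ?thesis by blast
qed

text \<open>By the Leibniz rule \<open>\<partial>\<^sup>\<alpha> (f \<phi>)\<close> is a sum of products \<open>\<partial>\<^sup>u f \<cdot> \<partial>\<^sup>v \<phi>\<close> over complementary
  subwords \<open>u\<close>, \<open>v\<close> of a word for \<open>\<alpha>\<close>. In each of them \<open>m \<cdot> \<partial>\<^sup>u f\<close> has \<open>length v\<close> weak
  derivatives, so \<open>\<partial>\<^sup>v\<close> can be moved off the test function.\<close>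

lemma deriv_mult_bounded_if_mult_bounded:
  fixes m :: "real ^ 'n::finite \<Rightarrow> complex"
  assumes m: "m \<in> borel_measurable lebesgue" and mb: "mult_bounded k m C" and \<alpha>: "msize \<alpha> \<le> k"
  shows "deriv_mult_L2_bounded m \<alpha>"
proof -
  have mC: "AE x in lebesgue. cmod (m x) \<le> C" by (rule mult_bounded_AE_le[OF mb m])
  let ?a = "msize \<alpha>"
  let ?ps = "splits (mword \<alpha>)"
  have len: "length (snd p) + length (fst p) = ?a" if "p \<in> set ?ps" for p
    using splits_length[of "fst p" "snd p" "mword \<alpha>"] that by (simp add: length_mword)
  let ?Q = "\<lambda>p f G. \<forall>\<psi>\<in>schwartz. (\<integral>x. m x * foldr partial (fst p) f x * foldr partial (snd p) \<psi> x \<partial>lebesgue)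
      = (-1) ^ length (snd p) * (\<integral>x. G x * \<psi> x \<partial>lebesgue)"
  have "\<forall>p\<in>set ?ps. \<exists>K. 0 \<le> K \<and> (\<forall>f\<in>schwartz. \<exists>G\<in>L2. l2norm G \<le> K * hermite_sobolev_norm ?a f \<and> ?Q p f G)"
  proof
    fix p assume p: "p \<in> set ?ps"
    have "length (snd p) \<le> k" using len[OF p] \<alpha> by linarith
    from multiplier_weak_derivative[OF m mb this, of "fst p"]
    show "\<exists>K. 0 \<le> K \<and> (\<forall>f\<in>schwartz. \<exists>G\<in>L2. l2norm G \<le> K * hermite_sobolev_norm ?a f \<and> ?Q p f G)"
      unfolding len[OF p] .
  qed
  from bchoice[OF this] obtain K where
    K': "\<forall>p\<in>set ?ps. 0 \<le> K p \<and> (\<forall>f\<in>schwartz. \<exists>G\<in>L2. l2norm G \<le> K p * hermite_sobolev_norm ?a f \<and> ?Q p f G)"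
    by (rule exE)
  let ?K = "\<Sum>p\<leftarrow>?ps. K p"
  have "\<exists>g\<in>L2. (\<forall>\<phi>\<in>test_functions. dist_mult (dist_deriv \<alpha> (dist_of_fun m)) f \<phi> = dist_of_fun g \<phi>) \<and>
      l2norm g \<le> ?K * hermite_sobolev_norm ?a f" if f: "f \<in> schwartz" for f
  proof -
    have "\<forall>p\<in>set ?ps. \<exists>G. G \<in> L2 \<and> l2norm G \<le> K p * hermite_sobolev_norm ?a f \<and> ?Q p f G"
    proof
      fix p assume "p \<in> set ?ps"
      from bspec[OF conjunct2[OF bspec[OF K' this]] f]
      show "\<exists>G. G \<in> L2 \<and> l2norm G \<le> K p * hermite_sobolev_norm ?a f \<and> ?Q p f G" unfolding Bex_def .
    qed
    from bchoice[OF this] obtain G where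
      G': "\<forall>p\<in>set ?ps. G p \<in> L2 \<and> l2norm (G p) \<le> K p * hermite_sobolev_norm ?a f \<and> ?Q p f (G p)"
      by (rule exE)
    have GL: "G p \<in> L2" and GK: "l2norm (G p) \<le> K p * hermite_sobolev_norm ?a f" and GQ: "?Q p f (G p)"
      if "p \<in> set ?ps" for p
      using bspec[OF G' that] by simp_all
    let ?s = "\<lambda>p :: 'n list \<times> 'n list. (-1) ^ ?a * (-1) ^ length (snd p) :: complex"
    let ?g = "\<lambda>x. \<Sum>p\<leftarrow>?ps. ?s p * G p x"
    have g: "?g \<in> L2" "l2norm ?g \<le> (\<Sum>p\<leftarrow>?ps. l2norm (\<lambda>x. ?s p * G p x))"
      by (rule sum_list_L2, rule L2_scale, rule GL, assumption)+
    note g(2)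
    also have "(\<Sum>p\<leftarrow>?ps. l2norm (\<lambda>x. ?s p * G p x)) \<le> (\<Sum>p\<leftarrow>?ps. K p * hermite_sobolev_norm ?a f)"
    proof (rule sum_list_mono)
      fix p assume p: "p \<in> set ?ps"
      have "cmod (?s p) = 1" by (simp add: norm_mult norm_power)
      then show "l2norm (\<lambda>x. ?s p * G p x) \<le> K p * hermite_sobolev_norm ?a f"
        unfolding l2norm_scale using GK[OF p] by simp
    qed
    also have "\<dots> = ?K * hermite_sobolev_norm ?a f" by (rule sum_list_mult_const)
    finally have le: "l2norm ?g \<le> ?K * hermite_sobolev_norm ?a f" .
    have "dist_mult (dist_deriv \<alpha> (dist_of_fun m)) f \<phi> = dist_of_fun ?g \<phi>" if \<phi>: "\<phi> \<in> test_functions" for \<phi>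
    proof -
      have \<phi>s: "\<phi> \<in> schwartz" by (rule test_function_schwartz[OF \<phi>])
      let ?d = "\<lambda>p x. m x * foldr partial (fst p) f x * foldr partial (snd p) \<phi> x"
      have id: "integrable lebesgue (?d p)" for p :: "'n list \<times> 'n list"
        unfolding mult.assoc
        by (rule integrable_AE_bounded_mult[OF m mC L2_mult_integrable[OF schwartz_L2[OF schwartz_foldr_partial[OF f]]
              schwartz_L2[OF schwartz_foldr_partial[OF \<phi>s]]]])
      have L: "mderiv \<alpha> (\<lambda>x. f x * \<phi> x) = (\<lambda>x. \<Sum>p\<leftarrow>?ps. foldr partial (fst p) f x * foldr partial (snd p) \<phi> x)"
        unfolding mderiv_mword foldr_partial_mult[OF schwartz_smooth[OF f] schwartz_smooth[OF \<phi>s]] split_def ..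
      have "dist_mult (dist_deriv \<alpha> (dist_of_fun m)) f \<phi> = (-1) ^ ?a * (\<integral>x. (\<Sum>p\<leftarrow>?ps. ?d p x) \<partial>lebesgue)"
        unfolding dist_mult_def dist_deriv_def dist_of_fun_def L sum_list_const_mult[symmetric] mult.assoc ..
      also have "(\<integral>x. (\<Sum>p\<leftarrow>?ps. ?d p x) \<partial>lebesgue) = (\<Sum>p\<leftarrow>?ps. \<integral>x. ?d p x \<partial>lebesgue)"
        by (rule sum_list_integrable(2)) (rule id)
      also have "\<dots> = (\<Sum>p\<leftarrow>?ps. (-1) ^ length (snd p) * (\<integral>x. G p x * \<phi> x \<partial>lebesgue))"
        by (rule arg_cong[where f = sum_list], rule map_cong[OF refl]) (rule bspec[OF GQ \<phi>s])
      also have "(-1) ^ ?a * \<dots> = (\<Sum>p\<leftarrow>?ps. \<integral>x. ?s p * (G p x * \<phi> x) \<partial>lebesgue)"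
        unfolding integral_mult_right_zero sum_list_const_mult[symmetric] mult.assoc ..
      also have "\<dots> = (\<integral>x. (\<Sum>p\<leftarrow>?ps. ?s p * (G p x * \<phi> x)) \<partial>lebesgue)"
        by (rule sum_list_integrable(2)[symmetric], rule integrable_mult_right, rule L2_mult_integrable[OF GL schwartz_L2[OF \<phi>s]])
      also have "\<dots> = dist_of_fun ?g \<phi>"
        unfolding dist_of_fun_def sum_list_mult_const[symmetric] mult.assoc ..
      finally show ?thesis .
    qed
    with g(1) le show ?thesis by blast
  qed
  then show ?thesis
    unfolding deriv_mult_L2_bounded_def hermite_sobolev_norm_def
    using locally_integrable_AE_bounded[OF m mC] by blast
qed

section \<open>The characterization\<close>

theorem lemma2p2:
  fixes m :: "real ^ 'n::finite \<Rightarrow> complex" and k :: nat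
  assumes "m \<in> borel_measurable lebesgue"
  shows "m \<in> hermite_multipliers k \<longleftrightarrow>
    (\<forall>\<alpha> :: 'n \<Rightarrow> nat. msize \<alpha> \<le> k \<longrightarrow> deriv_mult_L2_bounded m \<alpha>)"
  unfolding hermite_multipliers_mult_bounded[OF assms]
proof
  assume "\<exists>C. mult_bounded k m C"
  then obtain C where "mult_bounded k m C" ..
  then show "\<forall>\<alpha> :: 'n \<Rightarrow> nat. msize \<alpha> \<le> k \<longrightarrow> deriv_mult_L2_bounded m \<alpha>"
    by (intro allI impI) (rule deriv_mult_bounded_if_mult_bounded[OF assms])
next
  assume d: "\<forall>\<alpha> :: 'n \<Rightarrow> nat. msize \<alpha> \<le> k \<longrightarrow> deriv_mult_L2_bounded m \<alpha>"
  show "\<exists>C. mult_bounded k m C"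
  proof (rule mult_bounded_if_deriv_mult_bounded[OF assms])
    fix \<alpha> :: "'n \<Rightarrow> nat" assume "msize \<alpha> \<le> k"
    with d show "deriv_mult_L2_bounded m \<alpha>" by simp
  qed
qed

end
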